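(* (a) The decision problem MSP is $\mathbf{NP}$-complete even if the flow $F$ is fixed to be any feasible flow, i.e. the variant in which a feasible flow $F$ is prescribed with the instance and one asks whether there exist $L$ and $M$ such that $(F,L,M)$ is a feasible solution with $\mathrm{T}(F,L,M)\le a$ and $\mathrm{H}(F,L,M)\le b$ is $\mathbf{NP}$-complete. As a consequence, MSP is $\mathbf{NP}$-complete even when restricted to instances in which $G$ is tree-like. These statements also hold when restricted to instances with $m=1$. (b) MSP is $\mathbf{NP}$-complete even when restricted to instances in which $G$ consists of only one directed edge $e$ with weight $w(e)=1$.
   Context: Modal Split Problem: data. A directed, weighted graph $G=(V,E,w)$ with $w:E\to\mathbb{R}_{\ge 0}$; a budget $B>0$; a demand $D:V^2\to\mathbb{N}_{\ge 0}$ with $D(v,v)=0$; a number $m$ of public transportation modes; and for each mode $i=0,\dots,m$ a travel time $\tau_i$, an energy consumption $\eta_i$, a cost $c_i$ (all nonnegative, per unit of distance, the last two per vehicle) and a positive capacity $k_i$ per vehicle. Mode $0$ is private transport, with $c_0=0$ and $k_0=1$; it is allowed on every edge without capacity constraint. For complexity purposes all numbers in an instance are rationals encoded in binary. The commodities are $K=\{(s,t)\in V^2: D(s,t)>0\}$. A layout is a map $L:E\to\mathbb{N}^m$ (with $0\in\mathbb{N}$); it is feasible if $\sum_{e}w(e)\sum_{i=1}^m c_iL(e)_i\le B$. For each $\kappa=(s,t)\in K$, a flow is a map $F_\kappa:E\to\mathbb{R}_{\ge 0}$ such that for every $v$ the inflow minus the outflow, $\sum_{e\in \mathrm{in}(v)}F_\kappa(e)-\sum_{e\in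 \mathrm{out}(v)}F_\kappa(e)$, equals $0$ if $v\ne s,t$, equals $D(s,t)$ if $v=t$, and equals $-D(s,t)$ if $v=s$; a feasible flow is a family $F=(F_\kappa)_{\kappa\in K}$ of such flows. A modal split consists of maps $M_\kappa:E\to[0,1]^{m+1}$, $\kappa\in K$, with $\sum_{i=0}^m M_\kappa(e)_i=1$ for all $e$; it is feasible if $\sum_{\kappa\in K}F_\kappa(e)M_\kappa(e)_i\le k_iL(e)_i$ for all $e\in E$ and $i=1,\dots,m$. Put $F(e)=\sum_\kappa F_\kappa(e)$ and $M(e)_i=\frac{1}{F(e)}\sum_\kappa F_\kappa(e)M_\kappa(e)_i$ if $F(e)>0$, and $M(e)=(1,0,\dots,0)$ otherwise. A feasible solution is a triple $(F,L,M)$ of a feasible flow, a feasible layout and a feasible modal split. Total travel time: $\mathrm{T}(F,L,M)=\sum_e w(e)\sum_{i=0}^m\tau_iF(e)M(e)_i$. Total energy consumption: $\mathrm{H}(F,L,M)=\sum_e w(e)\bigl(\eta_0F(e)M(e)_0+\sum_{i=1}^m\eta_iL(e)_i\bigr)$. Decision problem MSP. Instance: a directed, weighted graph $G=(V,E,w)$ with $w:E\to\mathbb{R}_{\ge 0}$, a budget $B>0$, a demand $D:V^2\to\mathbb{N}_{\ge 0}$ with $D(v,v)=0$, a number $m$ of public transportation modes, and mode data $\tau_i,\eta_i,c_i\ge 0$, $k_i>0$ for $i=0,\dots,m$ with $c_0=0$ and $k_0=1$, together with $a,b\ge 0$ (with $a=\infty$ allowed, meaning $\mathrm{T}$ is not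 bounded). Question: does there exist a feasible solution $(F,L,M)$ with $\mathrm{T}(F,L,M)\le a$ and $\mathrm{H}(F,L,M)\le b$? A directed graph is called tree-like if it is (weakly) connected and does not contain non-trivial directed cycles. *)

theory Defs
  imports
    Complex_Main
    "HOL-Computational_Algebra.Polynomial"
    "Graph_Theory.Digraph_Component"
    "Graph_Theory.Pair_Digraph"
begin

section \<open>NP-completeness\<close>

text \<open>
  Deterministic multi-tape Turing machines, given by the numbers of tapes, states and symbols.
  Symbol 0 is the blank; symbols 1 and 2 represent the input bits \<^term>\<open>False\<close> and \<^term>\<open>True\<close>.
  Tapes are infinite in both directions.
\<close>

datatype move = Left | Stay | Right

record tm =
  num_tapes :: nat
  num_states :: nat
  num_symbols :: nat
  start :: nat
  accept :: nat
  reject :: nat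
  delta :: "nat \<Rightarrow> nat list \<Rightarrow> nat \<times> (nat \<times> move) list"

definition wf_tm :: "tm \<Rightarrow> bool" where
  "wf_tm M \<longleftrightarrow>
     num_tapes M \<ge> 1 \<and> num_symbols M \<ge> 3 \<and>
     start M < num_states M \<and> accept M < num_states M \<and> reject M < num_states M \<and>
     accept M \<noteq> reject M \<and>
     (\<forall>q xs. q < num_states M \<longrightarrow> length xs = num_tapes M \<longrightarrow> set xs \<subseteq> {..<num_symbols M} \<longrightarrow>
        (case delta M q xs of (q', acts) \<Rightarrow>
           q' < num_states M \<and> length acts = num_tapes M \<and>
           fst ` set acts \<subseteq> {..<num_symbols M}))"

type_synonym tape = "(int \<Rightarrow> nat) \<times> int"  \<comment> \<open>contents and head position\<close>
type_synonym config = "nat \<times> tape list"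

definition halted :: "tm \<Rightarrow> config \<Rightarrow> bool" where
  "halted M c \<longleftrightarrow> fst c \<in> {accept M, reject M}"

fun scan :: "tape \<Rightarrow> nat" where
  "scan (t, h) = t h"

fun shift :: "move \<Rightarrow> int" where
  "shift Left = -1" | "shift Stay = 0" | "shift Right = 1"

fun act :: "tape \<Rightarrow> nat \<times> move \<Rightarrow> tape" where
  "act (t, h) (s, d) = (t(h := s), h + shift d)"

definition step :: "tm \<Rightarrow> config \<Rightarrow> config" where
  "step M c =
     (if halted M c then c
      else let (q, acts) = delta M (fst c) (map scan (snd c))
           in (q, map2 act (snd c) acts))"

definition tape_of :: "bool list \<Rightarrow> int \<Rightarrow> nat" where
  "tape_of w z = (if 0 \<le> z \<and> z < int (length w) then (if w ! nat z then 2 else 1) else 0)"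

text \<open>The input words are placed on the first tapes, one word per tape.\<close>

definition init :: "tm \<Rightarrow> bool list list \<Rightarrow> config" where
  "init M ws = (start M, map (\<lambda>i. (tape_of (if i < length ws then ws ! i else []), 0)) [0..<num_tapes M])"

definition run :: "tm \<Rightarrow> bool list list \<Rightarrow> nat \<Rightarrow> config" where
  "run M ws n = (step M ^^ n) (init M ws)"

text \<open>The output of a function is read off the last tape.\<close>

definition poly_time_computable :: "(bool list \<Rightarrow> bool list) \<Rightarrow> bool" where
  "poly_time_computable f \<longleftrightarrow>
     (\<exists>M (p :: nat poly). wf_tm M \<and>
        (\<forall>x. halted M (run M [x] (poly p (length x))) \<and>
             fst (last (snd (run M [x] (poly p (length x))))) = tape_of (f x)))"

text \<open>
  Verifier definition of NP: the verifier gets the input on its first and the certificate on its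
  second tape.  Certificate length and running time are polynomial in the length of the input.
\<close>

definition NP :: "bool list set set" where
  "NP = {A. \<exists>M (p :: nat poly) (q :: nat poly). wf_tm M \<and> num_tapes M \<ge> 2 \<and>
          (\<forall>x u. length u \<le> poly q (length x) \<longrightarrow> halted M (run M [x, u] (poly p (length x)))) \<and>
          (\<forall>x. x \<in> A \<longleftrightarrow>
             (\<exists>u. length u \<le> poly q (length x) \<and>
                  fst (run M [x, u] (poly p (length x))) = accept M))}"

definition poly_reducible :: "bool list set \<Rightarrow> bool list set \<Rightarrow> bool" where
  "poly_reducible A B \<longleftrightarrow> (\<exists>f. poly_time_computable f \<and> (\<forall>x. x \<in> A \<longleftrightarrow> f x \<in> B))"

definition NP_hard :: "bool list set \<Rightarrow> bool" where
  "NP_hard B \<longleftrightarrow> (\<forall>A\<in>NP. poly_reducible A B)"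

definition NP_complete :: "bool list set \<Rightarrow> bool" where
  "NP_complete B \<longleftrightarrow> B \<in> NP \<and> NP_hard B"


section \<open>The modal split problem\<close>

text \<open>
  Since instances have to be encoded, their numbers are rational and the vertices are
  \<open>{..<num_verts}\<close>.  The functions are meaningful on vertices, edges and modes \<open>{..modes}\<close> only;
  other values influence neither the properties below nor the encoding.
  A missing bound on the total travel time is represented by \<^term>\<open>None\<close>.
\<close>

type_synonym edge = "nat \<times> nat"
type_synonym commodity = "nat \<times> nat"

record msp =
  num_verts :: nat
  edges :: "edge set"
  weight :: "edge \<Rightarrow> rat"
  budget :: rat
  demand :: "nat \<times> nat \<Rightarrow> nat"
  modes :: nat
  travel_time :: "nat \<Rightarrow> rat"
  energy :: "nat \<Rightarrow> rat"
  cost :: "nat \<Rightarrow> rat"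
  capacity :: "nat \<Rightarrow> rat"
  time_bound :: "rat option"
  energy_bound :: rat

definition graph_of :: "msp \<Rightarrow> nat pair_pre_digraph" where
  "graph_of I = \<lparr> pverts = {..<num_verts I}, parcs = edges I \<rparr>"

definition msp_instance :: "msp \<Rightarrow> bool" where
  "msp_instance I \<longleftrightarrow>
     pair_fin_digraph (graph_of I) \<and>
     (\<forall>e\<in>edges I. weight I e \<ge> 0) \<and>
     budget I > 0 \<and>
     (\<forall>v<num_verts I. demand I (v, v) = 0) \<and>
     (\<forall>i\<le>modes I. travel_time I i \<ge> 0 \<and> energy I i \<ge> 0 \<and> cost I i \<ge> 0 \<and> capacity I i > 0) \<and>
     cost I 0 = 0 \<and> capacity I 0 = 1 \<and>
     (case time_bound I of None \<Rightarrow> True | Some a \<Rightarrow> a \<ge> 0) \<and>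
     energy_bound I \<ge> 0"

definition commodities :: "msp \<Rightarrow> commodity set" where
  "commodities I = {\<kappa> \<in> {..<num_verts I} \<times> {..<num_verts I}. demand I \<kappa> > 0}"

type_synonym layout = "edge \<Rightarrow> nat \<Rightarrow> nat"
type_synonym flow = "commodity \<Rightarrow> edge \<Rightarrow> real"
type_synonym split = "commodity \<Rightarrow> edge \<Rightarrow> nat \<Rightarrow> real"

definition feasible_layout :: "msp \<Rightarrow> layout \<Rightarrow> bool" where
  "feasible_layout I L \<longleftrightarrow>
     (\<Sum>e\<in>edges I. real_of_rat (weight I e) * (\<Sum>i=1..modes I. real_of_rat (cost I i) * real (L e i)))
       \<le> real_of_rat (budget I)"

definition feasible_flow :: "msp \<Rightarrow> flow \<Rightarrow> bool" where
  "feasible_flow I F \<longleftrightarrow>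
     (\<forall>(s, t) \<in> commodities I.
        (\<forall>e\<in>edges I. F (s, t) e \<ge> 0) \<and>
        (\<forall>v<num_verts I.
           (\<Sum>e\<in>in_arcs (graph_of I) v. F (s, t) e) - (\<Sum>e\<in>out_arcs (graph_of I) v. F (s, t) e) =
           (if v = t then real (demand I (s, t))
            else if v = s then - real (demand I (s, t))
            else 0)))"

definition feasible_split :: "msp \<Rightarrow> flow \<Rightarrow> layout \<Rightarrow> split \<Rightarrow> bool" where
  "feasible_split I F L M \<longleftrightarrow>
     (\<forall>\<kappa>\<in>commodities I. \<forall>e\<in>edges I.
        (\<forall>i\<le>modes I. M \<kappa> e i \<in> {0..1}) \<and> (\<Sum>i=0..modes I. M \<kappa> e i) = 1) \<and>
     (\<forall>e\<in>edges I. \<forall>i\<in>{1..modes I}.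
        (\<Sum>\<kappa>\<in>commodities I. F \<kappa> e * M \<kappa> e i) \<le> real_of_rat (capacity I i) * real (L e i))"

definition feasible_solution :: "msp \<Rightarrow> flow \<Rightarrow> layout \<Rightarrow> split \<Rightarrow> bool" where
  "feasible_solution I F L M \<longleftrightarrow>
     feasible_flow I F \<and> feasible_layout I L \<and> feasible_split I F L M"

definition total_flow :: "msp \<Rightarrow> flow \<Rightarrow> edge \<Rightarrow> real" where
  "total_flow I F e = (\<Sum>\<kappa>\<in>commodities I. F \<kappa> e)"

definition total_split :: "msp \<Rightarrow> flow \<Rightarrow> split \<Rightarrow> edge \<Rightarrow> nat \<Rightarrow> real" where
  "total_split I F M e i =
     (if total_flow I F e > 0
      then 1 / total_flow I F e * (\<Sum>\<kappa>\<in>commodities I. F \<kappa> e * M \<kappa> e i)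
      else if i = 0 then 1 else 0)"

definition total_time :: "msp \<Rightarrow> flow \<Rightarrow> layout \<Rightarrow> split \<Rightarrow> real" where
  "total_time I F L M =
     (\<Sum>e\<in>edges I. real_of_rat (weight I e) *
        (\<Sum>i=0..modes I. real_of_rat (travel_time I i) * total_flow I F e * total_split I F M e i))"

definition total_energy :: "msp \<Rightarrow> flow \<Rightarrow> layout \<Rightarrow> split \<Rightarrow> real" where
  "total_energy I F L M =
     (\<Sum>e\<in>edges I. real_of_rat (weight I e) *
        (real_of_rat (energy I 0) * total_flow I F e * total_split I F M e 0 +
         (\<Sum>i=1..modes I. real_of_rat (energy I i) * real (L e i))))"

definition within_bounds :: "msp \<Rightarrow> flow \<Rightarrow> layout \<Rightarrow> split \<Rightarrow> bool" where
  "within_bounds I F L M \<longleftrightarrow>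
     (case time_bound I of None \<Rightarrow> True | Some a \<Rightarrow> total_time I F L M \<le> real_of_rat a) \<and>
     total_energy I F L M \<le> real_of_rat (energy_bound I)"

text \<open>
  The library's \<open>connected\<close> means weakly connected (and nonempty).  Its cycles have positive length;
  loops and pairs of antiparallel edges count as cycles, only the empty walk is a trivial cycle.
\<close>

definition tree_like :: "'a pair_pre_digraph \<Rightarrow> bool" where
  "tree_like G \<longleftrightarrow> Digraph_Component.connected (with_proj G) \<and> (\<nexists>p. pre_digraph.cycle (with_proj G) p)"

definition single_unit_edge :: "msp \<Rightarrow> bool" where
  "single_unit_edge I \<longleftrightarrow>
     (\<exists>u v. u \<noteq> v \<and> pverts (graph_of I) = {u, v} \<and> parcs (graph_of I) = {(u, v)} \<and> weight I (u, v) = 1)"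


section \<open>Binary encoding\<close>

text \<open>
  All encodings are prefix codes, so that concatenations can be decoded uniquely.
  A natural number is written in binary, least significant bit first, every bit being
  preceded by the marker \<^term>\<open>True\<close>; the marker \<^term>\<open>False\<close> ends the number.
\<close>

fun enc_nat :: "nat \<Rightarrow> bool list" where
  "enc_nat n = (if n = 0 then [False] else True # odd n # enc_nat (n div 2))"

declare enc_nat.simps [simp del]

definition enc_int :: "int \<Rightarrow> bool list" where
  "enc_int z = (z < 0) # enc_nat (nat \<bar>z\<bar>)"

definition enc_rat :: "rat \<Rightarrow> bool list" where
  "enc_rat r = enc_int (fst (quotient_of r)) @ enc_int (snd (quotient_of r))"

definition enc_option :: "('a \<Rightarrow> bool list) \<Rightarrow> 'a option \<Rightarrow> bool list" where
  "enc_option f x = (case x of None \<Rightarrow> [False] | Some y \<Rightarrow> True # f y)"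

definition enc_list :: "('a \<Rightarrow> bool list) \<Rightarrow> 'a list \<Rightarrow> bool list" where
  "enc_list f xs = concat (map (\<lambda>x. True # f x) xs) @ [False]"

text \<open>The graph is encoded by its weighted adjacency matrix and the demand by its matrix.\<close>

definition enc_matrix :: "nat \<Rightarrow> (nat \<times> nat \<Rightarrow> bool list) \<Rightarrow> bool list" where
  "enc_matrix n f = enc_list (\<lambda>u. enc_list (\<lambda>v. f (u, v)) [0..<n]) [0..<n]"

definition enc_msp :: "msp \<Rightarrow> bool list" where
  "enc_msp I =
     enc_matrix (num_verts I)
       (\<lambda>e. enc_option enc_rat (if e \<in> edges I then Some (weight I e) else None)) @
     enc_rat (budget I) @
     enc_matrix (num_verts I) (\<lambda>\<kappa>. enc_nat (demand I \<kappa>)) @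
     enc_list (\<lambda>i. enc_rat (travel_time I i) @ enc_rat (energy I i) @
                   enc_rat (cost I i) @ enc_rat (capacity I i)) [0..<Suc (modes I)] @
     enc_option enc_rat (time_bound I) @
     enc_rat (energy_bound I)"

definition enc_flow :: "msp \<Rightarrow> (commodity \<Rightarrow> edge \<Rightarrow> rat) \<Rightarrow> bool list" where
  "enc_flow I F =
     (let pairs = List.product [0..<num_verts I] [0..<num_verts I] in
        enc_list (\<lambda>\<kappa>. enc_list (\<lambda>e. enc_rat (F \<kappa> e)) (filter (\<lambda>e. e \<in> edges I) pairs))
          (filter (\<lambda>\<kappa>. \<kappa> \<in> commodities I) pairs))"


section \<open>The decision problems\<close>

text \<open>In both problems, \<open>C\<close> is the class of instances the problem is restricted to.\<close>

definition MSP :: "(msp \<Rightarrow> bool) \<Rightarrow> bool list set" where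
  "MSP C = {enc_msp I | I. msp_instance I \<and> C I \<and>
              (\<exists>F L M. feasible_solution I F L M \<and> within_bounds I F L M)}"

definition MSP_fixed_flow :: "(msp \<Rightarrow> bool) \<Rightarrow> bool list set" where
  "MSP_fixed_flow C =
     {enc_msp I @ enc_flow I F | I F. msp_instance I \<and> C I \<and>
        feasible_flow I (\<lambda>\<kappa> e. real_of_rat (F \<kappa> e)) \<and>
        (\<exists>L M. feasible_solution I (\<lambda>\<kappa> e. real_of_rat (F \<kappa> e)) L M \<and>
               within_bounds I (\<lambda>\<kappa> e. real_of_rat (F \<kappa> e)) L M)}"

end

(*
Hardness. For a verifier with polynomial running time, the accepting runs on an input x are the tilings of a
rectangle that is cyclic in the horizontal direction. Its rows are configurations (the columns being tape cells),
and the information on the scanned symbols is passed along a row by the horizontal colours. Writing the colour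
constraints as digits turns tilings into solutions of an equation sum L_j a_j = t in natural numbers.
One edge with modes of cost and capacity a_j, and a star whose edges have weight a_j, with a single mode, encode
such an equation, because a layout has to be bought within a budget of t.

Membership. For a fixed layout L, the flows by modes x = F M are the solutions of a linear program. Deleting
directed cycles from the flow makes it bounded by the demand, hence L may be taken small. A solution of the
linear program with minimal support is unique on its support, so that Siegel's lemma applied to the normal
equations gives a solution y / z with small natural numbers.

Turing machines are obtained from a small language of stack programs, which is shown to be closed under the
usual operations on lists and binary numbers.
*)

theory Submission
  imports Defs
begin

section \<open>A stack language and its compilation to Turing machines\<close>

text \<open>Hardness is required for every language with a Turing machine verifier, and the
  reduction must itself be computed by a machine; hence instances, certificates and intermediate
  results all become first-order data with a size. The two hard families need different sums: a
  layout on a single edge may use any multiplicity, whereas on the star, with unit flow per edge,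
  only multiplicities 0 and 1 are useful. One equation serves both because its solutions are 0-1
  automatically: every \<open>a_j\<close> has leading coefficient 1 and \<open>t\<close> has the
  number of cells there, which bounds the number of chosen tiles and thereby excludes carries; the
  digits then force one tile per cell. Rows are cyclic so that no border tiles are needed, and the
  window is so wide that no head crosses the seam. In the membership part the obstacle is that flows
  and splits are real and layouts unbounded. No optimum has to be computed: it suffices that some
  certificate is short, and the verifier works with natural numbers only.\<close>

datatype com = Push nat nat | Pop nat | Emit nat | Seq com com (infixr ";;" 60)
  | If nat nat com com | While nat nat com

text \<open>An empty stack shows the blank 0, so a loop on symbol 0 runs until its stack is empty.
  Symbol 3 never occurs in data and is free to serve as a marker.\<close>

fun top_of :: "nat list => nat" where
  "top_of [] = 0" | "top_of (a # l) = a"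

type_synonym stacks = "nat => nat list"

text \<open>The counts are exact machine steps. A push costs two, since the head moves left before
  it writes, and the first arm of a test pays for the jump over the second. Stack 4 only grows at
  its far end and becomes the output tape.\<close>

inductive bs :: "com => stacks => nat => stacks => bool" where
  bs_Push: "bs (Push i a) s 2 (s(i := a # s i))"
| bs_Pop: "bs (Pop i) s 1 (s(i := tl (s i)))"
| bs_Emit: "bs (Emit a) s 1 (s(4 := s 4 @ [a]))"
| bs_Seq: "bs c1 s n1 s' ==> bs c2 s' n2 s'' ==> bs (c1 ;; c2) s (n1 + n2) s''"
| bs_IfT: "top_of (s i) = a ==> bs c1 s n s' ==> bs (If i a c1 c2) s (n + 2) s'"
| bs_IfF: "top_of (s i) \<noteq> a ==> bs c2 s n s' ==> bs (If i a c1 c2) s (n + 1) s'"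
| bs_WhileF: "top_of (s i) = a ==> bs (While i a c) s 1 s"
| bs_WhileT: "top_of (s i) \<noteq> a ==> bs c s n s' ==> bs (While i a c) s' m s'' ==>
    bs (While i a c) s (n + m + 2) s''"

fun wfc :: "com => bool" where
  "wfc (Push i a) \<longleftrightarrow> i < 4 \<and> a < 4"
| "wfc (Pop i) \<longleftrightarrow> i < 4"
| "wfc (Emit a) \<longleftrightarrow> a < 4"
| "wfc (c1 ;; c2) \<longleftrightarrow> wfc c1 \<and> wfc c2"
| "wfc (If i a c1 c2) \<longleftrightarrow> i < 4 \<and> wfc c1 \<and> wfc c2"
| "wfc (While i a c) \<longleftrightarrow> i < 4 \<and> wfc c"

fun csize :: "com => nat" where
  "csize (Push i a) = 2"
| "csize (Pop i) = 1"
| "csize (Emit a) = 1"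
| "csize (c1 ;; c2) = csize c1 + csize c2"
| "csize (If i a c1 c2) = csize c1 + csize c2 + 2"
| "csize (While i a c) = csize c + 2"

section \<open>Translation of programs into Turing machines\<close>

definition stays :: "nat list => (nat \<times> move) list" where
  "stays xs = map (\<lambda>a. (a, Stay)) xs"

text \<open>The state is the program counter. The code of \<open>c\<close> occupies the
  \<open>csize c\<close> states from \<open>ofs\<close> on and is left through state
  \<open>ofs + csize c\<close>, so that sequential composition is juxtaposition of
  intervals.\<close>

fun dl :: "com => nat => nat => nat list => nat \<times> (nat \<times> move) list" where
  "dl (Push i a) ofs q xs =
     (Suc q, (stays xs)[i := if q = ofs then (xs ! i, Left) else (a, Stay)])"
| "dl (Pop i) ofs q xs = (Suc q, (stays xs)[i := (0, Right)])"
| "dl (Emit a) ofs q xs = (Suc q, (stays xs)[4 := (a, Right)])"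
| "dl (c1 ;; c2) ofs q xs =
     (if q < ofs + csize c1 then dl c1 ofs q xs else dl c2 (ofs + csize c1) q xs)"
| "dl (If i a c1 c2) ofs q xs =
     (if q = ofs then (if xs ! i = a then Suc ofs else ofs + csize c1 + 2, stays xs)
      else if q < Suc ofs + csize c1 then dl c1 (Suc ofs) q xs
      else if q = Suc ofs + csize c1 then (ofs + csize c1 + csize c2 + 2, stays xs)
      else dl c2 (ofs + csize c1 + 2) q xs)"
| "dl (While i a c) ofs q xs =
     (if q = ofs then (if xs ! i = a then ofs + csize c + 2 else Suc ofs, stays xs)
      else if q < Suc ofs + csize c then dl c (Suc ofs) q xs
      else (ofs, stays xs))"

text \<open>One state behind the code gives the verdict: it accepts exactly if the top of stack 0 is
  1. The four symbols are the blank, the two input bits and one marker.\<close>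

definition mach :: "com => tm" where
  "mach c = \<lparr> num_tapes = 5, num_states = csize c + 3, num_symbols = 4,
     start = 0, accept = csize c + 1, reject = csize c + 2,
     delta = (\<lambda>q xs. if q < csize c then dl c 0 q xs
                     else (if xs ! 0 = 1 then csize c + 1 else csize c + 2, stays xs)) \<rparr>"

lemma csize_pos: "csize c > 0"
  by (induction c) auto

lemma length_dl: "length (snd (dl c ofs q xs)) = length xs"
  by (induction c arbitrary: ofs) (auto simp: stays_def)

lemma set_update: "set (xs[i := x]) \<subseteq> insert x (set xs)"
  by (rule set_update_subset_insert)

lemma dl_wf:
  assumes "wfc c" "length xs = 5" "set xs \<subseteq> {..<4}" "ofs \<le> q" "q < ofs + csize c"
  shows "fst (dl c ofs q xs) \<le> ofs + csize c \<and> fst ` set (snd (dl c ofs q xs)) \<subseteq> {..<4}"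
proof -
  have st: "fst ` set (stays xs) \<subseteq> {..<4}"
    using assms(3) by (auto simp: stays_def)
  have up: "fst ` set ((stays xs)[i := (a, d)]) \<subseteq> {..<4}" if "a < 4" for i a d
    using set_update[of "stays xs" i "(a, d)"] st that by fastforce
  have nth: "xs ! i < 4" if "i < 4" for i
  proof -
    have "xs ! i \<in> set xs" using that assms(2) by simp
    then show ?thesis using assms(3) by blast
  qed
  show ?thesis
    using assms(1,4,5)
  proof (induction c arbitrary: ofs)
    case (Push i a)
    then show ?case using nth[of i] up by auto
  next
    case (Seq c1 c2)
    show ?case
    proof (cases "q < ofs + csize c1")
      case True
      then show ?thesis using Seq.IH(1)[of ofs] Seq.prems by auto
    next
      case False
      then show ?thesis using Seq.IH(2)[of "ofs + csize c1"] Seq.prems by auto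
    qed
  next
    case (If i a c1 c2)
    consider "q = ofs" | "ofs < q" "q < Suc ofs + csize c1" | "q = Suc ofs + csize c1"
      | "q > Suc ofs + csize c1"
      using If.prems(2) by linarith
    then show ?case
    proof cases
      case 1 then show ?thesis using st by auto
    next
      case 2 then show ?thesis using If.IH(1)[of "Suc ofs"] If.prems by auto
    next
      case 3 then show ?thesis using st by auto
    next
      case 4 then show ?thesis using If.IH(2)[of "ofs + csize c1 + 2"] If.prems by auto
    qed
  next
    case (While i a c)
    consider "q = ofs" | "ofs < q" "q < Suc ofs + csize c" | "q \<ge> Suc ofs + csize c"
      using While.prems(2) by linarith
    then show ?case
    proof cases
      case 1 then show ?thesis using st by auto
    next
      case 2 then show ?thesis using While.IH[of "Suc ofs"] While.prems by auto
    next
      case 3 then show ?thesis using st by auto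
    qed
  qed (use up in auto)
qed

lemma wf_mach: "wfc c ==> wf_tm (mach c)"
proof -
  assume c: "wfc c"
  have "case delta (mach c) q xs of (q', acts) =>
           q' < num_states (mach c) \<and> length acts = num_tapes (mach c) \<and>
           fst ` set acts \<subseteq> {..<num_symbols (mach c)}"
    if "q < num_states (mach c)" "length xs = num_tapes (mach c)"
      "set xs \<subseteq> {..<num_symbols (mach c)}" for q xs
  proof (cases "q < csize c")
    case True
    then show ?thesis
      using dl_wf[OF c, of xs 0 q] that length_dl[of c 0 q xs]
      by (cases "dl c 0 q xs") (simp add: mach_def)
  next
    case False
    then show ?thesis
      using that by (auto simp: mach_def stays_def)
  qed
  then show ?thesis
    by (auto simp: wf_tm_def mach_def)
qed

text \<open>The top of a stack lies under the head and the rest to its right. Pushing and popping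
  move the head, so the position drifts and \<open>rep\<close> quantifies it away; the output is
  instead anchored at cell 0, as \<open>tape_of\<close> demands.\<close>

definition stk :: "nat list => int => tape" where
  "stk l h = ((\<lambda>z. if h \<le> z \<and> z < h + int (length l) then l ! nat (z - h) else 0), h)"

definition outp :: "nat list => tape" where
  "outp l = ((\<lambda>z. if 0 \<le> z \<and> z < int (length l) then l ! nat z else 0), int (length l))"

definition rep :: "stacks => tape list => bool" where
  "rep s ts \<longleftrightarrow> length ts = 5 \<and> (\<forall>i<4. \<exists>h. ts ! i = stk (s i) h) \<and> ts ! 4 = outp (s 4)"

lemma scan_stk: "scan (stk l h) = top_of l"
  by (cases l) (auto simp: stk_def)

lemma scan_eq_fst: "scan t = fst t (snd t)"
  by (cases t) auto

lemma act_stay: "act t (scan t, Stay) = t"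
  by (cases t) auto

lemma act_push: "act (act (stk l h) (scan (stk l h), Left)) (a, Stay) = stk (a # l) (h - 1)"
  by (auto simp: stk_def fun_eq_iff nth_Cons' nat_diff_distrib algebra_simps intro!: arg_cong[of _ _ "(!) l"])

lemma act_pop: "act (stk l h) (0, Right) = stk (tl l) (h + 1)"
  by (cases l) (auto simp: stk_def fun_eq_iff nth_Cons' algebra_simps intro!: arg_cong[of _ _ "(!) _"])

lemma act_emit: "act (outp l) (a, Right) = outp (l @ [a])"
  by (auto simp: outp_def fun_eq_iff nth_append)

lemma map2_stays: "map2 act ts (stays (map scan ts)) = ts"
  by (intro nth_equalityI) (auto simp: stays_def act_stay)

lemma map2_update:
  "i < length ts ==>
   map2 act ts ((stays (map scan ts))[i := p]) = ts[i := act (ts ! i) p]"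
  by (intro nth_equalityI) (auto simp: stays_def act_stay nth_list_update)

lemma rep_update:
  assumes "rep s ts" "i < 4" "t = stk l h"
  shows "rep (s(i := l)) (ts[i := t])"
  using assms by (auto simp: rep_def nth_list_update)

text \<open>Only the states of the fragment are required to behave like \<open>dl\<close>, so that
  each subprogram inherits the hypothesis from its context. The halting states do not lie inside the
  code, hence no step in it is idle.\<close>

lemma compile_correct:
  assumes "bs c s n s'" "wfc c" "rep s ts"
    and "!!q. ofs \<le> q ==> q < ofs + csize c ==> delta M q = dl c ofs q"
    and "ofs + csize c \<le> accept M" "ofs + csize c \<le> reject M"
  shows "\<exists>ts'. (step M ^^ n) (ofs, ts) = (ofs + csize c, ts') \<and> rep s' ts'"
  using assms
proof (induction arbitrary: ts ofs rule: bs.induct)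
  case (bs_Push i a s)
  obtain h where h: "ts ! i = stk (s i) h" and i: "i < length ts"
    using bs_Push.prems by (auto simp: rep_def)
  let ?t1 = "act (ts ! i) (scan (ts ! i), Left)"
  have 1: "step M (ofs, ts) = (Suc ofs, ts[i := ?t1])"
    using bs_Push.prems(3)[of ofs] bs_Push.prems(4,5) i
    by (auto simp: step_def halted_def map2_update)
  have 2: "step M (Suc ofs, ts[i := ?t1]) = (Suc (Suc ofs), ts[i := act ?t1 (a, Stay)])"
    using bs_Push.prems(3)[of "Suc ofs"] bs_Push.prems(4,5) i
    by (auto simp: step_def halted_def map2_update[of i "ts[i := ?t1]"])
  have "rep (s(i := a # s i)) (ts[i := act ?t1 (a, Stay)])"
    by (rule rep_update[OF bs_Push.prems(2)]) (use bs_Push.prems h act_push in auto)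
  moreover have "(step M ^^ 2) (ofs, ts) = (ofs + 2, ts[i := act ?t1 (a, Stay)])"
    using 1 2 by (simp add: numeral_2_eq_2)
  ultimately show ?case by fastforce
next
  case (bs_Pop i s)
  obtain h where h: "ts ! i = stk (s i) h" and i: "i < length ts"
    using bs_Pop.prems by (auto simp: rep_def)
  have 1: "step M (ofs, ts) = (Suc ofs, ts[i := act (ts ! i) (0, Right)])"
    using bs_Pop.prems(3)[of ofs] bs_Pop.prems(4,5) i
    by (auto simp: step_def halted_def map2_update)
  have "rep (s(i := tl (s i))) (ts[i := act (ts ! i) (0, Right)])"
    by (rule rep_update[OF bs_Pop.prems(2)]) (use bs_Pop.prems h act_pop in auto)
  then show ?case using 1 by fastforce
next
  case (bs_Emit a s)
  have h: "ts ! 4 = outp (s 4)" and i: "4 < length ts"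
    using bs_Emit.prems by (auto simp: rep_def)
  have 1: "step M (ofs, ts) = (Suc ofs, ts[4 := act (ts ! 4) (a, Right)])"
    using bs_Emit.prems(3)[of ofs] bs_Emit.prems(4,5) i
    by (auto simp: step_def halted_def map2_update)
  have "rep (s(4 := s 4 @ [a])) (ts[4 := act (ts ! 4) (a, Right)])"
    using bs_Emit.prems(2) h by (auto simp: rep_def act_emit)
  then show ?case using 1 by fastforce
next
  case (bs_Seq c1 s n1 s' c2 n2 s'')
  obtain ts1 where 1: "(step M ^^ n1) (ofs, ts) = (ofs + csize c1, ts1)" "rep s' ts1"
    using bs_Seq.IH(1)[of ts ofs] bs_Seq.prems by force
  have d2: "delta M q = dl c2 (ofs + csize c1) q"
    if "ofs + csize c1 \<le> q" "q < ofs + csize c1 + csize c2" for q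
    using bs_Seq.prems(3)[of q] that by (auto simp: fun_eq_iff)
  obtain ts2 where 2: "(step M ^^ n2) (ofs + csize c1, ts1) = (ofs + csize c1 + csize c2, ts2)" "rep s'' ts2"
    using bs_Seq.IH(2)[OF _ 1(2) d2] bs_Seq.prems by force
  have "(step M ^^ (n1 + n2)) (ofs, ts) = (ofs + csize c1 + csize c2, ts2)"
    using 1 2 by (simp add: funpow_add add.commute[of n1])
  then show ?case using 2 by (auto simp: add.assoc)
next
  case (bs_IfT s i a c1 n s' c2)
  have i: "i < length ts" and sc: "scan (ts ! i) = a"
    using bs_IfT.prems bs_IfT.hyps by (auto simp: rep_def scan_stk)
  have 1: "step M (ofs, ts) = (Suc ofs, ts)"
    using bs_IfT.prems(3)[of ofs] bs_IfT.prems(4,5) i sc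
    by (auto simp: step_def halted_def map2_stays)
  have d: "delta M q = dl c1 (Suc ofs) q" if "Suc ofs \<le> q" "q < Suc ofs + csize c1" for q
    using bs_IfT.prems(3)[of q] that by (auto simp: fun_eq_iff)
  obtain ts1 where 2: "(step M ^^ n) (Suc ofs, ts) = (Suc ofs + csize c1, ts1)" "rep s' ts1"
    using bs_IfT.IH[OF _ bs_IfT.prems(2) d] bs_IfT.prems by force
  have 3: "step M (Suc ofs + csize c1, ts1) = (ofs + csize c1 + csize c2 + 2, ts1)"
    using bs_IfT.prems(3)[of "Suc ofs + csize c1"] bs_IfT.prems(4,5)
    by (auto simp: step_def halted_def map2_stays)
  have "(step M ^^ (Suc (n + 1))) (ofs, ts) = (step M ^^ (n + 1)) (step M (ofs, ts))"
    by (simp only: funpow_Suc_right o_apply)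
  then show ?case using 1 2 3 by auto
next
  case (bs_IfF s i a c2 n s' c1)
  have i: "i < length ts" and sc: "scan (ts ! i) \<noteq> a"
    using bs_IfF.prems bs_IfF.hyps by (auto simp: rep_def scan_stk)
  have 1: "step M (ofs, ts) = (ofs + csize c1 + 2, ts)"
    using bs_IfF.prems(3)[of ofs] bs_IfF.prems(4,5) i sc
    by (auto simp: step_def halted_def map2_stays)
  have d: "delta M q = dl c2 (ofs + csize c1 + 2) q"
    if "ofs + csize c1 + 2 \<le> q" "q < ofs + csize c1 + 2 + csize c2" for q
    using bs_IfF.prems(3)[of q] that by (auto simp: fun_eq_iff)
  obtain ts1 where 2: "(step M ^^ n) (ofs + csize c1 + 2, ts) = (ofs + csize c1 + 2 + csize c2, ts1)" "rep s' ts1"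
    using bs_IfF.IH[OF _ bs_IfF.prems(2) d] bs_IfF.prems by force
  have "(step M ^^ (Suc n)) (ofs, ts) = (step M ^^ n) (step M (ofs, ts))"
    by (simp only: funpow_Suc_right o_apply)
  then show ?case using 1 2 by (auto simp: algebra_simps)
next
  case (bs_WhileF s i a c)
  have i: "i < length ts" and sc: "scan (ts ! i) = a"
    using bs_WhileF.prems bs_WhileF.hyps by (auto simp: rep_def scan_stk)
  have 1: "step M (ofs, ts) = (ofs + csize c + 2, ts)"
    using bs_WhileF.prems(3)[of ofs] bs_WhileF.prems(4,5) i sc
    by (auto simp: step_def halted_def map2_stays)
  then show ?case using bs_WhileF.prems by auto
next
  case (bs_WhileT s i a c n s' m s'')
  have i: "i < length ts" and sc: "scan (ts ! i) \<noteq> a"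
    using bs_WhileT.prems bs_WhileT.hyps by (auto simp: rep_def scan_stk)
  have 1: "step M (ofs, ts) = (Suc ofs, ts)"
    using bs_WhileT.prems(3)[of ofs] bs_WhileT.prems(4,5) i sc
    by (auto simp: step_def halted_def map2_stays)
  have d: "delta M q = dl c (Suc ofs) q" if "Suc ofs \<le> q" "q < Suc ofs + csize c" for q
    using bs_WhileT.prems(3)[of q] that by (auto simp: fun_eq_iff)
  obtain ts1 where 2: "(step M ^^ n) (Suc ofs, ts) = (Suc ofs + csize c, ts1)" "rep s' ts1"
    using bs_WhileT.IH(1)[OF _ bs_WhileT.prems(2) d] bs_WhileT.prems by force
  have 3: "step M (Suc ofs + csize c, ts1) = (ofs, ts1)"
    using bs_WhileT.prems(3)[of "Suc ofs + csize c"] bs_WhileT.prems(4,5)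
    by (auto simp: step_def halted_def map2_stays)
  obtain ts2 where 4: "(step M ^^ m) (ofs, ts1) = (ofs + csize (While i a c), ts2)" "rep s'' ts2"
    using bs_WhileT.IH(2)[OF bs_WhileT.prems(1) 2(2) bs_WhileT.prems(3-5)] by blast
  have "(step M ^^ (m + Suc (Suc n))) (ofs, ts) = (step M ^^ m) ((step M ^^ Suc n) (step M (ofs, ts)))"
    by (simp only: funpow_add funpow_Suc_right o_apply)
  then have "(step M ^^ (n + m + 2)) (ofs, ts) = (ofs + csize (While i a c), ts2)"
    using 1 2 3 4 by (simp add: algebra_simps)
  then show ?case using 4 by blast
qed

lemma step_halted: "halted M c ==> (step M ^^ n) c = c"
  by (induction n) (auto simp: step_def)

text \<open>\<open>n < m\<close> leaves one step for the verdict; all later steps idle in a halting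
  state, so any larger polynomial may serve as time bound.\<close>

lemma mach_run:
  assumes "bs c s n s'" "wfc c" "length ws \<le> 4" "n < m"
    and s: "!!i. s i = (if i < length ws then map (\<lambda>b. if b then 2 else 1) (ws ! i) else [])"
  shows "\<exists>ts. run (mach c) ws m =
      (if top_of (s' 0) = 1 then accept (mach c) else reject (mach c), ts) \<and> rep s' ts"
proof -
  \<comment> \<open>Bits are written as 1 and 2 from cell 0 on, so an input tape already is a
    stack.\<close>
  have tp: "(tape_of w, 0) = stk (map (\<lambda>b. if b then 2 else 1) w) 0" for w
    by (auto simp: stk_def tape_of_def fun_eq_iff)
  have e: "(tape_of [], 0) = outp []"
    by (auto simp: outp_def tape_of_def fun_eq_iff)
  have "snd (init (mach c) ws) ! i = (tape_of (if i < length ws then ws ! i else []), 0)" if "i < 5" for i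
    using that by (auto simp: init_def mach_def nth_append simp del: upt_Suc)
  moreover have "length (snd (init (mach c) ws)) = 5"
    by (auto simp: init_def mach_def)
  ultimately have r: "rep s (snd (init (mach c) ws))"
    using assms(3) e unfolding rep_def by (auto simp: s tp intro: exI[of _ 0])
  obtain ts where 1: "(step (mach c) ^^ n) (0, snd (init (mach c) ws)) = (csize c, ts)" "rep s' ts"
    using compile_correct[OF assms(1,2) r, of 0 "mach c"] by (auto simp: mach_def)
  have i0: "init (mach c) ws = (0, snd (init (mach c) ws))"
    by (auto simp: init_def mach_def)
  let ?e = "(if top_of (s' 0) = 1 then accept (mach c) else reject (mach c), ts)"
  obtain h where ts0: "ts ! 0 = stk (s' 0) h" "0 < length ts"
    using 1(2) unfolding rep_def by (metis zero_less_numeral)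
  then have "map scan ts ! 0 = top_of (s' 0)"
    using scan_stk[of "s' 0"] by (metis nth_map)
  then have 2: "step (mach c) (csize c, ts) = ?e"
    using csize_pos[of c] by (auto simp: step_def halted_def mach_def map2_stays)
  have 3: "(step (mach c) ^^ (m - Suc n)) ?e = ?e"
    by (rule step_halted) (auto simp: halted_def)
  have "(step (mach c) ^^ ((m - Suc n) + Suc n)) (0, snd (init (mach c) ws)) = ?e"
    unfolding funpow_add o_apply funpow.simps(2) 1(1) 2 3 ..
  then have "run (mach c) ws m = ?e"
    using assms(4) i0 by (simp add: run_def)
  then show ?thesis using 1(2) by blast
qed

section \<open>Polynomial-time functions on encoded data\<close>

definition pb :: "(nat => nat) => bool" where
  "pb g \<longleftrightarrow> (\<exists>p. \<forall>n. g n \<le> poly p n)"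

lemma poly_nat_mono: "m \<le> n ==> poly p m \<le> poly (p :: nat poly) n"
  by (induction p) (auto intro!: add_mono mult_mono)

lemma pb_poly: "pb (\<lambda>n. poly p n)"
  by (auto simp: pb_def)

lemma pb_const: "pb (\<lambda>n. c)"
  unfolding pb_def by (rule exI[of _ "[:c:]"]) simp

lemma pb_id: "pb (\<lambda>n. n)"
  unfolding pb_def by (rule exI[of _ "[:0, 1:]"]) simp

lemma pb_add: "pb f ==> pb g ==> pb (\<lambda>n. f n + g n)"
proof -
  assume "pb f" "pb g"
  then obtain p q where "\<forall>n. f n \<le> poly p n" "\<forall>n. g n \<le> poly q n" by (auto simp: pb_def)
  then have "\<forall>n. f n + g n \<le> poly (p + q) n" by (auto intro: add_mono)
  then show ?thesis unfolding pb_def by blast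
qed

lemma pb_mult: "pb f ==> pb g ==> pb (\<lambda>n. f n * g n)"
proof -
  assume "pb f" "pb g"
  then obtain p q where "\<forall>n. f n \<le> poly p n" "\<forall>n. g n \<le> poly q n" by (auto simp: pb_def)
  then have "\<forall>n. f n * g n \<le> poly (p * q) n" by (auto intro: mult_mono)
  then show ?thesis unfolding pb_def by blast
qed

lemma pb_comp: "pb f ==> pb g ==> pb (\<lambda>n. f (g n))"
proof -
  assume "pb f" "pb g"
  then obtain p q where "\<forall>n. f n \<le> poly p n" "\<forall>n. g n \<le> poly q n" by (auto simp: pb_def)
  then have "\<forall>n. f (g n) \<le> poly (pcompose p q) n"
    unfolding poly_pcompose by (meson order_trans poly_nat_mono)
  then show ?thesis unfolding pb_def by blast
qed

lemma pb_poly_comp: "pb g ==> pb (\<lambda>n. poly p (g n))"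
  by (rule pb_comp[OF pb_poly])

lemma pb_Suc: "pb g ==> pb (\<lambda>n. Suc (g n))"
  using pb_add[OF _ pb_const[of 1]] by simp

lemma pb_power: "pb g ==> pb (\<lambda>n. g n ^ k)"
  by (induction k) (auto intro: pb_mult pb_const)

lemmas pb_intros = pb_const pb_id pb_Suc pb_add pb_mult pb_power pb_poly_comp

section \<open>Trees on stacks\<close>

datatype val = Nl | Cn val val

text \<open>Preorder with 2 for an inner node and 1 for a leaf. The code is self-delimiting, so
  codes can be put on top of one another and a program can work on the topmost one without looking
  below it.\<close>

fun ser :: "val => nat list" where
  "ser Nl = [1]" | "ser (Cn a b) = 2 # ser a @ ser b"

lemma set_ser: "set (ser v) \<subseteq> {1, 2}"
  by (induction v) auto

lemma length_ser_pos: "length (ser v) > 0"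
  by (cases v) auto

text \<open>Only upper bounds on time are tracked from here on, which lets the two arms of a test
  share one bound.\<close>

definition bt :: "com => stacks => nat => stacks => bool" where
  "bt c s n s' \<longleftrightarrow> (\<exists>m\<le>n. bs c s m s')"

lemma bt_Push: "bt (Push i a) s 2 (s(i := a # s i))"
  unfolding bt_def using bs_Push by blast

lemma bt_Pop: "bt (Pop i) s 1 (s(i := tl (s i)))"
  unfolding bt_def using bs_Pop by blast

lemma bt_Emit: "bt (Emit a) s 1 (s(4 := s 4 @ [a]))"
  unfolding bt_def using bs_Emit by blast

lemma bt_Seq: "bt c1 s n1 s' ==> bt c2 s' n2 s'' ==> bt (c1 ;; c2) s (n1 + n2) s''"
  unfolding bt_def by (meson add_mono bs_Seq)

lemma bt_IfT: "top_of (s i) = a ==> bt c1 s n s' ==> bt (If i a c1 c2) s (n + 2) s'"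
  unfolding bt_def by (meson add_mono bs_IfT order_refl)

lemma bt_IfF: "top_of (s i) \<noteq> a ==> bt c2 s n s' ==> bt (If i a c1 c2) s (n + 2) s'"
  unfolding bt_def by (meson add_mono bs_IfF one_le_numeral)

lemma bt_WhileF: "top_of (s i) = a ==> bt (While i a c) s 1 s"
  unfolding bt_def using bs_WhileF by blast

lemma bt_WhileT: "top_of (s i) \<noteq> a ==> bt c s n s' ==> bt (While i a c) s' m s'' ==>
    bt (While i a c) s (n + m + 2) s''"
  unfolding bt_def by (meson add_mono bs_WhileT order_refl)

lemma bt_conv: "bt c s n s' ==> n \<le> m ==> s' = t ==> bt c s m t"
  unfolding bt_def by (meson order_trans)

lemma bs_length: "bs c s n s' ==> length (s' i) \<le> length (s i) + n"
  by (induction rule: bs.induct) auto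

text \<open>Stack 2 holds one 1 for each subtree still to be read: an inner node adds one, a leaf
  removes one, and the marker 3 appears when the tree is complete. The symbols arrive on stack 1 in
  reverse order.\<close>

definition mvloop :: "nat => com" where
  "mvloop i = While 2 3 (If i 2 (Pop i ;; Push 1 2 ;; Push 2 1) (Pop i ;; Push 1 1 ;; Pop 2))"

lemma mvloop_2:
  assumes i: "i \<noteq> 1" "i \<noteq> 2"
    and "bt (mvloop i) (s(i := r, 1 := 2 # t, 2 := 1 # 1 # k)) n s'"
  shows "bt (mvloop i) (s(i := 2 # r, 1 := t, 2 := 1 # k)) (n + 9) s'"
proof -
  let ?s = "s(i := 2 # r, 1 := t, 2 := 1 # k)"
  have "bt (Pop i ;; Push 1 2 ;; Push 2 1) ?s 5 (s(i := r, 1 := 2 # t, 2 := 1 # 1 # k))"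
    by (rule bt_conv, (rule bt_Seq bt_Push bt_Pop)+) (use i in \<open>auto simp: fun_eq_iff\<close>)
  then have "bt (If i 2 (Pop i ;; Push 1 2 ;; Push 2 1) (Pop i ;; Push 1 1 ;; Pop 2)) ?s (5 + 2)
    (s(i := r, 1 := 2 # t, 2 := 1 # 1 # k))"
    by (rule bt_IfT[rotated]) (use i in auto)
  from bt_WhileT[OF _ this assms(3)[unfolded mvloop_def]] show ?thesis
    unfolding mvloop_def by (auto intro: bt_conv)
qed

lemma mvloop_1:
  assumes i: "i \<noteq> 1" "i \<noteq> 2"
    and "bt (mvloop i) (s(i := r, 1 := 1 # t, 2 := k)) n s'"
  shows "bt (mvloop i) (s(i := 1 # r, 1 := t, 2 := 1 # k)) (n + 9) s'"
proof -
  let ?s = "s(i := 1 # r, 1 := t, 2 := 1 # k)"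
  have "bt (Pop i ;; Push 1 1 ;; Pop 2) ?s 5 (s(i := r, 1 := 1 # t, 2 := k))"
    by (rule bt_conv, (rule bt_Seq bt_Push bt_Pop)+) (use i in \<open>auto simp: fun_eq_iff\<close>)
  then have "bt (If i 2 (Pop i ;; Push 1 2 ;; Push 2 1) (Pop i ;; Push 1 1 ;; Pop 2)) ?s (5 + 2)
    (s(i := r, 1 := 1 # t, 2 := k))"
    by (rule bt_IfF[rotated]) (use i in auto)
  from bt_WhileT[OF _ this assms(3)[unfolded mvloop_def]] show ?thesis
    unfolding mvloop_def by (auto intro: bt_conv)
qed

text \<open>The run is prolonged at the front: from a run that starts after \<open>v\<close> has
  been moved, one is obtained that starts before. In this form the node case applies the hypotheses
  to the right and then to the left subtree, without cutting a loop in the middle.\<close>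

lemma mvloop:
  assumes i: "i \<noteq> 1" "i \<noteq> 2"
  shows "bt (mvloop i) (s(i := r, 1 := rev (ser v) @ t, 2 := k)) n s' ==>
    bt (mvloop i) (s(i := ser v @ r, 1 := t, 2 := 1 # k)) (n + 9 * length (ser v)) s'"
proof (induction v arbitrary: r t k n)
  case Nl
  have e: "rev (ser Nl) @ t = 1 # t" "ser Nl @ r = 1 # r" by auto
  show ?case
    using mvloop_1[OF i Nl[unfolded e]] unfolding e by (rule bt_conv) auto
next
  case (Cn a b)
  have "bt (mvloop i) (s(i := r, 1 := rev (ser b) @ rev (ser a) @ 2 # t, 2 := k)) n s'"
    using Cn.prems by (simp add: fun_upd_def)
  from Cn.IH(2)[OF this]
  have "bt (mvloop i) (s(i := ser b @ r, 1 := rev (ser a) @ 2 # t, 2 := 1 # k)) (n + 9 * length (ser b)) s'" .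
  from Cn.IH(1)[OF this]
  have "bt (mvloop i) (s(i := ser a @ ser b @ r, 1 := 2 # t, 2 := 1 # 1 # k))
      (n + 9 * length (ser b) + 9 * length (ser a)) s'" .
  from mvloop_2[OF i this] show ?case
    unfolding ser.simps append.simps append_assoc by (rule bt_conv) auto
qed

definition mvr :: "nat => com" where
  "mvr i = Push 2 3 ;; Push 2 1 ;; mvloop i ;; Pop 2"

lemma mvr:
  assumes i: "i \<noteq> 1" "i \<noteq> 2" and s: "s i = ser v @ r"
  shows "bt (mvr i) s (9 * length (ser v) + 6) (s(i := r, 1 := rev (ser v) @ s 1))"
proof -
  have "bt (mvloop i) (s(i := r, 1 := rev (ser v) @ s 1, 2 := 3 # s 2)) 1
      (s(i := r, 1 := rev (ser v) @ s 1, 2 := 3 # s 2))"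
    unfolding mvloop_def by (rule bt_WhileF) auto
  from mvloop[OF i this]
  have *: "bt (mvloop i) (s(i := ser v @ r, 1 := s 1, 2 := 1 # 3 # s 2)) (1 + 9 * length (ser v))
      (s(i := r, 1 := rev (ser v) @ s 1, 2 := 3 # s 2))" .
  have e: "s(i := ser v @ r, 1 := s 1, 2 := 1 # 3 # s 2) = s(2 := 1 # 3 # s 2)"
    using s i by (auto simp: fun_eq_iff)
  have "bt (Push 2 3 ;; Push 2 1 ;; mvloop i ;; Pop 2) s (2 + (2 + (1 + 9 * length (ser v) + 1)))
      ((s(i := r, 1 := rev (ser v) @ s 1, 2 := 3 # s 2))(2 := tl ((s(i := r, 1 := rev (ser v) @ s 1, 2 := 3 # s 2)) 2)))"
    by (intro bt_Seq[OF bt_Push] bt_Seq[OF _ bt_Pop]) (use * e in simp)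
  then show ?thesis
    unfolding mvr_def by (rule bt_conv) (use i in \<open>auto simp: fun_eq_iff\<close>)
qed

fun pushes :: "nat list => nat => com" where
  "pushes [] a = Pop 1" | "pushes (j # js) a = Push j a ;; pushes js a"

text \<open>A second reversal restores the order, and pushing each symbol to several stacks copies
  at the same time. The marker 3 on stack 1 ends the loop.\<close>

definition put :: "nat list => com" where
  "put js = While 1 3 (If 1 2 (pushes js 2) (pushes js 1))"

definition upds :: "stacks => nat list => nat list => stacks" where
  "upds s js w = (\<lambda>i. if i \<in> set js then w @ s i else s i)"

lemma pushes:
  "distinct js ==> 1 \<notin> set js ==>
   bt (pushes js a) s (2 * length js + 1) ((upds s js [a])(1 := tl (s 1)))"
proof (induction js arbitrary: s)
  case Nil
  show ?case unfolding pushes.simps by (rule bt_conv[OF bt_Pop]) (auto simp: upds_def)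
next
  case (Cons j js)
  have "bt (pushes js a) (s(j := a # s j)) (2 * length js + 1)
      ((upds (s(j := a # s j)) js [a])(1 := tl ((s(j := a # s j)) 1)))"
    by (rule Cons.IH) (use Cons.prems in auto)
  from bt_Seq[OF bt_Push this] show ?case
    unfolding pushes.simps by (rule bt_conv) (use Cons.prems in \<open>auto simp: upds_def fun_eq_iff\<close>)
qed

lemma put:
  assumes js: "distinct js" "1 \<notin> set js"
  shows "set w \<subseteq> {1, 2} ==> s 1 = w @ 3 # t ==>
    bt (put js) s ((2 * length js + 5) * length w + 1) ((upds s js (rev w))(1 := 3 # t))"
proof (induction w arbitrary: s)
  case Nil
  then show ?case
    unfolding put_def by (intro bt_conv[OF bt_WhileF]) (auto simp: upds_def)
next
  case (Cons a w)
  have a: "a = 1 \<or> a = 2" using Cons.prems by auto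
  let ?s = "(upds s js [a])(1 := w @ 3 # t)"
  have p: "bt (pushes js a) s (2 * length js + 1) ?s"
    using pushes[OF js, of a s] Cons.prems by simp
  have "bt (If 1 2 (pushes js 2) (pushes js 1)) s (2 * length js + 1 + 2) ?s"
    using a by (metis Cons.prems(2) append_Cons bt_IfF bt_IfT p top_of.simps(2))
  moreover have "bt (put js) ?s ((2 * length js + 5) * length w + 1) ((upds ?s js (rev w))(1 := 3 # t))"
    by (rule Cons.IH) (use Cons.prems in auto)
  ultimately have "bt (put js) s (2 * length js + 1 + 2 + ((2 * length js + 5) * length w + 1) + 2)
     ((upds ?s js (rev w))(1 := 3 # t))"
    unfolding put_def by (intro bt_WhileT) (use Cons.prems a in auto)
  then show ?case
    by (rule bt_conv) (use js in \<open>auto simp: upds_def fun_eq_iff\<close>)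
qed

lemma set_rev_ser: "set (rev (ser v)) \<subseteq> {1, 2}"
  using set_ser by simp

text \<open>Without a target the tree is discarded, with two targets it is duplicated;
  \<open>drp\<close> and \<open>dup\<close> rest on these cases.\<close>

definition mv :: "nat => nat list => com" where
  "mv i js = Push 1 3 ;; mvr i ;; put js ;; Pop 1"

lemma mv:
  assumes i: "i \<noteq> 1" "i \<noteq> 2" and js: "distinct js" "1 \<notin> set js" and s: "s i = ser v @ r"
  shows "bt (mv i js) s ((2 * length js + 14) * length (ser v) + 10) (upds (s(i := r)) js (ser v))"
proof -
  let ?s1 = "s(1 := 3 # s 1)"
  let ?s2 = "?s1(i := r, 1 := rev (ser v) @ ?s1 1)"
  have 1: "bt (mvr i) ?s1 (9 * length (ser v) + 6) ?s2"
    by (rule mvr) (use i s in auto)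
  have 2: "bt (put js) ?s2 ((2 * length js + 5) * length (rev (ser v)) + 1) ((upds ?s2 js (rev (rev (ser v))))(1 := 3 # s 1))"
    by (rule put[OF js set_rev_ser]) auto
  have 3: "bt (Pop 1) ((upds ?s2 js (rev (rev (ser v))))(1 := 3 # s 1)) 1 (upds (s(i := r)) js (ser v))"
    by (rule bt_conv[OF bt_Pop]) (use i js in \<open>auto simp: upds_def fun_eq_iff\<close>)
  from bt_Seq[OF bt_Push bt_Seq[OF 1 bt_Seq[OF 2 3]]] show ?thesis
    unfolding mv_def by (rule bt_conv) (auto simp: algebra_simps)
qed

lemma mv_single:
  assumes "i \<noteq> 1" "i \<noteq> 2" "j \<noteq> 1" "i \<noteq> j" "s i = ser v @ r"
  shows "bt (mv i [j]) s (16 * length (ser v) + 10) (s(i := r, j := ser v @ s j))"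
  by (rule bt_conv[OF mv]) (use assms in \<open>auto simp: upds_def fun_eq_iff\<close>)

definition drp :: com where "drp = mv 0 []"

lemma drp: "s 0 = ser v @ r ==> bt drp s (14 * length (ser v) + 10) (s(0 := r))"
  unfolding drp_def by (rule bt_conv[OF mv]) (auto simp: upds_def fun_eq_iff)

definition dup :: com where "dup = mv 0 [0, 3] ;; mv 3 [0]"

lemma dup: "s 0 = ser v @ r ==> bt dup s (34 * length (ser v) + 20) (s(0 := ser v @ ser v @ r))"
proof -
  assume s: "s 0 = ser v @ r"
  have 1: "bt (mv 0 [0, 3]) s (18 * length (ser v) + 10) (s(0 := ser v @ r, 3 := ser v @ s 3))"
    by (rule bt_conv[OF mv]) (use s in \<open>auto simp: upds_def fun_eq_iff\<close>)
  have 2: "bt (mv 3 [0]) (s(0 := ser v @ r, 3 := ser v @ s 3)) (16 * length (ser v) + 10) (s(0 := ser v @ ser v @ r))"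
    by (rule bt_conv[OF mv_single]) (use s in \<open>auto simp: upds_def fun_eq_iff\<close>)
  show ?thesis
    unfolding dup_def by (rule bt_conv[OF bt_Seq[OF 1 2]]) auto
qed

lemma wfc_pushes: "set js \<subseteq> {..<4} ==> a < 4 ==> wfc (pushes js a)"
  by (induction js) auto

lemma wfc_mv: "i < 4 ==> set js \<subseteq> {..<4} ==> wfc (mv i js)"
  by (auto simp: mv_def mvr_def mvloop_def put_def wfc_pushes)

lemma wfc_drp: "wfc drp" and wfc_dup: "wfc dup"
  by (auto simp: drp_def dup_def wfc_mv)

section \<open>Encodable types and polynomial-time functions\<close>

class enc =
  fixes ev :: "'a => val" and dv :: "val => 'a"
  assumes dv_ev: "dv (ev x) = x"

lemma ev_inj: "ev x = ev y \<longleftrightarrow> x = y"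
  by (metis dv_ev)

definition sz :: "'a::enc => nat" where
  "sz x = length (ser (ev x))"

text \<open>The program replaces the topmost code on stack 0 and restores everything below it and on
  the other stacks. This frame condition makes such programs composable; time is measured in the
  size of the code.\<close>

definition pt :: "('a::enc => 'b::enc) => bool" where
  "pt f \<longleftrightarrow> (\<exists>c p. wfc c \<and> (\<forall>x s r. s 0 = ser (ev x) @ r -->
      bt c s (poly p (sz x)) (s(0 := ser (ev (f x)) @ r))))"

lemma ptI:
  assumes "wfc c" "pb g"
    and "!!x s r. s 0 = ser (ev x) @ r ==> bt c s (g (sz x)) (s(0 := ser (ev (f x)) @ r))"
  shows "pt f"
proof -
  obtain p where "\<forall>n. g n \<le> poly p n" using assms(2) by (auto simp: pb_def)
  then show ?thesis
    unfolding pt_def using assms(1,3) bt_conv by blast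
qed

abbreviation computes :: "com => nat poly => ('a::enc => 'b::enc) => prop" where
  "computes c p f \<equiv> (!!x s r. s 0 = ser (ev x) @ r ==> bt c s (poly p (sz x)) (s(0 := ser (ev (f x)) @ r)))"

lemma ptE:
  assumes "pt f"
  obtains c p where "wfc c"
    "PROP computes c p f"
  using assms unfolding pt_def by blast

text \<open>A stack grows by at most one symbol per step, so the time bound also bounds the size of
  the value. To read this off, the program is run on otherwise empty stacks.\<close>

lemma pt_size:
  assumes "pt f"
  shows "\<exists>p. \<forall>x. sz (f x) \<le> poly p (sz x)"
proof -
  obtain c p where c: "PROP computes c p f"
    using ptE[OF assms] by metis
  have "sz (f x) \<le> poly (p + [:0, 1:]) (sz x)" for x
  proof -
    obtain m where "m \<le> poly p (sz x)" "bs c (\<lambda>i. if i = 0 then ser (ev x) else []) m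
        ((\<lambda>i. if i = 0 then ser (ev x) else [])(0 := ser (ev (f x)) @ []))"
      using c[of "\<lambda>i. if i = 0 then ser (ev x) else []" x "[]"] by (auto simp: bt_def)
    then show ?thesis using bs_length[where i = 0] by (fastforce simp: sz_def)
  qed
  then show ?thesis by blast
qed

text \<open>A program sees encodings only, hence values of different types with equal codes, such as
  a number and its bit list, are interchangeable at no cost.\<close>

lemma pt_ev_cong: "pt f ==> (!!x. ev (g x) = ev (f x)) ==> pt g"
  unfolding pt_def by simp

lemma pt_id: "pt (\<lambda>x :: 'a::enc. x)"
proof (rule ptI[of "Push 0 1 ;; Pop 0" "\<lambda>n. 3"])
  fix x :: 'a and s :: stacks and r
  assume s: "s 0 = ser (ev x) @ r"
  show "bt (Push 0 1 ;; Pop 0) s 3 (s(0 := ser (ev x) @ r))"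
    by (rule bt_conv[OF bt_Seq[OF bt_Push bt_Pop]]) (use s in auto)
qed (auto intro: pb_const)

lemma pt_coerce: "(!!x. ev (g x) = ev x) ==> pt g"
  using pt_ev_cong[OF pt_id] .

lemma pt_comp:
  assumes "pt f" "pt g"
  shows "pt (\<lambda>x. f (g x))"
proof -
  obtain c p where c: "wfc c" "PROP computes c p f"
    using ptE[OF assms(1)] by metis
  obtain d q where d: "wfc d" "PROP computes d q g"
    using ptE[OF assms(2)] by metis
  obtain q' where q': "!!x. sz (g x) \<le> poly q' (sz x)"
    using pt_size[OF assms(2)] by blast
  show ?thesis
  proof (rule ptI[of "d ;; c" "\<lambda>n. poly q n + poly p (poly q' n)"])
    fix x :: 'c and s :: stacks and r
    assume s: "s 0 = ser (ev x) @ r"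
    have "bt c (s(0 := ser (ev (g x)) @ r)) (poly p (sz (g x))) (s(0 := ser (ev (g x)) @ r, 0 := ser (ev (f (g x))) @ r))"
      by (rule c) auto
    from bt_Seq[OF d(2)[of s x r, OF s] this] show "bt (d ;; c) s (poly q (sz x) + poly p (poly q' (sz x))) (s(0 := ser (ev (f (g x))) @ r))"
      by (rule bt_conv) (auto intro!: poly_nat_mono q')
  qed (auto simp: c d intro!: pb_intros)
qed

text \<open>Pushing and popping one symbol serves as the empty program.\<close>

fun pushlist :: "nat list => com" where
  "pushlist [] = Push 0 1 ;; Pop 0"
| "pushlist (a # w) = pushlist w ;; Push 0 a"

lemma pushlist: "bt (pushlist w) s (3 + 2 * length w) (s(0 := w @ s 0))"
proof (induction w)
  case Nil
  show ?case unfolding pushlist.simps by (rule bt_conv[OF bt_Seq[OF bt_Push bt_Pop]]) auto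
next
  case (Cons a w)
  show ?case unfolding pushlist.simps by (rule bt_conv[OF bt_Seq[OF Cons bt_Push]]) auto
qed

lemma wfc_pushlist: "set w \<subseteq> {1, 2} ==> wfc (pushlist w)"
  by (induction w) auto

lemma pt_const: "pt (\<lambda>x :: 'a::enc. c)"
proof (rule ptI[of "drp ;; pushlist (ser (ev c))" "\<lambda>n. 14 * n + 10 + (3 + 2 * length (ser (ev c)))"])
  fix x :: 'a and s :: stacks and r
  assume s: "s 0 = ser (ev x) @ r"
  show "bt (drp ;; pushlist (ser (ev c))) s (14 * sz x + 10 + (3 + 2 * length (ser (ev c)))) (s(0 := ser (ev c) @ r))"
    by (rule bt_conv[OF bt_Seq[OF drp[of s "ev x" r, OF s] pushlist]]) (auto simp: sz_def)
qed (auto simp: wfc_drp wfc_pushlist[OF set_ser] intro!: pb_intros)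

instantiation val :: enc
begin
definition ev_val :: "val => val" where "ev_val v = v"
definition dv_val :: "val => val" where "dv_val v = v"
instance by standard (simp add: ev_val_def dv_val_def)
end

instantiation prod :: (enc, enc) enc
begin
definition ev_prod :: "'a \<times> 'b => val" where "ev_prod x = Cn (ev (fst x)) (ev (snd x))"
definition dv_prod :: "val => 'a \<times> 'b" where
  "dv_prod v = (case v of Nl => (dv Nl, dv Nl) | Cn a b => (dv a, dv b))"
instance by standard (simp add: ev_prod_def dv_prod_def dv_ev)
end

text \<open>Both truth values have the same size, so that the size of a number is affine in its bit length.\<close>

instantiation bool :: enc
begin
definition ev_bool :: "bool => val" where
  "ev_bool b = (if b then Cn Nl (Cn Nl Nl) else Cn (Cn Nl Nl) Nl)"
definition dv_bool :: "val => bool" where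
  "dv_bool v = (case v of Cn Nl b => True | _ => False)"
instance by standard (simp add: ev_bool_def dv_bool_def)
end

instantiation unit :: enc
begin
definition ev_unit :: "unit => val" where "ev_unit u = Nl"
definition dv_unit :: "val => unit" where "dv_unit v = ()"
instance by standard simp
end

text \<open>Every tree is a list along its right spine, and this is a bijection; case analysis on
  trees is thus reduced to that on lists.\<close>

fun vlist :: "val => val list" where
  "vlist Nl = []" | "vlist (Cn a b) = a # vlist b"

fun listv :: "val list => val" where
  "listv [] = Nl" | "listv (a # b) = Cn a (listv b)"

lemma vlist_listv [simp]: "vlist (listv l) = l"
  by (induction l) auto

lemma listv_vlist [simp]: "listv (vlist v) = v"
  by (induction v) auto

instantiation list :: (enc) enc
begin
definition ev_list :: "'a list => val" where "ev_list l = listv (map ev l)"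
definition dv_list :: "val => 'a list" where "dv_list v = map dv (vlist v)"
instance by standard (simp add: ev_list_def dv_list_def dv_ev o_def)
end

instantiation option :: (enc) enc
begin
definition ev_option :: "'a option => val" where
  "ev_option x = (case x of None => Nl | Some y => Cn (ev y) Nl)"
definition dv_option :: "val => 'a option" where
  "dv_option v = (case v of Nl => None | Cn a b => Some (dv a))"
instance by standard (auto simp: ev_option_def dv_option_def dv_ev split: option.splits)
end

fun nbits :: "nat => bool list" where
  "nbits n = (if n = 0 then [] else odd n # nbits (n div 2))"
declare nbits.simps [simp del]

definition ofbits :: "bool list => nat" where
  "ofbits l = foldr (\<lambda>b r. of_bool b + 2 * r) l 0"

lemma ofbits_nbits: "ofbits (nbits n) = n"
proof (induction n rule: nbits.induct)
  case (1 n)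
  then show ?case by (subst nbits.simps) (auto simp: ofbits_def)
qed

instantiation nat :: enc
begin
definition ev_nat :: "nat => val" where "ev_nat n = ev (nbits n)"
definition dv_nat :: "val => nat" where "dv_nat v = ofbits (dv v)"
instance by standard (simp add: ev_nat_def dv_nat_def dv_ev ofbits_nbits)
end

lemma ev_Cons: "ev (x # xs) = Cn (ev x) (ev xs)" and ev_Nil: "ev [] = Nl"
  by (auto simp: ev_list_def)

lemma sz_pair [simp]: "sz (x, y) = 1 + sz x + sz y"
  by (simp add: sz_def ev_prod_def)

lemma sz_bool [simp]: "sz (b :: bool) = 5"
  by (simp add: sz_def ev_bool_def)

lemma sz_Nil [simp]: "sz [] = 1"
  by (simp add: sz_def ev_Nil)

lemma sz_Cons [simp]: "sz (x # xs) = 1 + sz x + sz xs"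
  by (simp add: sz_def ev_Cons)

lemma sz_unit [simp]: "sz (u :: unit) = 1"
  by (simp add: sz_def ev_unit_def)

lemma sz_None [simp]: "sz None = 1" and sz_Some [simp]: "sz (Some x) = 2 + sz x"
  by (auto simp: sz_def ev_option_def)

lemma sz_pos: "sz x \<ge> 1"
  using length_ser_pos[of "ev x"] by (simp add: sz_def Suc_le_eq)

text \<open>The first result waits on stack 3 while the second is computed, which is safe because a
  program leaves stack 3 as it was.\<close>

lemma pt_pair:
  assumes "pt f" "pt g"
  shows "pt (\<lambda>x. (f x, g x))"
proof -
  obtain c p where c: "wfc c" "PROP computes c p f"
    using ptE[OF assms(1)] by metis
  obtain d q where d: "wfc d" "PROP computes d q g"
    using ptE[OF assms(2)] by metis
  obtain p' where p': "!!x. sz (f x) \<le> poly p' (sz x)"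
    using pt_size[OF assms(1)] by blast
  show ?thesis
  proof (rule ptI[of "dup ;; c ;; mv 0 [3] ;; d ;; mv 3 [0] ;; Push 0 2"
        "\<lambda>n. 34 * n + 20 + (poly p n + (16 * poly p' n + 10 + (poly q n + (16 * poly p' n + 10 + 2))))"])
    fix x :: 'a and s :: stacks and r
    assume s: "s 0 = ser (ev x) @ r"
    let ?X = "ser (ev x)" and ?F = "ser (ev (f x))" and ?G = "ser (ev (g x))"
    have 1: "bt dup s (34 * sz x + 20) (s(0 := ?X @ ?X @ r))"
      using dup[of s "ev x" r] s by (simp add: sz_def)
    have 2: "bt c (s(0 := ?X @ ?X @ r)) (poly p (sz x)) (s(0 := ?F @ ?X @ r))"
      by (rule bt_conv[OF c(2)[where x = x and r = "?X @ r"]]) auto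
    have 3: "bt (mv 0 [3]) (s(0 := ?F @ ?X @ r)) (16 * poly p' (sz x) + 10) (s(0 := ?X @ r, 3 := ?F @ s 3))"
      by (rule bt_conv[OF mv_single[where v = "ev (f x)" and r = "?X @ r"]]) (use p' in \<open>auto simp: sz_def fun_eq_iff\<close>)
    have 4: "bt d (s(0 := ?X @ r, 3 := ?F @ s 3)) (poly q (sz x)) (s(0 := ?G @ r, 3 := ?F @ s 3))"
      by (rule bt_conv[OF d(2)[where x = x and r = r]]) (auto simp: fun_eq_iff)
    have 5: "bt (mv 3 [0]) (s(0 := ?G @ r, 3 := ?F @ s 3)) (16 * poly p' (sz x) + 10) (s(0 := ?F @ ?G @ r))"
      by (rule bt_conv[OF mv_single[where v = "ev (f x)" and r = "s 3"]]) (use p' in \<open>auto simp: sz_def fun_eq_iff\<close>)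
    show "bt (dup ;; c ;; mv 0 [3] ;; d ;; mv 3 [0] ;; Push 0 2) s
       (34 * sz x + 20 + (poly p (sz x) + (16 * poly p' (sz x) + 10 + (poly q (sz x) + (16 * poly p' (sz x) + 10 + 2)))))
       (s(0 := ser (ev (f x, g x)) @ r))"
      by (rule bt_conv[OF bt_Seq[OF 1 bt_Seq[OF 2 bt_Seq[OF 3 bt_Seq[OF 4 bt_Seq[OF 5 bt_Push]]]]]])
        (auto simp: ev_prod_def fun_eq_iff)
  qed (auto simp: c d wfc_dup wfc_mv intro!: pb_intros)
qed

lemma pt_fst': "pt (fst :: 'a::enc \<times> 'b::enc => 'a)"
proof (rule ptI[of "Pop 0 ;; mv 0 [3] ;; drp ;; mv 3 [0]" "\<lambda>n. 1 + (16 * n + 10 + (14 * n + 10 + (16 * n + 10)))"])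
  fix x :: "'a \<times> 'b" and s :: stacks and r
  assume "s 0 = ser (ev x) @ r"
  then have s: "s 0 = 2 # ser (ev (fst x)) @ ser (ev (snd x)) @ r" by (simp add: ev_prod_def)
  have l: "length (ser (ev (fst x))) \<le> sz x" "length (ser (ev (snd x))) \<le> sz x"
    by (auto simp: sz_def ev_prod_def)
  let ?F = "ser (ev (fst x))" and ?G = "ser (ev (snd x))"
  have 1: "bt (Pop 0) s 1 (s(0 := ?F @ ?G @ r))"
    by (rule bt_conv[OF bt_Pop]) (auto simp: s)
  have 2: "bt (mv 0 [3]) (s(0 := ?F @ ?G @ r)) (16 * sz x + 10) (s(0 := ?G @ r, 3 := ?F @ s 3))"
    by (rule bt_conv[OF mv_single[where v = "ev (fst x)" and r = "?G @ r"]]) (use l in \<open>auto simp: fun_eq_iff\<close>)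
  have 3: "bt drp (s(0 := ?G @ r, 3 := ?F @ s 3)) (14 * sz x + 10) (s(0 := r, 3 := ?F @ s 3))"
    by (rule bt_conv[OF drp[where v = "ev (snd x)" and r = r]]) (use l in \<open>auto simp: fun_eq_iff\<close>)
  have 4: "bt (mv 3 [0]) (s(0 := r, 3 := ?F @ s 3)) (16 * sz x + 10) (s(0 := ?F @ r))"
    by (rule bt_conv[OF mv_single[where v = "ev (fst x)" and r = "s 3"]]) (use l in \<open>auto simp: fun_eq_iff\<close>)
  show "bt (Pop 0 ;; mv 0 [3] ;; drp ;; mv 3 [0]) s (1 + (16 * sz x + 10 + (14 * sz x + 10 + (16 * sz x + 10)))) (s(0 := ?F @ r))"
    using bt_Seq[OF 1 bt_Seq[OF 2 bt_Seq[OF 3 4]]] .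
qed (auto simp: wfc_drp wfc_mv intro!: pb_intros)

lemma pt_snd': "pt (snd :: 'a::enc \<times> 'b::enc => 'b)"
proof (rule ptI[of "Pop 0 ;; drp" "\<lambda>n. 1 + (14 * n + 10)"])
  fix x :: "'a \<times> 'b" and s :: stacks and r
  assume "s 0 = ser (ev x) @ r"
  then have s: "s 0 = 2 # ser (ev (fst x)) @ ser (ev (snd x)) @ r" by (simp add: ev_prod_def)
  have l: "length (ser (ev (fst x))) \<le> sz x"
    by (auto simp: sz_def ev_prod_def)
  let ?F = "ser (ev (fst x))" and ?G = "ser (ev (snd x))"
  have 1: "bt (Pop 0) s 1 (s(0 := ?F @ ?G @ r))"
    by (rule bt_conv[OF bt_Pop]) (auto simp: s)
  have 3: "bt drp (s(0 := ?F @ ?G @ r)) (14 * sz x + 10) (s(0 := ?G @ r))"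
    by (rule bt_conv[OF drp[where v = "ev (fst x)" and r = "?G @ r"]]) (use l in \<open>auto simp: fun_eq_iff\<close>)
  show "bt (Pop 0 ;; drp) s (1 + (14 * sz x + 10)) (s(0 := ?G @ r))"
    using bt_Seq[OF 1 3] .
qed (auto simp: wfc_drp intro!: pb_intros)

lemmas pt_fst = pt_comp[OF pt_fst'] and pt_snd = pt_comp[OF pt_snd']

lemma pt_if:
  assumes "pt b" "pt f" "pt g"
  shows "pt (\<lambda>x. if b x then f x else g x)"
proof -
  obtain c p where c: "wfc c" "PROP computes c p b"
    using ptE[OF assms(1)] by metis
  obtain d q where d: "wfc d" "PROP computes d q f"
    using ptE[OF assms(2)] by metis
  obtain d' q' where d': "wfc d'" "PROP computes d' q' g"
    using ptE[OF assms(3)] by metis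
  \<comment> \<open>After the first symbol has been dropped, the codes of the truth values differ in
    the next one, 1 for True and 2 for False; in both cases four symbols remain to be
    removed.\<close>
  let ?pops = "Pop 0 ;; Pop 0 ;; Pop 0 ;; Pop 0"
  show ?thesis
  proof (rule ptI[of "dup ;; c ;; Pop 0 ;; If 0 1 (?pops ;; d) (?pops ;; d')"
        "\<lambda>n. 34 * n + 20 + (poly p n + (1 + (4 + poly q n + poly q' n + 2)))"])
    fix x :: 'a and s :: stacks and r
    assume s: "s 0 = ser (ev x) @ r"
    let ?X = "ser (ev x)" and ?F = "ser (ev (f x))" and ?G = "ser (ev (g x))"
    have 1: "bt dup s (34 * sz x + 20) (s(0 := ?X @ ?X @ r))"
      using dup[of s "ev x" r] s by (simp add: sz_def)
    have 2: "bt c (s(0 := ?X @ ?X @ r)) (poly p (sz x)) (s(0 := ser (ev (b x)) @ ?X @ r))"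
      by (rule bt_conv[OF c(2)[where x = x and r = "?X @ r"]]) auto
    have 3: "bt (Pop 0) (s(0 := ser (ev (b x)) @ ?X @ r)) 1 (s(0 := (if b x then [1, 2, 1, 1] else [2, 1, 1, 1]) @ ?X @ r))"
      by (rule bt_conv[OF bt_Pop]) (auto simp: ev_bool_def)
    have 4: "bt ?pops (s(0 := (if b x then [1, 2, 1, 1] else [2, 1, 1, 1]) @ ?X @ r)) 4 (s(0 := ?X @ r))"
      by (rule bt_conv, (rule bt_Seq bt_Pop)+) auto
    have 5: "bt d (s(0 := ?X @ r)) (poly q (sz x)) (s(0 := ?F @ r))"
      by (rule bt_conv[OF d(2)[where x = x and r = r]]) auto
    have 6: "bt d' (s(0 := ?X @ r)) (poly q' (sz x)) (s(0 := ?G @ r))"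
      by (rule bt_conv[OF d'(2)[where x = x and r = r]]) auto
    have 7: "bt (If 0 1 (?pops ;; d) (?pops ;; d')) (s(0 := (if b x then [1, 2, 1, 1] else [2, 1, 1, 1]) @ ?X @ r))
       (4 + poly q (sz x) + poly q' (sz x) + 2) (s(0 := (if b x then ?F else ?G) @ r))"
    proof (cases "b x")
      case True
      show ?thesis
        by (rule bt_conv[OF bt_IfT[OF _ bt_Seq[OF 4 5]]]) (use True in auto)
    next
      case False
      show ?thesis
        by (rule bt_conv[OF bt_IfF[OF _ bt_Seq[OF 4 6]]]) (use False in auto)
    qed
    show "bt (dup ;; c ;; Pop 0 ;; If 0 1 (?pops ;; d) (?pops ;; d')) s
        (34 * sz x + 20 + (poly p (sz x) + (1 + (4 + poly q (sz x) + poly q' (sz x) + 2))))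
        (s(0 := ser (ev (if b x then f x else g x)) @ r))"
      by (rule bt_conv[OF bt_Seq[OF 1 bt_Seq[OF 2 bt_Seq[OF 3 7]]]]) auto
  qed (auto simp: c d d' wfc_dup intro!: pb_intros)
qed

lemma pt_case_list':
  assumes "pt l" "pt f" "pt g"
  shows "pt (\<lambda>x. case l x of [] => f x | y # ys => g (y, ys, x))"
proof -
  obtain c p where c: "wfc c" "PROP computes c p l"
    using ptE[OF assms(1)] by metis
  obtain d q where d: "wfc d" "PROP computes d q f"
    using ptE[OF assms(2)] by metis
  obtain d' q' where d': "wfc d'" "PROP computes d' q' g"
    using ptE[OF assms(3)] by metis
  obtain p' where p': "!!x. sz (l x) \<le> poly p' (sz x)"
    using pt_size[OF assms(1)] by blast
  \<comment> \<open>The parts of the list and the saved argument become the code of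
    \<open>(y, ys, x)\<close>; the head is lifted to stack 3 in order to insert the inner pairing
    symbol below it.\<close>
  let ?A = "Pop 0 ;; mv 0 [3] ;; Push 0 2 ;; mv 3 [0] ;; Push 0 2 ;; d'"
  let ?tA = "\<lambda>n. 1 + (16 * poly p' n + 10 + (2 + (16 * poly p' n + 10 + (2 + poly q' (1 + n + poly p' n)))))"
  show ?thesis
  proof (rule ptI[of "dup ;; c ;; If 0 2 ?A (Pop 0 ;; d)"
        "\<lambda>n. 34 * n + 20 + (poly p n + (?tA n + (1 + poly q n) + 2))"])
    fix x :: 'a and s :: stacks and r
    assume s: "s 0 = ser (ev x) @ r"
    let ?X = "ser (ev x)" and ?R = "case l x of [] => f x | y # ys => g (y, ys, x)"
    have 1: "bt dup s (34 * sz x + 20) (s(0 := ?X @ ?X @ r))"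
      using dup[of s "ev x" r] s by (simp add: sz_def)
    have 2: "bt c (s(0 := ?X @ ?X @ r)) (poly p (sz x)) (s(0 := ser (ev (l x)) @ ?X @ r))"
      by (rule bt_conv[OF c(2)[where x = x and r = "?X @ r"]]) auto
    have 3: "bt (If 0 2 ?A (Pop 0 ;; d)) (s(0 := ser (ev (l x)) @ ?X @ r)) (?tA (sz x) + (1 + poly q (sz x)) + 2)
        (s(0 := ser (ev ?R) @ r))"
    proof (cases "l x")
      case Nil
      have 31: "bt (Pop 0) (s(0 := ser (ev (l x)) @ ?X @ r)) 1 (s(0 := ?X @ r))"
        by (rule bt_conv[OF bt_Pop]) (auto simp: Nil ev_Nil)
      have 32: "bt d (s(0 := ?X @ r)) (poly q (sz x)) (s(0 := ser (ev (f x)) @ r))"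
        by (rule bt_conv[OF d(2)[where x = x and r = r]]) auto
      show ?thesis
        by (rule bt_conv[OF bt_IfF[OF _ bt_Seq[OF 31 32]]]) (auto simp: Nil ev_Nil)
    next
      case (Cons y ys)
      have le: "length (ser (ev y)) \<le> poly p' (sz x)" "sz y + sz ys \<le> poly p' (sz x)"
        using p'[of x] by (auto simp: Cons sz_def ev_Cons)
      let ?Y = "ser (ev y)" and ?Z = "ser (ev ys)"
      have 31: "bt (Pop 0) (s(0 := ser (ev (l x)) @ ?X @ r)) 1 (s(0 := ?Y @ ?Z @ ?X @ r))"
        by (rule bt_conv[OF bt_Pop]) (auto simp: Cons ev_Cons)
      have 32: "bt (mv 0 [3]) (s(0 := ?Y @ ?Z @ ?X @ r)) (16 * poly p' (sz x) + 10) (s(0 := ?Z @ ?X @ r, 3 := ?Y @ s 3))"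
        by (rule bt_conv[OF mv_single[where v = "ev y" and r = "?Z @ ?X @ r"]]) (use le in \<open>auto simp: fun_eq_iff\<close>)
      have 33: "bt (Push 0 2) (s(0 := ?Z @ ?X @ r, 3 := ?Y @ s 3)) 2 (s(0 := 2 # ?Z @ ?X @ r, 3 := ?Y @ s 3))"
        by (rule bt_conv[OF bt_Push]) (auto simp: fun_eq_iff)
      have 34: "bt (mv 3 [0]) (s(0 := 2 # ?Z @ ?X @ r, 3 := ?Y @ s 3)) (16 * poly p' (sz x) + 10) (s(0 := ?Y @ 2 # ?Z @ ?X @ r))"
        by (rule bt_conv[OF mv_single[where v = "ev y" and r = "s 3"]]) (use le in \<open>auto simp: fun_eq_iff\<close>)
      have 35: "bt (Push 0 2) (s(0 := ?Y @ 2 # ?Z @ ?X @ r)) 2 (s(0 := 2 # ?Y @ 2 # ?Z @ ?X @ r))"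
        by (rule bt_conv[OF bt_Push]) (auto simp: fun_eq_iff)
      have 36: "bt d' (s(0 := 2 # ?Y @ 2 # ?Z @ ?X @ r)) (poly q' (sz (y, ys, x))) (s(0 := ser (ev (g (y, ys, x))) @ r))"
        by (rule bt_conv[OF d'(2)[where x = "(y, ys, x)" and r = r]]) (auto simp: ev_prod_def)
      have lq: "poly q' (sz (y, ys, x)) \<le> poly q' (1 + sz x + poly p' (sz x))"
        using p'[of x] by (intro poly_nat_mono) (auto simp: Cons)
      show ?thesis
        by (rule bt_conv[OF bt_IfT[OF _ bt_Seq[OF 31 bt_Seq[OF 32 bt_Seq[OF 33 bt_Seq[OF 34 bt_Seq[OF 35 36]]]]]]])
          (use lq in \<open>auto simp: Cons ev_Cons\<close>)
    qed
    show "bt (dup ;; c ;; If 0 2 ?A (Pop 0 ;; d)) s (34 * sz x + 20 + (poly p (sz x) + (?tA (sz x) + (1 + poly q (sz x)) + 2)))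
        (s(0 := ser (ev ?R) @ r))"
      using bt_Seq[OF 1 bt_Seq[OF 2 3]] .
  qed (auto simp: c d d' wfc_dup wfc_mv intro!: pb_intros)
qed

text \<open>The word \<open>w\<close> above the marker on stack 3 is a clock: one symbol is dropped
  per round, and it only matters that none of them is 3.\<close>

lemma loop_funpow:
  fixes f :: "'a::enc => 'a"
  assumes c: "PROP computes c p f"
  shows "3 \<notin> set w ==> (!!i. i < length w ==> poly p (sz ((f ^^ i) x)) \<le> B) ==>
    s 0 = ser (ev x) @ r ==> s 3 = w @ 3 # t ==>
    bt (While 3 3 (Pop 3 ;; c)) s (length w * (B + 3) + 1) (s(0 := ser (ev ((f ^^ length w) x)) @ r, 3 := 3 # t))"
proof (induction w arbitrary: x s)
  case Nil
  show ?case by (rule bt_conv[OF bt_WhileF]) (use Nil in \<open>auto simp: fun_eq_iff\<close>)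
next
  case (Cons a w)
  let ?s = "s(0 := ser (ev (f x)) @ r, 3 := w @ 3 # t)"
  have "bt c (s(3 := w @ 3 # t)) (poly p (sz x)) ?s"
    by (rule bt_conv[OF c[where x = x and r = r]]) (use Cons.prems in \<open>auto simp: fun_eq_iff\<close>)
  then have c': "bt c (s(3 := w @ 3 # t)) B ?s"
    by (rule bt_conv) (use Cons.prems(2)[of 0] in auto)
  have "bt (Pop 3) s 1 (s(3 := w @ 3 # t))"
    by (rule bt_conv[OF bt_Pop]) (use Cons.prems in auto)
  from bt_Seq[OF this c'] have 1: "bt (Pop 3 ;; c) s (1 + B) ?s" .
  have 2: "bt (While 3 3 (Pop 3 ;; c)) ?s (length w * (B + 3) + 1) (?s(0 := ser (ev ((f ^^ length w) (f x))) @ r, 3 := 3 # t))"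
  proof (rule Cons.IH)
    show "poly p (sz ((f ^^ i) (f x))) \<le> B" if "i < length w" for i
      using Cons.prems(2)[of "Suc i"] that by (simp add: funpow_swap1)
  qed (use Cons.prems in auto)
  show ?case
    by (rule bt_conv[OF bt_WhileT[OF _ 1 2]]) (use Cons.prems in \<open>auto simp: fun_eq_iff funpow_swap1\<close>)
qed

text \<open>The code of the start value itself is the clock, so the number of rounds is its size.
  The bound on all iterates is essential, because a polynomial-time step may square the size in each
  round.\<close>

lemma pt_funpow:
  fixes f :: "'a::enc => 'a" and g :: "'c::enc => 'a"
  assumes "pt f" "pt g" and q: "!!x i. sz ((f ^^ i) (g x)) \<le> poly q (sz x)"
  shows "pt (\<lambda>x. (f ^^ sz (g x)) (g x))"
proof -
  obtain c p where c: "wfc c" "PROP computes c p f"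
    using ptE[OF assms(1)] by metis
  obtain d q' where d: "wfc d" "PROP computes d q' g"
    using ptE[OF assms(2)] by metis
  let ?C = "d ;; dup ;; Push 3 3 ;; mv 0 [3] ;; While 3 3 (Pop 3 ;; c) ;; Pop 3"
  show ?thesis
  proof (rule ptI[of ?C "\<lambda>n. poly q' n + (34 * poly q n + 20 + (2 + (16 * poly q n + 10 +
        (poly q n * (poly p (poly q n) + 3) + 1 + 1))))"])
    fix x :: 'c and s :: stacks and r
    assume s: "s 0 = ser (ev x) @ r"
    let ?X = "ser (ev (g x))"
    have l: "length ?X \<le> poly q (sz x)" using q[of 0 x] by (simp add: sz_def)
    have 0: "bt d s (poly q' (sz x)) (s(0 := ?X @ r))"
      using d(2)[of s x r, OF s] .
    have 1: "bt dup (s(0 := ?X @ r)) (34 * poly q (sz x) + 20) (s(0 := ?X @ ?X @ r))"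
      by (rule bt_conv[OF dup[where v = "ev (g x)" and r = r]]) (use l in auto)
    have 2: "bt (Push 3 3) (s(0 := ?X @ ?X @ r)) 2 (s(0 := ?X @ ?X @ r, 3 := 3 # s 3))"
      by (rule bt_conv[OF bt_Push]) auto
    have 3: "bt (mv 0 [3]) (s(0 := ?X @ ?X @ r, 3 := 3 # s 3)) (16 * poly q (sz x) + 10) (s(0 := ?X @ r, 3 := ?X @ 3 # s 3))"
      by (rule bt_conv[OF mv_single[where v = "ev (g x)" and r = "?X @ r"]]) (use l in \<open>auto simp: fun_eq_iff\<close>)
    let ?R = "ser (ev ((f ^^ sz (g x)) (g x)))"
    have 4: "bt (While 3 3 (Pop 3 ;; c)) (s(0 := ?X @ r, 3 := ?X @ 3 # s 3))
       (length ?X * (poly p (poly q (sz x)) + 3) + 1) (s(0 := ?R @ r, 3 := 3 # s 3))"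
      by (rule bt_conv[OF loop_funpow[where t = "s 3" and r = r and x = "g x" and w = ?X and B = "poly p (poly q (sz x))", OF c(2)]])
        (use set_ser[of "ev (g x)"] q in \<open>auto simp: fun_eq_iff sz_def intro!: poly_nat_mono\<close>)
    have 5: "bt (Pop 3) (s(0 := ?R @ r, 3 := 3 # s 3)) 1 (s(0 := ?R @ r))"
      by (rule bt_conv[OF bt_Pop]) (auto simp: fun_eq_iff)
    show "bt ?C s (poly q' (sz x) + (34 * poly q (sz x) + 20 + (2 + (16 * poly q (sz x) + 10 +
        (poly q (sz x) * (poly p (poly q (sz x)) + 3) + 1 + 1))))) (s(0 := ?R @ r))"
      by (rule bt_conv[OF bt_Seq[OF 0 bt_Seq[OF 1 bt_Seq[OF 2 bt_Seq[OF 3 bt_Seq[OF 4 5]]]]]])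
        (use l in auto)
  qed (auto simp: c d wfc_dup wfc_mv intro!: pb_intros)
qed

lemma map_ev_val: "map ev l = (l :: val list)"
  by (simp add: ev_val_def map_idI)

lemma pt_vlist: "pt f ==> pt (\<lambda>x. vlist (f x))"
  by (erule pt_ev_cong) (simp add: ev_list_def map_ev_val, simp add: ev_val_def)

lemma pt_listv: "pt f ==> pt (\<lambda>x. listv (f x))"
  by (erule pt_ev_cong) (simp add: ev_list_def map_ev_val, simp add: ev_val_def)

lemma pt_Cons: "pt f ==> pt g ==> pt (\<lambda>x. f x # g x)"
  by (rule pt_ev_cong[OF pt_pair]) (auto simp: ev_Cons ev_prod_def)

lemma pt_Some: "pt f ==> pt (\<lambda>x. Some (f x))"
  by (rule pt_ev_cong[OF pt_pair[OF _ pt_const[of "()"]]]) (auto simp: ev_option_def ev_prod_def ev_unit_def)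

lemma pt_case_list:
  assumes "pt l" "pt f" "pt (\<lambda>p. g (snd (snd p)) (fst p) (fst (snd p)))"
  shows "pt (\<lambda>x. case l x of [] => f x | y # ys => g x y ys)"
  using pt_case_list'[OF assms] by (simp cong: list.case_cong)

lemma pt_case_option:
  assumes "pt l" "pt f" "pt (\<lambda>p. g (fst p) (snd p))"
  shows "pt (\<lambda>x. case l x of None => f x | Some y => g x y)"
proof -
  have l: "pt (\<lambda>x. case l x of None => [] | Some y => [y])"
    by (rule pt_ev_cong[OF assms(1)]) (auto simp: ev_option_def ev_list_def split: option.splits)
  have g: "pt (\<lambda>p. g (snd (snd p)) (fst p))"
    using pt_comp[OF assms(3) pt_pair[OF pt_snd[OF pt_snd[OF pt_id]] pt_fst[OF pt_id]]] by simp
  have "pt (\<lambda>x. case (case l x of None => [] | Some y => [y]) of [] => f x | y # ys => g x y)"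
    by (rule pt_case_list[OF l assms(2)]) (rule g)
  then show ?thesis
    by (rule pt_ev_cong) (auto split: option.splits)
qed

lemma pt_Not: "pt f ==> pt (\<lambda>x. \<not> f x)"
  by (rule pt_ev_cong[OF pt_if[of f, OF _ pt_const[of False] pt_const[of True]]]) auto

lemma pt_conj: "pt f ==> pt g ==> pt (\<lambda>x. f x \<and> g x)"
  by (rule pt_ev_cong[OF pt_if[of f g, OF _ _ pt_const[of False]]]) auto

lemma pt_disj: "pt f ==> pt g ==> pt (\<lambda>x. f x \<or> g x)"
  by (rule pt_ev_cong[OF pt_if[of f _ g, OF _ pt_const[of True]]]) auto

lemma pt_imp: "pt f ==> pt g ==> pt (\<lambda>x. f x --> g x)"
  by (rule pt_ev_cong[OF pt_if[of f g, OF _ _ pt_const[of True]]]) auto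

named_theorems pti

lemmas [pti] = pt_id pt_const pt_pair pt_fst pt_snd pt_Cons pt_Some pt_vlist pt_listv pt_if
  pt_case_list pt_case_option pt_Not pt_conj pt_disj pt_imp

lemma pt_comp2:
  assumes "pt (\<lambda>p. f (fst p) (snd p))" "pt a" "pt b"
  shows "pt (\<lambda>x. f (a x) (b x))"
  using pt_comp[OF assms(1) pt_pair[OF assms(2,3)]] by simp

lemma pt_comp3:
  assumes "pt (\<lambda>p. f (fst p) (fst (snd p)) (snd (snd p)))" "pt a" "pt b" "pt c"
  shows "pt (\<lambda>x. f (a x) (b x) (c x))"
  using pt_comp[OF assms(1) pt_pair[OF assms(2) pt_pair[OF assms(3,4)]]] by simp

section \<open>Iteration over lists\<close>

lemma sz_ge_length: "length l \<le> sz l"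
  by (induction l) auto

lemma sz_mem: "y \<in> set l ==> sz y \<le> sz l"
  by (induction l) auto

lemma sz_append: "sz (l @ m) + 1 = sz l + sz m"
  by (induction l) auto

lemma sz_take: "sz (take k l) \<le> sz l"
  using sz_append[of "take k l" "drop k l"] sz_pos[of "drop k l"] by simp

lemma sz_drop: "sz (drop k l) \<le> sz l"
  using sz_append[of "take k l" "drop k l"] sz_pos[of "take k l"] by simp

lemma sz_list_le: "(!!y. y \<in> set l ==> sz y \<le> B) ==> sz l \<le> 1 + length l * (1 + B)"
proof (induction l)
  case (Cons a l)
  then show ?case using Cons.prems[of a] by force
qed simp

text \<open>On an exhausted list the step idles, so more rounds than there are elements do no harm;
  the size of the state is always enough.\<close>

definition fold_step :: "('x => 'a => 'y => 'a) => 'x \<times> 'a \<times> 'y list => 'x \<times> 'a \<times> 'y list" where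
  "fold_step s p = (case snd (snd p) of [] => p | y # ys => (fst p, s (fst p) (fst (snd p)) y, ys))"

lemma fold_step_funpow:
  "(fold_step s ^^ k) (x, a, ys) = (x, foldl (s x) a (take k ys), drop k ys)"
proof (induction k arbitrary: a ys)
  case (Suc k)
  have *: "fold_step s (x, a, y # zs) = (x, s x a y, zs)" for y zs
    by (simp add: fold_step_def)
  have "fold_step s (x, a, []) = (x, a, [])"
    by (simp add: fold_step_def)
  then show ?case
    by (cases ys) (simp_all add: funpow_Suc_right Suc * del: funpow.simps)
qed auto

lemma pt_foldl_bound:
  assumes s: "pt (\<lambda>p. s (fst p) (fst (snd p)) (snd (snd p)))" and i: "pt i" and l: "pt l"
    and q: "!!x k. sz (foldl (s x) (i x) (take k (l x))) \<le> poly q (sz x)"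
  shows "pt (\<lambda>x. foldl (s x) (i x) (l x))"
proof -
  obtain r where r: "!!x. sz (l x) \<le> poly r (sz x)" using pt_size[OF l] by blast
  have 1: "pt (fold_step s)"
    unfolding fold_step_def by (intro pti pt_comp3[OF s])
  have 2: "pt (\<lambda>x. (x, i x, l x))"
    by (intro pti i l)
  have "sz ((fold_step s ^^ k) (x, i x, l x)) \<le> poly ([:2:] + [:0, 1:] + q + r) (sz x)" for x k
    using q[of x k] order_trans[OF sz_drop[of k "l x"] r] by (simp add: fold_step_funpow)
  from pt_funpow[OF 1 2 this]
  have "pt (\<lambda>x. (fold_step s ^^ sz (x, i x, l x)) (x, i x, l x))" .
  then have "pt (\<lambda>x. fst (snd ((fold_step s ^^ sz (x, i x, l x)) (x, i x, l x))))"
    by (intro pti)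
  moreover have "length (l x) \<le> sz (x, i x, l x)" for x
    using sz_ge_length[of "l x"] by simp
  ultimately show ?thesis
    by (simp add: fold_step_funpow del: sz_pair)
qed

text \<open>If each step adds an amount that depends only on the parameter and the element, the
  accumulator stays polynomial over the whole list.\<close>

lemma pt_foldl:
  fixes s :: "'x::enc => 'a::enc => 'y::enc => 'a"
  assumes s: "pt (\<lambda>p. s (fst p) (fst (snd p)) (snd (snd p)))" and i: "pt i" and l: "pt l"
    and q: "!!x a y. sz (s x a y) \<le> sz a + poly q (sz x + sz y)"
  shows "pt (\<lambda>x. foldl (s x) (i x) (l x))"
proof -
  obtain r where r: "!!x. sz (l x) \<le> poly r (sz x)" using pt_size[OF l] by blast
  obtain r' where r': "!!x. sz (i x) \<le> poly r' (sz x)" using pt_size[OF i] by blast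
  show ?thesis
  proof (rule pt_foldl_bound[OF s i l])
    fix x :: 'x and k
    let ?B = "poly q (sz x + poly r (sz x))"
    have "sz (foldl (s x) a ys) \<le> sz a + length ys * ?B" if "set ys \<subseteq> set (l x)" for a ys
      using that
    proof (induction ys arbitrary: a)
      case (Cons y ys)
      have "sz (s x a y) \<le> sz a + poly q (sz x + sz y)" by (rule q)
      also have "... \<le> sz a + ?B"
        using Cons.prems by (intro add_mono poly_nat_mono) (auto intro: order_trans[OF sz_mem r])
      finally show ?case using Cons.IH[of "s x a y"] Cons.prems by simp
    qed simp
    from this[of "take k (l x)" "i x"] set_take_subset
    have "sz (foldl (s x) (i x) (take k (l x))) \<le> sz (i x) + length (take k (l x)) * ?B"
      by fast
    also have "... \<le> poly r' (sz x) + poly r (sz x) * ?B"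
      using order_trans[OF sz_ge_length order_trans[OF sz_take r]]
      by (intro add_mono mult_mono r') blast+
    also have "... = poly (r' + r * pcompose q ([:0, 1:] + r)) (sz x)"
      by (simp add: poly_pcompose)
    finally show "sz (foldl (s x) (i x) (take k (l x))) \<le> poly (r' + r * pcompose q ([:0, 1:] + r)) (sz x)" .
  qed
qed

lemma pt_foldl_const:
  assumes s: "pt (\<lambda>p. s (fst p) (fst (snd p)) (snd (snd p)))" and i: "pt i" and l: "pt l"
    and q: "!!x a y. sz (s x a y) \<le> sz a + (c + d * sz y + e * sz x)"
  shows "pt (\<lambda>x. foldl (s x) (i x) (l x))"
proof (rule pt_foldl[OF s i l])
  fix x a y
  show "sz (s x a y) \<le> sz a + poly [:c, d + e:] (sz x + sz y)"
    using q[of x a y] by (auto simp: algebra_simps)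
qed

lemma pt_rev [pti]:
  assumes "pt l" shows "pt (\<lambda>x. rev (l x))"
proof -
  have *: "foldl (\<lambda>a y. y # a) b l = rev l @ b" for l b :: "'b list"
    by (induction l arbitrary: b) auto
  have "pt (\<lambda>x. foldl (\<lambda>a y. y # a) [] (l x))"
    by (rule pt_foldl_const[where c = 1 and d = 1 and e = 0]) (intro pti assms | simp)+
  then show ?thesis by (simp add: *)
qed

lemma pt_append [pti]:
  assumes "pt l" "pt m" shows "pt (\<lambda>x. l x @ m x)"
proof -
  have *: "foldl (\<lambda>a y. y # a) b l = rev l @ b" for l b :: "'b list"
    by (induction l arbitrary: b) auto
  have "pt (\<lambda>x. foldl (\<lambda>a y. y # a) (m x) (rev (l x)))"
    by (rule pt_foldl_const[where c = 1 and d = 1 and e = 0]) (intro pti assms | simp)+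
  then show ?thesis by (simp add: *)
qed

lemma pt_map [pti]:
  fixes f :: "'x::enc => 'a::enc => 'b::enc"
  assumes f: "pt (\<lambda>p. f (fst p) (snd p))" and l: "pt l"
  shows "pt (\<lambda>x. map (f x) (l x))"
proof -
  obtain q where q: "!!p. sz (f (fst p) (snd p)) \<le> poly q (sz p)" using pt_size[OF f] by blast
  have *: "foldl (\<lambda>a y. f x y # a) b l = rev (map (f x) l) @ b" for x l b
    by (induction l arbitrary: b) auto
  have "pt (\<lambda>x. foldl (\<lambda>a y. f x y # a) [] (l x))"
  proof (rule pt_foldl)
    show "pt (\<lambda>p. f (fst p) (snd (snd p)) # fst (snd p))"
      by (intro pti pt_comp2[OF f])
    show "sz (f x y # a) \<le> sz a + poly ([:1:] + pcompose q [:1, 1:]) (sz x + sz y)" for x a y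
      using q[of "(x, y)"] by (simp add: poly_pcompose)
  qed (intro pti l)+
  then have "pt (\<lambda>x. rev (foldl (\<lambda>a y. f x y # a) [] (l x)))" by (rule pt_rev)
  then show ?thesis by (simp add: *)
qed

lemma pt_concat [pti]:
  assumes "pt l" shows "pt (\<lambda>x. concat (l x))"
proof -
  have *: "foldl (\<lambda>a y. a @ y) b l = b @ concat l" for l and b :: "'b list"
    by (induction l arbitrary: b) auto
  have "pt (\<lambda>x. foldl (\<lambda>a y. a @ y) [] (l x))"
  proof (rule pt_foldl_const[where c = 0 and d = 1 and e = 0])
    show "sz (a @ y) \<le> sz a + (0 + 1 * sz y + 0 * sz x)" for x :: 'a and a y :: "'b list"
      using sz_append[of a y] by simp
  qed (intro pti assms)+
  then show ?thesis by (simp add: *)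
qed

lemma pt_Ball_list [pti]:
  assumes f: "pt (\<lambda>p. f (fst p) (snd p))" and l: "pt l"
  shows "pt (\<lambda>x. \<forall>y\<in>set (l x). f x y)"
proof -
  have *: "foldl (\<lambda>a y. a \<and> f x y) b l \<longleftrightarrow> b \<and> (\<forall>y\<in>set l. f x y)" for x l b
    by (induction l arbitrary: b) auto
  have "pt (\<lambda>x. foldl (\<lambda>a y. a \<and> f x y) True (l x))"
  proof (rule pt_foldl_const[where c = 0 and d = 0 and e = 0])
    show "pt (\<lambda>p. fst (snd p) \<and> f (fst p) (snd (snd p)))"
      by (intro pti pt_comp2[OF f])
  qed (simp | intro pti l)+
  then show ?thesis by (simp add: *)
qed

lemma pt_Bex_list [pti]:
  assumes f: "pt (\<lambda>p. f (fst p) (snd p))" and l: "pt l"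
  shows "pt (\<lambda>x. \<exists>y\<in>set (l x). f x y)"
  using pt_Not[OF pt_Ball_list[OF pt_Not[OF f] l]] by simp

lemma pt_filter [pti]:
  assumes f: "pt (\<lambda>p. f (fst p) (snd p))" and l: "pt l"
  shows "pt (\<lambda>x. filter (f x) (l x))"
proof -
  have "pt (\<lambda>x. concat (map (\<lambda>y. if f x y then [y] else []) (l x)))"
    by (intro pti pt_comp2[OF f] l)
  moreover have "concat (map (\<lambda>y. if f x y then [y] else []) m) = filter (f x) m" for x m
    by (induction m) auto
  ultimately show ?thesis by simp
qed

lemma pt_tl [pti]: assumes "pt l" shows "pt (\<lambda>x. tl (l x))"
proof -
  have "pt (\<lambda>x. case l x of [] => [] | y # ys => ys)"
    by (intro pti assms)
  then show ?thesis by (rule pt_ev_cong) (auto split: list.splits)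
qed

text \<open>Equality is decided on the encodings, with a work list of pairs of subtrees to be compared.\<close>

definition eq_step :: "(val \<times> val) list \<times> bool => (val \<times> val) list \<times> bool" where
  "eq_step p = (case fst p of [] => p | q # r =>
     (case vlist (fst q) of
        [] => (case vlist (snd q) of [] => (r, snd p) | _ # _ => (r, False))
      | a # b => (case vlist (snd q) of [] => (r, False)
                  | c # d => ((a, c) # (listv b, listv d) # r, snd p))))"

lemma eq_step_inv:
  "snd (eq_step p) \<and> (\<forall>q\<in>set (fst (eq_step p)). fst q = snd q) \<longleftrightarrow>
   snd p \<and> (\<forall>q\<in>set (fst p). fst q = snd q)"
proof (cases "fst p")
  case (Cons q r)
  then show ?thesis
    by (cases "fst q"; cases "snd q") (auto simp: eq_step_def)
qed (auto simp: eq_step_def)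

lemma eq_step_size: "sz (eq_step p) \<le> sz p"
  by (cases p; cases "fst p")
    (auto simp: eq_step_def split: list.splits, auto simp: sz_def ev_list_def ev_val_def elim!: vlist.elims)

text \<open>The total size of the left components decreases even when a pair is split, since
  splitting consumes the symbol of the inner node; hence the size of the initial work list is a
  sufficient clock.\<close>

lemma eq_step_less: "fst p \<noteq> [] ==> (\<Sum>q\<leftarrow>fst (eq_step p). sz (fst q)) < (\<Sum>q\<leftarrow>fst p. sz (fst q))"
  by (cases p; cases "fst p")
    (auto simp: eq_step_def split: list.splits, auto simp: sz_def ev_list_def ev_val_def elim!: vlist.elims)

lemma eq_step_funpow:
  "snd ((eq_step ^^ n) p) \<and> (\<forall>q\<in>set (fst ((eq_step ^^ n) p)). fst q = snd q) \<longleftrightarrow>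
   snd p \<and> (\<forall>q\<in>set (fst p). fst q = snd q)"
  "sz ((eq_step ^^ n) p) \<le> sz p"
  by (induction n) (auto simp: eq_step_inv intro: order_trans[OF eq_step_size])

lemma eq_step_funpow_Nil:
  "(\<Sum>q\<leftarrow>fst p. sz (fst q)) \<le> n ==> fst ((eq_step ^^ n) p) = []"
proof (induction n arbitrary: p)
  case 0
  then show ?case
    using sz_pos[of "fst (hd (fst p))"] by (cases "fst p") auto
next
  case (Suc n)
  have "eq_step p = p" if "fst p = []"
    using that by (simp add: eq_step_def)
  then have "(\<Sum>q\<leftarrow>fst (eq_step p). sz (fst q)) \<le> n"
    using Suc.prems eq_step_less[of p] by (cases "fst p = []") auto
  from Suc.IH[OF this] show ?case by (simp add: funpow_Suc_right del: funpow.simps)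
qed

lemma pt_eq [pti]:
  assumes "pt f" "pt g" shows "pt (\<lambda>x. f x = g x)"
proof -
  have 1: "pt eq_step"
    unfolding eq_step_def by (intro pti)
  have f: "pt (\<lambda>x. ev (f x))"
    by (rule pt_ev_cong[OF assms(1)]) (simp add: ev_val_def)
  have g: "pt (\<lambda>x. ev (g x))"
    by (rule pt_ev_cong[OF assms(2)]) (simp add: ev_val_def)
  have 2: "pt (\<lambda>x. ([(ev (f x), ev (g x))], True))"
    by (intro pti f g)
  obtain q where q: "!!x. sz ([(ev (f x), ev (g x))], True) \<le> poly q (sz x)" using pt_size[OF 2] by blast
  have 3: "pt (\<lambda>x. snd ((eq_step ^^ sz ([(ev (f x), ev (g x))], True)) ([(ev (f x), ev (g x))], True)))"
    by (intro pt_snd pt_funpow[OF 1 2]) (rule order_trans[OF eq_step_funpow(2) q])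
  have 4: "snd ((eq_step ^^ sz ([(a, b)], True)) ([(a, b)], True)) \<longleftrightarrow> a = b" for a b :: val
    using eq_step_funpow_Nil[of "([(a, b)], True)" "sz ([(a, b)], True)"]
      eq_step_funpow(1)[of "sz ([(a, b)], True)" "([(a, b)], True)"] by auto
  from 3 show ?thesis unfolding 4 ev_inj .
qed

section \<open>Arithmetic\<close>

definition bl :: "nat => nat" where "bl n = length (nbits n)"

lemma sz_bools: "sz (l :: bool list) = 1 + 6 * length l"
  by (induction l) auto

lemma sz_nbits: "sz (nbits n) = sz n"
  by (simp add: sz_def ev_nat_def)

lemma sz_nat: "sz n = 1 + 6 * bl n"
  using sz_bools[of "nbits n"] by (simp add: bl_def sz_nbits)

lemma bl_0 [simp]: "bl 0 = 0"
  by (simp add: bl_def nbits.simps)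

lemma bl_rec: "n > 0 ==> bl n = Suc (bl (n div 2))"
  by (simp add: bl_def nbits.simps[of n])

lemma bl_le_iff: "bl n \<le> k \<longleftrightarrow> n < 2 ^ k"
proof (induction k arbitrary: n)
  case 0
  show ?case using bl_rec[of n] by (cases "n = 0") auto
next
  case (Suc k)
  show ?case
  proof (cases "n = 0")
    case False
    then have "bl n = Suc (bl (n div 2))" by (simp add: bl_rec)
    then show ?thesis by (simp add: Suc.IH div_less_iff_less_mult mult.commute)
  qed simp
qed

lemma less_two_bl: "n < 2 ^ bl n"
  using bl_le_iff by blast

lemma bl_mono: "m \<le> n ==> bl m \<le> bl n"
  using bl_le_iff less_two_bl le_less_trans by metis

lemma bl_le_self: "bl n \<le> n"
  by (simp add: bl_le_iff)

lemma bl_add: "bl (m + n) \<le> bl m + bl n + 1"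
proof -
  have "m + n < 2 ^ bl m + 2 ^ bl n"
    using less_two_bl[of m] less_two_bl[of n] by linarith
  also have "... \<le> 2 ^ (bl m + bl n) + 2 ^ (bl m + bl n)"
    by (intro add_mono power_increasing) auto
  finally show ?thesis by (simp add: bl_le_iff mult_2)
qed

lemma bl_mult: "bl (m * n) \<le> bl m + bl n"
  unfolding bl_le_iff power_add by (intro mult_strict_mono less_two_bl) auto

lemma bl_div2: "bl (n div 2) \<le> bl n"
  by (rule bl_mono) simp

lemma bl_bitcons: "bl (of_bool b + 2 * n) \<le> bl n + 1"
  using less_two_bl[of n] by (auto simp: bl_le_iff)

lemma pt_nbits [pti]: "pt f ==> pt (\<lambda>x. nbits (f x))"
  by (erule pt_ev_cong) (simp add: ev_nat_def)

lemma pt_div2 [pti]: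
  assumes "pt f" shows "pt (\<lambda>x. f x div 2 :: nat)"
proof -
  have "pt (\<lambda>x. tl (nbits (f x)))" by (intro pti assms)
  then show ?thesis
    by (rule pt_ev_cong) (auto simp: ev_nat_def nbits.simps)
qed

lemma pt_odd [pti]:
  assumes "pt f" shows "pt (\<lambda>x. odd (f x :: nat))"
proof -
  have "pt (\<lambda>x. case nbits (f x) of [] => False | b # _ => b)" by (intro pti assms)
  then show ?thesis
    by (rule pt_ev_cong) (auto simp: nbits.simps)
qed

lemma pt_bitcons [pti]:
  assumes "pt f" "pt g" shows "pt (\<lambda>x. of_bool (f x) + 2 * g x :: nat)"
proof -
  have "pt (\<lambda>x. if \<not> f x \<and> g x = 0 then [] else f x # nbits (g x))" by (intro pti assms)
  then show ?thesis
    by (rule pt_ev_cong) (auto simp: ev_nat_def nbits.simps)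
qed

lemma foldl_ofbits: "foldl (\<lambda>r b. of_bool b + 2 * r) n (rev l) = ofbits l + 2 ^ length l * n"
  by (induction l) (auto simp: ofbits_def)

lemma pt_ofbits [pti]:
  assumes "pt f" shows "pt (\<lambda>x. ofbits (f x))"
proof -
  have "pt (\<lambda>x. foldl (\<lambda>r b. of_bool b + 2 * r) (0::nat) (rev (f x)))"
  proof (rule pt_foldl_const[where c = 6 and d = 0 and e = 0])
    show "sz (of_bool y + 2 * a :: nat) \<le> sz a + (6 + 0 * sz y + 0 * sz x)" for x :: 'a and a y
      using bl_bitcons[of y a] by (simp add: sz_nat)
  qed (intro pti assms)+
  then show ?thesis by (simp add: foldl_ofbits)
qed

lemma ofbits_Cons [simp]: "ofbits (b # l) = of_bool b + 2 * ofbits l" and ofbits_Nil [simp]: "ofbits [] = 0"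
  by (auto simp: ofbits_def)

lemma ofbits_append: "ofbits (l @ m) = ofbits l + 2 ^ length l * ofbits m"
  by (induction l) (auto simp: algebra_simps)

text \<open>A ripple-carry adder: the third component is the carry, the majority of three bits, and
  the new digit is their parity, written as iterated equality. The digits accumulate with the most
  significant one in front.\<close>

definition add_step :: "nat \<times> nat \<times> bool \<times> bool list => nat \<times> nat \<times> bool \<times> bool list" where
  "add_step p = (fst p div 2, fst (snd p) div 2,
     (if fst (snd (snd p)) then odd (fst p) \<or> odd (fst (snd p)) else odd (fst p) \<and> odd (fst (snd p))),
     ((odd (fst p) = odd (fst (snd p))) = fst (snd (snd p))) # snd (snd (snd p)))"

lemma add_step_foldl:
  "\<exists>c acc'. foldl (\<lambda>p y. add_step p) (a, b, c0, acc) l = (a div 2 ^ length l, b div 2 ^ length l, c, acc') \<and>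
    length acc' = length l + length acc \<and>
    (a div 2 ^ length l + b div 2 ^ length l + of_bool c) * 2 ^ length acc' + ofbits (rev acc') =
    (a + b + of_bool c0) * 2 ^ length acc + ofbits (rev acc)"
proof (induction l arbitrary: a b c0 acc)
  case (Cons y l)
  obtain c1 where c1: "add_step (a, b, c0, acc) = (a div 2, b div 2, c1, ((odd a = odd b) = c0) # acc)"
    "2 * (a div 2 + b div 2 + of_bool c1) + of_bool ((odd a = odd b) = c0) = a + b + of_bool c0"
  proof
    show "add_step (a, b, c0, acc) = (a div 2, b div 2, (if c0 then odd a \<or> odd b else odd a \<and> odd b),
      ((odd a = odd b) = c0) # acc)"
      by (simp add: add_step_def)
    show "2 * (a div 2 + b div 2 + of_bool (if c0 then odd a \<or> odd b else odd a \<and> odd b)) +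
        of_bool ((odd a = odd b) = c0) = a + b + of_bool c0"
      by (cases "odd a"; cases "odd b"; cases c0) (auto elim!: oddE evenE)
  qed
  obtain c acc' where *: "foldl (\<lambda>p y. add_step p) (a div 2, b div 2, c1, ((odd a = odd b) = c0) # acc) l =
      (a div 2 div 2 ^ length l, b div 2 div 2 ^ length l, c, acc')"
    "length acc' = length l + length (((odd a = odd b) = c0) # acc)"
    "(a div 2 div 2 ^ length l + b div 2 div 2 ^ length l + of_bool c) * 2 ^ length acc' + ofbits (rev acc') =
    (a div 2 + b div 2 + of_bool c1) * 2 ^ length (((odd a = odd b) = c0) # acc) + ofbits (rev (((odd a = odd b) = c0) # acc))"
    using Cons[of "a div 2" "b div 2" c1 "((odd a = odd b) = c0) # acc"] by metis
  have "(a div 2 + b div 2 + of_bool c1) * 2 ^ length (((odd a = odd b) = c0) # acc) + ofbits (rev (((odd a = odd b) = c0) # acc))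
      = (2 * (a div 2 + b div 2 + of_bool c1) + of_bool ((odd a = odd b) = c0)) * 2 ^ length acc + ofbits (rev acc)"
    by (simp add: ofbits_append algebra_simps)
  also have "... = (a + b + of_bool c0) * 2 ^ length acc + ofbits (rev acc)"
    unfolding c1(2) ..
  finally have E: "(a div 2 + b div 2 + of_bool c1) * 2 ^ length (((odd a = odd b) = c0) # acc) +
      ofbits (rev (((odd a = odd b) = c0) # acc)) = (a + b + of_bool c0) * 2 ^ length acc + ofbits (rev acc)" .
  show ?case
  proof (intro exI conjI)
    show "foldl (\<lambda>p y. add_step p) (a, b, c0, acc) (y # l) = (a div 2 ^ length (y # l), b div 2 ^ length (y # l), c, acc')"
      using *(1) by (simp add: c1(1) div_mult2_eq)
    show "length acc' = length (y # l) + length acc"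
      using *(2) by simp
    show "(a div 2 ^ length (y # l) + b div 2 ^ length (y # l) + of_bool c) * 2 ^ length acc' + ofbits (rev acc') =
        (a + b + of_bool c0) * 2 ^ length acc + ofbits (rev acc)"
      using *(3)[unfolded E] by (simp add: div_mult2_eq)
  qed
qed simp

text \<open>The two bit lists are only a clock; together they are long enough to exhaust both
  summands, and the remaining carry is the top digit.\<close>

lemma add_correct:
  assumes "foldl (\<lambda>p y. add_step p) (a, b, False, []) (nbits a @ nbits b) = p"
  shows "a + b = ofbits (rev (fst (snd (snd p)) # snd (snd (snd p))))"
proof -
  let ?l = "nbits a @ nbits b"
  obtain c acc where *: "foldl (\<lambda>p y. add_step p) (a, b, False, []) ?l = (a div 2 ^ length ?l, b div 2 ^ length ?l, c, acc)"
    "length acc = length ?l + length ([] :: bool list)"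
    "(a div 2 ^ length ?l + b div 2 ^ length ?l + of_bool c) * 2 ^ length acc + ofbits (rev acc) =
    (a + b + of_bool False) * 2 ^ length ([] :: bool list) + ofbits (rev [])"
    using add_step_foldl[of a b False "[]" ?l] by metis
  have "a < 2 ^ length ?l"
    by (rule less_le_trans[OF less_two_bl[of a] power_increasing]) (auto simp: bl_def)
  moreover have "b < 2 ^ length ?l"
    by (rule less_le_trans[OF less_two_bl[of b] power_increasing]) (auto simp: bl_def)
  ultimately  have "a div 2 ^ length ?l = 0" "b div 2 ^ length ?l = 0" by auto
  then show ?thesis
    using assms * by (auto simp: ofbits_append)
qed

lemma pt_add [pti]:
  assumes "pt f" "pt g" shows "pt (\<lambda>x. f x + g x :: nat)"
proof -
  have 1: "pt add_step" unfolding add_step_def by (intro pti)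
  have "pt (\<lambda>x. foldl (\<lambda>p y. add_step p) (f x, g x, False, []) (nbits (f x) @ nbits (g x)))"
  proof (rule pt_foldl_const[where c = 6 and d = 0 and e = 0])
    show "sz (add_step a) \<le> sz a + (6 + 0 * sz y + 0 * sz x)" for x :: 'a and a and y :: bool
      using bl_div2[of "fst a"] bl_div2[of "fst (snd a)"] by (cases a) (auto simp: add_step_def sz_nat)
  qed (intro pti assms pt_comp[OF 1])+
  then have "pt (\<lambda>x. (\<lambda>p. ofbits (rev (fst (snd (snd p)) # snd (snd (snd p)))))
      (foldl (\<lambda>p y. add_step p) (f x, g x, False, []) (nbits (f x) @ nbits (g x))))"
    by (intro pti)
  then show ?thesis by (simp only: add_correct[OF refl, symmetric])
qed

lemma pt_Suc [pti]: "pt f ==> pt (\<lambda>x. Suc (f x))"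
  using pt_add[OF _ pt_const[of 1]] by simp

text \<open>Comparison from the least significant bit: the verdict is overwritten wherever the bits
  differ, so the most significant difference decides, and the initial True covers equality.\<close>

lemma pt_le_nat [pti]:
  assumes "pt f" "pt g" shows "pt (\<lambda>x. f x \<le> (g x :: nat))"
proof -
  define st :: "nat \<times> nat \<times> bool => nat \<times> nat \<times> bool" where
    "st = (\<lambda>p. (fst p div 2, fst (snd p) div 2,
       if odd (fst p) = odd (fst (snd p)) then snd (snd p) else odd (fst (snd p))))"
  have st: "pt st" unfolding st_def by (intro pti)
  have *: "foldl (\<lambda>p y. st p) (a, b, c) l = (a div 2 ^ length l, b div 2 ^ length l, c') ==>
      (if a div 2 ^ length l = b div 2 ^ length l then c' else a div 2 ^ length l < b div 2 ^ length l) \<longleftrightarrow>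
      (if a = b then c else a < b)" for a b c c' and l :: "bool list"
  proof (induction l arbitrary: a b c)
    case (Cons y l)
    let ?c = "if odd a = odd b then c else odd b"
    have D: "x div 2 ^ length (y # l) = x div 2 div 2 ^ length l" for x :: nat
      by (simp add: div_mult2_eq)
    have P: "foldl (\<lambda>p y. st p) (a div 2, b div 2, ?c) l = (a div 2 div 2 ^ length l, b div 2 div 2 ^ length l, c')"
      using Cons.prems by (simp add: st_def div_mult2_eq cong: if_cong)
    have "(if a div 2 = b div 2 then (if odd a = odd b then c else odd b) else a div 2 < b div 2) \<longleftrightarrow>
        (if a = b then c else a < b)"
      by (cases "odd a"; cases "odd b") (auto elim!: oddE evenE)
    from trans[OF Cons.IH[OF P] this] show ?case unfolding D .
  qed auto
  have **: "fst (foldl (\<lambda>p y. st p) p l) = fst p div 2 ^ length l \<and>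
      fst (snd (foldl (\<lambda>p y. st p) p l)) = fst (snd p) div 2 ^ length l" for p and l :: "bool list"
    by (induction l arbitrary: p) (auto simp: st_def div_mult2_eq)
  have 2: "snd (snd (foldl (\<lambda>p y. st p) (a, b, True) (nbits a @ nbits b))) \<longleftrightarrow> a \<le> b" for a b
  proof -
    let ?l = "nbits a @ nbits b"
    have "a < 2 ^ length ?l"
      by (rule less_le_trans[OF less_two_bl[of a] power_increasing]) (auto simp: bl_def)
    moreover have "b < 2 ^ length ?l"
      by (rule less_le_trans[OF less_two_bl[of b] power_increasing]) (auto simp: bl_def)
    ultimately have "a div 2 ^ length ?l = 0" "b div 2 ^ length ?l = 0" by auto
    moreover obtain c where "foldl (\<lambda>p y. st p) (a, b, True) ?l = (a div 2 ^ length ?l, b div 2 ^ length ?l, c)"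
      using **[of "(a, b, True)" ?l] by (metis fst_conv prod.collapse snd_conv)
    ultimately show ?thesis using *[of a b True ?l c] by (auto split: if_splits)
  qed
  have "pt (\<lambda>x. foldl (\<lambda>p y. st p) (f x, g x, True) (nbits (f x) @ nbits (g x)))"
  proof (rule pt_foldl_const[where c = 0 and d = 0 and e = 0])
    show "sz (st a) \<le> sz a + (0 + 0 * sz y + 0 * sz x)" for x :: 'a and a and y :: bool
      using bl_div2[of "fst a"] bl_div2[of "fst (snd a)"] by (cases a) (auto simp: st_def sz_nat)
  qed (intro pti assms pt_comp[OF st])+
  then have "pt (\<lambda>x. snd (snd (foldl (\<lambda>p y. st p) (f x, g x, True) (nbits (f x) @ nbits (g x)))))"
    by (intro pti)
  then show ?thesis by (simp only: 2)
qed

lemma pt_less_nat [pti]: "pt f ==> pt g ==> pt (\<lambda>x. f x < (g x :: nat))"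
  using pt_Not[OF pt_le_nat] by (simp add: not_le)

text \<open>Horner's scheme on the binary digits of the first factor, most significant first; every
  partial result is a leading part of that factor times the second one, whence the bound.\<close>

lemma pt_mult [pti]:
  assumes "pt f" "pt g" shows "pt (\<lambda>x. f x * g x :: nat)"
proof -
  have *: "foldl (\<lambda>r d. (if d then b else 0) + (of_bool False + 2 * r)) 0 l = ofbits (rev l) * b" for b :: nat and l
    by (induction l rule: rev_induct) (auto simp: algebra_simps)
  have lt: "ofbits l < 2 ^ length l" for l
    by (induction l) auto
  obtain p q where p: "!!x. sz (f x) \<le> poly p (sz x)" and q: "!!x. sz (g x) \<le> poly q (sz x)"
    using pt_size[OF assms(1)] pt_size[OF assms(2)] by metis
  have "pt (\<lambda>x. foldl (\<lambda>r d. (if d then g x else 0) + (of_bool False + 2 * r)) 0 (rev (nbits (f x))))"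
  proof (rule pt_foldl_bound)
    fix x k
    let ?l = "take k (rev (nbits (f x)))"
    have "bl (ofbits (rev ?l) * g x) \<le> bl (ofbits (rev ?l)) + bl (g x)" by (rule bl_mult)
    also have "bl (ofbits (rev ?l)) \<le> length (rev ?l)"
      using lt[of "rev ?l"] by (simp only: bl_le_iff)
    also have "... \<le> bl (f x)" by (simp add: bl_def)
    finally show "sz (foldl (\<lambda>r d. (if d then g x else 0) + (of_bool False + 2 * r)) 0 ?l) \<le> poly (p + q) (sz x)"
      using p[of x] q[of x] unfolding * by (simp add: sz_nat)
  qed (intro pti assms pt_comp[OF assms(2)])+
  then show ?thesis unfolding * by (simp add: ofbits_nbits)
qed

lemma pt_length [pti]:
  assumes "pt l" shows "pt (\<lambda>x. length (l x))"
proof -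
  have *: "foldl (\<lambda>a y. Suc a) n l = n + length l" for n and l :: "'b list"
    by (induction l arbitrary: n) auto
  have "pt (\<lambda>x. foldl (\<lambda>a y. Suc a) 0 (l x))"
  proof (rule pt_foldl_const[where c = 12 and d = 0 and e = 0])
    show "sz (Suc a) \<le> sz a + (12 + 0 * sz y + 0 * sz x)" for x :: 'a and a and y :: 'b
      using bl_add[of a 1] bl_le_self[of 1] by (simp add: sz_nat)
  qed (intro pti assms)+
  then show ?thesis by (simp add: *)
qed

lemma pt_sum_list [pti]:
  assumes "pt l" shows "pt (\<lambda>x. sum_list (l x) :: nat)"
proof -
  have *: "foldl (\<lambda>a y. a + y) n l = n + sum_list l" for n :: nat and l
    by (induction l arbitrary: n) auto
  have "pt (\<lambda>x. foldl (\<lambda>a y. a + y) (0::nat) (l x))"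
  proof (rule pt_foldl_const[where c = 6 and d = 1 and e = 0])
    show "sz (a + y) \<le> sz a + (6 + 1 * sz y + 0 * sz x)" for x :: 'a and a y :: nat
      using bl_add[of a y] by (simp add: sz_nat)
  qed (intro pti assms)+
  then show ?thesis by (simp add: *)
qed

lemma pt_upt [pti]:
  assumes "pt l" shows "pt (\<lambda>x. [0..<length (l x)])"
proof -
  have *: "foldl (\<lambda>p y. (Suc (fst p), snd p @ [fst p])) (0, []) l = (length l, [0..<length l])" for l :: "'b list"
    by (induction l rule: rev_induct) auto
  obtain p where p: "!!x. sz (l x) \<le> poly p (sz x)" using pt_size[OF assms] by blast
  have "pt (\<lambda>x. foldl (\<lambda>p y. (Suc (fst p), snd p @ [fst p])) (0, []) (l x))"
  proof (rule pt_foldl_bound)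
    fix x k
    let ?n = "length (take k (l x))"
    have n: "?n \<le> poly p (sz x)"
      using order_trans[OF sz_ge_length order_trans[OF sz_take p]] .
    have e: "sz j \<le> 1 + 6 * poly p (sz x)" if "j \<le> ?n" for j
      unfolding sz_nat using order_trans[OF bl_le_self order_trans[OF that n]] by simp
    have "sz [0..<?n] \<le> 1 + length [0..<?n] * (1 + (1 + 6 * poly p (sz x)))"
      by (rule sz_list_le) (use e in auto)
    also have "... \<le> 1 + poly p (sz x) * (2 + 6 * poly p (sz x))"
      using mult_right_mono[OF n, of "2 + 6 * poly p (sz x)"] by simp
    finally have "sz (foldl (\<lambda>p y. (Suc (fst p), snd p @ [fst p])) (0, []) (take k (l x)))
        \<le> 1 + (1 + 6 * poly p (sz x)) + (1 + poly p (sz x) * (2 + 6 * poly p (sz x)))"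
      unfolding * using e[of ?n] by simp
    also have "... = poly ([:3:] + smult 6 p + p * ([:2:] + smult 6 p)) (sz x)" by simp
    finally show "sz (foldl (\<lambda>p y. (Suc (fst p), snd p @ [fst p])) (0, []) (take k (l x)))
        \<le> poly ([:3:] + smult 6 p + p * ([:2:] + smult 6 p)) (sz x)" .
  qed (intro pti assms)+
  then have "pt (\<lambda>x. snd (foldl (\<lambda>p y. (Suc (fst p), snd p @ [fst p])) (0, []) (l x)))" by (rule pt_snd)
  then show ?thesis by (simp add: *)
qed

text \<open>Unary numbers of polynomial size, by Horner's rule on the coefficients; they later
  provide the dimensions of tilings.\<close>

lemma pt_replicate_poly:
  assumes "pt f" shows "pt (\<lambda>x. replicate (poly p (length (f x))) ())"
proof (induction p)
  case 0
  show ?case using pt_const by simp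
next
  case (pCons a p)
  have "pt (\<lambda>x. replicate a () @ concat (map (\<lambda>_. replicate (poly p (length (f x))) ()) (f x)))"
    by (intro pti assms pt_comp[OF pCons(2)])
  moreover have "concat (map (\<lambda>_. replicate n ()) l) = replicate (length l * n) ()" for n and l :: "'b list"
    by (induction l) (auto simp: replicate_add)
  ultimately show ?case by (simp add: replicate_add)
qed

definition nthd :: "'a => 'a list => nat => 'a" where
  "nthd d xs i = (if i < length xs then xs ! i else d)"

lemma pt_nthd [pti]:
  assumes "pt d" "pt l" "pt g" shows "pt (\<lambda>x. nthd (d x) (l x) (g x))"
proof -
  have *: "foldl (\<lambda>p y. case p of [] => p | z # zs => zs) m us = drop (length us) m" for m :: "'b list" and us :: "unit list"
    by (induction us arbitrary: m) (auto split: list.splits)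
  have sel: "foldl (\<lambda>p y. (Suc (fst p), if fst p = i then y else snd p)) (k, d) l =
      (k + length l, if k \<le> i \<and> i < k + length l then l ! (i - k) else d)" for k i d and l :: "'b list"
    by (induction l arbitrary: k d) (auto simp: nth_Cons')
  obtain p q where p: "!!x. sz (l x) \<le> poly p (sz x)" and q: "!!x. sz (d x) \<le> poly q (sz x)"
    using pt_size[OF assms(1)] pt_size[OF assms(2)] by metis
  have "pt (\<lambda>x. foldl (\<lambda>p y. (Suc (fst p), if fst p = g x then y else snd p)) (0, d x) (l x))"
  proof (rule pt_foldl_bound)
    fix x k
    let ?l = "take k (l x)"
    have n: "length ?l \<le> poly p (sz x)"
      using order_trans[OF sz_ge_length order_trans[OF sz_take p]] .
    have 1: "sz (length ?l) \<le> 1 + 6 * poly p (sz x)"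
      unfolding sz_nat using order_trans[OF bl_le_self n] by simp
    have 2: "sz (if 0 \<le> g x \<and> g x < 0 + length ?l then ?l ! (g x - 0) else d x) \<le> poly p (sz x) + poly q (sz x)"
    proof (cases "g x < length ?l")
      case True
      then have "?l ! g x \<in> set (l x)" using nth_mem[OF True] set_take_subset by fast
      from order_trans[OF sz_mem[OF this] p] show ?thesis using True by simp
    qed (use q[of x] in auto)
    show "sz (foldl (\<lambda>p y. (Suc (fst p), if fst p = g x then y else snd p)) (0, d x) ?l)
        \<le> poly ([:2:] + smult 7 p + q) (sz x)"
      unfolding sel using 1 2 by simp
  qed (intro pti assms pt_comp[OF assms(3)])+
  then have "pt (\<lambda>x. snd (foldl (\<lambda>p y. (Suc (fst p), if fst p = g x then y else snd p)) (0, d x) (l x)))"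
    by (rule pt_snd)
  then show ?thesis by (simp add: sel nthd_def cong: if_cong)
qed

lemma pt_product [pti]:
  assumes "pt f" "pt g" shows "pt (\<lambda>x. List.product (f x) (g x))"
proof -
  have "pt (\<lambda>x. concat (map (\<lambda>y. map (\<lambda>z. (y, z)) (g x)) (f x)))"
    by (intro pti assms pt_comp[OF assms(2)])
  then show ?thesis by (simp add: product_concat_map)
qed

section \<open>Polynomial-time functions on Turing machines, and typed certificates\<close>

text \<open>Decoding has to be computable as well, since a verifier turns an arbitrary bit string
  into a typed certificate.\<close>

lemma pt_dv_val [pti]: "pt (dv :: val => val)"
  by (rule pt_coerce) (simp add: dv_val_def)

lemma pt_dv_bool [pti]: "pt (dv :: val => bool)"
proof -
  have "pt (\<lambda>v. case vlist v of [] => False | a # b => (case vlist a of [] => True | _ # _ => False))"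
    by (intro pti)
  moreover have "dv v = (case vlist v of [] => False | a # b => (case vlist a of [] => True | _ # _ => False))" for v
    by (auto simp: dv_bool_def split: val.splits)
  ultimately show ?thesis by presburger
qed

lemma pt_dv_prod [pti]:
  assumes "pt (dv :: val => 'a::enc)" "pt (dv :: val => 'b::enc)"
  shows "pt (dv :: val => 'a \<times> 'b)"
proof -
  have "pt (\<lambda>v. case vlist v of [] => (dv Nl :: 'a, dv Nl :: 'b) | a # b => (dv a, dv (listv b)))"
    by (intro pti pt_comp[OF assms(1)] pt_comp[OF assms(2)])
  moreover have "dv v = (case vlist v of [] => (dv Nl :: 'a, dv Nl :: 'b) | a # b => (dv a, dv (listv b)))" for v
    by (auto simp: dv_prod_def split: val.splits)
  ultimately show ?thesis by presburger
qed

lemma pt_dv_list [pti]: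
  assumes "pt (dv :: val => 'a::enc)" shows "pt (dv :: val => 'a list)"
  unfolding dv_list_def by (intro pti pt_comp[OF assms])

lemma pt_dv_option [pti]:
  assumes "pt (dv :: val => 'a::enc)" shows "pt (dv :: val => 'a option)"
proof -
  have "pt (\<lambda>v. case vlist v of [] => None | a # b => Some (dv a :: 'a))"
    by (intro pti pt_comp[OF assms])
  moreover have "dv v = (case vlist v of [] => None | a # b => Some (dv a :: 'a))" for v
    by (auto simp: dv_option_def split: val.splits)
  ultimately show ?thesis by presburger
qed

lemma pt_dv_nat [pti]: "pt (dv :: val => nat)"
  unfolding dv_nat_def by (intro pti)

text \<open>Preorder is evaluated from the right with a stack of trees: a leaf is pushed, an inner
  node joins the two topmost trees. Ill-formed words are mapped to some tree, so that every
  certificate has a meaning.\<close>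

definition parse_step :: "val list => bool => val list" where
  "parse_step st b = (if b then (case st of [] => [] | a # r => (case r of [] => [] | c # r' => listv (a # vlist c) # r'))
     else Nl # st)"

definition parse :: "bool list => val" where
  "parse l = (case foldl parse_step [] (rev l) of [] => Nl | a # _ => a)"

definition serb :: "val => bool list" where
  "serb v = map (\<lambda>a. a = 2) (ser v)"

lemma parse_step_serb: "foldl parse_step st (rev (serb v)) = v # st"
  by (induction v arbitrary: st) (auto simp: serb_def parse_step_def)

lemma parse_serb: "parse (serb v) = v"
  by (simp add: parse_def parse_step_serb)

lemma pt_parse [pti]:
  assumes "pt f" shows "pt (\<lambda>x. parse (f x))"
  unfolding parse_def
proof (intro pti)
  show "pt (\<lambda>x. foldl parse_step [] (rev (f x)))"
  proof (rule pt_foldl_const[where c = 2 and d = 0 and e = 0])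
    show "pt (\<lambda>p. parse_step (fst (snd p)) (snd (snd p)))"
      unfolding parse_step_def by (intro pti)
    have "sz (Cn a b) = 1 + sz a + sz b" "sz Nl = 1" for a b
      by (auto simp: sz_def ev_val_def)
    then show "sz (parse_step a y) \<le> sz a + (2 + 0 * sz y + 0 * sz x)" for x :: 'a and a y
      by (auto simp: parse_step_def split: list.splits)
  qed (intro pti assms)+
qed

section \<open>Transfer between tapes and encoded data\<close>

definition syms :: "bool list => nat list" where
  "syms w = map (\<lambda>b. if b then 2 else 1) w"

definition readraw :: "nat => nat => com" where
  "readraw i j = While i 0 (If i 2 (Pop i ;; Push j 2) (Pop i ;; Push j 1))"

lemma readraw:
  "i \<noteq> j ==> s i = syms w ==>
   bt (readraw i j) s (7 * length w + 1) (s(i := [], j := syms (rev w) @ s j))"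
proof (induction w arbitrary: s)
  case Nil
  show ?case unfolding readraw_def
    by (rule bt_conv[OF bt_WhileF]) (use Nil in \<open>auto simp: syms_def fun_eq_iff\<close>)
next
  case (Cons b w)
  let ?s = "s(i := syms w, j := (if b then 2 else 1) # s j)"
  have "bt (If i 2 (Pop i ;; Push j 2) (Pop i ;; Push j 1)) s (3 + 2) ?s"
  proof (cases b)
    case True
    show ?thesis
      by (rule bt_IfT, use Cons.prems True in \<open>simp add: syms_def\<close>, rule bt_conv[OF bt_Seq[OF bt_Pop bt_Push]])
        (use Cons.prems True in \<open>auto simp: syms_def fun_eq_iff\<close>)
  next
    case False
    show ?thesis
      by (rule bt_IfF, use Cons.prems False in \<open>simp add: syms_def\<close>, rule bt_conv[OF bt_Seq[OF bt_Pop bt_Push]])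
        (use Cons.prems False in \<open>auto simp: syms_def fun_eq_iff\<close>)
  qed
  moreover have "bt (readraw i j) ?s (7 * length w + 1) (?s(i := [], j := syms (rev w) @ ?s j))"
    by (rule Cons.IH) (use Cons.prems in auto)
  ultimately have "bt (readraw i j) s (3 + 2 + (7 * length w + 1) + 2) (?s(i := [], j := syms (rev w) @ ?s j))"
    unfolding readraw_def by (intro bt_WhileT) (use Cons.prems in \<open>auto simp: syms_def\<close>)
  then show ?case
    by (rule bt_conv) (use Cons.prems in \<open>auto simp: syms_def fun_eq_iff\<close>)
qed

text \<open>The list is built by prepending, which is why the raw word must arrive reversed.\<close>

definition bld :: "nat => com" where
  "bld j = While j 0 (If j 2 (Pop j ;; pushlist (2 # ser (ev True))) (Pop j ;; pushlist (2 # ser (ev False))))"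

lemma bld:
  "j \<noteq> 0 ==> s j = syms w ==> s 0 = ser (ev l) @ r ==>
   bt (bld j) s (20 * length w + 1) (s(j := [], 0 := ser (ev (rev w @ l)) @ r))"
proof (induction w arbitrary: s l)
  case Nil
  show ?case unfolding bld_def
    by (rule bt_conv[OF bt_WhileF]) (use Nil in \<open>auto simp: syms_def fun_eq_iff\<close>)
next
  case (Cons b w)
  let ?s = "s(j := syms w, 0 := ser (ev (b # l)) @ r)"
  have "bt (If j 2 (Pop j ;; pushlist (2 # ser (ev True))) (Pop j ;; pushlist (2 # ser (ev False)))) s (16 + 2) ?s"
  proof (cases b)
    case True
    show ?thesis
      by (rule bt_IfT, use Cons.prems True in \<open>simp add: syms_def\<close>, rule bt_conv[OF bt_Seq[OF bt_Pop pushlist]])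
        (use Cons.prems True in \<open>auto simp: syms_def fun_eq_iff ev_Cons ev_bool_def\<close>)
  next
    case False
    show ?thesis
      by (rule bt_IfF, use Cons.prems False in \<open>simp add: syms_def\<close>, rule bt_conv[OF bt_Seq[OF bt_Pop pushlist]])
        (use Cons.prems False in \<open>auto simp: syms_def fun_eq_iff ev_Cons ev_bool_def\<close>)
  qed
  moreover have "bt (bld j) ?s (20 * length w + 1) (?s(j := [], 0 := ser (ev (rev w @ (b # l))) @ r))"
    by (rule Cons.IH) (use Cons.prems in auto)
  ultimately have "bt (bld j) s (16 + 2 + (20 * length w + 1) + 2) (?s(j := [], 0 := ser (ev (rev w @ (b # l))) @ r))"
    unfolding bld_def by (intro bt_WhileT) (use Cons.prems in \<open>auto simp: syms_def\<close>)
  then show ?case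
    by (rule bt_conv) (use Cons.prems in \<open>auto simp: fun_eq_iff\<close>)
qed

definition istate :: "bool list list => stacks" where
  "istate ws = (\<lambda>i. if i < length ws then syms (ws ! i) else [])"

lemma istate_eq: "istate ws i = (if i < length ws then map (\<lambda>b. if b then 2 else 1) (ws ! i) else [])"
  by (simp add: istate_def syms_def)

definition only0 :: "nat list => stacks" where
  "only0 l = (\<lambda>i. if i = 0 then l else [])"

definition input1 :: com where
  "input1 = readraw 0 2 ;; Push 0 1 ;; bld 2"

lemma input1: "bt input1 (istate [x]) (27 * length x + 4) (only0 (ser (ev x)))"
proof -
  have 1: "bt (readraw 0 2) (istate [x]) (7 * length x + 1) (\<lambda>i. if i = 2 then syms (rev x) else [])"
    by (rule bt_conv[OF readraw[where w = x]]) (auto simp: istate_def fun_eq_iff)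
  have 2: "bt (Push 0 1) (\<lambda>i. if i = 2 then syms (rev x) else []) 2
      (\<lambda>i. if i = 2 then syms (rev x) else if i = 0 then [1] else [])"
    by (rule bt_conv[OF bt_Push]) (auto simp: fun_eq_iff)
  have 3: "bt (bld 2) (\<lambda>i. if i = 2 then syms (rev x) else if i = 0 then [1] else []) (20 * length x + 1)
      (only0 (ser (ev x)))"
    by (rule bt_conv[OF bld[where w = "rev x" and l = "[]" and r = "[]"]])
      (auto simp: only0_def ev_Nil fun_eq_iff)
  show ?thesis unfolding input1_def
    by (rule bt_conv[OF bt_Seq[OF 1 bt_Seq[OF 2 3]]]) auto
qed

text \<open>Both raw words are parked on stacks 2 and 3 because stack 0 is needed for the result;
  the second word is built first, as it has to lie deeper.\<close>

definition input2 :: com where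
  "input2 = readraw 0 2 ;; readraw 1 3 ;; Push 0 1 ;; bld 3 ;; Push 0 1 ;; bld 2 ;; Push 0 2"

lemma input2: "bt input2 (istate [x, u]) (27 * (length x + length u) + 10) (only0 (ser (ev (x, u))))"
proof -
  have 1: "bt (readraw 0 2) (istate [x, u]) (7 * length x + 1)
      (\<lambda>i. if i = 2 then syms (rev x) else if i = 1 then syms u else [])"
    by (rule bt_conv[OF readraw[where w = x]]) (auto simp: istate_def fun_eq_iff nth_Cons')
  have 2: "bt (readraw 1 3) (\<lambda>i. if i = 2 then syms (rev x) else if i = 1 then syms u else []) (7 * length u + 1)
      (\<lambda>i. if i = 2 then syms (rev x) else if i = 3 then syms (rev u) else [])"
    by (rule bt_conv[OF readraw[where w = u]]) (auto simp: fun_eq_iff)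
  have 3: "bt (Push 0 1) (\<lambda>i. if i = 2 then syms (rev x) else if i = 3 then syms (rev u) else []) 2
      (\<lambda>i. if i = 2 then syms (rev x) else if i = 3 then syms (rev u) else if i = 0 then [1] else [])"
    by (rule bt_conv[OF bt_Push]) (auto simp: fun_eq_iff)
  have 4: "bt (bld 3) (\<lambda>i. if i = 2 then syms (rev x) else if i = 3 then syms (rev u) else if i = 0 then [1] else [])
      (20 * length u + 1) (\<lambda>i. if i = 2 then syms (rev x) else if i = 0 then ser (ev u) else [])"
    by (rule bt_conv[OF bld[where w = "rev u" and l = "[]" and r = "[]"]])
      (auto simp: ev_Nil fun_eq_iff)
  have 5: "bt (Push 0 1) (\<lambda>i. if i = 2 then syms (rev x) else if i = 0 then ser (ev u) else []) 2
      (\<lambda>i. if i = 2 then syms (rev x) else if i = 0 then 1 # ser (ev u) else [])"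
    by (rule bt_conv[OF bt_Push]) (auto simp: fun_eq_iff)
  have 6: "bt (bld 2) (\<lambda>i. if i = 2 then syms (rev x) else if i = 0 then 1 # ser (ev u) else []) (20 * length x + 1)
      (only0 (ser (ev x) @ ser (ev u)))"
    by (rule bt_conv[OF bld[where w = "rev x" and l = "[]" and r = "ser (ev u)"]])
      (auto simp: only0_def ev_Nil fun_eq_iff)
  have 7: "bt (Push 0 2) (only0 (ser (ev x) @ ser (ev u))) 2 (only0 (ser (ev (x, u))))"
    by (rule bt_conv[OF bt_Push]) (auto simp: only0_def fun_eq_iff ev_prod_def)
  show ?thesis unfolding input2_def
    by (rule bt_conv[OF bt_Seq[OF 1 bt_Seq[OF 2 bt_Seq[OF 3 bt_Seq[OF 4 bt_Seq[OF 5 bt_Seq[OF 6 7]]]]]]]) auto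
qed

lemma wfc_input1: "wfc input1" and wfc_input2: "wfc input2"
  using wfc_pushlist[of "2 # ser (ev True)"] wfc_pushlist[of "2 # ser (ev False)"]
    set_ser[of "ev True"] set_ser[of "ev False"]
  by (auto simp: input1_def input2_def readraw_def bld_def)

text \<open>A list cell takes six symbols, one for the cell and five for the truth value, of which
  the second decides what is emitted. The final leaf stays on stack 0, so the machine halts by
  accepting.\<close>

definition outlist :: com where
  "outlist = While 0 1 (Pop 0 ;; Pop 0 ;;
     If 0 1 (Pop 0 ;; Pop 0 ;; Pop 0 ;; Pop 0 ;; Emit 2) (Pop 0 ;; Pop 0 ;; Pop 0 ;; Pop 0 ;; Emit 1))"

lemma outlist:
  "s 0 = ser (ev w) @ r ==> bt outlist s (11 * length w + 1) (s(0 := 1 # r, 4 := s 4 @ syms w))"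
proof (induction w arbitrary: s)
  case Nil
  show ?case unfolding outlist_def
    by (rule bt_conv[OF bt_WhileF]) (use Nil in \<open>auto simp: syms_def fun_eq_iff ev_Nil\<close>)
next
  case (Cons b w)
  let ?pe = "\<lambda>a. Pop 0 ;; Pop 0 ;; Pop 0 ;; Pop 0 ;; Emit a"
  let ?t = "s(0 := (if b then [1, 2, 1, 1] else [2, 1, 1, 1]) @ ser (ev w) @ r)"
  let ?s = "s(0 := ser (ev w) @ r, 4 := s 4 @ [if b then 2 else 1])"
  have 1: "bt (Pop 0) s 1 (s(0 := ser (ev b) @ ser (ev w) @ r))"
    by (rule bt_conv[OF bt_Pop]) (use Cons.prems in \<open>auto simp: ev_Cons\<close>)
  have 2: "bt (Pop 0) (s(0 := ser (ev b) @ ser (ev w) @ r)) 1 ?t"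
    by (rule bt_conv[OF bt_Pop]) (auto simp: ev_bool_def)
  have 3: "bt (?pe a) (s(0 := a1 # a2 # a3 # a4 # l)) 5 (s(0 := l, 4 := s 4 @ [a]))" for a a1 a2 a3 a4 l
    by (rule bt_conv, (rule bt_Seq bt_Pop bt_Emit)+) (auto simp: fun_eq_iff)
  have 4: "bt (If 0 1 (?pe 2) (?pe 1)) ?t (5 + 2) ?s"
  proof (cases b)
    case True
    have t: "?t = s(0 := 1 # 2 # 1 # 1 # ser (ev w) @ r)" by (simp add: True)
    show ?thesis unfolding t by (rule bt_IfT, simp, rule bt_conv[OF 3]) (auto simp: True)
  next
    case False
    have t: "?t = s(0 := 2 # 1 # 1 # 1 # ser (ev w) @ r)" by (simp add: False)
    show ?thesis unfolding t by (rule bt_IfF, simp, rule bt_conv[OF 3]) (auto simp: False)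
  qed
  have "bt outlist ?s (11 * length w + 1) (?s(0 := 1 # r, 4 := ?s 4 @ syms w))"
    by (rule Cons.IH) auto
  then have "bt outlist s (1 + (1 + (5 + 2)) + (11 * length w + 1) + 2) (?s(0 := 1 # r, 4 := ?s 4 @ syms w))"
    unfolding outlist_def by (intro bt_WhileT[OF _ bt_Seq[OF 1 bt_Seq[OF 2 4]]]) (use Cons.prems in \<open>auto simp: ev_Cons\<close>)
  then show ?case
    by (rule bt_conv) (auto simp: syms_def fun_eq_iff)
qed

lemma wfc_outlist: "wfc outlist"
  by (simp add: outlist_def)

lemma pt_poly_time_computable:
  assumes "pt f" shows "poly_time_computable f"
proof -
  obtain c p where c: "wfc c" "PROP computes c p f"
    using ptE[OF assms] by metis
  obtain q where q: "!!x. sz (f x) \<le> poly q (sz x)" using pt_size[OF assms] by blast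
  let ?C = "input1 ;; c ;; outlist"
  \<comment> \<open>\<open>1 + 6 * n\<close> is the size of a bit list of length \<open>n\<close>;
    the summands stand for reading, computing and writing, and the last 1 is for the
    verdict.\<close>
  let ?g = "\<lambda>n. 27 * n + 4 + (poly p (1 + 6 * n) + (11 * poly q (1 + 6 * n) + 1)) + 1"
  have "pb ?g" by (intro pb_intros)
  then obtain P where P: "!!n. ?g n \<le> poly P n" unfolding pb_def by metis
  have wf: "wfc ?C" by (simp add: c wfc_input1 wfc_outlist)
  have "halted (mach ?C) (run (mach ?C) [x] (poly P (length x))) \<and>
    fst (last (snd (run (mach ?C) [x] (poly P (length x))))) = tape_of (f x)" for x
  proof -
    have sx: "sz x = 1 + 6 * length x" by (rule sz_bools)
    have 1: "bt c (only0 (ser (ev x))) (poly p (sz x)) (only0 (ser (ev (f x))))"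
      by (rule bt_conv[OF c(2)[where r = "[]" and x = x]]) (auto simp: only0_def fun_eq_iff)
    have 2: "bt outlist (only0 (ser (ev (f x)))) (11 * length (f x) + 1) (\<lambda>i. if i = 4 then syms (f x) else if i = 0 then [1] else [])"
      by (rule bt_conv[OF outlist[where w = "f x" and r = "[]"]]) (auto simp: only0_def fun_eq_iff)
    obtain m where m: "m \<le> 27 * length x + 4 + (poly p (sz x) + (11 * length (f x) + 1))"
      "bs ?C (istate [x]) m (\<lambda>i. if i = 4 then syms (f x) else if i = 0 then [1] else [])"
      using bt_Seq[OF input1 bt_Seq[OF 1 2]] unfolding bt_def by blast
    have "length (f x) \<le> poly q (1 + 6 * length x)"
      using order_trans[OF sz_ge_length q[of x]] unfolding sx .
    then have "m < poly P (length x)"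
      using m(1) P[of "length x"] unfolding sx by linarith
    from mach_run[OF m(2) wf _ this istate_eq] obtain ts where
      ts: "run (mach ?C) [x] (poly P (length x)) = (accept (mach ?C), ts)" "rep (\<lambda>i. if i = 4 then syms (f x) else if i = 0 then [1] else []) ts"
      by auto
    have "length ts = 5" "ts ! 4 = outp (syms (f x))" using ts(2) by (auto simp: rep_def)
    then have "last ts = outp (syms (f x))" by (metis One_nat_def diff_Suc_1 eval_nat_numeral(3) last_conv_nth list.size(3) nat.simps(3) numeral_2_eq_2 numeral_3_eq_3 semiring_norm(26) semiring_norm(27))
    moreover have "fst (outp (syms w)) = tape_of w" for w
      by (auto simp: outp_def tape_of_def syms_def fun_eq_iff)
    ultimately show ?thesis using ts(1) by (auto simp: halted_def)
  qed
  then show ?thesis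
    unfolding poly_time_computable_def using wf_mach[OF wf] by blast
qed

text \<open>Certificates of any encodable type are admissible: decoding is total, so soundness holds
  for every bit string, and completeness asks only that a short certificate exists whenever there is
  one.\<close>

lemma NP_I:
  fixes R :: "bool list => 'c::enc => bool"
  assumes R: "pt (\<lambda>p. R (fst p) (snd p))" and d: "pt (dv :: val => 'c)"
    and q: "!!x c. R x c ==> \<exists>c'. R x c' \<and> sz c' \<le> poly q (length x)"
  shows "{x. \<exists>c. R x c} \<in> NP"
proof -
  define R' where "R' = (\<lambda>p. R (fst p) (dv (parse (snd p))))"
  have "pt R'"
    unfolding R'_def by (intro pt_comp2[OF R] pt_comp[OF d] pti)
  from ptE[OF this] obtain c p where c: "wfc c"
    "PROP computes c p R'"
    by metis
  \<comment> \<open>Dropping the first symbol of a truth value leaves 1 on top exactly for True,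
    which is what the machine tests at the end.\<close>
  let ?C = "input2 ;; c ;; Pop 0"
  let ?g = "\<lambda>n. 27 * (n + poly q n) + 10 + (poly p (3 + 6 * n + 6 * poly q n) + 1) + 1"
  have "pb ?g" by (intro pb_intros)
  then obtain P where P: "!!n. ?g n \<le> poly P n" unfolding pb_def by metis
  have wf: "wfc ?C" by (simp add: c wfc_input2)
  have run: "halted (mach ?C) (run (mach ?C) [x, u] (poly P (length x)))
     \<and> (fst (run (mach ?C) [x, u] (poly P (length x))) = accept (mach ?C) \<longleftrightarrow> R' (x, u))"
    if u: "length u \<le> poly q (length x)" for x u
  proof -
    have 1: "bt c (only0 (ser (ev (x, u)))) (poly p (sz (x, u))) (only0 (ser (ev (R' (x, u)))))"
      by (rule bt_conv[OF c(2)[where r = "[]" and x = "(x, u)"]]) (auto simp: only0_def fun_eq_iff)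
    obtain m where m: "m \<le> 27 * (length x + length u) + 10 + (poly p (sz (x, u)) + 1)"
      "bs ?C (istate [x, u]) m ((only0 (ser (ev (R' (x, u)))))(0 := tl (only0 (ser (ev (R' (x, u)))) 0)))"
      using bt_Seq[OF input2 bt_Seq[OF 1 bt_Pop]] unfolding bt_def by blast
    have "poly p (sz (x, u)) \<le> poly p (3 + 6 * length x + 6 * poly q (length x))"
      using u by (intro poly_nat_mono) (simp add: sz_bools)
    moreover have "27 * (length x + length u) \<le> 27 * (length x + poly q (length x))"
      using u by simp
    ultimately have "m < poly P (length x)"
      using m(1) P[of "length x"] by linarith
    from mach_run[OF m(2) wf _ this istate_eq] show ?thesis
      using wf_mach[OF wf] by (cases "R' (x, u)") (auto simp: only0_def ev_bool_def halted_def wf_tm_def)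
  qed
  have "x \<in> {x. \<exists>c. R x c} \<longleftrightarrow> (\<exists>u. length u \<le> poly q (length x) \<and>
      fst (run (mach ?C) [x, u] (poly P (length x))) = accept (mach ?C))" for x
  proof
    assume "x \<in> {x. \<exists>c. R x c}"
    then obtain c' where c': "R x c'" "sz c' \<le> poly q (length x)" using q by blast
    have "R' (x, serb (ev c'))" by (simp add: R'_def parse_serb dv_ev c')
    moreover have "length (serb (ev c')) \<le> poly q (length x)" using c'(2) by (simp add: serb_def sz_def)
    ultimately show "\<exists>u. length u \<le> poly q (length x) \<and>
      fst (run (mach ?C) [x, u] (poly P (length x))) = accept (mach ?C)"
      using run by blast
  next
    assume "\<exists>u. length u \<le> poly q (length x) \<and>
      fst (run (mach ?C) [x, u] (poly P (length x))) = accept (mach ?C)"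
    then show "x \<in> {x. \<exists>c. R x c}" using run by (auto simp: R'_def)
  qed
  moreover have "num_tapes (mach ?C) \<ge> 2" by (simp add: mach_def)
  ultimately show ?thesis
    unfolding NP_def using wf_mach[OF wf] run by blast
qed

section \<open>Encoded instances as data\<close>

definition diff_step :: "nat \<times> nat \<times> bool \<times> bool list => nat \<times> nat \<times> bool \<times> bool list" where
  "diff_step p = (fst p div 2, fst (snd p) div 2,
     (if fst (snd (snd p)) then \<not> odd (fst p) \<or> odd (fst (snd p)) else \<not> odd (fst p) \<and> odd (fst (snd p))),
     ((odd (fst p) = odd (fst (snd p))) = fst (snd (snd p))) # snd (snd (snd p)))"

text \<open>The invariant of the adder with a borrow in place of the carry, over the integers
  because intermediate differences may be negative.\<close>

lemma diff_step_foldl: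
  "\<exists>c acc'. foldl (\<lambda>p y. diff_step p) (a, b, c0, acc) l = (a div 2 ^ length l, b div 2 ^ length l, c, acc') \<and>
    length acc' = length l + length acc \<and>
    (int (a div 2 ^ length l) - int (b div 2 ^ length l) - of_bool c) * 2 ^ length acc' + int (ofbits (rev acc')) =
    (int a - int b - of_bool c0) * 2 ^ length acc + int (ofbits (rev acc))"
proof (induction l arbitrary: a b c0 acc)
  case (Cons y l)
  let ?b = "(odd a = odd b) = c0"
  obtain c1 where c1: "diff_step (a, b, c0, acc) = (a div 2, b div 2, c1, ?b # acc)"
    "2 * (int (a div 2) - int (b div 2) - of_bool c1) + of_bool ?b = int a - int b - of_bool c0"
  proof
    show "diff_step (a, b, c0, acc) = (a div 2, b div 2, (if c0 then \<not> odd a \<or> odd b else \<not> odd a \<and> odd b), ?b # acc)"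
      by (simp add: diff_step_def)
    show "2 * (int (a div 2) - int (b div 2) - of_bool (if c0 then \<not> odd a \<or> odd b else \<not> odd a \<and> odd b)) +
        of_bool ?b = int a - int b - of_bool c0"
      by (cases "odd a"; cases "odd b"; cases c0) (auto elim!: oddE evenE)
  qed
  obtain c acc' where *: "foldl (\<lambda>p y. diff_step p) (a div 2, b div 2, c1, ?b # acc) l =
      (a div 2 div 2 ^ length l, b div 2 div 2 ^ length l, c, acc')"
    "length acc' = length l + length (?b # acc)"
    "(int (a div 2 div 2 ^ length l) - int (b div 2 div 2 ^ length l) - of_bool c) * 2 ^ length acc' + int (ofbits (rev acc')) =
    (int (a div 2) - int (b div 2) - of_bool c1) * 2 ^ length (?b # acc) + int (ofbits (rev (?b # acc)))"
    using Cons[of "a div 2" "b div 2" c1 "?b # acc"] by metis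
  have "(int (a div 2) - int (b div 2) - of_bool c1) * 2 ^ length (?b # acc) + int (ofbits (rev (?b # acc)))
      = (2 * (int (a div 2) - int (b div 2) - of_bool c1) + of_bool ?b) * 2 ^ length acc + int (ofbits (rev acc))"
    by (simp add: ofbits_append algebra_simps)
  also have "... = (int a - int b - of_bool c0) * 2 ^ length acc + int (ofbits (rev acc))"
    unfolding c1(2) ..
  finally have E: "(int (a div 2) - int (b div 2) - of_bool c1) * 2 ^ length (?b # acc) +
      int (ofbits (rev (?b # acc))) = (int a - int b - of_bool c0) * 2 ^ length acc + int (ofbits (rev acc))" .
  have D: "x div 2 ^ length (y # l) = x div 2 div 2 ^ length l" for x :: nat
    by (simp add: div_mult2_eq)
  show ?case
  proof (intro exI conjI)
    show "foldl (\<lambda>p y. diff_step p) (a, b, c0, acc) (y # l) = (a div 2 ^ length (y # l), b div 2 ^ length (y # l), c, acc')"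
      using *(1) by (simp add: c1(1) div_mult2_eq)
    show "length acc' = length (y # l) + length acc"
      using *(2) by simp
    show "(int (a div 2 ^ length (y # l)) - int (b div 2 ^ length (y # l)) - of_bool c) * 2 ^ length acc' + int (ofbits (rev acc')) =
        (int a - int b - of_bool c0) * 2 ^ length acc + int (ofbits (rev acc))"
      using *(3)[unfolded E] unfolding D .
  qed
qed simp

lemma ofbits_less: "ofbits l < 2 ^ length l"
  by (induction l) auto

lemma diff_correct:
  assumes "foldl (\<lambda>p y. diff_step p) (a, b, False, []) (nbits a @ nbits b) = p" "b \<le> a"
  shows "a - b = ofbits (rev (snd (snd (snd p))))"
proof -
  let ?l = "nbits a @ nbits b"
  obtain c acc where *: "foldl (\<lambda>p y. diff_step p) (a, b, False, []) ?l = (a div 2 ^ length ?l, b div 2 ^ length ?l, c, acc)"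
    "length acc = length ?l + length ([] :: bool list)"
    "(int (a div 2 ^ length ?l) - int (b div 2 ^ length ?l) - of_bool c) * 2 ^ length acc + int (ofbits (rev acc)) =
    (int a - int b - of_bool False) * 2 ^ length ([] :: bool list) + int (ofbits (rev []))"
    using diff_step_foldl[of a b False "[]" ?l] by metis
  have "a < 2 ^ length ?l"
    by (rule less_le_trans[OF less_two_bl[of a] power_increasing]) (auto simp: bl_def)
  moreover have "b < 2 ^ length ?l"
    by (rule less_le_trans[OF less_two_bl[of b] power_increasing]) (auto simp: bl_def)
  ultimately have "a div 2 ^ length ?l = 0" "b div 2 ^ length ?l = 0" by auto
  then have E: "int (ofbits (rev acc)) - of_bool c * 2 ^ length acc = int a - int b"
    using *(3) by simp
  have "int (ofbits (rev acc)) < 2 ^ length acc"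
    using ofbits_less[of "rev acc"] by (metis length_rev of_nat_less_iff of_nat_numeral of_nat_power)
  \<comment> \<open>A remaining borrow would make the difference negative, since the digits
    represent less than the power of two that is borrowed.\<close>
  have "\<not> c"
  proof
    assume c
    then have "int (ofbits (rev acc)) - 2 ^ length acc = int a - int b" using E by simp
    with \<open>int (ofbits (rev acc)) < 2 ^ length acc\<close> assms(2) show False by linarith
  qed
  then show ?thesis using E assms * by auto
qed

lemma pt_diff [pti]:
  assumes "pt f" "pt g" shows "pt (\<lambda>x. f x - g x :: nat)"
proof -
  have 1: "pt diff_step" unfolding diff_step_def by (intro pti)
  have "pt (\<lambda>x. foldl (\<lambda>p y. diff_step p) (f x, g x, False, []) (nbits (f x) @ nbits (g x)))"
  proof (rule pt_foldl_const[where c = 6 and d = 0 and e = 0])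
    show "sz (diff_step a) \<le> sz a + (6 + 0 * sz y + 0 * sz x)" for x :: 'a and a and y :: bool
      using bl_div2[of "fst a"] bl_div2[of "fst (snd a)"] by (cases a) (auto simp: diff_step_def sz_nat)
  qed (intro pti assms pt_comp[OF 1])+
  then have "pt (\<lambda>x. if g x \<le> f x then (\<lambda>p. ofbits (rev (snd (snd (snd p)))))
      (foldl (\<lambda>p y. diff_step p) (f x, g x, False, []) (nbits (f x) @ nbits (g x))) else 0)"
    by (intro pti assms)
  then show ?thesis
    by (rule pt_ev_cong) (use diff_correct[OF refl] in auto)
qed

text \<open>Stein's binary gcd: a common factor 2 stops the process, a factor 2 of only one number
  is removed, and the difference of two odd numbers is halved at once. Each step is a subtraction or
  a shift.\<close>

definition cop_step :: "nat \<times> nat => nat \<times> nat" where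
  "cop_step p = (if fst p = 0 \<or> \<not> odd (fst p) \<and> \<not> odd (snd p) then p
     else if \<not> odd (fst p) then (fst p div 2, snd p)
     else if \<not> odd (snd p) then (fst p, snd p div 2)
     else if snd p \<le> fst p then ((fst p - snd p) div 2, snd p)
     else ((snd p - fst p) div 2, fst p))"

lemma coprime_half: "even a ==> odd b ==> coprime (a div 2) b \<longleftrightarrow> coprime a (b :: nat)"
  by (auto elim!: evenE simp: coprime_mult_left_iff)

lemma coprime_diff: "b \<le> a ==> coprime (a - b) b \<longleftrightarrow> coprime a (b :: nat)"
  by (metis coprime_add_one_left coprime_iff_gcd_eq_1 gcd_add1 le_add_diff_inverse2)

lemma cop_step_inv:
  assumes "snd p > 0"
  shows "snd (cop_step p) > 0 \<and> (coprime (fst (cop_step p)) (snd (cop_step p)) \<longleftrightarrow> coprime (fst p) (snd p))"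
proof -
  obtain a b where p: "p = (a, b)" by (cases p)
  consider "a = 0 \<or> even a \<and> even b" | "a > 0" "even a" "odd b" | "a > 0" "odd a" "even b"
    | "odd a" "odd b" "b \<le> a" | "odd a" "odd b" "a < b"
    by fastforce
  then show ?thesis
  proof cases
    case 1
    then show ?thesis using assms by (auto simp: p cop_step_def)
  next
    case 2
    then show ?thesis using assms coprime_half by (auto simp: p cop_step_def)
  next
    case 3
    then show ?thesis using assms coprime_half[of b a]
      by (auto simp: p cop_step_def coprime_commute elim!: evenE)
  next
    case 4
    then show ?thesis using assms coprime_half[of "a - b" b] coprime_diff[of b a] by (auto simp: p cop_step_def)
  next
    case 5
    then show ?thesis using assms coprime_half[of "b - a" a] coprime_diff[of a b]
      by (auto simp: p cop_step_def coprime_commute elim!: oddE)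
  qed
qed

lemma bl_less_half: "a > 0 ==> bl (a div 2) < bl a"
  using bl_rec by simp

text \<open>Each proper step shortens the two numbers by at least one bit in total, so their bit
  lists are a sufficient clock.\<close>

lemma cop_step_less:
  assumes "snd p > 0"
  shows "cop_step p = p \<and> (fst p = 0 \<or> even (fst p) \<and> even (snd p)) \<or>
    bl (fst (cop_step p)) + bl (snd (cop_step p)) < bl (fst p) + bl (snd p)"
proof -
  obtain a b where p: "p = (a, b)" by (cases p)
  have "bl ((a - b) div 2) < bl a" if "a > 0"
    using bl_less_half[OF that] bl_mono[OF div_le_mono[of "a - b" a 2]] by simp
  moreover have "bl ((b - a) div 2) < bl b"
    using bl_less_half[of b] bl_mono[OF div_le_mono[of "b - a" b 2]] assms by (simp add: p)
  ultimately show ?thesis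
    using assms bl_less_half[of a] bl_less_half[of b] by (auto simp: p cop_step_def)
qed

lemma cop_step_size: "sz (cop_step p) \<le> sz p"
proof (cases "snd p > 0")
  case True
  from cop_step_less[OF this] show ?thesis by (cases p; cases "cop_step p") (auto simp: sz_nat)
next
  case False
  then show ?thesis using bl_div2[of "fst p"] by (cases p) (auto simp: cop_step_def sz_nat)
qed

lemma cop_foldl:
  assumes "b > 0"
  shows "fst (foldl (\<lambda>p y. cop_step p) (a, b) (nbits a @ nbits b)) = 0 \<and>
     snd (foldl (\<lambda>p y. cop_step p) (a, b) (nbits a @ nbits b)) = 1 \<longleftrightarrow> coprime a b"
proof -
  have "snd p > 0 ==> bl (fst p) + bl (snd p) \<le> length l ==>
      (let r = foldl (\<lambda>p y. cop_step p) p l in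
        snd r > 0 \<and> (coprime (fst r) (snd r) \<longleftrightarrow> coprime (fst p) (snd p)) \<and> (fst r = 0 \<or> even (fst r) \<and> even (snd r)))"
    for p and l :: "bool list"
  proof (induction l arbitrary: p)
    case Nil
    then show ?case using bl_rec[of "snd p"] by auto
  next
    case (Cons y l)
    show ?case
    proof (cases "bl (fst (cop_step p)) + bl (snd (cop_step p)) < bl (fst p) + bl (snd p)")
      case True
      then show ?thesis using Cons.IH[of "cop_step p"] cop_step_inv[of p] Cons.prems by (auto simp: Let_def)
    next
      case False
      then have *: "cop_step p = p" "fst p = 0 \<or> even (fst p) \<and> even (snd p)"
        using cop_step_less[OF Cons.prems(1)] by auto
      have "foldl (\<lambda>p y. cop_step p) p l = p" for l :: "bool list"
        by (induction l) (auto simp: *(1))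
      then show ?thesis using Cons.prems(1) * by (simp add: Let_def)
    qed
  qed
  \<comment> \<open>At a fixed point either the first number is 0, and coprimality means that the
    second is 1, or both are even and not coprime.\<close>
  from this[of "(a, b)" "nbits a @ nbits b"] assms show ?thesis
    by (auto simp: Let_def bl_def coprime_absorb_left dest: coprime_common_divisor_nat[of _ _ 2])
qed

lemma pt_coprime:
  assumes "pt f" "pt g" shows "pt (\<lambda>x. g x > 0 \<and> coprime (f x) (g x :: nat))"
proof -
  have 1: "pt cop_step" unfolding cop_step_def by (intro pti)
  have "pt (\<lambda>x. foldl (\<lambda>p y. cop_step p) (f x, g x) (nbits (f x) @ nbits (g x)))"
  proof (rule pt_foldl_const[where c = 0 and d = 0 and e = 0])
    show "sz (cop_step a) \<le> sz a + (0 + 0 * sz y + 0 * sz x)" for x :: 'a and a and y :: bool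
      using cop_step_size[of a] by simp
  qed (intro pti assms pt_comp[OF 1])+
  then have "pt (\<lambda>x. g x > 0 \<and> fst (foldl (\<lambda>p y. cop_step p) (f x, g x) (nbits (f x) @ nbits (g x))) = 0 \<and>
      snd (foldl (\<lambda>p y. cop_step p) (f x, g x) (nbits (f x) @ nbits (g x))) = 1)"
    by (intro pti assms)
  moreover have "g x > 0 \<and> coprime (f x) (g x) \<longleftrightarrow> g x > 0 \<and>
      fst (foldl (\<lambda>p y. cop_step p) (f x, g x) (nbits (f x) @ nbits (g x))) = 0 \<and>
      snd (foldl (\<lambda>p y. cop_step p) (f x, g x) (nbits (f x) @ nbits (g x))) = 1" for x
    using cop_foldl[of "g x" "f x"] by blast
  ultimately show ?thesis by presburger
qed

section \<open>Instances as first-order data\<close>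

type_synonym fr = "nat \<times> nat"
type_synonym dat = "fr option list list \<times> fr \<times> nat list list \<times> (fr \<times> fr \<times> fr \<times> fr) list \<times> fr option \<times> fr"

text \<open>The inserted False are the sign bits of the integer encoding; all numbers of an instance
  and of a feasible flow are nonnegative.\<close>

definition encf :: "fr => bool list" where
  "encf f = False # enc_nat (fst f) @ False # enc_nat (snd f)"

definition encm :: "fr \<times> fr \<times> fr \<times> fr => bool list" where
  "encm m = encf (fst m) @ encf (fst (snd m)) @ encf (fst (snd (snd m))) @ encf (snd (snd (snd m)))"

definition encd :: "dat => bool list" where
  "encd d = enc_list (enc_list (enc_option encf)) (fst d) @ encf (fst (snd d)) @
     enc_list (enc_list enc_nat) (fst (snd (snd d))) @ enc_list encm (fst (snd (snd (snd d)))) @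
     enc_option encf (fst (snd (snd (snd (snd d))))) @ encf (snd (snd (snd (snd (snd d)))))"

lemma enc_nat_nbits: "enc_nat n = concat (map (\<lambda>b. [True, b]) (nbits n)) @ [False]"
proof (induction n rule: enc_nat.induct)
  case (1 n)
  show ?case
    by (subst enc_nat.simps, subst nbits.simps) (use 1 in auto)
qed

lemma pt_enc_nat [pti]: "pt f ==> pt (\<lambda>x. enc_nat (f x))"
  unfolding enc_nat_nbits by (intro pti)

lemma pt_enc_list [pti]:
  assumes "pt (\<lambda>p. f (fst p) (snd p))" "pt l" shows "pt (\<lambda>x. enc_list (f x) (l x))"
  unfolding enc_list_def by (intro pti pt_comp2[OF assms(1)] assms(2))

lemma pt_enc_option [pti]:
  assumes "pt (\<lambda>p. f (fst p) (snd p))" "pt l" shows "pt (\<lambda>x. enc_option (f x) (l x))"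
  unfolding enc_option_def by (intro pti pt_comp2[OF assms(1)] assms(2))

lemma pt_encf [pti]: "pt f ==> pt (\<lambda>x. encf (f x))"
  unfolding encf_def by (intro pti)

lemma pt_encm [pti]: "pt f ==> pt (\<lambda>x. encm (f x))"
  unfolding encm_def by (intro pti)

lemma pt_encd [pti]: "pt f ==> pt (\<lambda>x. encd (f x))"
  unfolding encd_def by (intro pti)

text \<open>Stated with arbitrary tails, since this form passes through concatenation and lists; it
  also separates an instance from the flow that follows it.\<close>

definition pfree :: "('a => bool list) => bool" where
  "pfree f \<longleftrightarrow> (\<forall>x y r r'. f x @ r = f y @ r' --> x = y \<and> r = r')"

lemma pfree_enc_nat: "pfree enc_nat"
proof -
  have "enc_nat m @ r = enc_nat n @ r' ==> m = n \<and> r = r'" for m n r r'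
  proof (induction m arbitrary: n rule: less_induct)
    case (less m)
    show ?case
    proof (cases "m = 0 \<or> n = 0")
      case True
      then show ?thesis using less.prems by (auto simp: enc_nat.simps[of m] enc_nat.simps[of n] split: if_splits)
    next
      case False
      then have 1: "odd m = odd n" "enc_nat (m div 2) @ r = enc_nat (n div 2) @ r'"
        using less.prems by (auto simp: enc_nat.simps[of m] enc_nat.simps[of n])
      have 2: "m div 2 = n div 2 \<and> r = r'"
        by (rule less.IH[OF _ 1(2)]) (use False in auto)
      then have "m div 2 = n div 2" by blast
      then have "m = n" using 1(1) by presburger
      with 2 show ?thesis by blast
    qed
  qed
  then show ?thesis unfolding pfree_def by blast
qed

lemma pfree_encf: "pfree encf"
  unfolding pfree_def encf_def
proof (intro allI impI)
  fix x y :: fr and r r'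
  assume "(False # enc_nat (fst x) @ False # enc_nat (snd x)) @ r = (False # enc_nat (fst y) @ False # enc_nat (snd y)) @ r'"
  then have "enc_nat (fst x) @ (False # enc_nat (snd x) @ r) = enc_nat (fst y) @ (False # enc_nat (snd y) @ r')" by simp
  then have 1: "fst x = fst y" "enc_nat (snd x) @ r = enc_nat (snd y) @ r'"
    using pfree_enc_nat unfolding pfree_def by blast+
  then have "snd x = snd y \<and> r = r'"
    using pfree_enc_nat unfolding pfree_def by blast
  with 1 show "x = y \<and> r = r'" by (auto simp: prod_eq_iff)
qed

lemma pfree_option: "pfree f ==> pfree (enc_option f)"
proof -
  assume f: "pfree f"
  show ?thesis
    unfolding pfree_def
  proof (intro allI impI)
    fix x y r r'
    assume "enc_option f x @ r = enc_option f y @ r'"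
    then have "x = None \<and> y = None \<and> r = r' \<or> (\<exists>a b. x = Some a \<and> y = Some b \<and> f a @ r = f b @ r')"
      by (cases x; cases y) (auto simp: enc_option_def)
    then show "x = y \<and> r = r'"
      using f unfolding pfree_def by blast
  qed
qed

lemma pfree_list: assumes "pfree f" shows "pfree (enc_list f)"
proof -
  have "enc_list f l @ r = enc_list f m @ r' ==> l = m \<and> r = r'" for l m r r'
  proof (induction l arbitrary: m)
    case Nil
    then show ?case by (cases m) (auto simp: enc_list_def)
  next
    case (Cons a l)
    obtain b m' where m: "m = b # m'"
      using Cons.prems by (cases m) (auto simp: enc_list_def)
    have "f a @ (enc_list f l @ r) = f b @ (enc_list f m' @ r')"
      using Cons.prems by (simp add: m enc_list_def)
    then have "a = b" "enc_list f l @ r = enc_list f m' @ r'"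
      using assms unfolding pfree_def by blast+
    with Cons.IH show ?case by (simp add: m)
  qed
  then show ?thesis unfolding pfree_def by blast
qed

lemma pfree_append:
  assumes "pfree f" "pfree g" shows "pfree (\<lambda>x. f (fst x) @ g (snd x))"
  unfolding pfree_def
proof (intro allI impI)
  fix x y r r'
  assume "(f (fst x) @ g (snd x)) @ r = (f (fst y) @ g (snd y)) @ r'"
  then have "f (fst x) @ (g (snd x) @ r) = f (fst y) @ (g (snd y) @ r')" by simp
  then have "fst x = fst y" "g (snd x) @ r = g (snd y) @ r'"
    using assms(1) unfolding pfree_def by blast+
  with assms(2) show "x = y \<and> r = r'" unfolding pfree_def prod_eq_iff by blast
qed

lemma pfree_encm: "pfree encm"
  unfolding encm_def[abs_def]
  using pfree_append[OF pfree_encf pfree_append[OF pfree_encf pfree_append[OF pfree_encf pfree_encf]]] .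

lemma pfree_encd: "pfree encd"
  unfolding encd_def[abs_def]
  using pfree_append[OF pfree_list[OF pfree_list[OF pfree_option[OF pfree_encf]]]
    pfree_append[OF pfree_encf pfree_append[OF pfree_list[OF pfree_list[OF pfree_enc_nat]]
    pfree_append[OF pfree_list[OF pfree_encm] pfree_append[OF pfree_option[OF pfree_encf] pfree_encf]]]]] .

lemma pfree_inj: "pfree f ==> f x = f y ==> x = y"
  unfolding pfree_def by blast

definition fr :: "rat => fr" where
  "fr r = (nat (fst (quotient_of r)), nat (snd (quotient_of r)))"

definition frval :: "fr => rat" where
  "frval f = of_nat (fst f) / of_nat (snd f)"

text \<open>The encoding writes reduced fractions. A verifier that handles raw pairs must reject all
  others, for only on these are \<open>fr\<close> and \<open>frval\<close> mutually inverse.\<close>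

definition valid_fr :: "fr => bool" where
  "valid_fr f \<longleftrightarrow> snd f > 0 \<and> coprime (fst f) (snd f)"

lemma pt_valid_fr [pti]: "pt f ==> pt (\<lambda>x. valid_fr (f x))"
  unfolding valid_fr_def by (intro pt_coprime pti)

lemma fst_quotient_of_nonneg: "r \<ge> 0 ==> fst (quotient_of r) \<ge> 0"
proof -
  assume r: "r \<ge> 0"
  obtain p q where pq: "quotient_of r = (p, q)" by (cases "quotient_of r")
  have "q > 0" "r = of_int p / of_int q"
    using quotient_of_denom_pos[OF pq] quotient_of_div[OF pq] by auto
  with r have "p \<ge> 0" by (simp add: zero_le_divide_iff)
  with pq show ?thesis by simp
qed

lemma valid_fr_fr: "r \<ge> 0 ==> valid_fr (fr r)"
proof -
  assume r: "r \<ge> 0"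
  obtain p q where pq: "quotient_of r = (p, q)" by (cases "quotient_of r")
  then have "p \<ge> 0" "q > 0" "coprime p q"
    using fst_quotient_of_nonneg[OF r] quotient_of_denom_pos[OF pq] quotient_of_coprime[OF pq] by auto
  then have "coprime (int (nat p)) (int (nat q))" by simp
  then show ?thesis
    using \<open>q > 0\<close> unfolding coprime_int_iff by (simp add: valid_fr_def fr_def pq)
qed

lemma frval_fr: "r \<ge> 0 ==> frval (fr r) = r"
proof -
  assume r: "r \<ge> 0"
  obtain p q where pq: "quotient_of r = (p, q)" by (cases "quotient_of r")
  then have "p \<ge> 0" "q > 0" "r = of_int p / of_int q"
    using fst_quotient_of_nonneg[OF r] quotient_of_denom_pos[OF pq] quotient_of_div[OF pq] by auto
  have "frval (fr r) = rat_of_int p / rat_of_int q"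
    using \<open>p \<ge> 0\<close> \<open>q > 0\<close> by (simp add: frval_def fr_def pq)
  then show ?thesis using \<open>r = of_int p / of_int q\<close> by simp
qed

lemma fr_frval: "valid_fr f ==> fr (frval f) = f"
proof -
  assume f: "valid_fr f"
  have "frval f = Rat.Fract (int (fst f)) (int (snd f))"
    using f by (simp add: frval_def Fract_of_int_quotient)
  then have "quotient_of (frval f) = (int (fst f), int (snd f))"
    using f by (auto simp: quotient_of_Fract Rat.normalize_def valid_fr_def coprime_iff_gcd_eq_1 Let_def)
  then show ?thesis by (simp add: fr_def)
qed

lemma frval_nonneg: "frval f \<ge> 0"
  by (simp add: frval_def)

lemma enc_rat_fr: "r \<ge> 0 ==> enc_rat r = encf (fr r)"
  using quotient_of_denom_pos'[of r] fst_quotient_of_nonneg[of r]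
  by (auto simp: enc_rat_def encf_def fr_def enc_int_def)

text \<open>The restriction of an instance to its meaningful arguments: instances with the same
  encoding may differ as records, but not in these data.\<close>

definition todata :: "msp => dat" where
  "todata I =
    (let n = num_verts I in
     (map (\<lambda>u. map (\<lambda>v. if (u, v) \<in> edges I then Some (fr (weight I (u, v))) else None) [0..<n]) [0..<n],
      fr (budget I),
      map (\<lambda>u. map (\<lambda>v. demand I (u, v)) [0..<n]) [0..<n],
      map (\<lambda>i. (fr (travel_time I i), fr (energy I i), fr (cost I i), fr (capacity I i))) [0..<Suc (modes I)],
      map_option fr (time_bound I), fr (energy_bound I)))"

lemma enc_list_cong: "(!!x. x \<in> set l ==> f x = g (h x)) ==> enc_list f l = enc_list g (map h l)"
  by (simp add: enc_list_def o_def cong: map_cong)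

lemma enc_msp_todata:
  assumes "msp_instance I"
  shows "enc_msp I = encd (todata I)"
proof -
  let ?n = "num_verts I"
  have e: "edges I \<subseteq> {..<?n} \<times> {..<?n}"
    using assms pair_wf_digraph.in_arcsD1[of "graph_of I"]
    by (auto simp: msp_instance_def graph_of_def pair_fin_digraph_def pair_wf_digraph_def)
  have 1: "enc_matrix ?n (\<lambda>e. enc_option enc_rat (if e \<in> edges I then Some (weight I e) else None)) =
     enc_list (enc_list (enc_option encf)) (fst (todata I))"
    unfolding enc_matrix_def todata_def Let_def fst_conv using assms
    by (intro enc_list_cong) (auto simp: enc_option_def enc_rat_fr msp_instance_def)
  have 2: "enc_matrix ?n (\<lambda>\<kappa>. enc_nat (demand I \<kappa>)) = enc_list (enc_list enc_nat) (fst (snd (snd (todata I))))"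
    unfolding enc_matrix_def todata_def Let_def fst_conv snd_conv
    by (intro enc_list_cong) auto
  have 3: "enc_list (\<lambda>i. enc_rat (travel_time I i) @ enc_rat (energy I i) @
                   enc_rat (cost I i) @ enc_rat (capacity I i)) [0..<Suc (modes I)] =
      enc_list encm (fst (snd (snd (snd (todata I)))))"
    unfolding todata_def Let_def fst_conv snd_conv using assms
    by (intro enc_list_cong) (auto simp: encm_def enc_rat_fr msp_instance_def less_imp_le simp del: upt_Suc)
  have 4: "enc_option enc_rat (time_bound I) = enc_option encf (map_option fr (time_bound I))"
    using assms by (auto simp: enc_option_def enc_rat_fr msp_instance_def split: option.splits)
  show ?thesis
    unfolding enc_msp_def encd_def 1 2 3 4 using assms
    by (simp add: todata_def Let_def enc_rat_fr msp_instance_def)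
qed

section \<open>From cyclic tilings to sums of natural numbers\<close>

type_synonym tile = "nat \<times> nat \<times> nat \<times> nat"  \<comment> \<open>north, south, east, west\<close>

definition north :: "tile => nat" where "north t = fst t"
definition south :: "tile => nat" where "south t = fst (snd t)"
definition east :: "tile => nat" where "east t = fst (snd (snd t))"
definition west :: "tile => nat" where "west t = snd (snd (snd t))"

definition nxt :: "nat => nat => nat" where
  "nxt W c = (if Suc c = W then 0 else Suc c)"

definition tiling :: "tile set => nat => nat => (nat => nat) => nat => (nat => nat => tile) => bool" where
  "tiling T R W bc tc \<tau> \<longleftrightarrow>
     (\<forall>r<R. \<forall>c<W. \<tau> r c \<in> T \<and> east (\<tau> r c) = west (\<tau> r (nxt W c)) \<and>
        south (\<tau> r c) = (if r = 0 then bc c else north (\<tau> (r - 1) c)) \<and>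
        (Suc r = R --> north (\<tau> r c) = tc))"

text \<open>A number in base \<open>\<beta>\<close> whose leading coefficient \<open>i\<close> is
  not a digit and may exceed the base; \<open>ks\<close> lists the positions from the most
  significant one on.\<close>

definition horner :: "nat => ('k => nat) => nat => 'k list => nat" where
  "horner \<beta> d i ks = foldl (\<lambda>a k. a * \<beta> + d k) i ks"

text \<open>Linear combinations act on the digits separately, without any condition on carries;
  sizes matter only when digits are compared.\<close>

lemma horner_sum:
  "finite J ==> (\<Sum>j\<in>J. L j * horner \<beta> (d j) (i j) ks) = horner \<beta> (\<lambda>k. \<Sum>j\<in>J. L j * d j k) (\<Sum>j\<in>J. L j * i j) ks"
proof (induction ks arbitrary: i)
  case (Cons k ks)
  have "(\<Sum>j\<in>J. L j * horner \<beta> (d j) (i j) (k # ks)) = (\<Sum>j\<in>J. L j * horner \<beta> (d j) (i j * \<beta> + d j k) ks)"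
    by (simp add: horner_def)
  also have "... = horner \<beta> (\<lambda>k. \<Sum>j\<in>J. L j * d j k) (\<Sum>j\<in>J. L j * (i j * \<beta> + d j k)) ks"
    using Cons by simp
  also have "(\<Sum>j\<in>J. L j * (i j * \<beta> + d j k)) = (\<Sum>j\<in>J. L j * i j) * \<beta> + (\<Sum>j\<in>J. L j * d j k)"
    by (simp add: sum.distrib sum_distrib_right sum_distrib_left algebra_simps)
  finally show ?case by (simp add: horner_def)
qed (simp add: horner_def)

lemma horner_ge: "i * \<beta> ^ length ks \<le> horner \<beta> d i ks"
proof (induction ks arbitrary: i)
  case (Cons k ks)
  have "i * \<beta> ^ length (k # ks) \<le> (i * \<beta> + d k) * \<beta> ^ length ks" by (simp add: algebra_simps)
  also have "... \<le> horner \<beta> d (i * \<beta> + d k) ks" by (rule Cons)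
  finally show ?case by (simp add: horner_def)
qed (simp add: horner_def)

lemma horner_less: "(!!k. k \<in> set ks ==> d k < \<beta>) ==> horner \<beta> d i ks < Suc i * \<beta> ^ length ks"
proof (induction ks arbitrary: i)
  case (Cons k ks)
  have "horner \<beta> d i (k # ks) = horner \<beta> d (i * \<beta> + d k) ks" by (simp add: horner_def)
  also have "... < Suc (i * \<beta> + d k) * \<beta> ^ length ks" using Cons by simp
  also have "... \<le> (Suc i * \<beta>) * \<beta> ^ length ks"
    using Cons.prems[of k] by (intro mult_right_mono) auto
  finally show ?case by (simp add: algebra_simps)
qed (simp add: horner_def)

lemma horner_inj:
  assumes "horner \<beta> d i ks = horner \<beta> d' i' ks"
    and "!!k. k \<in> set ks ==> d k < \<beta>" "!!k. k \<in> set ks ==> d' k < \<beta>"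
  shows "i = i' \<and> (\<forall>k\<in>set ks. d k = d' k)"
  using assms
proof (induction ks rule: rev_induct)
  case (snoc k ks)
  let ?a = "horner \<beta> d i ks" and ?b = "horner \<beta> d' i' ks"
  have e: "?a * \<beta> + d k = ?b * \<beta> + d' k" and l: "d k < \<beta>" "d' k < \<beta>"
    using snoc.prems by (auto simp: horner_def)
  have "?a = (?a * \<beta> + d k) div \<beta>" using l by simp
  also have "... = ?b" unfolding e using l by simp
  finally have ab: "?a = ?b" .
  have "d k = d' k" using e unfolding ab by simp
  moreover have "i = i' \<and> (\<forall>k\<in>set ks. d k = d' k)"
    by (rule snoc.IH[OF ab]) (use snoc.prems in auto)
  ultimately show ?case by auto
qed (simp add: horner_def)

section \<open>Tilings as digit equations\<close>

definition tvars :: "tile list => nat => nat => (nat \<times> nat \<times> tile) list" where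
  "tvars T R W = List.product [0..<R] (List.product [0..<W] T)"

text \<open>\<open>Suc R\<close> because \<open>R\<close> rows have \<open>R + 1\<close> horizontal
  border lines; in row \<open>R\<close> the keys of the kinds 0 and 1 have digit and target
  0.\<close>

definition tkeys :: "nat => nat => (nat \<times> nat \<times> nat) list" where
  "tkeys R W = List.product [0, 1, 2] (List.product [0..<Suc R] [0..<W])"

text \<open>
  The digits at the keys (0, r, c), (1, r, c) and (2, r, c) are for the choice of one tile in the cell (r, c)
  and for the matching of colours at the western and southern border of this cell. At a border the neighbour
  contributes the complement of its colour, so that the digits add up to C if and only if the colours agree.
\<close>

definition dg :: "nat => nat => nat \<times> nat \<times> tile => nat \<times> nat \<times> nat => nat" where
  "dg C W v k =
     (if fst k = 0 then (if fst v = fst (snd k) \<and> fst (snd v) = snd (snd k) then 1 else 0)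
      else if fst k = 1 then
        (if fst v = fst (snd k) \<and> fst (snd v) = snd (snd k) then west (snd (snd v)) else 0) +
        (if fst v = fst (snd k) \<and> nxt W (fst (snd v)) = snd (snd k) then C - east (snd (snd v)) else 0)
      else
        (if fst v = fst (snd k) \<and> fst (snd v) = snd (snd k) then south (snd (snd v)) else 0) +
        (if Suc (fst v) = fst (snd k) \<and> fst (snd v) = snd (snd k) then C - north (snd (snd v)) else 0))"

definition tg :: "nat => nat => (nat => nat) => nat => nat \<times> nat \<times> nat => nat" where
  "tg C R bc tc k =
     (if fst k = 0 then (if fst (snd k) < R then 1 else 0)
      else if fst k = 1 then (if fst (snd k) < R then C else 0)
      else if fst (snd k) = 0 then bc (snd (snd k)) else if fst (snd k) = R then C - tc else C)"

text \<open>Larger than every digit of a sum of at most \<open>R * W\<close> terms, as one term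
  contributes at most \<open>2 * C + 1\<close>, and larger than every target digit.\<close>

definition tbase :: "nat => nat => nat => nat" where
  "tbase C R W = 2 * (R * W) * C + R * W + C + 2"

text \<open>The leading coefficient 1 counts the chosen variables. As the target has
  \<open>R * W\<close> there, the total multiplicity is bounded before any digit is known, which
  excludes carries even for arbitrary natural multiplicities.\<close>

definition tnum :: "nat => nat => nat => nat \<times> nat \<times> tile => nat" where
  "tnum C R W v = horner (tbase C R W) (dg C W v) 1 (tkeys R W)"

definition ttarget :: "nat => nat => nat => (nat => nat) => nat => nat" where
  "ttarget C R W bc tc = horner (tbase C R W) (tg C R bc tc) (R * W) (tkeys R W)"

locale tile_sum =
  fixes T :: "tile list" and R W :: nat and bc :: "nat => nat" and tc C :: nat
  assumes R: "R > 0" and W: "W > 0" and dT: "distinct T"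
    and colours: "!!t. t \<in> set T ==> north t \<le> C \<and> south t \<le> C \<and> east t \<le> C \<and> west t \<le> C"
    and bc: "!!c. bc c \<le> C" and tc: "tc \<le> C"
begin

abbreviation "vs \<equiv> tvars T R W"
abbreviation "ks \<equiv> tkeys R W"
abbreviation "cells \<equiv> {..<R} \<times> {..<W}"

lemma set_vs: "set vs = {(r, c, t). r < R \<and> c < W \<and> t \<in> set T}"
  by (auto simp: tvars_def)

lemma distinct_vs: "distinct vs"
  unfolding tvars_def by (intro distinct_product) (auto simp: dT)

text \<open>\<open>L\<close> behaves like the indicator of one tile \<open>\<tau> r c\<close> per
  cell. Quantifying over all weights \<open>g\<close> lets every digit be evaluated by the same
  equation.\<close>

definition picks :: "(nat => nat) => (nat => nat => tile) => bool" where
  "picks L \<tau> \<longleftrightarrow> (\<forall>r<R. \<forall>c<W. \<tau> r c \<in> set T) \<and>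
     (\<forall>g :: nat \<times> nat \<times> tile => nat. (\<Sum>j<length vs. L j * g (vs ! j)) = (\<Sum>(r, c)\<in>cells. g (r, c, \<tau> r c)))"

lemma picksI:
  assumes "!!r c. r < R ==> c < W ==> \<tau> r c \<in> set T"
  shows "\<exists>L. picks L \<tau> \<and> (\<forall>j. L j \<le> 1)"
proof -
  let ?S = "(\<lambda>(r, c). (r, c, \<tau> r c)) ` cells"
  define L where "L j = (if vs ! j \<in> ?S then 1 else 0 :: nat)" for j
  have "(\<Sum>j<length vs. L j * g (vs ! j)) = (\<Sum>(r, c)\<in>cells. g (r, c, \<tau> r c))" for g :: "nat \<times> nat \<times> tile => nat"
  proof -
    have "(\<Sum>j<length vs. L j * g (vs ! j)) = (\<Sum>v\<in>set vs. (if v \<in> ?S then 1 else 0) * g v)"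
      by (rule sum.reindex_bij_betw[OF bij_betw_nth[OF distinct_vs], of _ _ "\<lambda>v. (if v \<in> ?S then 1 else 0) * g v", folded L_def])
        auto
    also have "... = (\<Sum>v\<in>set vs. if v \<in> ?S then g v else 0)" by (intro sum.cong) auto
    also have "... = (\<Sum>v\<in>?S. g v)"
      by (subst sum.inter_restrict[symmetric]) (auto simp: set_vs assms intro!: sum.cong)
    also have "... = (\<Sum>(r, c)\<in>cells. g (r, c, \<tau> r c))"
      by (subst sum.reindex) (auto simp: inj_on_def case_prod_beta o_def)
    finally show ?thesis .
  qed
  then have "picks L \<tau>" using assms by (auto simp: picks_def)
  then show ?thesis by (auto simp: L_def)
qed

lemma sum_cells: "(\<Sum>(r, c)\<in>cells. if r = a \<and> c = b then f r c else 0) = (if a < R \<and> b < W then f a b else (0::nat))"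
proof -
  have "(\<lambda>(r, c). if r = a \<and> c = b then f r c else 0) = (\<lambda>p. if p = (a, b) then f a b else 0)"
    by (auto simp: fun_eq_iff)
  then show ?thesis by (simp add: sum.delta)
qed

text \<open>Natural numbers with sum 1 consist of a single 1 and zeros; this is where multiplicities
  become 0 or 1.\<close>

lemma picks_exists:
  assumes L: "!!r c. r < R ==> c < W ==> (\<Sum>j<length vs. L j * (if fst (vs ! j) = r \<and> fst (snd (vs ! j)) = c then 1 else 0)) = 1"
  shows "\<exists>\<tau>. picks L \<tau>"
proof -
  let ?P = "\<lambda>r c j. j < length vs \<and> L j = 1 \<and> fst (vs ! j) = r \<and> fst (snd (vs ! j)) = c \<and>
      (\<forall>j'<length vs. j' \<noteq> j --> fst (vs ! j') = r --> fst (snd (vs ! j')) = c --> L j' = 0)"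
  have "\<exists>j. ?P r c j" if "r < R" "c < W" for r c
  proof -
    have "\<exists>j\<in>{..<length vs}. L j * (if fst (vs ! j) = r \<and> fst (snd (vs ! j)) = c then 1 else 0) = 1 \<and>
      (\<forall>j'\<in>{..<length vs}. j' \<noteq> j --> L j' * (if fst (vs ! j') = r \<and> fst (snd (vs ! j')) = c then 1 else 0) = 0)"
      using L[OF that, unfolded One_nat_def sum_eq_Suc0_iff[OF finite_lessThan]] unfolding One_nat_def by metis
    then obtain j where "j < length vs" "L j * (if fst (vs ! j) = r \<and> fst (snd (vs ! j)) = c then 1 else 0) = 1"
      "\<forall>j'<length vs. j' \<noteq> j --> L j' * (if fst (vs ! j') = r \<and> fst (snd (vs ! j')) = c then 1 else 0) = 0"
      by auto
    then show ?thesis by (intro exI[of _ j]) (auto split: if_splits)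
  qed
  then obtain J where J: "!!r c. r < R ==> c < W ==> ?P r c (J r c)"
    by metis
  define \<tau> where "\<tau> r c = snd (snd (vs ! J r c))" for r c
  have "\<tau> r c \<in> set T" if "r < R" "c < W" for r c
    using J[OF that] nth_mem[of "J r c" vs] by (auto simp: \<tau>_def set_vs)
  moreover have "(\<Sum>j<length vs. L j * g (vs ! j)) = (\<Sum>(r, c)\<in>cells. g (r, c, \<tau> r c))"
    for g :: "nat \<times> nat \<times> tile => nat"
  proof -
    have "(\<Sum>j<length vs. L j * g (vs ! j)) = (\<Sum>j<length vs. \<Sum>p\<in>cells. if p = (fst (vs ! j), fst (snd (vs ! j))) then L j * g (vs ! j) else 0)"
    proof (intro sum.cong refl)
      fix j assume "j \<in> {..<length vs}"
      then have "vs ! j \<in> set vs" by simp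
      then have "(fst (vs ! j), fst (snd (vs ! j))) \<in> cells" by (auto simp: set_vs)
      then show "L j * g (vs ! j) = (\<Sum>p\<in>cells. if p = (fst (vs ! j), fst (snd (vs ! j))) then L j * g (vs ! j) else 0)"
        by (simp only: sum.delta finite_cartesian_product finite_lessThan if_True)
    qed
    also have "... = (\<Sum>p\<in>cells. \<Sum>j<length vs. if p = (fst (vs ! j), fst (snd (vs ! j))) then L j * g (vs ! j) else 0)"
      by (rule sum.swap)
    also have "... = (\<Sum>p\<in>cells. g (fst p, snd p, \<tau> (fst p) (snd p)))"
    proof (intro sum.cong refl)
      fix p assume "p \<in> cells"
      then have P: "?P (fst p) (snd p) (J (fst p) (snd p))" using J by auto
      let ?j = "J (fst p) (snd p)"
      have "(\<Sum>j<length vs. if p = (fst (vs ! j), fst (snd (vs ! j))) then L j * g (vs ! j) else 0) =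
          (\<Sum>j<length vs. if j = ?j then g (vs ! ?j) else 0)"
        using P by (intro sum.cong) auto
      also have "... = g (vs ! ?j)" using P by simp
      also have "vs ! ?j = (fst p, snd p, \<tau> (fst p) (snd p))"
        using P by (auto simp: \<tau>_def prod_eq_iff)
      finally show "(\<Sum>j<length vs. if p = (fst (vs ! j), fst (snd (vs ! j))) then L j * g (vs ! j) else 0)
          = g (fst p, snd p, \<tau> (fst p) (snd p))" .
    qed
    finally show ?thesis by (simp add: case_prod_beta)
  qed
  ultimately show ?thesis unfolding picks_def by blast
qed

definition prv :: "nat => nat" where "prv c = (if c = 0 then W - 1 else c - 1)"

lemma nxt_iff: "c < W ==> b < W ==> nxt W c = b \<longleftrightarrow> c = prv b"
  using W by (auto simp: nxt_def prv_def)

lemma prv_less: "b < W ==> prv b < W"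
  using W by (auto simp: prv_def)

text \<open>Two cells contribute at a border: the cell itself and its western or southern neighbour,
  found by \<open>prv\<close> or by decreasing the row.\<close>

lemma digit_sum:
  assumes "picks L \<tau>" "b < W" "a \<le> R"
  shows "(\<Sum>j<length vs. L j * dg C W (vs ! j) (0, a, b)) = (if a < R then 1 else 0)"
    "(\<Sum>j<length vs. L j * dg C W (vs ! j) (1, a, b)) = (if a < R then west (\<tau> a b) + (C - east (\<tau> a (prv b))) else 0)"
    "(\<Sum>j<length vs. L j * dg C W (vs ! j) (2, a, b)) =
       (if a < R then south (\<tau> a b) else 0) + (if a = 0 then 0 else C - north (\<tau> (a - 1) b))"
proof -
  have *: "(\<Sum>j<length vs. L j * g (vs ! j)) = (\<Sum>(r, c)\<in>cells. g (r, c, \<tau> r c))" for g :: "nat \<times> nat \<times> tile => nat"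
    using assms(1) unfolding picks_def by blast
  show "(\<Sum>j<length vs. L j * dg C W (vs ! j) (0, a, b)) = (if a < R then 1 else 0)"
    unfolding *[of "\<lambda>v. dg C W v (0, a, b)"] using assms sum_cells[of a b "\<lambda>r c. 1"] by (simp add: dg_def)
  have "(\<Sum>(r, c)\<in>cells. dg C W (r, c, \<tau> r c) (1, a, b)) =
      (\<Sum>(r, c)\<in>cells. (if r = a \<and> c = b then west (\<tau> r c) else 0) + (if r = a \<and> c = prv b then C - east (\<tau> r c) else 0))"
    using assms by (intro sum.cong) (auto simp: dg_def nxt_iff)
  also have "... = (if a < R then west (\<tau> a b) + (C - east (\<tau> a (prv b))) else 0)"
    using assms prv_less[of b] sum_cells[of a b "\<lambda>r c. west (\<tau> r c)"] sum_cells[of a "prv b" "\<lambda>r c. C - east (\<tau> r c)"]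
    by (simp add: case_prod_beta sum.distrib)
  finally show "(\<Sum>j<length vs. L j * dg C W (vs ! j) (1, a, b)) = (if a < R then west (\<tau> a b) + (C - east (\<tau> a (prv b))) else 0)"
    unfolding *[of "\<lambda>v. dg C W v (1, a, b)"] .
  have "(\<Sum>(r, c)\<in>cells. dg C W (r, c, \<tau> r c) (2, a, b)) =
      (\<Sum>(r, c)\<in>cells. (if r = a \<and> c = b then south (\<tau> r c) else 0) +
        (if a = 0 then 0 else if r = a - 1 \<and> c = b then C - north (\<tau> r c) else 0))"
    using assms by (intro sum.cong) (auto simp: dg_def)
  also have "... = (if a < R then south (\<tau> a b) else 0) + (if a = 0 then 0 else C - north (\<tau> (a - 1) b))"
    using assms sum_cells[of a b "\<lambda>r c. south (\<tau> r c)"] sum_cells[of "a - 1" b "\<lambda>r c. C - north (\<tau> r c)"]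
    by (cases "a = 0") (auto simp: case_prod_beta sum.distrib)
  finally show "(\<Sum>j<length vs. L j * dg C W (vs ! j) (2, a, b)) =
       (if a < R then south (\<tau> a b) else 0) + (if a = 0 then 0 else C - north (\<tau> (a - 1) b))"
    unfolding *[of "\<lambda>v. dg C W v (2, a, b)"] .
qed

lemma set_ks: "set ks = {0, 1, 2} \<times> {..R} \<times> {..<W}"
  by (auto simp: tkeys_def)

lemma tiling_iff_digits:
  assumes p: "picks L \<tau>"
  shows "tiling (set T) R W bc tc \<tau> \<longleftrightarrow> (\<forall>k\<in>set ks. (\<Sum>j<length vs. L j * dg C W (vs ! j) k) = tg C R bc tc k)"
proof
  assume t: "tiling (set T) R W bc tc \<tau>"
  show "\<forall>k\<in>set ks. (\<Sum>j<length vs. L j * dg C W (vs ! j) k) = tg C R bc tc k"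
  proof
    fix k assume "k \<in> set ks"
    then obtain a b where ab: "a \<le> R" "b < W" and k: "k = (0, a, b) \<or> k = (1, a, b) \<or> k = (2, a, b)"
      by (auto simp: set_ks)
    have col: "north (\<tau> r c) \<le> C" "east (\<tau> r c) \<le> C" if "r < R" "c < W" for r c
    proof -
      have "\<tau> r c \<in> set T" using t that unfolding tiling_def by blast
      then show "north (\<tau> r c) \<le> C" "east (\<tau> r c) \<le> C" using colours by blast+
    qed
    have e: "east (\<tau> a (prv b)) = west (\<tau> a b)" if "a < R"
      using t that prv_less[OF ab(2)] nxt_iff[of "prv b" b] ab by (auto simp: tiling_def)
    have s: "a > 0 ==> a < R ==> south (\<tau> a b) = north (\<tau> (a - 1) b)" "a = 0 ==> south (\<tau> a b) = bc b"
      "a = R ==> north (\<tau> (a - 1) b) = tc"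
      using t ab R by (auto simp: tiling_def)
    from k show "(\<Sum>j<length vs. L j * dg C W (vs ! j) k) = tg C R bc tc k"
    proof (elim disjE)
      assume "k = (0, a, b)"
      then show ?thesis using digit_sum(1)[OF p ab(2,1)] by (simp add: tg_def)
    next
      assume "k = (1, a, b)"
      then show ?thesis using digit_sum(2)[OF p ab(2,1)] e col(2)[OF _ prv_less[OF ab(2)], of a] by (simp add: tg_def)
    next
      assume "k = (2, a, b)"
      then show ?thesis using digit_sum(3)[OF p ab(2,1)] s col(1)[of "a - 1" b] ab R by (auto simp: tg_def)
    qed
  qed
next
  assume d: "\<forall>k\<in>set ks. (\<Sum>j<length vs. L j * dg C W (vs ! j) k) = tg C R bc tc k"
  show "tiling (set T) R W bc tc \<tau>"
    unfolding tiling_def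
  proof (intro allI impI)
    fix r c assume rc: "r < R" "c < W"
    have T: "\<tau> r c \<in> set T" if "r < R" "c < W" for r c using p that by (auto simp: picks_def)
    have n: "nxt W c < W" "prv (nxt W c) = c" using rc W nxt_iff[of c "nxt W c"] by (auto simp: nxt_def)
    have "(1, r, nxt W c) \<in> set ks" "(2, r, c) \<in> set ks" "(2, Suc r, c) \<in> set ks" using rc n by (auto simp: set_ks)
    note d' = this[THEN bspec[OF d]]
    have "west (\<tau> r (nxt W c)) + (C - east (\<tau> r c)) = C"
      using d'(1) digit_sum(2)[OF p n(1), of r] rc n(2) by (simp add: tg_def)
    \<comment> \<open>The subtraction is truncated, but colours are at most \<open>C\<close>, so the
      sum \<open>C\<close> means equality.\<close>
    then have e: "east (\<tau> r c) = west (\<tau> r (nxt W c))"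
      using colours[OF T[OF rc]] by linarith
    have s: "south (\<tau> r c) + (if r = 0 then 0 else C - north (\<tau> (r - 1) c)) = (if r = 0 then bc c else C)"
      using d'(2) digit_sum(3)[OF p rc(2), of r] rc by (simp add: tg_def)
    have s': "south (\<tau> r c) = (if r = 0 then bc c else north (\<tau> (r - 1) c))"
    proof (cases "r = 0")
      case False
      then have "north (\<tau> (r - 1) c) \<le> C" using colours[OF T[of "r - 1" c]] rc by auto
      then show ?thesis using s False by simp
    qed (use s in simp)
    have "north (\<tau> r c) = tc" if "Suc r = R"
    proof -
      have "C - north (\<tau> r c) = C - tc"
        using d'(3)[unfolded digit_sum(3)[OF p rc(2) Suc_leI[OF rc(1)]]] by (simp add: tg_def that[symmetric])
      then show ?thesis using colours[OF T[OF rc]] tc by linarith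
    qed
    then show "\<tau> r c \<in> set T \<and> east (\<tau> r c) = west (\<tau> r (nxt W c)) \<and>
        south (\<tau> r c) = (if r = 0 then bc c else north (\<tau> (r - 1) c)) \<and>
        (Suc r = R --> north (\<tau> r c) = tc)"
      using T[OF rc] e s' by blast
  qed
qed

lemma total_sum:
  "(\<Sum>j<length vs. L j * tnum C R W (vs ! j)) =
    horner (tbase C R W) (\<lambda>k. \<Sum>j<length vs. L j * dg C W (vs ! j) k) (\<Sum>j<length vs. L j) ks"
  using horner_sum[of "{..<length vs}" L "tbase C R W" "\<lambda>j. dg C W (vs ! j)" "\<lambda>_. 1" ks]
  by (simp add: tnum_def)

lemma tiling_imp_sum:
  assumes t: "tiling (set T) R W bc tc \<tau>"
  shows "\<exists>L. (\<forall>j. L j \<le> 1) \<and> (\<Sum>j<length vs. L j * tnum C R W (vs ! j)) = ttarget C R W bc tc"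
proof -
  obtain L where L: "picks L \<tau>" "\<forall>j. L j \<le> 1"
    using picksI[of \<tau>] t by (auto simp: tiling_def)
  have "(\<Sum>j<length vs. L j) = R * W"
    using L(1)[unfolded picks_def, THEN conjunct2, THEN spec[of _ "\<lambda>_. 1"]] by (simp add: case_prod_beta)
  moreover have "horner \<beta> d i ks = horner \<beta> d' i ks" if "\<forall>k\<in>set ks. d k = d' k" for \<beta> d d' i
    using that unfolding horner_def by (intro foldl_cong) auto
  ultimately have "(\<Sum>j<length vs. L j * tnum C R W (vs ! j)) = ttarget C R W bc tc"
    using tiling_iff_digits[OF L(1)] t unfolding total_sum ttarget_def by simp
  with L(2) show ?thesis by blast
qed

text \<open>No bound on \<open>L\<close> is assumed. Comparing leading coefficients gives at most
  \<open>R * W\<close> chosen tiles; then the base exceeds all digits, and these can be compared one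
  by one.\<close>

lemma sum_imp_tiling:
  assumes L: "(\<Sum>j<length vs. L j * tnum C R W (vs ! j)) = ttarget C R W bc tc"
  shows "\<exists>\<tau>. tiling (set T) R W bc tc \<tau>"
proof -
  let ?\<beta> = "tbase C R W"
  let ?D = "\<lambda>k. \<Sum>j<length vs. L j * dg C W (vs ! j) k"
  let ?s = "\<Sum>j<length vs. L j"
  have tgl: "tg C R bc tc k < ?\<beta>" for k
    using bc[of "snd (snd k)"] by (auto simp: tg_def tbase_def)
  have "?s * ?\<beta> ^ length ks \<le> horner ?\<beta> ?D ?s ks" by (rule horner_ge)
  also have "... = horner ?\<beta> (tg C R bc tc) (R * W) ks" using L unfolding total_sum ttarget_def .
  also have "... < Suc (R * W) * ?\<beta> ^ length ks" by (rule horner_less) (rule tgl)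
  finally have s: "?s \<le> R * W" by (simp only: mult_less_cancel2 less_Suc_eq_le)
  have "?D k < ?\<beta>" for k
  proof -
    have "dg C W (vs ! j) k \<le> 2 * C + 1" if "j < length vs" for j
      using colours[of "snd (snd (vs ! j))"] nth_mem[OF that] by (fastforce simp: dg_def set_vs)
    then have "?D k \<le> (\<Sum>j<length vs. L j * (2 * C + 1))" by (intro sum_mono mult_left_mono) auto
    also have "... = ?s * (2 * C + 1)" by (simp only: sum_distrib_right)
    also have "... \<le> R * W * (2 * C + 1)" using s by (rule mult_right_mono) simp
    also have "... < ?\<beta>" by (simp add: tbase_def algebra_simps)
    finally show ?thesis .
  qed
  with tgl have "\<forall>k\<in>set ks. ?D k = tg C R bc tc k"
    using horner_inj[of ?\<beta> ?D ?s ks "tg C R bc tc" "R * W"] L[unfolded total_sum ttarget_def] by blast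
  note d = this
  have "(\<Sum>j<length vs. L j * (if fst (vs ! j) = r \<and> fst (snd (vs ! j)) = c then 1 else 0)) = 1" if "r < R" "c < W" for r c
    using d[THEN bspec, of "(0, r, c)"] that by (simp add: set_ks dg_def tg_def)
  from picks_exists[OF this] obtain \<tau> where "picks L \<tau>" by blast
  from tiling_iff_digits[OF this] d show ?thesis by blast
qed

end

lemma tnum_pos: "R > 0 ==> W > 0 ==> tnum C R W v > 0"
  using horner_ge[of 1 "tbase C R W" "tkeys R W" "dg C W v"] by (auto simp: tnum_def tbase_def intro: less_le_trans[rotated])

lemma ttarget_pos: "R > 0 ==> W > 0 ==> ttarget C R W bc tc > 0"
  using horner_ge[of "R * W" "tbase C R W" "tkeys R W" "tg C R bc tc"]
  by (auto simp: ttarget_def tbase_def intro: less_le_trans[rotated])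

section \<open>Tree-like graphs\<close>

lemma in_arcs_graph: "in_arcs (graph_of I) v = {e \<in> edges I. snd e = v}"
  and out_arcs_graph: "out_arcs (graph_of I) v = {e \<in> edges I. fst e = v}"
  by (auto simp: in_arcs_def out_arcs_def graph_of_def)

lemma pair_fin_digraph_graph:
  "pair_fin_digraph (graph_of I) \<longleftrightarrow> edges I \<subseteq> {..<num_verts I} \<times> {..<num_verts I}"
proof
  assume "pair_fin_digraph (graph_of I)"
  then interpret pair_fin_digraph "graph_of I" .
  show "edges I \<subseteq> {..<num_verts I} \<times> {..<num_verts I}"
    using in_arcsD1 in_arcsD2 by (auto simp: graph_of_def)
next
  assume e: "edges I \<subseteq> {..<num_verts I} \<times> {..<num_verts I}"
  then have "finite (edges I)" by (rule finite_subset) auto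
  with e show "pair_fin_digraph (graph_of I)"
    by unfold_locales (auto simp: graph_of_def)
qed

text \<open>A checkable form of tree-likeness: \<open>rk\<close> increases along edges and excludes
  cycles, while \<open>d\<close> decreases at some neighbour of each vertex other than 0, so that
  every vertex is linked to 0.\<close>

definition ranked :: "edge set => nat => (nat => nat) => (nat => nat) => bool" where
  "ranked E n rk d \<longleftrightarrow> 0 < n \<and> (\<forall>(u, v)\<in>E. rk u < rk v) \<and>
     (\<forall>v<n. v \<noteq> 0 --> (\<exists>u<n. d u < d v \<and> ((u, v) \<in> E \<or> (v, u) \<in> E)))"

lemma graph_of_simps [simp]: "pverts (graph_of I) = {..<num_verts I}" "parcs (graph_of I) = edges I"
  by (auto simp: graph_of_def)

lemma ranked_imp_tree_like:
  assumes E: "edges I \<subseteq> {..<num_verts I} \<times> {..<num_verts I}" and r: "ranked (edges I) (num_verts I) rk d"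
  shows "tree_like (graph_of I)"
proof -
  let ?G = "with_proj (graph_of I)"
  interpret pair_fin_digraph "graph_of I"
    using E by (simp add: pair_fin_digraph_graph)
  \<comment> \<open>The rank grows along a walk by at least its length, so no closed walk has
    positive length.\<close>
  have w: "rk u + length p \<le> rk v" if "awalk u p v" for u p v
    using that
  proof (induction p arbitrary: u)
    case Nil
    then show ?case by (simp add: awalk_Nil_iff)
  next
    case (Cons e p)
    have "e \<in> edges I" "u = fst e" "awalk (snd e) p v"
      using Cons.prems by (auto simp: awalk_Cons_iff)
    then have "rk u < rk (snd e)" "rk (snd e) + length p \<le> rk v"
      using r Cons.IH by (auto simp: ranked_def)
    then show ?case by simp
  qed
  have "\<not> cycle p" for p
    using w by (fastforce simp: cycle_def)
  moreover have "connected ?G"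
    unfolding connected_def strongly_connected_def
  proof (intro conjI ballI)
    show "verts (with_proj (mk_symmetric ?G)) \<noteq> {}" using r by (auto simp: ranked_def)
    interpret S: pair_wf_digraph "mk_symmetric ?G" by (rule wellformed_mk_symmetric)
    have V: "verts (with_proj (mk_symmetric ?G)) = {..<num_verts I}" by simp
    have r0: "0 \<rightarrow>\<^sup>*\<^bsub>mk_symmetric ?G\<^esub> v \<and> v \<rightarrow>\<^sup>*\<^bsub>mk_symmetric ?G\<^esub> 0" if "v < num_verts I" for v
      using that
    proof (induction "d v" arbitrary: v rule: less_induct)
      case less
      show ?case
      proof (cases "v = 0")
        case True
        then show ?thesis using less.prems V by (auto intro: S.reachable_refl)
      next
        case False
        then obtain u where u: "u < num_verts I" "d u < d v" "(u, v) \<in> edges I \<or> (v, u) \<in> edges I"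
          using r less.prems by (auto simp: ranked_def)
        have "(u, v) \<in> parcs (mk_symmetric ?G)" "(v, u) \<in> parcs (mk_symmetric ?G)"
          using u(3) by (auto simp: parcs_mk_symmetric) (metis fst_conv snd_conv)+
        then have "u \<rightarrow>\<^sup>*\<^bsub>mk_symmetric ?G\<^esub> v" "v \<rightarrow>\<^sup>*\<^bsub>mk_symmetric ?G\<^esub> u"
          by auto
        then show ?thesis using less.hyps[OF u(2,1)] S.reachable_trans by blast
      qed
    qed
    fix u v assume "u \<in> verts (with_proj (mk_symmetric ?G))" "v \<in> verts (with_proj (mk_symmetric ?G))"
    then show "u \<rightarrow>\<^sup>*\<^bsub>mk_symmetric ?G\<^esub> v"
      using r0[of u] r0[of v] S.reachable_trans V by blast
  qed
  ultimately show ?thesis by (simp add: tree_like_def)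
qed

text \<open>Both functions are chosen as cardinalities of vertex sets, hence at most the number of
  vertices and short enough for a certificate.\<close>

lemma tree_like_imp_ranked:
  assumes E: "edges I \<subseteq> {..<num_verts I} \<times> {..<num_verts I}" and t: "tree_like (graph_of I)"
  shows "\<exists>rk d. ranked (edges I) (num_verts I) rk d \<and> (\<forall>v. rk v \<le> num_verts I \<and> d v \<le> num_verts I)"
proof -
  let ?G = "with_proj (graph_of I)" and ?n = "num_verts I"
  interpret pair_fin_digraph "graph_of I"
    using E by (simp add: pair_fin_digraph_graph)
  have cnt: "card {u. u < ?n \<and> P u} \<le> ?n" for P
    using card_mono[of "{..<?n}" "{u. u < ?n \<and> P u}"] by auto
  have walk: "\<exists>p. awalk u p v \<and> p \<noteq> []" if "(u, v) \<in> (edges I)\<^sup>+" for u v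
    using that
  proof (induction rule: converse_trancl_induct)
    case (base u)
    then have "awalk u [(u, v)] v" using E by (auto simp: awalk_Cons_iff awalk_Nil_iff)
    then show ?case by blast
  next
    case (step u w)
    then obtain p where "awalk w p v" by blast
    then have "awalk u ((u, w) # p) v" using step by (auto simp: awalk_Cons_iff)
    then show ?case by blast
  qed
  have acyc: "(u, u) \<notin> (edges I)\<^sup>+" for u
  proof
    assume "(u, u) \<in> (edges I)\<^sup>+"
    from walk[OF this] obtain p where "awalk u p u" "p \<noteq> []" by blast
    then have "closed_w p" by (auto simp: closed_w_def)
    then show False using closed_w_imp_cycle t by (auto simp: tree_like_def)
  qed
  \<comment> \<open>Counting ancestors: those of the tail of an edge, together with the tail itself,
    are ancestors of the head.\<close>
  define rk where "rk v = card {u. u < ?n \<and> (u, v) \<in> (edges I)\<^sup>+}" for v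
  have rk: "rk u < rk v" if "(u, v) \<in> edges I" for u v
    unfolding rk_def
  proof (rule psubset_card_mono)
    have "u < ?n" using that E by auto
    then have "u \<in> {w. w < ?n \<and> (w, v) \<in> (edges I)\<^sup>+}" "u \<notin> {w. w < ?n \<and> (w, u) \<in> (edges I)\<^sup>+}"
      using that acyc by auto
    moreover have "{w. w < ?n \<and> (w, u) \<in> (edges I)\<^sup>+} \<subseteq> {w. w < ?n \<and> (w, v) \<in> (edges I)\<^sup>+}"
      using that by (auto intro: trancl_into_trancl)
    ultimately show "{w. w < ?n \<and> (w, u) \<in> (edges I)\<^sup>+} \<subset> {w. w < ?n \<and> (w, v) \<in> (edges I)\<^sup>+}" by blast
  qed simp
  define S where "S = parcs (mk_symmetric ?G)"
  have S: "S = {(u, v). (u, v) \<in> edges I \<or> (v, u) \<in> edges I}"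
    by (auto simp: S_def parcs_mk_symmetric)
  interpret Sy: pair_wf_digraph "mk_symmetric ?G" by (rule wellformed_mk_symmetric)
  have con: "connected ?G" using t by (simp add: tree_like_def)
  then have n0: "0 < ?n" by (auto simp: connected_def strongly_connected_def)
  have reach: "(0, v) \<in> S\<^sup>*" if "v < ?n" for v
  proof -
    have "0 \<rightarrow>\<^sup>*\<^bsub>mk_symmetric ?G\<^esub> v"
      using con that n0 by (auto simp: connected_def strongly_connected_def)
    then show ?thesis using Sy.reachable_conv by (auto simp: S_def)
  qed
  define d0 where "d0 v = (LEAST k. (0, v) \<in> S ^^ k)" for v
  have d0: "\<exists>u<?n. d0 u < d0 v \<and> (u, v) \<in> S" if v: "v < ?n" "v \<noteq> 0" for v
  proof -
    have "(0, v) \<in> S ^^ d0 v"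
      using reach[OF v(1)] unfolding d0_def rtrancl_power by (rule LeastI_ex)
    moreover from this have "d0 v \<noteq> 0" using v(2) by (cases "d0 v") auto
    then obtain j where j: "d0 v = Suc j" by (cases "d0 v") auto
    ultimately obtain u where u: "(0, u) \<in> S ^^ j" "(u, v) \<in> S" by auto
    have "d0 u \<le> j" unfolding d0_def by (rule Least_le) (rule u(1))
    moreover have "u < ?n" using u(2) E by (auto simp: S)
    ultimately show ?thesis using u(2) j by auto
  qed
  \<comment> \<open>The distance is replaced by the number of vertices that are nearer to 0, which
    is bounded at once.\<close>
  define d where "d v = card {u. u < ?n \<and> d0 u < d0 v}" for v
  have d: "d u < d v" if "u < ?n" "d0 u < d0 v" for u v
    unfolding d_def by (rule psubset_card_mono) (use that in auto)
  have "ranked (edges I) ?n rk d"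
    unfolding ranked_def using n0 rk d0 d S by blast
  moreover have "rk v \<le> ?n \<and> d v \<le> ?n" for v
    using cnt[of "\<lambda>u. (u, v) \<in> (edges I)\<^sup>+"] cnt[of "\<lambda>u. d0 u < d0 v"] by (simp add: rk_def d_def)
  ultimately show ?thesis by blast
qed

section \<open>Accepting runs as tilings\<close>

text \<open>\<open>VInit\<close> carries the input symbol, the mark of cell 0 and the permission for
  a certificate symbol; \<open>VCell\<close> carries the state, the symbols of all tapes in this
  cell and the marks of their heads.\<close>

datatype vcol = VInit nat bool bool | VCell nat "nat list" "bool list" | VFin
text \<open>\<open>HInit\<close> tells whether the cell on the left has a certificate symbol.
  \<open>HStep\<close> carries the guessed tuple of scanned symbols and the heads that cross this
  border to the right and to the left.\<close>

datatype hcol = HInit bool | HStep "nat list" "bool list" "bool list" | HFin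

instance vcol :: countable by countable_datatype
instance hcol :: countable by countable_datatype

type_synonym ctile = "vcol \<times> vcol \<times> hcol \<times> hcol"

text \<open>Halting states get an idle transition, so that runs can be padded to the common number
  of rows.\<close>

definition act_of :: "tm => nat => nat list => nat \<times> (nat \<times> move) list" where
  "act_of M q xs = (if q \<in> {accept M, reject M} then (q, stays xs) else delta M q xs)"

lemma step_act_of: "step M (q, ts) = (fst (act_of M q (map scan ts)), map2 act ts (snd (act_of M q (map scan ts))))"
  by (auto simp: step_def halted_def act_of_def map2_stays split: prod.splits)

definition lists_of :: "nat => 'a set => 'a list set" where
  "lists_of k A = {xs. set xs \<subseteq> A \<and> length xs = k}"

lemma finite_lists_of: "finite A ==> finite (lists_of k A)"
  unfolding lists_of_def by (rule finite_lists_length_eq)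

text \<open>The old configuration is in the south, the new one in the north. A head found in the
  cell after the step has stayed there or has come in from the west or the east; heads that leave
  appear in the border colours.\<close>

definition stile :: "tm => nat => nat list => bool list => nat list => bool list => bool list => ctile" where
  "stile M q \<sigma> hm xs inR inL =
    (let acts = snd (act_of M q xs); k = num_tapes M in
     (VCell (fst (act_of M q xs)) (map (\<lambda>i. if hm ! i then fst (acts ! i) else \<sigma> ! i) [0..<k])
        (map (\<lambda>i. hm ! i \<and> snd (acts ! i) = Stay \<or> inR ! i \<or> inL ! i) [0..<k]),
      VCell q \<sigma> hm,
      HStep xs (map (\<lambda>i. hm ! i \<and> snd (acts ! i) = Right) [0..<k]) inL,
      HStep xs inR (map (\<lambda>i. hm ! i \<and> snd (acts ! i) = Left) [0..<k])))"

definition itile :: "tm => nat => nat => bool => bool => bool => ctile" where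
  "itile M a b h al p = (VCell (start M) (a # b # replicate (num_tapes M - 2) 0) (replicate (num_tapes M) h),
     VInit a h al, HInit (b \<noteq> 0), HInit p)"

definition ftile :: "tm => nat list => bool list => ctile" where
  "ftile M \<sigma> hm = (VFin, VCell (accept M) \<sigma> hm, HFin, HFin)"

text \<open>The last condition is the only test of the guessed scanned symbols: it takes effect in
  the cell that holds the head, and the horizontal colours carry it through the row.\<close>

definition stiles :: "tm => ctile set" where
  "stiles M = {stile M q \<sigma> hm xs inR inL | q \<sigma> hm xs inR inL.
     q < num_states M \<and> \<sigma> \<in> lists_of (num_tapes M) {..<num_symbols M} \<and> hm \<in> lists_of (num_tapes M) UNIV \<and>
     xs \<in> lists_of (num_tapes M) {..<num_symbols M} \<and> inR \<in> lists_of (num_tapes M) UNIV \<and>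
     inL \<in> lists_of (num_tapes M) UNIV \<and> (\<forall>i<num_tapes M. hm ! i --> \<sigma> ! i = xs ! i)}"

text \<open>A certificate symbol needs permission and, outside cell 0, a certificate symbol on its
  left; so the guessed symbols form one word that starts in cell 0.\<close>

definition itiles :: "tm => ctile set" where
  "itiles M = {itile M a b h al p | a b h al p. a < 3 \<and> b < 3 \<and> (b \<noteq> 0 --> al \<and> (h \<or> p))}"

definition ftiles :: "tm => ctile set" where
  "ftiles M = {ftile M \<sigma> hm | \<sigma> hm. \<sigma> \<in> lists_of (num_tapes M) {..<num_symbols M} \<and> hm \<in> lists_of (num_tapes M) UNIV}"

definition ctiles :: "tm => ctile set" where
  "ctiles M = stiles M \<union> itiles M \<union> ftiles M"

lemma finite_ctiles: "finite (ctiles M)"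
proof -
  let ?A = "lists_of (num_tapes M) {..<num_symbols M}" and ?B = "lists_of (num_tapes M) (UNIV :: bool set)"
  have 1: "finite ?A" "finite ?B" by (auto intro: finite_lists_of)
  have "stiles M \<subseteq> (\<lambda>(q, \<sigma>, hm, xs, inR, inL). stile M q \<sigma> hm xs inR inL) ` ({..<num_states M} \<times> ?A \<times> ?B \<times> ?A \<times> ?B \<times> ?B)"
  proof
    fix t assume "t \<in> stiles M"
    then obtain q \<sigma> hm xs inR inL where "t = stile M q \<sigma> hm xs inR inL"
      "(q, \<sigma>, hm, xs, inR, inL) \<in> {..<num_states M} \<times> ?A \<times> ?B \<times> ?A \<times> ?B \<times> ?B"
      unfolding stiles_def by blast
    then show "t \<in> (\<lambda>(q, \<sigma>, hm, xs, inR, inL). stile M q \<sigma> hm xs inR inL) ` ({..<num_states M} \<times> ?A \<times> ?B \<times> ?A \<times> ?B \<times> ?B)"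
      by (intro image_eqI[of _ _ "(q, \<sigma>, hm, xs, inR, inL)"]) auto
  qed
  moreover have "itiles M \<subseteq> (\<lambda>(a, b, h, al, p). itile M a b h al p) ` ({..<3} \<times> {..<3} \<times> UNIV \<times> UNIV \<times> UNIV)"
  proof
    fix t assume "t \<in> itiles M"
    then obtain a b h al p where "t = itile M a b h al p" "a < 3" "b < 3"
      unfolding itiles_def by blast
    then show "t \<in> (\<lambda>(a, b, h, al, p). itile M a b h al p) ` ({..<3} \<times> {..<3} \<times> UNIV \<times> UNIV \<times> UNIV)"
      by (intro image_eqI[of _ _ "(a, b, h, al, p)"]) auto
  qed
  moreover have "ftiles M \<subseteq> (\<lambda>(\<sigma>, hm). ftile M \<sigma> hm) ` (?A \<times> ?B)"
    unfolding ftiles_def by blast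
  ultimately show ?thesis
    using 1 unfolding ctiles_def
    by (intro finite_UnI; elim finite_subset; intro finite_imageI finite_cartesian_product) auto
qed

definition ctiling :: "ctile set => nat => nat => (nat => vcol) => vcol => (nat => nat => ctile) => bool" where
  "ctiling T R W bc tc \<tau> \<longleftrightarrow>
     (\<forall>r<R. \<forall>c<W. \<tau> r c \<in> T \<and> fst (snd (snd (\<tau> r c))) = snd (snd (snd (\<tau> r (nxt W c)))) \<and>
        fst (snd (\<tau> r c)) = (if r = 0 then bc c else fst (\<tau> (r - 1) c)) \<and>
        (Suc r = R --> fst (\<tau> r c) = tc))"

section \<open>Configurations as rows\<close>

locale tm_tiles =
  fixes M :: tm and N :: nat and x :: "bool list" and cl :: nat
  assumes wf: "wf_tm M" and k2: "num_tapes M \<ge> 2" and clN: "cl \<le> N" and xN: "length x \<le> N"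
begin

abbreviation "K \<equiv> num_tapes M"
definition W where "W = 2 * N + 1"

text \<open>Columns start with the tape cells 0 to \<open>N\<close>, and the negative cells follow.
  The seam of the tape lies between the cells \<open>N\<close> and \<open>-N\<close>, and no head
  crosses it within \<open>N\<close> steps.\<close>

definition zc :: "nat => int" where
  "zc c = (if c \<le> N then int c else int c - int W)"

lemma zc_nxt: "c < W ==> zc (nxt W c) = (if c = N then - int N else zc c + 1)"
  by (auto simp: zc_def nxt_def W_def)

lemma zc_inj: "c < W ==> d < W ==> zc c = zc d ==> c = d"
  by (auto simp: zc_def W_def split: if_splits)

lemma zc_bounds: "c < W ==> - int N \<le> zc c \<and> zc c \<le> int N"
  by (auto simp: zc_def W_def)

lemma zc_surj: "- int N \<le> z ==> z \<le> int N ==> \<exists>c<W. zc c = z"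
  by (rule exI[of _ "if 0 \<le> z then nat z else nat (z + int W)"]) (auto simp: zc_def W_def)

lemma nxt_less: "c < W ==> nxt W c < W"
  by (auto simp: nxt_def)

definition prv :: "nat => nat" where "prv c = (if c = 0 then W - 1 else c - 1)"

lemma prv_less: "c < W ==> prv c < W" and nxt_prv: "c < W ==> nxt W (prv c) = c"
  and prv_nxt: "c < W ==> prv (nxt W c) = c"
  by (auto simp: prv_def nxt_def W_def)

definition good :: "nat => config => bool" where
  "good m c \<longleftrightarrow> fst c < num_states M \<and> length (snd c) = K \<and>
     (\<forall>t\<in>set (snd c). (\<forall>z. fst t z < num_symbols M) \<and> \<bar>snd t\<bar> \<le> int m)"

lemma good_nth: "good m c ==> i < K ==> \<bar>snd (snd c ! i)\<bar> \<le> int m"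
  unfolding good_def by (metis nth_mem)

lemma good_scan: "good m c ==> map scan (snd c) \<in> lists_of K {..<num_symbols M}"
  by (cases c) (auto simp: good_def lists_of_def scan_eq_fst)

lemma act_of_good:
  assumes "q < num_states M" "xs \<in> lists_of K {..<num_symbols M}"
  shows "fst (act_of M q xs) < num_states M \<and> length (snd (act_of M q xs)) = K \<and>
    (\<forall>a\<in>set (snd (act_of M q xs)). fst a < num_symbols M)"
proof (cases "q \<in> {accept M, reject M}")
  case True
  then show ?thesis using assms by (auto simp: act_of_def stays_def lists_of_def)
next
  case False
  obtain q' acts where d: "delta M q xs = (q', acts)" by (cases "delta M q xs")
  have "\<forall>q xs. q < num_states M --> length xs = K --> set xs \<subseteq> {..<num_symbols M} -->
      (case delta M q xs of (q', acts) => q' < num_states M \<and> length acts = K \<and> fst ` set acts \<subseteq> {..<num_symbols M})"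
    using wf unfolding wf_tm_def by (elim conjE)
  from this[rule_format, of q xs] assms
  have "q' < num_states M \<and> length acts = K \<and> fst ` set acts \<subseteq> {..<num_symbols M}"
    by (simp add: d lists_of_def)
  with False d show ?thesis by (auto simp: act_of_def)
qed

lemma act_eq: "act t a = ((fst t)(snd t := fst a), snd t + shift (snd a))"
  by (cases t; cases a) auto

lemma shift_le: "\<bar>shift d\<bar> \<le> 1"
  by (cases d) auto

lemma good_step:
  assumes "good m c" shows "good (Suc m) (step M c)"
proof -
  obtain q ts where c: "c = (q, ts)" by (cases c)
  let ?xs = "map scan ts"
  have g: "q < num_states M" "?xs \<in> lists_of K {..<num_symbols M}"
    using assms good_scan[OF assms] by (auto simp: c good_def)
  note a = act_of_good[OF this]
  have "(\<forall>z. fst t z < num_symbols M) \<and> \<bar>snd t\<bar> \<le> int (Suc m)"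
    if "t \<in> set (map2 act ts (snd (act_of M q ?xs)))" for t
  proof -
    from that obtain u b where ub: "u \<in> set ts" "b \<in> set (snd (act_of M q ?xs))" "t = act u b"
      by (auto elim!: in_set_zipE)
    then have "(\<forall>z. fst u z < num_symbols M) \<and> \<bar>snd u\<bar> \<le> int m" "fst b < num_symbols M"
      using assms a by (auto simp: c good_def)
    then show ?thesis using shift_le[of "snd b"] by (auto simp: ub(3) act_eq)
  qed
  with a g assms show ?thesis
    by (auto simp: c good_def step_act_of)
qed

definition cellcol :: "config => nat => vcol" where
  "cellcol cf c = VCell (fst cf) (map (\<lambda>t. fst t (zc c)) (snd cf)) (map (\<lambda>t. snd t = zc c) (snd cf))"

text \<open>\<open>m < N\<close> is strict so that a head that is about to move stays in the window;
  arrival from a neighbouring column is then arrival from a neighbouring tape cell.\<close>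

lemma row_north:
  assumes g: "good m cf" and m: "m < N"
    and tile: "!!c. c < W ==> \<tau> c = stile M (fst cf) (map (\<lambda>t. fst t (zc c)) (snd cf)) (map (\<lambda>t. snd t = zc c) (snd cf)) (xs c) (inR c) (inL c)"
    and scan: "!!c. c < W ==> xs c = map scan (snd cf)"
    and ew: "!!c. c < W ==> fst (snd (snd (\<tau> c))) = snd (snd (snd (\<tau> (nxt W c))))"
    and c: "c < W"
  shows "fst (\<tau> c) = cellcol (step M cf) c"
proof -
  obtain q ts where cf: "cf = (q, ts)" by (cases cf)
  let ?xs = "map scan ts"
  let ?acts = "snd (act_of M q ?xs)"
  have len: "length ts = K" "length ?acts = K"
    using g act_of_good[of q ?xs] good_scan[OF g] by (auto simp: cf good_def)
  have hb: "\<bar>snd (ts ! i)\<bar> < int N" if "i < K" for i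
    using good_nth[OF g that] m by (simp add: cf)
  have R: "inR (nxt W d) = map (\<lambda>i. map (\<lambda>t. snd t = zc d) ts ! i \<and> snd (?acts ! i) = Right) [0..<K]"
    "inL d = map (\<lambda>i. map (\<lambda>t. snd t = zc (nxt W d)) ts ! i \<and> snd (?acts ! i) = Left) [0..<K]" if "d < W" for d
    using ew[OF that] tile[OF that] tile[OF nxt_less[OF that]] scan[OF that] scan[OF nxt_less[OF that]]
    by (auto simp: stile_def Let_def cf)
  have inR: "inR c ! i \<longleftrightarrow> snd (ts ! i) + 1 = zc c \<and> snd (?acts ! i) = Right" if "i < K" for i
    using R(1)[OF prv_less[OF c]] hb[OF that] that zc_nxt[OF prv_less[OF c]] zc_bounds[OF prv_less[OF c]] len
    by (auto simp: nxt_prv[OF c] zc_def split: if_splits)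
  have inL: "inL c ! i \<longleftrightarrow> snd (ts ! i) - 1 = zc c \<and> snd (?acts ! i) = Left" if "i < K" for i
    using R(2)[OF c] hb[OF that] that zc_nxt[OF c] len by (auto simp: zc_def split: if_splits)
  have st: "snd (ts ! i) + shift (snd (?acts ! i)) = zc c \<longleftrightarrow>
      snd (ts ! i) = zc c \<and> snd (?acts ! i) = Stay \<or> inR c ! i \<or> inL c ! i" if "i < K" for i
    using inR[OF that] inL[OF that] by (cases "snd (?acts ! i)") auto
  have "fst (\<tau> c) = VCell (fst (act_of M q ?xs))
      (map (\<lambda>i. if map (\<lambda>t. snd t = zc c) ts ! i then fst (?acts ! i) else map (\<lambda>t. fst t (zc c)) ts ! i) [0..<K])
      (map (\<lambda>i. map (\<lambda>t. snd t = zc c) ts ! i \<and> snd (?acts ! i) = Stay \<or> inR c ! i \<or> inL c ! i) [0..<K])"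
    using tile[OF c] scan[OF c] by (simp add: stile_def Let_def cf)
  also have "... = cellcol (step M cf) c"
    using len st by (auto simp: cellcol_def cf step_act_of act_eq list_eq_iff_nth_eq)
  finally show ?thesis .
qed

text \<open>The guessed tuple is constant along the cyclic row, and every head stands in some
  column, where the tile compares the guess with the symbol actually scanned.\<close>

lemma row_scan:
  assumes g: "good m cf" and m: "m \<le> N"
    and tile: "!!c. c < W ==> \<tau> c = stile M (fst cf) (map (\<lambda>t. fst t (zc c)) (snd cf)) (map (\<lambda>t. snd t = zc c) (snd cf)) (xs c) (inR c) (inL c)"
    and len: "!!c. c < W ==> length (xs c) = K"
    and hm: "!!c i. c < W ==> i < K ==> snd (snd cf ! i) = zc c ==> fst (snd cf ! i) (zc c) = xs c ! i"
    and ew: "!!c. c < W ==> fst (snd (snd (\<tau> c))) = snd (snd (snd (\<tau> (nxt W c))))"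
    and c: "c < W"
  shows "xs c = map scan (snd cf)"
proof -
  have eq: "xs (nxt W d) = xs d" if "d < W" for d
    using ew[OF that] tile[OF that] tile[OF nxt_less[OF that]] by (auto simp: stile_def Let_def)
  have "xs d = xs 0" if "d < W" for d
    using that
  proof (induction d)
    case (Suc d)
    then show ?case using eq[of d] by (auto simp: nxt_def)
  qed simp
  then have all: "xs d = xs c" if "d < W" for d using that c by metis
  have lt: "length (snd cf) = K" using g by (simp add: good_def)
  show ?thesis
  proof (rule nth_equalityI)
    show "length (xs c) = length (map scan (snd cf))" using len[OF c] lt by simp
    fix i assume "i < length (xs c)"
    then have i: "i < K" using len[OF c] by simp
    then have "\<bar>snd (snd cf ! i)\<bar> \<le> int N"
      using good_nth[OF g] m by (meson of_nat_mono order_trans)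
    then have "- int N \<le> snd (snd cf ! i) \<and> snd (snd cf ! i) \<le> int N" by linarith
    then obtain d where d: "d < W" "zc d = snd (snd cf ! i)"
      using zc_surj by blast
    have "xs c ! i = fst (snd cf ! i) (zc d)"
      using hm[OF d(1) i d(2)[symmetric]] all[OF d(1)] by simp
    then show "xs c ! i = map scan (snd cf) ! i"
      using i lt d(2) by (simp add: scan_eq_fst)
  qed
qed

definition bcol :: "nat => vcol" where
  "bcol c = VInit (if c < length x then (if x ! c then 2 else 1) else 0) (c = 0) (c < cl)"

lemma bcol_tape: "c < W ==> (if c < length x then (if x ! c then 2 else 1) else 0) = tape_of x (zc c)"
  using xN by (auto simp: tape_of_def zc_def W_def)

lemma init_nth:
  "i < K ==> snd (init M [x, u]) ! i = (tape_of (if i = 0 then x else if i = 1 then u else []), 0)"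
  by (auto simp: init_def nth_Cons' less_2_cases_iff)

lemma length_init: "length (snd (init M [x, u])) = K"
  by (simp add: init_def)

lemma tape_of_le: "tape_of w z < 3"
  by (auto simp: tape_of_def)

lemma good_init: "good 0 (init M [x, u])"
proof -
  have "(\<forall>z. fst t z < num_symbols M) \<and> \<bar>snd t\<bar> \<le> int 0" if t: "t \<in> set (snd (init M [x, u]))" for t
  proof -
    obtain i where "i < K" "t = snd (init M [x, u]) ! i"
      using t by (metis in_set_conv_nth length_init)
    then show ?thesis
      using init_nth[of i u] wf tape_of_le less_le_trans unfolding wf_tm_def by fastforce
  qed
  then show ?thesis
    using wf length_init by (auto simp: good_def init_def wf_tm_def)
qed

lemma cellcol_init:
  assumes "c < W"
  shows "cellcol (init M [x, u]) c = fst (itile M (tape_of x (zc c)) (tape_of u (zc c)) (c = 0) al p)"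
proof -
  have z: "zc c = 0 \<longleftrightarrow> c = 0" using zc_inj[OF assms, of 0] by (auto simp: zc_def W_def)
  have e: "tape_of [] z = 0" for z by (simp add: tape_of_def)
  have "map (\<lambda>t. fst t (zc c)) (snd (init M [x, u])) = tape_of x (zc c) # tape_of u (zc c) # replicate (K - 2) 0"
    using k2 by (intro nth_equalityI) (auto simp: length_init init_nth nth_Cons' e)
  moreover have "map (\<lambda>t. snd t = zc c) (snd (init M [x, u])) = replicate K (c = 0)"
    using z by (intro nth_equalityI) (auto simp: length_init init_nth)
  ultimately show ?thesis by (simp add: cellcol_def itile_def init_def)
qed

abbreviation "cfg u r \<equiv> run M [x, u] r"

lemma good_cfg: "good r (cfg u r)"
  by (induction r) (auto simp: run_def good_init intro: good_step)

lemma accept_imp_ctiling: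
  assumes u: "length u \<le> cl" and acc: "fst (cfg u N) = accept M"
  shows "\<exists>\<tau>. ctiling (ctiles M) (N + 2) W bcol VFin \<tau>"
proof -
  define xs where "xs r = map scan (snd (cfg u r))" for r
  define oR where "oR r c = map (\<lambda>i. map (\<lambda>t. snd t = zc c) (snd (cfg u r)) ! i \<and> snd (snd (act_of M (fst (cfg u r)) (xs r)) ! i) = Right) [0..<K]" for r c
  define oL where "oL r c = map (\<lambda>i. map (\<lambda>t. snd t = zc c) (snd (cfg u r)) ! i \<and> snd (snd (act_of M (fst (cfg u r)) (xs r)) ! i) = Left) [0..<K]" for r c
  define st where "st r c = stile M (fst (cfg u r)) (map (\<lambda>t. fst t (zc c)) (snd (cfg u r))) (map (\<lambda>t. snd t = zc c) (snd (cfg u r)))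
    (xs r) (oR r (prv c)) (oL r (nxt W c))" for r c
  \<comment> \<open>Row 0 writes the initial configuration, row \<open>r\<close> from 1 to
    \<open>N\<close> leads from configuration \<open>r - 1\<close> to \<open>r\<close>, and row
    \<open>N + 1\<close> checks acceptance; hence \<open>N + 2\<close> rows.\<close>
  define \<tau> where "\<tau> r c = (if r = 0 then itile M (tape_of x (zc c)) (tape_of u (zc c)) (c = 0) (c < cl) (tape_of u (zc (prv c)) \<noteq> 0)
    else if r \<le> N then st (r - 1) c
    else ftile M (map (\<lambda>t. fst t (zc c)) (snd (cfg u N))) (map (\<lambda>t. snd t = zc c) (snd (cfg u N))))" for r c
  have ew: "fst (snd (snd (st r c))) = snd (snd (snd (st r (nxt W c))))" if "c < W" for r c
    using that by (simp add: st_def stile_def Let_def oR_def oL_def prv_nxt)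
  have n: "fst (st r c) = cellcol (cfg u (Suc r)) c" if "r < N" "c < W" for r c
  proof -
    have "fst (st r c) = cellcol (step M (cfg u r)) c"
      by (rule row_north[OF good_cfg that(1), where \<tau> = "st r", OF st_def])
        (use that ew in \<open>auto simp: xs_def\<close>)
    then show ?thesis by (simp add: run_def)
  qed
  have lists: "map (\<lambda>t. fst t (zc c)) (snd (cfg u r)) \<in> lists_of K {..<num_symbols M}"
    "map (\<lambda>t. snd t = zc c) (snd (cfg u r)) \<in> lists_of K UNIV" for r c
    using good_cfg[of r u] by (auto simp: good_def lists_of_def)
  have st_in: "st r c \<in> stiles M" for r c
  proof -
    have "xs r \<in> lists_of K {..<num_symbols M}" unfolding xs_def by (rule good_scan[OF good_cfg])
    moreover have "oR r (prv c) \<in> lists_of K UNIV" "oL r (nxt W c) \<in> lists_of K UNIV"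
      by (auto simp: oR_def oL_def lists_of_def)
    moreover have "\<forall>i<K. map (\<lambda>t. snd t = zc c) (snd (cfg u r)) ! i --> map (\<lambda>t. fst t (zc c)) (snd (cfg u r)) ! i = xs r ! i"
      using good_cfg[of r u] by (auto simp: xs_def good_def scan_eq_fst)
    moreover have "fst (cfg u r) < num_states M" using good_cfg[of r u] by (simp add: good_def)
    ultimately show ?thesis
      using lists unfolding stiles_def st_def by blast
  qed
  have it_in: "\<tau> 0 c \<in> itiles M" if "c < W" for c
  proof -
    have *: "c < cl \<and> (c = 0 \<or> tape_of u (zc (prv c)) \<noteq> 0)" if "tape_of u (zc c) \<noteq> 0"
      using that \<open>c < W\<close> u clN by (auto simp: tape_of_def zc_def prv_def W_def split: if_splits)
    have "\<tau> 0 c = itile M (tape_of x (zc c)) (tape_of u (zc c)) (c = 0) (c < cl) (tape_of u (zc (prv c)) \<noteq> 0)"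
      by (simp add: \<tau>_def)
    then show ?thesis
      unfolding itiles_def using * tape_of_le by blast
  qed
  have "ctiling (ctiles M) (N + 2) W bcol VFin \<tau>"
    unfolding ctiling_def
  proof (intro allI impI conjI)
    fix r c assume rc: "r < N + 2" "c < W"
    consider "r = 0" | "0 < r" "r \<le> N" | "r = Suc N" using rc by linarith
    note cs = this
    show "\<tau> r c \<in> ctiles M"
      using cs
    proof cases
      case 1 then show ?thesis using it_in[OF rc(2)] by (simp add: ctiles_def)
    next
      case 2 then show ?thesis using st_in by (simp add: ctiles_def \<tau>_def)
    next
      case 3
      then have "\<tau> r c = ftile M (map (\<lambda>t. fst t (zc c)) (snd (cfg u N))) (map (\<lambda>t. snd t = zc c) (snd (cfg u N)))"
        by (simp add: \<tau>_def)
      then have "\<tau> r c \<in> ftiles M"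
        using lists unfolding ftiles_def by blast
      then show ?thesis by (simp add: ctiles_def)
    qed
    show "fst (snd (snd (\<tau> r c))) = snd (snd (snd (\<tau> r (nxt W c))))"
      using cs
    proof cases
      case 1 then show ?thesis using rc by (simp add: \<tau>_def itile_def prv_nxt)
    next
      case 2 then show ?thesis using ew rc by (simp add: \<tau>_def)
    next
      case 3 then show ?thesis by (simp add: \<tau>_def ftile_def)
    qed
    show "fst (snd (\<tau> r c)) = (if r = 0 then bcol c else fst (\<tau> (r - 1) c))"
      using cs
    proof cases
      case 1 then show ?thesis using bcol_tape[OF rc(2)] by (simp add: \<tau>_def itile_def bcol_def)
    next
      case 2
      have "fst (\<tau> (r - 1) c) = cellcol (cfg u (r - 1)) c"
      proof (cases "r = 1")
        case True
        then show ?thesis using cellcol_init[OF rc(2)] by (simp add: \<tau>_def run_def)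
      next
        case False
        then obtain r' where "r = Suc (Suc r')" using 2 by (metis One_nat_def Suc_pred not_gr_zero)
        then show ?thesis using 2 n[of r' c] rc by (simp add: \<tau>_def)
      qed
      then show ?thesis using 2 by (simp add: \<tau>_def st_def stile_def Let_def cellcol_def)
    next
      case 3
      have "fst (\<tau> N c) = cellcol (cfg u N) c"
      proof (cases "N = 0")
        case True
        then show ?thesis using cellcol_init[OF rc(2)] by (simp add: \<tau>_def run_def)
      next
        case False
        then show ?thesis using n[of "N - 1" c] rc by (simp add: \<tau>_def)
      qed
      then show ?thesis using 3 acc by (simp add: \<tau>_def ftile_def cellcol_def)
    qed
    show "fst (\<tau> r c) = VFin" if "Suc r = N + 2"
      using that by (simp add: \<tau>_def ftile_def)
  qed
  then show ?thesis by blast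
qed

lemma ctiling_imp_accept:
  assumes t: "ctiling (ctiles M) (N + 2) W bcol VFin \<tau>"
  shows "\<exists>u. length u \<le> cl \<and> fst (cfg u N) = accept M"
proof -
  have T: "\<tau> r c \<in> ctiles M" and ew: "fst (snd (snd (\<tau> r c))) = snd (snd (snd (\<tau> r (nxt W c))))"
    and ns: "fst (snd (\<tau> r c)) = (if r = 0 then bcol c else fst (\<tau> (r - 1) c))"
    if "r < N + 2" "c < W" for r c
    using t that unfolding ctiling_def by blast+
  have fin: "fst (\<tau> (Suc N) c) = VFin" if "c < W" for c
    using t[unfolded ctiling_def, rule_format, of "Suc N" c] that by simp
  have "\<exists>b p. \<tau> 0 c = itile M (if c < length x then (if x ! c then 2 else 1) else 0) b (c = 0) (c < cl) p \<and>
      b < 3 \<and> (b \<noteq> 0 --> c < cl \<and> (c = 0 \<or> p))" if "c < W" for c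
    using T[of 0 c] ns[of 0 c] that
    by (auto simp: ctiles_def stiles_def itiles_def ftiles_def stile_def itile_def ftile_def bcol_def Let_def)
  then obtain b p where bp: "!!c. c < W ==> \<tau> 0 c = itile M (if c < length x then (if x ! c then 2 else 1) else 0) (b c) (c = 0) (c < cl) (p c)"
    "!!c. c < W ==> b c < 3" "!!c. c < W ==> b c \<noteq> 0 ==> c < cl \<and> (c = 0 \<or> p c)"
    by metis
  have p: "p (nxt W c) \<longleftrightarrow> b c \<noteq> 0" if "c < W" for c
    using ew[of 0 c] bp(1)[OF that] bp(1)[OF nxt_less[OF that]] that by (simp add: itile_def)
  \<comment> \<open>The length of the guessed certificate: the first cell without a certificate
    symbol, but at most \<open>cl\<close>.\<close>
  define m where "m = (LEAST c. b c = 0 \<or> c \<ge> cl)"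
  have m: "b m = 0 \<or> m \<ge> cl" "!!c. c < m ==> b c \<noteq> 0 \<and> c < cl"
    unfolding m_def by (rule LeastI[of _ cl], simp) (use not_less_Least in fastforce)
  have mcl: "m \<le> cl" using m(2)[of cl] by (metis less_irrefl not_le)
  have z: "b c = 0" if "c \<ge> m" "c < W" for c
    using that
  proof (induction c rule: dec_induct)
    case base
    then show ?case using m(1) bp(3)[of m] by (cases "b m = 0") auto
  next
    case (step c)
    then have "\<not> p (nxt W c)" using p[of c] by auto
    then show ?case using bp(3)[of "Suc c"] step.prems by (auto simp: nxt_def split: if_splits)
  qed
  define u where "u = map (\<lambda>c. b c = 2) [0..<m]"
  have u: "length u \<le> cl" using mcl by (simp add: u_def)
  have bu: "b c = tape_of u (zc c)" if "c < W" for c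
  proof (cases "c < m")
    case True
    then have "b c = 1 \<or> b c = 2" using m(2)[OF True] bp(2)[OF that] by auto
    then show ?thesis using True mcl clN by (auto simp: tape_of_def zc_def u_def)
  next
    case False
    then show ?thesis using z[of c] that by (auto simp: tape_of_def zc_def u_def)
  qed
  have rows: "\<forall>c<W. fst (\<tau> r c) = cellcol (cfg u r) c" if "r \<le> N" for r
    using that
  proof (induction r)
    case 0
    show ?case
    proof (intro allI impI)
      fix c assume c: "c < W"
      show "fst (\<tau> 0 c) = cellcol (cfg u 0) c"
        using bp(1)[OF c] cellcol_init[OF c, of u "c < cl" "p c"] bu[OF c] bcol_tape[OF c]
        by (simp add: run_def itile_def)
    qed
  next
    case (Suc r)
    let ?cf = "cfg u r"
    have s: "fst (snd (\<tau> (Suc r) c)) = cellcol ?cf c" if "c < W" for c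
      using ns[of "Suc r" c] Suc that by auto
    \<comment> \<open>There is a row above because \<open>Suc r \<le> N\<close>, and no tile has
      \<open>VFin\<close> in its south. This rules out final tiles, which would also fit a
      configuration in the accepting state.\<close>
    have nf: "fst (\<tau> (Suc r) c) \<noteq> VFin" if "c < W" for c
    proof -
      have "fst (snd (\<tau> (Suc (Suc r)) c)) = fst (\<tau> (Suc r) c)" using ns[of "Suc (Suc r)" c] Suc.prems that by simp
      moreover have "fst (snd (\<tau> (Suc (Suc r)) c)) \<noteq> VFin" using T[of "Suc (Suc r)" c] Suc.prems that
        by (auto simp: ctiles_def stiles_def itiles_def ftiles_def stile_def itile_def ftile_def Let_def)
      ultimately show ?thesis by simp
    qed
    have "\<exists>xs inR inL. \<tau> (Suc r) c = stile M (fst ?cf) (map (\<lambda>t. fst t (zc c)) (snd ?cf)) (map (\<lambda>t. snd t = zc c) (snd ?cf)) xs inR inL \<and>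
        length xs = K \<and> (\<forall>i<K. snd (snd ?cf ! i) = zc c --> fst (snd ?cf ! i) (zc c) = xs ! i)" if "c < W" for c
    proof -
      have "\<tau> (Suc r) c \<in> stiles M"
        using T[of "Suc r" c] s[OF that] nf[OF that] Suc.prems that
        by (auto simp: ctiles_def itiles_def ftiles_def itile_def ftile_def cellcol_def)
      then obtain q \<sigma> hm xs inR inL where 1: "\<tau> (Suc r) c = stile M q \<sigma> hm xs inR inL"
        "xs \<in> lists_of K {..<num_symbols M}" "\<forall>i<K. hm ! i --> \<sigma> ! i = xs ! i"
        unfolding stiles_def by blast
      then have "q = fst ?cf" "\<sigma> = map (\<lambda>t. fst t (zc c)) (snd ?cf)" "hm = map (\<lambda>t. snd t = zc c) (snd ?cf)"
        using s[OF that] by (auto simp: stile_def Let_def cellcol_def)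
      moreover have "length (snd ?cf) = K" using good_cfg[of r u] by (simp add: good_def)
      ultimately show ?thesis using 1 by (intro exI[of _ xs] exI[of _ inR] exI[of _ inL]) (auto simp: lists_of_def)
    qed
    then obtain xs inR inL where *: "!!c. c < W ==> \<tau> (Suc r) c = stile M (fst ?cf) (map (\<lambda>t. fst t (zc c)) (snd ?cf)) (map (\<lambda>t. snd t = zc c) (snd ?cf)) (xs c) (inR c) (inL c)"
      "!!c. c < W ==> length (xs c) = K"
      "!!c i. c < W ==> i < K ==> snd (snd ?cf ! i) = zc c ==> fst (snd ?cf ! i) (zc c) = xs c ! i"
      by metis
    have e: "fst (snd (snd (\<tau> (Suc r) c))) = snd (snd (snd (\<tau> (Suc r) (nxt W c))))" if "c < W" for c
      using ew[of "Suc r" c] Suc.prems that by simp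
    have xs: "xs c = map scan (snd ?cf)" if "c < W" for c
      by (rule row_scan[OF good_cfg _ *(1) *(2) *(3) e that]) (use Suc.prems in auto)
    have "fst (\<tau> (Suc r) c) = cellcol (step M ?cf) c" if "c < W" for c
      by (rule row_north[OF good_cfg _ *(1) xs e that]) (use Suc.prems in auto)
    then show ?case by (simp add: run_def)
  qed
  have W0: "0 < W" by (simp add: W_def)
  have "\<tau> (Suc N) 0 \<in> ftiles M"
    using T[of "Suc N" 0] fin[OF W0] W0
    by (auto simp: ctiles_def stiles_def itiles_def stile_def itile_def Let_def)
  moreover have "fst (snd (\<tau> (Suc N) 0)) = cellcol (cfg u N) 0"
    using ns[of "Suc N" 0] rows[of N] W0 by simp
  ultimately have "fst (cfg u N) = accept M"
    by (auto simp: ftiles_def ftile_def cellcol_def)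
  with u show ?thesis by blast
qed

end

section \<open>Instances for sums of natural numbers\<close>

abbreviation rflow :: "(commodity => edge => rat) => flow" where
  "rflow F \<equiv> (\<lambda>\<kappa> e. real_of_rat (F \<kappa> e))"

definition solvable_flow :: "msp => flow => bool" where
  "solvable_flow I F \<longleftrightarrow> (\<exists>L M. feasible_solution I F L M \<and> within_bounds I F L M)"

definition solvable :: "msp => bool" where
  "solvable I \<longleftrightarrow> (\<exists>F. solvable_flow I F)"

lemma finite_commodities: "finite (commodities I)"
  by (rule finite_subset[of _ "{..<num_verts I} \<times> {..<num_verts I}"]) (auto simp: commodities_def)

text \<open>Removes the case distinction in the aggregated split: by nonnegativity, zero total flow
  means zero flow of each commodity.\<close>

lemma total_flow_split:
  assumes "feasible_flow I F" "e \<in> edges I"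
  shows "total_flow I F e * total_split I F M e i = (\<Sum>\<kappa>\<in>commodities I. F \<kappa> e * M \<kappa> e i)"
proof (cases "total_flow I F e > 0")
  case True
  then show ?thesis by (simp add: total_split_def)
next
  case False
  note fin = finite_commodities[of I]
  have nn: "F \<kappa> e \<ge> 0" if "\<kappa> \<in> commodities I" for \<kappa>
    using assms that by (cases \<kappa>) (auto simp: feasible_flow_def)
  then have "total_flow I F e = 0"
    using False sum_nonneg[of "commodities I" "\<lambda>\<kappa>. F \<kappa> e"] by (simp add: total_flow_def)
  then have "\<forall>\<kappa>\<in>commodities I. F \<kappa> e = 0"
    using sum_nonneg_eq_0_iff[OF fin, of "\<lambda>\<kappa>. F \<kappa> e"] nn by (simp add: total_flow_def)
  with \<open>total_flow I F e = 0\<close> show ?thesis by simp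
qed

section \<open>A single edge with one mode per number\<close>

definition edge_msp :: "nat list => nat => msp" where
  "edge_msp as t = \<lparr> num_verts = 2, edges = {(0, 1)}, weight = (\<lambda>_. 1), budget = of_nat t,
     demand = (\<lambda>\<kappa>. if \<kappa> = (0, 1) then t else 0), modes = length as, travel_time = (\<lambda>_. 0),
     energy = (\<lambda>i. if i = 0 then 1 else 0), cost = (\<lambda>i. if i = 0 then 0 else of_nat (as ! (i - 1))),
     capacity = (\<lambda>i. if i = 0 then 1 else of_nat (as ! (i - 1))), time_bound = None, energy_bound = 0 \<rparr>"

lemma edge_msp_simps [simp]:
  "num_verts (edge_msp as t) = 2" "edges (edge_msp as t) = {(0, 1)}" "weight (edge_msp as t) e = 1"
  "budget (edge_msp as t) = of_nat t" "demand (edge_msp as t) \<kappa> = (if \<kappa> = (0, 1) then t else 0)"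
  "modes (edge_msp as t) = length as" "travel_time (edge_msp as t) i = 0"
  "energy (edge_msp as t) i = (if i = 0 then 1 else 0)"
  "cost (edge_msp as t) i = (if i = 0 then 0 else of_nat (as ! (i - 1)))"
  "capacity (edge_msp as t) i = (if i = 0 then 1 else of_nat (as ! (i - 1)))"
  "time_bound (edge_msp as t) = None" "energy_bound (edge_msp as t) = 0"
  by (auto simp: edge_msp_def)

lemma edge_msp_instance:
  assumes "!!a. a \<in> set as ==> a > 0" "t > 0"
  shows "msp_instance (edge_msp as t)" "single_unit_edge (edge_msp as t)"
proof -
  have "as ! (i - 1) > 0" if "0 < i" "i \<le> length as" for i
    using assms(1)[OF nth_mem[of "i - 1" as]] that by simp
  then show "msp_instance (edge_msp as t)"
    using assms(2) by (auto simp: msp_instance_def pair_fin_digraph_graph)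
  show "single_unit_edge (edge_msp as t)"
    by (auto simp: single_unit_edge_def graph_of_def intro!: exI[of _ 0] exI[of _ 1])
qed

lemma commodities_edge: "t > 0 ==> commodities (edge_msp as t) = {(0, 1)}"
  by (auto simp: commodities_def)

lemma sum_modes: "(\<Sum>i = Suc 0..n. f i) = (\<Sum>j<n. f (Suc j))"
  using sum.atLeast1_atMost_eq[of f n] by simp

lemma sum_modes0: "(\<Sum>i = 0..n. f i) = f 0 + (\<Sum>j<n. f (Suc j))" for f :: "nat => real"
  by (simp add: sum.atLeast0_atMost_Suc_shift atLeast0AtMost sum.atMost_shift)

text \<open>Private transport costs energy and the energy bound is 0, so the whole demand
  \<open>t\<close> uses public modes. Their total capacity is at least \<open>t\<close>, their cost
  is at most \<open>t\<close>, and both are the same sum.\<close>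

lemma edge_msp_solvable:
  assumes pos: "!!a. a \<in> set as ==> a > 0" and t: "t > 0"
  shows "solvable (edge_msp as t) \<longleftrightarrow> (\<exists>L. (\<Sum>j<length as. L j * as ! j) = t)"
proof
  let ?I = "edge_msp as t" and ?e = "(0, 1) :: nat \<times> nat"
  note com = commodities_edge[OF t, of as]
  assume "solvable ?I"
  then obtain F L M where F: "feasible_flow ?I F" and L: "feasible_layout ?I L" and M: "feasible_split ?I F L M"
    and b: "within_bounds ?I F L M"
    by (auto simp: solvable_def solvable_flow_def feasible_solution_def)
  have "F ?e ?e = real t"
  proof -
    have "in_arcs (graph_of ?I) 1 = {?e}" "out_arcs (graph_of ?I) 1 = {}"
      by (auto simp: in_arcs_graph out_arcs_graph)
    moreover have "\<forall>v<2. (\<Sum>e\<in>in_arcs (graph_of ?I) v. F ?e e) - (\<Sum>e\<in>out_arcs (graph_of ?I) v. F ?e e) =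
        (if v = 1 then real t else if v = 0 then - real t else 0)"
      using F unfolding feasible_flow_def com by simp
    ultimately show ?thesis by (auto dest: spec[of _ 1])
  qed
  note Fe = this
  have M': "\<forall>i\<le>length as. 0 \<le> M ?e ?e i" "(\<Sum>i=0..length as. M ?e ?e i) = 1"
    using M[unfolded feasible_split_def com] by auto
  have cap: "real t * M ?e ?e (Suc i) \<le> real (as ! i) * real (L ?e (Suc i))" if "i < length as" for i
    using M[unfolded feasible_split_def com, THEN conjunct2, THEN bspec, of ?e, THEN bspec, of "Suc i"] that Fe by simp
  have "total_flow ?I F ?e * total_split ?I F M ?e 0 \<le> 0"
    using b by (auto simp: within_bounds_def total_energy_def sum_modes)
  then have "real t * M ?e ?e 0 \<le> 0"
    using total_flow_split[OF F, of ?e M 0] Fe by (simp add: com)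
  then have "M ?e ?e 0 \<le> 0" using t by (simp add: mult_le_0_iff)
  then have "M ?e ?e 0 = 0" using M'(1) by (simp add: order_antisym)
  then have 1: "(\<Sum>j<length as. M ?e ?e (Suc j)) = 1" using M'(2) by (simp add: sum_modes0)
  have "real t = (\<Sum>j<length as. real t * M ?e ?e (Suc j))"
    using 1 by (simp flip: sum_distrib_left)
  also have "... \<le> (\<Sum>j<length as. real (as ! j) * real (L ?e (Suc j)))"
    by (intro sum_mono) (use cap in auto)
  also have "... = real (\<Sum>j<length as. L ?e (Suc j) * as ! j)" by (simp add: mult.commute)
  finally have "t \<le> (\<Sum>j<length as. L ?e (Suc j) * as ! j)" by (simp only: of_nat_le_iff)
  moreover have "(\<Sum>j<length as. L ?e (Suc j) * as ! j) \<le> t"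
  proof -
    have "real (\<Sum>j<length as. L ?e (Suc j) * as ! j) \<le> real t"
      using L by (simp add: feasible_layout_def sum_modes mult.commute)
    then show ?thesis by (simp only: of_nat_le_iff)
  qed
  ultimately show "\<exists>L. (\<Sum>j<length as. L j * as ! j) = t" by (auto intro: exI[of _ "\<lambda>j. L ?e (Suc j)"])
next
  let ?I = "edge_msp as t" and ?e = "(0, 1) :: nat \<times> nat"
  note com = commodities_edge[OF t, of as]
  assume "\<exists>L. (\<Sum>j<length as. L j * as ! j) = t"
  then obtain L where L: "(\<Sum>j<length as. L j * as ! j) = t" by blast
  define F :: flow where "F = (\<lambda>\<kappa> e. real t)"
  define L' :: layout where "L' = (\<lambda>e i. L (i - 1))"
  \<comment> \<open>Each mode is filled to its capacity, the share \<open>L j * as ! j\<close> of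
    the demand \<open>t\<close>.\<close>
  define M :: split where "M = (\<lambda>\<kappa> e i. if i = 0 then 0 else real (L (i - 1) * as ! (i - 1)) / real t)"
  have arcs: "in_arcs (graph_of ?I) v = (if v = 1 then {?e} else {})"
    "out_arcs (graph_of ?I) v = (if v = 0 then {?e} else {})" for v
    by (auto simp: in_arcs_graph out_arcs_graph)
  have F: "feasible_flow ?I F"
    by (auto simp: feasible_flow_def com arcs F_def less_2_cases_iff)
  have sumr: "(\<Sum>j<length as. real (L j) * real (as ! j)) = real t"
    using L by (metis (no_types, lifting) of_nat_mult of_nat_sum sum.cong)
  have le1: "real (L j * as ! j) / real t \<le> 1" if "j < length as" for j
  proof -
    have "L j * as ! j \<le> t" unfolding L[symmetric] using that by (intro member_le_sum) auto
    then show ?thesis using t by (simp only: divide_le_eq_1 of_nat_le_iff of_nat_0_less_iff) simp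
  qed
  have "feasible_layout ?I L'"
    using sumr by (simp add: feasible_layout_def sum_modes L'_def mult.commute)
  moreover have "feasible_split ?I F L' M"
    unfolding feasible_split_def com
  proof (intro conjI ballI allI impI)
    fix \<kappa> e i assume "i \<le> modes ?I"
    then show "M \<kappa> e i \<in> {0..1}" using le1[of "i - 1"] by (auto simp: M_def)
  next
    fix \<kappa> e
    show "(\<Sum>i=0..modes ?I. M \<kappa> e i) = 1"
      using sumr t by (simp add: M_def sum_modes0 flip: sum_divide_distrib)
  next
    fix e i assume "i \<in> {1..modes ?I}"
    then show "(\<Sum>\<kappa>\<in>{(0, 1)}. F \<kappa> e * M \<kappa> e i) \<le> real_of_rat (capacity ?I i) * real (L' e i)"
      using t by (auto simp: M_def F_def L'_def)
  qed
  moreover have "within_bounds ?I F L' M"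
    using total_flow_split[OF F, of ?e M 0] by (auto simp: within_bounds_def total_energy_def sum_modes com M_def)
  ultimately show "solvable ?I"
    using F unfolding solvable_def solvable_flow_def feasible_solution_def by blast
qed

section \<open>A star with one public mode\<close>

definition star_msp :: "nat list => nat => msp" where
  "star_msp as t = \<lparr> num_verts = Suc (length as), edges = (\<lambda>j. (0, Suc j)) ` {..<length as},
     weight = (\<lambda>e. of_nat (as ! (snd e - 1))), budget = (if t \<le> sum_list as then of_nat t else 1 / 2),
     demand = (\<lambda>\<kappa>. if fst \<kappa> = 0 \<and> snd \<kappa> > 0 then 1 else 0), modes = 1, travel_time = (\<lambda>_. 0),
     energy = (\<lambda>i. if i = 0 then 1 else 0), cost = (\<lambda>i. if i = 0 then 0 else 1),
     capacity = (\<lambda>_. 1), time_bound = None, energy_bound = of_nat (sum_list as - t) \<rparr>"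

lemma star_msp_simps [simp]:
  "num_verts (star_msp as t) = Suc (length as)" "edges (star_msp as t) = (\<lambda>j. (0, Suc j)) ` {..<length as}"
  "weight (star_msp as t) e = of_nat (as ! (snd e - 1))"
  "budget (star_msp as t) = (if t \<le> sum_list as then of_nat t else 1 / 2)"
  "demand (star_msp as t) \<kappa> = (if fst \<kappa> = 0 \<and> snd \<kappa> > 0 then 1 else 0)"
  "modes (star_msp as t) = 1" "travel_time (star_msp as t) i = 0"
  "energy (star_msp as t) i = (if i = 0 then 1 else 0)" "cost (star_msp as t) i = (if i = 0 then 0 else 1)"
  "capacity (star_msp as t) i = 1" "time_bound (star_msp as t) = None"
  "energy_bound (star_msp as t) = of_nat (sum_list as - t)"
  by (auto simp: star_msp_def)

lemma star_msp_instance: "t > 0 ==> msp_instance (star_msp as t)"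
  by (auto simp: msp_instance_def pair_fin_digraph_graph)

lemma commodities_star: "commodities (star_msp as t) = (\<lambda>j. (0, Suc j)) ` {..<length as}"
proof (rule set_eqI)
  fix \<kappa>
  show "\<kappa> \<in> commodities (star_msp as t) \<longleftrightarrow> \<kappa> \<in> (\<lambda>j. (0, Suc j)) ` {..<length as}"
    by (cases \<kappa>; cases "snd \<kappa>") (auto simp: commodities_def)
qed

lemma star_tree_like: "tree_like (graph_of (star_msp as t))"
  by (rule ranked_imp_tree_like[of _ "\<lambda>v. of_bool (v > 0)" "\<lambda>v. of_bool (v > 0)"])
    (auto simp: ranked_def image_iff gr0_conv_Suc)

lemma sum_star: "(\<Sum>e\<in>(\<lambda>j. (0, Suc j)) ` {..<n}. f e) = (\<Sum>j<n. f (0, Suc j))" for f :: "nat \<times> nat => real"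
  by (subst sum.reindex) (auto simp: inj_on_def)

definition star_flow :: "commodity => edge => rat" where
  "star_flow \<kappa> e = (if \<kappa> = e then 1 else 0)"

lemma star_arcs:
  "j < length as ==> in_arcs (graph_of (star_msp as t)) (Suc j) = {(0, Suc j)}"
  "in_arcs (graph_of (star_msp as t)) 0 = {}"
  "out_arcs (graph_of (star_msp as t)) (Suc j) = {}"
  "out_arcs (graph_of (star_msp as t)) 0 = (\<lambda>j. (0, Suc j)) ` {..<length as}"
  by (auto simp: in_arcs_graph out_arcs_graph)

lemma star_flow_feasible: "feasible_flow (star_msp as t) (\<lambda>\<kappa> e. real_of_rat (star_flow \<kappa> e))"
proof -
  have "(\<Sum>e\<in>in_arcs (graph_of (star_msp as t)) v. real_of_rat (star_flow (0, Suc j) e)) -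
        (\<Sum>e\<in>out_arcs (graph_of (star_msp as t)) v. real_of_rat (star_flow (0, Suc j) e)) =
        (if v = Suc j then 1 else if v = 0 then - 1 else 0)" if "j < length as" "v < Suc (length as)" for j v
  proof (cases v)
    case 0
    have "(\<Sum>i<length as. real_of_rat (star_flow (0, Suc j) (0, Suc i))) = (\<Sum>i<length as. if i = j then 1 else 0)"
      by (intro sum.cong) (auto simp: star_flow_def)
    then show ?thesis using 0 that by (simp add: star_arcs sum_star)
  next
    case (Suc i)
    then show ?thesis using that by (simp add: star_arcs star_flow_def)
  qed
  then show ?thesis
    unfolding feasible_flow_def commodities_star by (auto simp: star_flow_def)
qed

text \<open>Each leaf has a single incoming edge and none going out, so conservation determines the
  flow; free and prescribed flows coincide on stars.\<close>

lemma star_flow_unique: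
  assumes "feasible_flow (star_msp as t) F" "j < length as" "i < length as"
  shows "F (0, Suc j) (0, Suc i) = (if i = j then 1 else 0)"
proof -
  have "(\<Sum>e\<in>in_arcs (graph_of (star_msp as t)) (Suc i). F (0, Suc j) e) -
        (\<Sum>e\<in>out_arcs (graph_of (star_msp as t)) (Suc i). F (0, Suc j) e) =
        (if Suc i = Suc j then 1 else 0)"
    using assms unfolding feasible_flow_def commodities_star by auto
  then show ?thesis using assms by (simp add: star_arcs)
qed

lemma sum_list_real: "real (sum_list as) = (\<Sum>j<length as. real (as ! j))"
  by (simp add: sum_list_sum_nth atLeast0LessThan)

text \<open>On edge \<open>j\<close> a fraction \<open>m j \<le> l j\<close> is served. For
  \<open>t \<le> sum_list as\<close>, the energy bound makes the weighted sum of the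
  \<open>m j\<close> at least \<open>t\<close>, and the budget makes that of the \<open>l j\<close>
  at most \<open>t\<close>.\<close>

lemma star_solvable_imp:
  assumes s: "solvable (star_msp as t)" and pos: "!!a. a \<in> set as ==> a > 0" and as: "as \<noteq> []"
  shows "\<exists>L. (\<Sum>j<length as. L j * as ! j) = t"
proof -
  let ?I = "star_msp as t"
  obtain F L M where F: "feasible_flow ?I F" and L: "feasible_layout ?I L" and M: "feasible_split ?I F L M"
    and b: "within_bounds ?I F L M"
    using s by (auto simp: solvable_def solvable_flow_def feasible_solution_def)
  define m where "m j = M (0, Suc j) (0, Suc j) 1" for j
  define l where "l j = L (0, Suc j) 1" for j
  have Fs: "(\<Sum>\<kappa>\<in>commodities ?I. F \<kappa> (0, Suc j) * g \<kappa>) = g (0, Suc j)" if "j < length as" for j g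
  proof -
    have "(\<Sum>\<kappa>\<in>commodities ?I. F \<kappa> (0, Suc j) * g \<kappa>) = (\<Sum>i<length as. if i = j then g (0, Suc i) else 0)"
      unfolding commodities_star sum_star using star_flow_unique[OF F] that by (intro sum.cong) auto
    then show ?thesis using that by simp
  qed
  have M0: "M (0, Suc j) (0, Suc j) 0 = 1 - m j" "m j \<le> real (l j)" "m j \<le> 1" if "j < length as" for j
  proof -
    have "(\<Sum>i=0..1. M (0, Suc j) (0, Suc j) i) = 1" and "m j \<in> {0..1}"
      using M that unfolding feasible_split_def commodities_star m_def by auto
    then show "M (0, Suc j) (0, Suc j) 0 = 1 - m j" "m j \<le> 1" by (auto simp: m_def)
    have "(\<Sum>\<kappa>\<in>commodities ?I. F \<kappa> (0, Suc j) * M \<kappa> (0, Suc j) 1) \<le> real (L (0, Suc j) 1)"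
      using M that unfolding feasible_split_def by auto
    then show "m j \<le> real (l j)" using Fs[OF that] by (simp add: m_def l_def)
  qed
  have "total_energy ?I F L M = (\<Sum>j<length as. real (as ! j) * (1 - m j))"
    unfolding total_energy_def star_msp_simps sum_star
  proof (intro sum.cong refl)
    fix j assume "j \<in> {..<length as}"
    then have j: "j < length as" by simp
    have "total_flow ?I F (0, Suc j) * total_split ?I F M (0, Suc j) 0 = 1 - m j"
      using total_flow_split[OF F, of "(0, Suc j)" M 0] Fs[OF j] M0[OF j] j by simp
    then show "real_of_rat (of_nat (as ! (snd (0, Suc j) - 1))) *
         (real_of_rat (if (0::nat) = 0 then 1 else 0) * total_flow ?I F (0, Suc j) * total_split ?I F M (0, Suc j) 0 +
          (\<Sum>i = 1..1. real_of_rat (if i = 0 then 1 else 0) * real (L (0, Suc j) i))) = real (as ! j) * (1 - m j)"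
      by simp
  qed
  then have E: "(\<Sum>j<length as. real (as ! j) * (1 - m j)) \<le> real (sum_list as - t)"
    using b by (simp add: within_bounds_def)
  have B: "(\<Sum>j<length as. real (as ! j) * real (l j)) \<le> real_of_rat (budget ?I)"
    using L unfolding feasible_layout_def star_msp_simps sum_star by (simp add: l_def)
  have "(\<Sum>j<length as. real (as ! j) * (1 - m j)) = real (sum_list as) - (\<Sum>j<length as. real (as ! j) * m j)"
    by (simp add: sum_list_real algebra_simps sum_subtractf)
  with E have E': "real (sum_list as) - real (sum_list as - t) \<le> (\<Sum>j<length as. real (as ! j) * m j)" by linarith
  also have "... \<le> (\<Sum>j<length as. real (as ! j) * real (l j))"
    using M0(2) by (intro sum_mono mult_left_mono) auto
  finally have E2: "real (sum_list as) - real (sum_list as - t) \<le> (\<Sum>j<length as. real (as ! j) * real (l j))" .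
  \<comment> \<open>Otherwise the energy bound is the truncated difference 0, so every edge would
    have to be served, but the budget \<open>1 / 2\<close> is below every weight. With budget
    \<open>t\<close> such an instance could be solvable without a solution of the equation.\<close>
  have le: "t \<le> sum_list as"
  proof (rule ccontr)
    assume n: "\<not> t \<le> sum_list as"
    have "as ! 0 \<le> sum_list as" "as ! 0 > 0" using as pos by (auto intro: member_le_sum_list)
    then have "1 \<le> real (sum_list as)" by linarith
    with E2 B n show False by (simp add: of_rat_divide)
  qed
  have "real (\<Sum>j<length as. l j * as ! j) = real t"
    using E2 B le by (simp add: mult.commute of_nat_diff)
  then show ?thesis by (auto simp only: of_nat_eq_iff)
qed

text \<open>Multiplicities at most 1 are used as fractions: each edge is served completely or not at
  all.\<close>

lemma star_solvable:
  assumes L: "(\<Sum>j<length as. L j * as ! j) = t" and L1: "!!j. L j \<le> 1"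
  shows "solvable_flow (star_msp as t) (\<lambda>\<kappa> e. real_of_rat (star_flow \<kappa> e))"
proof -
  let ?I = "star_msp as t"
  define F :: flow where "F = (\<lambda>\<kappa> e. real_of_rat (star_flow \<kappa> e))"
  define L' :: layout where "L' = (\<lambda>e i. L (snd e - 1))"
  define M :: split where "M = (\<lambda>\<kappa> e i. if i = 0 then 1 - real (L (snd e - 1)) else real (L (snd e - 1)))"
  have F: "feasible_flow ?I F" unfolding F_def by (rule star_flow_feasible)
  have sumr: "(\<Sum>j<length as. real (as ! j) * real (L j)) = real t"
    using L by (metis (no_types, lifting) mult.commute of_nat_mult of_nat_sum sum.cong)
  have Ls: "real (L j) \<le> 1" for j using L1[of j] by simp
  have Fs: "(\<Sum>\<kappa>\<in>commodities ?I. F \<kappa> (0, Suc j) * g \<kappa>) = g (0, Suc j)" if "j < length as" for j g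
  proof -
    have "(\<Sum>\<kappa>\<in>commodities ?I. F \<kappa> (0, Suc j) * g \<kappa>) = (\<Sum>i<length as. if i = j then g (0, Suc i) else 0)"
      unfolding commodities_star sum_star by (intro sum.cong) (auto simp: F_def star_flow_def)
    then show ?thesis using that by simp
  qed
  have le: "t \<le> sum_list as"
  proof -
    have "(\<Sum>j<length as. L j * as ! j) \<le> (\<Sum>j<length as. 1 * as ! j)"
      by (intro sum_mono mult_right_mono) (use L1 in auto)
    then show ?thesis unfolding L by (simp add: sum_list_sum_nth atLeast0LessThan)
  qed
  have "feasible_layout ?I L'"
    unfolding feasible_layout_def star_msp_simps sum_star using le sumr by (simp add: L'_def)
  moreover have "feasible_split ?I F L' M"
    unfolding feasible_split_def
  proof (intro conjI ballI allI impI)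
    fix \<kappa> e i assume "i \<le> modes ?I"
    then show "M \<kappa> e i \<in> {0..1}" using Ls by (auto simp: M_def)
  next
    fix \<kappa> e
    show "(\<Sum>i=0..modes ?I. M \<kappa> e i) = 1" by (simp add: M_def)
  next
    fix e i assume e: "e \<in> edges ?I" and "i \<in> {1..modes ?I}"
    then have i: "i = 1" by simp
    from e obtain j where "e = (0, Suc j)" "j < length as" by auto
    then show "(\<Sum>\<kappa>\<in>commodities ?I. F \<kappa> e * M \<kappa> e i) \<le> real_of_rat (capacity ?I i) * real (L' e i)"
      using Fs[of j] by (simp add: M_def L'_def i)
  qed
  moreover have "within_bounds ?I F L' M"
  proof -
    have "total_energy ?I F L' M = (\<Sum>j<length as. real (as ! j) * (1 - real (L j)))"
      unfolding total_energy_def star_msp_simps sum_star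
    proof (intro sum.cong refl)
      fix j assume "j \<in> {..<length as}"
      then have j: "j < length as" by simp
      have "total_flow ?I F (0, Suc j) * total_split ?I F M (0, Suc j) 0 = 1 - real (L j)"
        using total_flow_split[OF F, of "(0, Suc j)" M 0] Fs[OF j] j by (simp add: M_def)
      then show "real_of_rat (of_nat (as ! (snd (0, Suc j) - 1))) *
         (real_of_rat (if (0::nat) = 0 then 1 else 0) * total_flow ?I F (0, Suc j) * total_split ?I F M (0, Suc j) 0 +
          (\<Sum>i = 1..1. real_of_rat (if i = 0 then 1 else 0) * real (L' (0, Suc j) i))) = real (as ! j) * (1 - real (L j))"
        by simp
    qed
    also have "... = real (sum_list as) - real t"
      using sumr by (simp add: sum_list_real algebra_simps sum_subtractf)
    finally show ?thesis using le by (simp add: within_bounds_def of_nat_diff of_rat_diff)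
  qed
  ultimately show ?thesis
    using F unfolding solvable_flow_def feasible_solution_def F_def[symmetric] by blast
qed

section \<open>The reductions\<close>

definition cvt :: "ctile => tile" where
  "cvt t = (to_nat (fst t), to_nat (fst (snd t)), to_nat (fst (snd (snd t))), to_nat (snd (snd (snd t))))"

lemma tiling_cvt:
  assumes "W > 0"
  shows "(\<exists>\<tau>. tiling (cvt ` T) R W (\<lambda>c. to_nat (bc c)) (to_nat tc) \<tau>) \<longleftrightarrow> (\<exists>\<tau>. ctiling T R W bc tc \<tau>)"
proof
  assume "\<exists>\<tau>. ctiling T R W bc tc \<tau>"
  then obtain \<tau> where "ctiling T R W bc tc \<tau>" by blast
  then have "tiling (cvt ` T) R W (\<lambda>c. to_nat (bc c)) (to_nat tc) (\<lambda>r c. cvt (\<tau> r c))"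
    unfolding tiling_def ctiling_def by (auto simp: cvt_def north_def south_def east_def west_def)
  then show "\<exists>\<tau>. tiling (cvt ` T) R W (\<lambda>c. to_nat (bc c)) (to_nat tc) \<tau>" by blast
next
  assume "\<exists>\<tau>. tiling (cvt ` T) R W (\<lambda>c. to_nat (bc c)) (to_nat tc) \<tau>"
  then obtain \<tau> where t: "tiling (cvt ` T) R W (\<lambda>c. to_nat (bc c)) (to_nat tc) \<tau>" by blast
  then have "\<forall>r c. \<exists>t. r < R \<and> c < W --> t \<in> T \<and> \<tau> r c = cvt t"
    unfolding tiling_def by (meson imageE)
  then obtain \<sigma> where \<sigma>: "!!r c. r < R ==> c < W ==> \<sigma> r c \<in> T \<and> \<tau> r c = cvt (\<sigma> r c)" by metis
  have "ctiling T R W bc tc \<sigma>"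
    unfolding ctiling_def
  proof (intro allI impI)
    fix r c assume rc: "r < R" "c < W"
    have n: "nxt W c < W" using rc by (auto simp: nxt_def)
    have "east (\<tau> r c) = west (\<tau> r (nxt W c)) \<and>
        south (\<tau> r c) = (if r = 0 then to_nat (bc c) else north (\<tau> (r - 1) c)) \<and>
        (Suc r = R --> north (\<tau> r c) = to_nat tc)"
      using t rc unfolding tiling_def by blast
    then show "\<sigma> r c \<in> T \<and> fst (snd (snd (\<sigma> r c))) = snd (snd (snd (\<sigma> r (nxt W c)))) \<and>
        fst (snd (\<sigma> r c)) = (if r = 0 then bc c else fst (\<sigma> (r - 1) c)) \<and>
        (Suc r = R --> fst (\<sigma> r c) = tc)"
      using \<sigma>[OF rc] \<sigma>[OF rc(1) n] \<sigma>[of "r - 1" c] rc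
      by (auto simp: cvt_def north_def south_def east_def west_def split: if_splits)
  qed
  then show "\<exists>\<tau>. ctiling T R W bc tc \<tau>" by blast
qed

text \<open>Each step lengthens the number by at most the bit lengths of base and digit and a
  constant, so the accumulator grows additively.\<close>

lemma pt_horner [pti]:
  assumes "pt \<beta>" "pt (\<lambda>p. d (fst p) (snd p))" "pt i" "pt ks"
  shows "pt (\<lambda>x. horner (\<beta> x) (d x) (i x) (ks x))"
proof -
  obtain p q where p: "!!x. sz (\<beta> x) \<le> poly p (sz x)" and q: "!!x. sz (d (fst x) (snd x)) \<le> poly q (sz x)"
    using pt_size[OF assms(1)] pt_size[OF assms(2)] by metis
  show ?thesis
    unfolding horner_def
  proof (rule pt_foldl[where q = "p + pcompose q [:1, 1:] + [:6:]"])
    fix x a y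
    have "sz (a * \<beta> x + d x y) \<le> sz a + sz (\<beta> x) + sz (d x y) + 6"
      using bl_add[of "a * \<beta> x" "d x y"] bl_mult[of a "\<beta> x"] by (simp add: sz_nat)
    also have "... \<le> sz a + poly p (sz x + sz y) + poly q (1 + (sz x + sz y)) + 6"
      using order_trans[OF p[of x] poly_nat_mono[of "sz x" "sz x + sz y" p]] q[of "(x, y)"] by (simp add: add_mono)
    finally show "sz (a * \<beta> x + d x y) \<le> sz a + poly (p + pcompose q [:1, 1:] + [:6:]) (sz x + sz y)"
      by (simp add: poly_pcompose)
  qed (intro pti assms pt_comp[OF assms(1)] pt_comp2[OF assms(2)])+
qed

lemma pt_nxt [pti]: "pt f ==> pt g ==> pt (\<lambda>x. nxt (f x) (g x))"
  unfolding nxt_def by (intro pti)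

lemma pt_dg [pti]: "pt w ==> pt v ==> pt k ==> pt (\<lambda>x. dg C (w x) (v x) (k x))"
  unfolding dg_def north_def south_def east_def west_def by (intro pti)

lemma pt_tg [pti]:
  assumes "pt r" "pt (\<lambda>p. b (fst p) (snd p))" "pt k"
  shows "pt (\<lambda>x. tg C (r x) (b x) tc (k x))"
  unfolding tg_def by (intro pti pt_comp2[OF assms(2)] assms(1,3))

lemma pt_upt_Suc [pti]:
  assumes "pt l" shows "pt (\<lambda>x. [0..<Suc (length (l x))])"
proof -
  have "pt (\<lambda>x. [0..<length (() # map (\<lambda>_. ()) (l x))])" by (intro pti assms)
  then show ?thesis by simp
qed

text \<open>The dimensions occur as lengths of lists, that is in unary, which is affordable as they
  are polynomial in the input length.\<close>

lemma pt_tvars [pti]: "pt r ==> pt w ==> pt (\<lambda>x. tvars T (length (r x)) (length (w x)))"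
  unfolding tvars_def by (intro pti)

lemma pt_tkeys [pti]: "pt r ==> pt w ==> pt (\<lambda>x. tkeys (length (r x)) (length (w x)))"
  unfolding tkeys_def by (intro pti)

lemma pt_tbase [pti]: "pt r ==> pt w ==> pt (\<lambda>x. tbase C (r x) (w x))"
  unfolding tbase_def by (intro pti)

lemma pt_tnum [pti]:
  assumes "pt r" "pt w" "pt v" shows "pt (\<lambda>x. tnum C (length (r x)) (length (w x)) (v x))"
  unfolding tnum_def by (intro pti pt_comp[OF assms(1)] pt_comp[OF assms(2)] pt_comp[OF assms(3)])

lemma pt_ttarget [pti]:
  assumes "pt r" "pt w" "pt (\<lambda>p. b (fst p) (snd p))"
  shows "pt (\<lambda>x. ttarget C (length (r x)) (length (w x)) (b x) tc)"
  unfolding ttarget_def by (intro pti pt_comp[OF assms(1)] pt_comp[OF assms(2)] pt_comp2[OF assms(3)])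

text \<open>Deliberately asymmetric: members have a solution with multiplicities at most 1, as the
  star requires, and any natural solution proves membership, as the single edge requires. One
  reduction feeds both constructions.\<close>

definition sum_reduction :: "bool list set => (bool list => nat list) => (bool list => nat) => bool" where
  "sum_reduction A as t \<longleftrightarrow> pt as \<and> pt t \<and> (\<forall>x. t x > 0 \<and> as x \<noteq> [] \<and> (\<forall>a\<in>set (as x). a > 0) \<and>
    (x \<in> A --> (\<exists>L. (\<forall>j. L j \<le> 1) \<and> (\<Sum>j<length (as x). L j * as x ! j) = t x)) \<and>
    ((\<exists>L. (\<Sum>j<length (as x). L j * as x ! j) = t x) --> x \<in> A))"

lemma NP_sums:
  assumes "A \<in> NP" shows "\<exists>as t. sum_reduction A as t"
proof -
  obtain M p q where wf: "wf_tm M" and k2: "num_tapes M \<ge> 2"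
    and hlt: "!!x u. length u \<le> poly q (length x) ==> halted M (run M [x, u] (poly p (length x)))"
    and acc: "!!x. x \<in> A \<longleftrightarrow> (\<exists>u. length u \<le> poly q (length x) \<and> fst (run M [x, u] (poly p (length x))) = accept M)"
    using assms unfolding NP_def by blast
  \<comment> \<open>At least the running time, the certificate length and the input length; padding
    the run does not change the verdict.\<close>
  define P where "P = p + q + [:0, 1:]"
  define uN where "uN x = replicate (poly P (length x)) ()" for x :: "bool list"
  define uR where "uR x = () # () # uN x" for x
  define uW where "uW x = () # (uN x @ uN x)" for x
  define uc where "uc x = replicate (poly q (length x)) ()" for x :: "bool list"
  obtain T :: "tile list" where T: "set T = cvt ` ctiles M" "distinct T"
    using finite_distinct_list[OF finite_imageI[OF finite_ctiles]] by metis
  define vi where "vi s h al = to_nat (VInit s h al)" for s h al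
  \<comment> \<open>A constant of the machine: the largest number of a colour that occurs on a tile,
    in the top row or in the bottom row.\<close>
  define C where "C = Max ((\<Union>t\<in>set T. {north t, south t, east t, west t}) \<union> {to_nat VFin} \<union>
     (\<lambda>(s, h, al). vi s h al) ` ({..<3} \<times> UNIV \<times> UNIV))"
  have C: "v \<le> C" if "v \<in> (\<Union>t\<in>set T. {north t, south t, east t, west t}) \<union> {to_nat VFin} \<union>
     (\<lambda>(s, h, al). vi s h al) ` ({..<3} \<times> UNIV \<times> UNIV)" for v
    unfolding C_def using that by (intro Max_ge) auto
  \<comment> \<open>The bottom colours are tabulated by cases so that only finitely many constants
    \<open>vi\<close> occur and the numbering of colours never has to be computed.\<close>
  define w where "w x c s = (if c = 0 then (if c < length (uc x) then vi s True True else vi s True False)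
     else (if c < length (uc x) then vi s False True else vi s False False))" for x c and s :: nat
  define b where "b x c = (if c < length x then (if nthd False x c then w x c 2 else w x c 1) else w x c 0)" for x c
  have pu: "pt uN" "pt uc"
    unfolding uN_def[abs_def] uc_def[abs_def] by (intro pt_replicate_poly pti)+
  have pu': "pt uR" "pt uW"
    unfolding uR_def[abs_def] uW_def[abs_def] by (intro pti pu pt_comp[OF pu(1)])+
  have pb: "pt (\<lambda>p. b (fst p) (snd p))"
    unfolding b_def w_def by (intro pti pt_comp[OF pu(2)])
  define as where "as x = map (\<lambda>v. tnum C (length (uR x)) (length (uW x)) v) (tvars T (length (uR x)) (length (uW x)))" for x
  define t where "t x = ttarget C (length (uR x)) (length (uW x)) (b x) (to_nat VFin)" for x
  have pas: "pt as"
    unfolding as_def[abs_def] by (intro pti pu' pt_comp[OF pu'(1)] pt_comp[OF pu'(2)])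
  have pT: "pt t"
    unfolding t_def[abs_def] by (intro pti pu' pb)
  have main: "t x > 0 \<and> as x \<noteq> [] \<and> (\<forall>a\<in>set (as x). a > 0) \<and>
    (x \<in> A --> (\<exists>L. (\<forall>j. L j \<le> 1) \<and> (\<Sum>j<length (as x). L j * as x ! j) = t x)) \<and>
    ((\<exists>L. (\<Sum>j<length (as x). L j * as x ! j) = t x) --> x \<in> A)" for x
  proof -
    define N where "N = poly P (length x)"
    interpret tm: tm_tiles M N x "poly q (length x)"
      by unfold_locales (auto simp: wf k2 N_def P_def)
    have "length (uW x) = 2 * N + 1" by (simp add: uW_def uN_def N_def)
    then have len: "length (uR x) = N + 2" "length (uW x) = tm.W" "length (uc x) = poly q (length x)"
      unfolding tm.W_def by (simp_all add: uR_def uN_def uc_def N_def)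
    have bx: "b x = (\<lambda>c. to_nat (tm.bcol c))"
      unfolding fun_eq_iff b_def w_def len(3) by (auto simp: vi_def tm.bcol_def nthd_def)
    have W0: "tm.W > 0" by (simp add: tm.W_def)
    have cl: "north u \<le> C \<and> south u \<le> C \<and> east u \<le> C \<and> west u \<le> C" if "u \<in> set T" for u
      using that by (intro conjI C) auto
    have bC: "to_nat (tm.bcol c) \<le> C" for c
      by (rule C, rule UnI2, rule image_eqI[where x = "(if c < length x then (if x ! c then 2 else 1) else 0, c = 0, c < poly q (length x))"])
        (auto simp: tm.bcol_def vi_def)
    interpret ts: tile_sum T "N + 2" tm.W "\<lambda>c. to_nat (tm.bcol c)" "to_nat VFin" C
    proof
      show "to_nat VFin \<le> C" by (rule C) simp
    qed (use W0 T(2) cl bC in simp_all)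
    have same: "fst (run M [x, u] N) = fst (run M [x, u] (poly p (length x)))" if "length u \<le> poly q (length x)" for u
    proof -
      have "N = (poly q (length x) + length x) + poly p (length x)" by (simp add: N_def P_def)
      then have "run M [x, u] N = (step M ^^ (poly q (length x) + length x)) (run M [x, u] (poly p (length x)))"
        unfolding run_def by (simp add: funpow_add)
      also have "... = run M [x, u] (poly p (length x))" by (rule step_halted[OF hlt[OF that]])
      finally show ?thesis by simp
    qed
    have til: "x \<in> A \<longleftrightarrow> (\<exists>\<tau>. tiling (set T) (N + 2) tm.W (\<lambda>c. to_nat (tm.bcol c)) (to_nat VFin) \<tau>)"
    proof -
      have "x \<in> A \<longleftrightarrow> (\<exists>u. length u \<le> poly q (length x) \<and> fst (run M [x, u] N) = accept M)"
        unfolding acc using same by (intro ex_cong1) auto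
      also have "... \<longleftrightarrow> (\<exists>\<tau>. ctiling (ctiles M) (N + 2) tm.W tm.bcol VFin \<tau>)"
        using tm.accept_imp_ctiling tm.ctiling_imp_accept by blast
      finally show ?thesis unfolding T tiling_cvt[OF W0] .
    qed
    have sum: "(\<Sum>j<length (as x). L j * as x ! j) = (\<Sum>j<length ts.vs. L j * tnum C (N + 2) tm.W (ts.vs ! j))" for L
      unfolding as_def len by (intro sum.cong) auto
    have tx: "t x = ttarget C (N + 2) tm.W (\<lambda>c. to_nat (tm.bcol c)) (to_nat VFin)"
      unfolding t_def len bx ..
    have "itile M 0 0 False False False \<in> ctiles M"
      unfolding ctiles_def itiles_def by (intro UnI1 UnI2 CollectI exI conjI) auto
    then have "T \<noteq> []" using T(1) by auto
    then have "ts.vs \<noteq> []" using W0 T(1) by (auto simp: tvars_def product_concat_map)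
    then have "as x \<noteq> []" by (simp add: as_def len)
    moreover have "\<forall>a\<in>set (as x). a > 0" using tnum_pos W0 by (auto simp: as_def len)
    moreover have "t x > 0" unfolding tx using W0 by (intro ttarget_pos) auto
    moreover have "\<exists>L. (\<forall>j. L j \<le> 1) \<and> (\<Sum>j<length (as x). L j * as x ! j) = t x" if "x \<in> A"
      using that ts.tiling_imp_sum unfolding til sum tx by blast
    moreover have "x \<in> A" if "(\<Sum>j<length (as x). L j * as x ! j) = t x" for L
      using that ts.sum_imp_tiling unfolding til sum tx by blast
    ultimately show ?thesis by blast
  qed
  show ?thesis
    unfolding sum_reduction_def
    by (rule exI[of _ as], rule exI[of _ t], rule conjI[OF pas conjI[OF pT allI[OF main]]])
qed

lemma sum_reductionD:
  assumes "sum_reduction A as t"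
  shows "pt as" "pt t" "t x > 0" "as x \<noteq> []" "a \<in> set (as x) ==> a > 0"
    "x \<in> A ==> \<exists>L. (\<forall>j. L j \<le> 1) \<and> (\<Sum>j<length (as x). L j * as x ! j) = t x"
    "\<exists>L. (\<Sum>j<length (as x). L j * as x ! j) = t x ==> x \<in> A"
proof -
  note H = assms[unfolded sum_reduction_def]
  note H' = H[THEN conjunct2, THEN conjunct2, THEN spec, of x]
  show "pt as" by (rule H[THEN conjunct1])
  show "pt t" by (rule H[THEN conjunct2, THEN conjunct1])
  show "t x > 0" by (rule H'[THEN conjunct1])
  show "as x \<noteq> []" by (rule H'[THEN conjunct2, THEN conjunct1])
  show "a \<in> set (as x) ==> a > 0" by (rule H'[THEN conjunct2, THEN conjunct2, THEN conjunct1, THEN bspec])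
  show "x \<in> A ==> \<exists>L. (\<forall>j. L j \<le> 1) \<and> (\<Sum>j<length (as x). L j * as x ! j) = t x"
    by (rule H'[THEN conjunct2, THEN conjunct2, THEN conjunct2, THEN conjunct1, THEN mp])
  show "\<exists>L. (\<Sum>j<length (as x). L j * as x ! j) = t x ==> x \<in> A"
    by (rule H'[THEN conjunct2, THEN conjunct2, THEN conjunct2, THEN conjunct2, THEN mp])
qed

section \<open>The produced instances as data\<close>

definition fr0 :: fr where "fr0 = (0, 1)"
definition fr1 :: fr where "fr1 = (1, 1)"

lemma fr_of_nat: "fr (of_nat n) = (n, 1)"
  using fr_frval[of "(n, 1)"] by (simp add: frval_def valid_fr_def)

lemma fr_0: "fr 0 = fr0" and fr_1: "fr 1 = fr1" and fr_half: "fr (1 / 2) = (1, 2)"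
  using fr_of_nat[of 0] fr_of_nat[of 1] fr_frval[of "(1, 2)"]
  by (auto simp: fr0_def fr1_def frval_def valid_fr_def)

text \<open>The instance in list operations alone, from which polynomial-time computability can be
  read off directly.\<close>

definition edge_dat :: "nat list => nat => dat" where
  "edge_dat as t = ([[None, Some fr1], [None, None]], (t, 1), [[0, t], [0, 0]],
     (fr0, fr1, fr0, fr1) # map (\<lambda>a. (fr0, fr0, (a, 1), (a, 1))) as, None, fr0)"

lemma todata_edge: "todata (edge_msp as t) = edge_dat as t"
proof -
  have "map (\<lambda>i. (fr 0, fr (if i = 0 then 1 else 0), fr (if i = 0 then 0 else of_nat (as ! (i - 1))),
       fr (if i = 0 then 1 else of_nat (as ! (i - 1))))) [0..<Suc (length as)] =
     (fr0, fr1, fr0, fr1) # map (\<lambda>a. (fr0, fr0, (a, 1), (a, 1))) as"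
    by (rule nth_equalityI) (auto simp: nth_Cons' fr_0 fr_1 fr_of_nat simp del: upt_Suc)
  moreover have "[0..<2] = [0, 1 :: nat]" by (simp add: numeral_2_eq_2)
  ultimately show ?thesis
    by (simp add: todata_def edge_dat_def Let_def fr_of_nat fr_0 fr_1 del: upt_Suc)
qed

definition star_dat :: "nat list => nat => dat" where
  "star_dat as t = ((None # map (\<lambda>a. Some (a, 1)) as) # map (\<lambda>_. None # map (\<lambda>_. None) as) as,
     (if t \<le> sum_list as then (t, 1) else (1, 2)),
     (0 # map (\<lambda>_. 1) as) # map (\<lambda>_. 0 # map (\<lambda>_. 0) as) as,
     [(fr0, fr1, fr0, fr1), (fr0, fr0, fr1, fr1)], None, (sum_list as - t, 1))"

lemma todata_star: "todata (star_msp as t) = star_dat as t"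
proof -
  let ?I = "star_msp as t"
  have up: "[0..<Suc n] = 0 # map Suc [0..<n]" for n
    by (simp add: upt_conv_Cons map_Suc_upt del: upt_Suc)
  have mp: "map f as = map (\<lambda>j. f (as ! j)) [0..<length as]" for f :: "nat => 'b"
    using map_map[of f "(!) as" "[0..<length as]"] by (simp add: map_nth o_def)
  have 1: "map (\<lambda>u. map (\<lambda>v. if (u, v) \<in> edges ?I then Some (fr (weight ?I (u, v))) else None) [0..<Suc (length as)]) [0..<Suc (length as)]
     = (None # map (\<lambda>a. Some (a, 1)) as) # map (\<lambda>_. None # map (\<lambda>_. None) as) as"
    unfolding up mp by (auto simp: fr_of_nat o_def)
  have 2: "map (\<lambda>u. map (\<lambda>v. demand ?I (u, v)) [0..<Suc (length as)]) [0..<Suc (length as)]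
     = (0 # map (\<lambda>_. 1) as) # map (\<lambda>_. 0 # map (\<lambda>_. 0) as) as"
    unfolding up mp by (simp add: o_def)
  have 3: "[0..<Suc 1] = [0, 1]" by simp
  show ?thesis
    unfolding todata_def star_dat_def Let_def star_msp_simps(1) 1[unfolded star_msp_simps(1)] 2 star_msp_simps(6) 3
    by (simp add: fr_of_nat fr_0 fr_1 fr_half)
qed

definition star_flow_enc :: "nat list => bool list" where
  "star_flow_enc as = enc_list (\<lambda>i. enc_list (\<lambda>j. encf (if i = j then fr1 else fr0)) [0..<length as]) [0..<length as]"

lemma filter_product_star:
  "filter (\<lambda>e. e \<in> (\<lambda>j. (0, Suc j)) ` {..<n}) (List.product [0..<Suc n] [0..<Suc n]) = map (\<lambda>j. (0, Suc j)) [0..<n]"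
proof -
  have 1: "filter (\<lambda>e. e \<in> (\<lambda>j. (0, Suc j)) ` {..<n}) (map (Pair 0) [0..<Suc n]) = map (\<lambda>j. (0, Suc j)) [0..<n]"
  proof -
    have "[0..<Suc n] = 0 # map Suc [0..<n]" by (simp add: upt_conv_Cons map_Suc_upt del: upt_Suc)
    then show ?thesis by (simp add: filter_map o_def del: upt_Suc) (auto intro!: filter_True)
  qed
  have 2: "filter (\<lambda>e. e \<in> (\<lambda>j. (0, Suc j)) ` {..<n}) (List.product us [0..<Suc n]) = []" if "0 \<notin> set us" for us
    using that by (auto simp: filter_empty_conv)
  have "[0..<Suc n] = 0 # [1..<Suc n]" by (simp add: upt_conv_Cons del: upt_Suc)
  then have e: "List.product [0..<Suc n] [0..<Suc n] = map (Pair 0) [0..<Suc n] @ List.product [1..<Suc n] [0..<Suc n]"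
    by (metis product.simps(2))
  show ?thesis unfolding e filter_append 1 using 2[of "[1..<Suc n]"] by (simp del: upt_Suc)
qed

lemma enc_flow_star: "enc_flow (star_msp as t) star_flow = star_flow_enc as"
proof -
  have l: "enc_list f (map g xs) = enc_list (\<lambda>x. f (g x)) xs" for f :: "'a => bool list" and g :: "'b => 'a" and xs
    by (simp add: enc_list_def o_def)
  have e: "enc_rat 1 = encf fr1" "enc_rat 0 = encf fr0"
    using enc_rat_fr[of 1] enc_rat_fr[of 0] by (auto simp: fr_1 fr_0)
  have "enc_rat (star_flow (0, Suc i) (0, Suc j)) = encf (if i = j then fr1 else fr0)" for i j
    by (auto simp: star_flow_def e)
  then show ?thesis
    unfolding enc_flow_def Let_def commodities_star star_msp_simps(1,2) filter_product_star l star_flow_enc_def by simp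
qed

lemma pt_edge_dat: "pt as ==> pt t ==> pt (\<lambda>x. encd (edge_dat (as x) (t x)))"
  unfolding edge_dat_def by (intro pti)

lemma pt_star_dat:
  assumes "pt as" "pt t" shows "pt (\<lambda>x. encd (star_dat (as x) (t x)))"
  unfolding star_dat_def by (intro pti pt_comp[OF assms(1)] assms(2))

lemma pt_star_flow_enc:
  assumes "pt as" shows "pt (\<lambda>x. star_flow_enc (as x))"
  unfolding star_flow_enc_def by (intro pti pt_comp[OF assms])

lemma NP_edge:
  assumes "A \<in> NP"
  shows "\<exists>f. pt f \<and> (\<forall>x. \<exists>I. f x = enc_msp I \<and> msp_instance I \<and> single_unit_edge I \<and> (x \<in> A \<longleftrightarrow> solvable I))"
proof -
  obtain as t where H: "sum_reduction A as t" using NP_sums[OF assms] by blast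
  note at = sum_reductionD(1,2)[OF H]
  have I: "encd (edge_dat (as x) (t x)) = enc_msp (edge_msp (as x) (t x)) \<and> msp_instance (edge_msp (as x) (t x)) \<and>
      single_unit_edge (edge_msp (as x) (t x)) \<and> (x \<in> A \<longleftrightarrow> solvable (edge_msp (as x) (t x)))" for x
  proof -
    note t = sum_reductionD(3)[OF H, of x] and pos = sum_reductionD(5)[OF H, of _ x]
    note inst = edge_msp_instance[OF pos t]
    have "x \<in> A \<longleftrightarrow> (\<exists>L. (\<Sum>j<length (as x). L j * as x ! j) = t x)"
    proof (rule iffI)
      assume "x \<in> A"
      from sum_reductionD(6)[OF H this] show "\<exists>L. (\<Sum>j<length (as x). L j * as x ! j) = t x"
        by (elim exE conjE) (rule exI)
    qed (rule sum_reductionD(7)[OF H])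
    from trans[OF this edge_msp_solvable[OF pos t, symmetric]]
    have "x \<in> A \<longleftrightarrow> solvable (edge_msp (as x) (t x))" .
    then show ?thesis
      using inst enc_msp_todata[OF inst(1)] by (simp add: todata_edge)
  qed
  show ?thesis
    by (rule exI, rule conjI, rule pt_edge_dat[OF at], rule allI, rule exI, rule I)
qed

lemma NP_star:
  assumes "A \<in> NP"
  shows "\<exists>f g. pt f \<and> pt g \<and> (\<forall>x. \<exists>I F. f x = enc_msp I \<and> g x = enc_msp I @ enc_flow I F \<and> msp_instance I \<and>
    tree_like (graph_of I) \<and> modes I = 1 \<and> feasible_flow I (rflow F) \<and>
    (x \<in> A \<longleftrightarrow> solvable I) \<and> (x \<in> A \<longleftrightarrow> solvable_flow I (rflow F)))"
proof -
  obtain as t where H: "sum_reduction A as t" using NP_sums[OF assms] by blast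
  note at = sum_reductionD(1,2)[OF H]
  let ?f = "\<lambda>x. encd (star_dat (as x) (t x))"
  have I: "?f x = enc_msp (star_msp (as x) (t x)) \<and>
    ?f x @ star_flow_enc (as x) = enc_msp (star_msp (as x) (t x)) @ enc_flow (star_msp (as x) (t x)) star_flow \<and>
    msp_instance (star_msp (as x) (t x)) \<and>
    tree_like (graph_of (star_msp (as x) (t x))) \<and> modes (star_msp (as x) (t x)) = 1 \<and>
    feasible_flow (star_msp (as x) (t x)) (\<lambda>\<kappa> e. real_of_rat (star_flow \<kappa> e)) \<and>
    (x \<in> A \<longleftrightarrow> solvable (star_msp (as x) (t x))) \<and>
    (x \<in> A \<longleftrightarrow> solvable_flow (star_msp (as x) (t x)) (\<lambda>\<kappa> e. real_of_rat (star_flow \<kappa> e)))" for x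
  proof -
    note t = sum_reductionD(3)[OF H, of x] and ne = sum_reductionD(4)[OF H, of x]
      and pos = sum_reductionD(5)[OF H, of _ x]
    have inst: "msp_instance (star_msp (as x) (t x))" by (rule star_msp_instance[OF t])
    have "solvable_flow (star_msp (as x) (t x)) (\<lambda>\<kappa> e. real_of_rat (star_flow \<kappa> e))" if xA: "x \<in> A"
    proof -
      obtain L where L: "\<forall>j. L j \<le> 1" "(\<Sum>j<length (as x). L j * as x ! j) = t x"
        using sum_reductionD(6)[OF H xA] by (elim exE conjE)
      show ?thesis by (rule star_solvable[OF L(2) L(1)[THEN spec]])
    qed
    moreover have "x \<in> A" if "solvable (star_msp (as x) (t x))"
      by (rule sum_reductionD(7)[OF H star_solvable_imp[OF that pos ne]])
    ultimately have "x \<in> A \<longleftrightarrow> solvable (star_msp (as x) (t x))"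
      "x \<in> A \<longleftrightarrow> solvable_flow (star_msp (as x) (t x)) (\<lambda>\<kappa> e. real_of_rat (star_flow \<kappa> e))"
      unfolding solvable_def by blast+
    then show ?thesis
    proof (intro conjI)
      show "?f x = enc_msp (star_msp (as x) (t x))" unfolding enc_msp_todata[OF inst] todata_star ..
      then show "?f x @ star_flow_enc (as x) = enc_msp (star_msp (as x) (t x)) @ enc_flow (star_msp (as x) (t x)) star_flow"
        by (simp only: enc_flow_star)
      show "modes (star_msp (as x) (t x)) = 1" by simp
    qed (rule inst star_tree_like star_flow_feasible | assumption)+
  qed
  have 1: "pt ?f" by (rule pt_star_dat[OF at])
  have 2: "pt (\<lambda>x. ?f x @ star_flow_enc (as x))"
    by (rule pt_append[OF 1 pt_star_flow_enc[OF at(1)]])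
  show ?thesis
    by (rule exI, rule exI, rule conjI, rule 1, rule conjI, rule 2, rule allI, rule exI, rule exI, rule I)
qed

section \<open>Small solutions of linear inequalities\<close>

text \<open>Pigeonhole: the box of integer points with coordinates from 0 to \<open>H\<close> has
  more points than the linear forms have values on it, and the difference of two points with equal
  values solves the system.\<close>

lemma siegel:
  fixes a :: "'i => 'j => int" and M :: nat
  assumes fin: "finite I" "finite J" and card: "card I < card J"
    and M: "!!i j. i \<in> I ==> j \<in> J ==> \<bar>a i j\<bar> \<le> int M"
  shows "\<exists>y. (\<exists>j\<in>J. y j \<noteq> 0) \<and> (\<forall>i\<in>I. (\<Sum>j\<in>J. a i j * y j) = 0) \<and>
    (\<forall>j\<in>J. \<bar>y j\<bar> \<le> int ((2 * card J * M + 1) ^ card I))"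
proof -
  let ?m = "card I" and ?n = "card J"
  \<comment> \<open>With n unknowns and m equations there are at most \<open>(2nMH + 1)^m\<close>
    values, and \<open>(2nMH + 1)^m \<le> (2nM + 1)^m (H + 1)^m = H (H + 1)^m < (H + 1)^n\<close>;
    this dictates \<open>H\<close>.\<close>
  define H where "H = (2 * ?n * M + 1) ^ ?m"
  define B where "B = int (?n * M * H)"
  let ?X = "PiE J (\<lambda>_. {0..int H})" and ?Y = "PiE I (\<lambda>_. {- B..B})"
  define f where "f y = (\<lambda>i\<in>I. \<Sum>j\<in>J. a i j * y j)" for y
  have "f y \<in> ?Y" if "y \<in> ?X" for y
  proof -
    have "\<bar>\<Sum>j\<in>J. a i j * y j\<bar> \<le> B" if "i \<in> I" for i
    proof -
      have "\<bar>\<Sum>j\<in>J. a i j * y j\<bar> \<le> (\<Sum>j\<in>J. \<bar>a i j * y j\<bar>)" by (rule sum_abs)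
      also have "... \<le> (\<Sum>j\<in>J. int M * int H)"
      proof (rule sum_mono)
        fix j assume "j \<in> J"
        then have "\<bar>y j\<bar> \<le> int H" using \<open>y \<in> ?X\<close> by (auto simp: PiE_iff)
        then show "\<bar>a i j * y j\<bar> \<le> int M * int H"
          unfolding abs_mult by (intro mult_mono M that \<open>j \<in> J\<close>) auto
      qed
      also have "... = B" by (simp add: B_def)
      finally show ?thesis .
    qed
    then show ?thesis by (force simp: f_def PiE_iff)
  qed
  then have im: "f ` ?X \<subseteq> ?Y" by blast
  have "card ?Y = (2 * (?n * M * H) + 1) ^ ?m"
    using fin(1) by (simp add: card_PiE B_def nat_add_distrib nat_mult_distrib mult_ac)
  also have "... \<le> ((2 * ?n * M + 1) * (H + 1)) ^ ?m"
    by (intro power_mono) (auto simp: algebra_simps)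
  also have "... = H * (H + 1) ^ ?m" unfolding power_mult_distrib H_def ..
  also have "... < (H + 1) * (H + 1) ^ ?m" by simp
  also have "... = (H + 1) ^ Suc ?m" by simp
  also have "... \<le> (H + 1) ^ ?n" using card by (intro power_increasing) auto
  also have "... = card ?X" using fin(2) by (simp add: card_PiE nat_add_distrib)
  finally have "card ?Y < card ?X" .
  moreover have "finite ?Y" using fin(1) by (intro finite_PiE) auto
  ultimately have "\<not> inj_on f ?X"
    using card_inj_on_le[OF _ im] by (metis not_le)
  then obtain u v where uv: "u \<in> ?X" "v \<in> ?X" "f u = f v" "u \<noteq> v" by (auto simp: inj_on_def)
  have "\<exists>j\<in>J. u j - v j \<noteq> 0" using uv PiE_ext[of u J _ v] by fastforce
  moreover have "(\<Sum>j\<in>J. a i j * (u j - v j)) = 0" if "i \<in> I" for i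
    using fun_cong[OF uv(3), of i] that by (simp add: f_def algebra_simps sum_subtractf)
  moreover have "\<bar>u j - v j\<bar> \<le> int H" if "j \<in> J" for j
  proof -
    have "0 \<le> u j" "u j \<le> int H" "0 \<le> v j" "v j \<le> int H" using uv that by (auto simp: PiE_iff)
    then show ?thesis by linarith
  qed
  ultimately show ?thesis unfolding H_def by (intro exI[of _ "\<lambda>j. u j - v j"]) blast
qed

text \<open>A vertex of the polyhedron, restricted to a set of linearly independent columns that
  contains its support.\<close>

definition basic_solution :: "'i set => ('i => 'j => int) => ('i => int) => 'j set => ('j => real) => bool" where
  "basic_solution I a b S x \<longleftrightarrow> (\<forall>j\<in>S. x j \<ge> 0) \<and> (\<forall>i\<in>I. (\<Sum>j\<in>S. of_int (a i j) * x j) = of_int (b i)) \<and>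
    (\<forall>d :: 'j => real. (\<forall>i\<in>I. (\<Sum>j\<in>S. of_int (a i j) * d j) = 0) --> (\<forall>j\<in>S. d j = 0))"

text \<open>Along a kernel vector one walks until a first coordinate vanishes, which removes an
  index.\<close>

lemma minimal_support:
  fixes a :: "'i => 'j => int" and b :: "'i => int" and x :: "'j => real"
  assumes "finite J" "!!j. j \<in> J ==> x j \<ge> 0" "!!i. i \<in> I ==> (\<Sum>j\<in>J. of_int (a i j) * x j) = of_int (b i)"
  shows "\<exists>S x. S \<subseteq> J \<and> basic_solution I a b S x"
  using assms
proof (induction "card J" arbitrary: J x rule: less_induct)
  case less
  show ?case
  proof (cases "\<forall>d :: 'j => real. (\<forall>i\<in>I. (\<Sum>j\<in>J. of_int (a i j) * d j) = 0) --> (\<forall>j\<in>J. d j = 0)")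
    case True
    then have "basic_solution I a b J x"
      unfolding basic_solution_def using less.prems(2,3) by simp
    then show ?thesis by blast
  next
    case False
    then obtain d0 :: "'j => real" and j0 where d0: "\<forall>i\<in>I. (\<Sum>j\<in>J. of_int (a i j) * d0 j) = 0" "j0 \<in> J" "d0 j0 \<noteq> 0"
      by blast
    \<comment> \<open>Normalized to have a positive entry, so that the walk must end.\<close>
    define d where "d j = d0 j / d0 j0" for j
    have d: "(\<Sum>j\<in>J. of_int (a i j) * d j) = 0" if "i \<in> I" for i
    proof -
      have "(\<Sum>j\<in>J. of_int (a i j) * d j) = (\<Sum>j\<in>J. of_int (a i j) * d0 j) / d0 j0"
        by (simp add: d_def sum_divide_distrib)
      then show ?thesis using d0(1) that by simp
    qed
    have dj0: "d j0 = 1" using d0(3) by (simp add: d_def)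
    let ?P = "{j \<in> J. d j > 0}"
    have finP: "finite ?P" "?P \<noteq> {}" using less.prems(1) d0(2) dj0 by auto
    define t where "t = Min ((\<lambda>j. x j / d j) ` ?P)"
    have "t \<in> (\<lambda>j. x j / d j) ` ?P" unfolding t_def using finP by (intro Min_in) auto
    then obtain k where k: "k \<in> J" "d k > 0" "t = x k / d k" by auto
    have t_le: "t \<le> x j / d j" if "j \<in> J" "d j > 0" for j
      unfolding t_def using finP that by (intro Min_le) auto
    have t0: "t \<ge> 0" using k less.prems(2)[of k] by simp
    define x' where "x' j = x j - t * d j" for j
    have x'0: "x' j \<ge> 0" if "j \<in> J" for j
    proof (cases "d j > 0")
      case True
      then show ?thesis using t_le[OF that True] by (simp add: x'_def field_simps)
    next
      case False
      then have "t * d j \<le> 0" using t0 by (simp add: mult_nonneg_nonpos)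
      then show ?thesis using less.prems(2)[OF that] by (simp add: x'_def)
    qed
    have x'k: "x' k = 0" using k by (simp add: x'_def)
    have eq: "(\<Sum>j\<in>J. of_int (a i j) * x' j) = of_int (b i)" if "i \<in> I" for i
    proof -
      have "(\<Sum>j\<in>J. of_int (a i j) * x' j) = (\<Sum>j\<in>J. of_int (a i j) * x j) - t * (\<Sum>j\<in>J. of_int (a i j) * d j)"
        by (simp add: x'_def algebra_simps sum_subtractf sum_distrib_left)
      then show ?thesis using d[OF that] less.prems(3)[OF that] by simp
    qed
    have "card (J - {k}) < card J" using k less.prems(1) by (intro card_Diff1_less) auto
    moreover have "(\<Sum>j\<in>J - {k}. of_int (a i j) * x' j) = of_int (b i)" if "i \<in> I" for i
      using eq[OF that] k less.prems(1) by (simp add: sum.remove x'k)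
    ultimately have "\<exists>S x. S \<subseteq> J - {k} \<and> basic_solution I a b S x"
      using less.hyps[of "J - {k}" x'] less.prems(1) x'0 by simp
    then show ?thesis by blast
  qed
qed

text \<open>
  With linearly independent columns the solution is unique and also solves the normal equations,
  which are as many as there are unknowns, so that Siegel's lemma applies to their homogenization.
\<close>

lemma small_solution_eq:
  fixes a :: "'i => 'j => int" and b :: "'i => int" and x :: "'j => real" and M :: nat
  assumes fin: "finite I" "finite J"
    and x: "!!j. j \<in> J ==> x j \<ge> 0" "!!i. i \<in> I ==> (\<Sum>j\<in>J. of_int (a i j) * x j) = of_int (b i)"
    and M: "!!i j. i \<in> I ==> j \<in> J ==> \<bar>a i j\<bar> \<le> int M" "!!i. i \<in> I ==> \<bar>b i\<bar> \<le> int M"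
  shows "\<exists>y (z :: int). z > 0 \<and> z \<le> int ((2 * (card J + 1) * (card I * M ^ 2) + 1) ^ card J) \<and>
    (\<forall>j\<in>J. 0 \<le> y j \<and> y j \<le> int ((2 * (card J + 1) * (card I * M ^ 2) + 1) ^ card J)) \<and>
    (\<forall>i\<in>I. (\<Sum>j\<in>J. a i j * y j) = b i * z)"
proof -
  obtain S x' where S1: "S \<subseteq> J" and bs: "basic_solution I a b S x'"
    using minimal_support[of J x I a b] fin x by blast
  note bs = bs[unfolded basic_solution_def]
  note S = S1 bs[THEN conjunct1, THEN bspec] bs[THEN conjunct2, THEN conjunct1, THEN bspec]
  have ind: "\<forall>j\<in>S. d j = 0" if "!!i. i \<in> I ==> (\<Sum>j\<in>S. of_int (a i j) * d j) = 0" for d :: "'j => real"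
    using bs[THEN conjunct2, THEN conjunct2, THEN spec, of d] that by simp
  have finS: "finite S" using S(1) fin(2) finite_subset by blast
  \<comment> \<open>The extra unknown \<open>None\<close> is the common denominator; the homogenized
    normal equations have one unknown more than there are equations.\<close>
  define J' where "J' = insert None (Some ` S)"
  define c where "c i q = (case q of None => - b i | Some j => a i j)" for i q
  define g where "g k q = (\<Sum>i\<in>I. a i k * c i q)" for k q
  have J': "finite J'" "card J' = card S + 1"
    using finS by (auto simp: J'_def card_image)
  have cM: "\<bar>c i q\<bar> \<le> int M" if "i \<in> I" "q \<in> J'" for i q
    using that M S(1) by (auto simp: c_def J'_def)
  have gM: "\<bar>g k q\<bar> \<le> int (card I * M ^ 2)" if "k \<in> S" "q \<in> J'" for k q
  proof -
    have "\<bar>g k q\<bar> \<le> (\<Sum>i\<in>I. \<bar>a i k * c i q\<bar>)" unfolding g_def by (rule sum_abs)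
    also have "... \<le> (\<Sum>i\<in>I. int M * int M)"
      unfolding abs_mult using that S(1) M(1) cM by (intro sum_mono mult_mono) auto
    also have "... = int (card I * M ^ 2)" by (simp add: power2_eq_square)
    finally show ?thesis .
  qed
  have "\<exists>y. (\<exists>q\<in>J'. y q \<noteq> 0) \<and> (\<forall>k\<in>S. (\<Sum>q\<in>J'. g k q * y q) = 0) \<and>
    (\<forall>q\<in>J'. \<bar>y q\<bar> \<le> int ((2 * card J' * (card I * M ^ 2) + 1) ^ card S))" (is "\<exists>y. ?P y")
    by (rule siegel[OF finS J'(1) _ gM]) (simp_all add: J'(2))
  then obtain y where yy: "?P y"
    by (elim exE)
  note y = yy[THEN conjunct1] yy[THEN conjunct2, THEN conjunct1, THEN bspec]
    yy[THEN conjunct2, THEN conjunct2, THEN bspec]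
  define H where "H = (2 * (card J + 1) * (card I * M ^ 2) + 1) ^ card J"
  have cSJ: "card S \<le> card J" using S(1) fin(2) by (rule card_mono[rotated])
  have "(2 * card J' * (card I * M ^ 2) + 1) ^ card S \<le> (2 * (card J + 1) * (card I * M ^ 2) + 1) ^ card S"
    using cSJ unfolding J'(2) by (intro power_mono add_mono mult_mono) auto
  also have "... \<le> H" unfolding H_def using cSJ by (intro power_increasing) auto
  finally have yH: "\<bar>y q\<bar> \<le> int H" if "q \<in> J'" for q
    using y(3)[OF that] by (meson of_nat_mono order_trans)
  define r where "r i = (\<Sum>q\<in>J'. c i q * y q)" for i
  have sumJ': "(\<Sum>q\<in>J'. h q) = h None + (\<Sum>j\<in>S. h (Some j))" for h :: "'j option => int"
    unfolding J'_def using finS by (simp add: sum.reindex)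
  have r: "r i = (\<Sum>j\<in>S. a i j * y (Some j)) - b i * y None" for i
    by (simp add: r_def sumJ' c_def)
  have ATr: "(\<Sum>i\<in>I. a i k * r i) = 0" if "k \<in> S" for k
  proof -
    have "(\<Sum>i\<in>I. a i k * r i) = (\<Sum>i\<in>I. \<Sum>q\<in>J'. a i k * c i q * y q)"
      by (simp add: r_def sum_distrib_left mult.assoc)
    also have "... = (\<Sum>q\<in>J'. g k q * y q)" by (subst sum.swap) (simp add: g_def sum_distrib_right)
    finally show ?thesis using y(2)[OF that] by simp
  qed
  define d where "d j = of_int (y (Some j)) - of_int (y None) * x' j" for j
  have rd: "real_of_int (r i) = (\<Sum>j\<in>S. of_int (a i j) * d j)" if "i \<in> I" for i
  proof -
    have "(\<Sum>j\<in>S. of_int (a i j) * d j) = (\<Sum>j\<in>S. of_int (a i j) * of_int (y (Some j))) - of_int (y None) * (\<Sum>j\<in>S. of_int (a i j) * x' j)"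
      by (simp add: d_def algebra_simps sum_subtractf sum_distrib_left)
    then show ?thesis using S(3)[OF that] by (simp add: r)
  qed
  \<comment> \<open>The residual \<open>r\<close> is a combination of the columns and orthogonal to
    all of them, so its square sum vanishes and the original equations hold.\<close>
  have "(\<Sum>i\<in>I. real_of_int (r i) * real_of_int (r i)) = (\<Sum>i\<in>I. \<Sum>j\<in>S. real_of_int (r i) * (of_int (a i j) * d j))"
    using rd by (intro sum.cong) (auto simp: sum_distrib_left)
  also have "... = (\<Sum>j\<in>S. d j * real_of_int (\<Sum>i\<in>I. a i j * r i))"
    by (subst sum.swap) (simp add: sum_distrib_left algebra_simps)
  also have "... = 0" using ATr by simp
  finally have "\<forall>i\<in>I. real_of_int (r i) * real_of_int (r i) = 0"
    using sum_nonneg_eq_0_iff[OF fin(1), of "\<lambda>i. real_of_int (r i) * real_of_int (r i)"] by simp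
  then have r0: "r i = 0" if "i \<in> I" for i using that by simp
  have d0: "\<forall>j\<in>S. d j = 0" by (rule ind) (use rd r0 in auto)
  define z where "z = y None"
  \<comment> \<open>With denominator 0, independence would force the whole vector to vanish, but it
    is nontrivial.\<close>
  have z0: "z \<noteq> 0"
  proof
    assume "z = 0"
    then have n: "y None = 0" by (simp add: z_def)
    have "y (Some j) = 0" if "j \<in> S" for j
      using d0[THEN bspec, OF that] n by (simp add: d_def)
    moreover obtain q where "q \<in> J'" "y q \<noteq> 0" using y(1) by blast
    ultimately show False using n by (cases q) (auto simp: J'_def)
  qed
  \<comment> \<open>Only the sign is left to be fixed: the vector is its denominator times the
    nonnegative basic solution.\<close>
  define s where "s = sgn z"
  have s: "s * z > 0" "\<bar>s\<bar> = 1" using z0 by (auto simp: s_def sgn_if)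
  define y' where "y' j = (if j \<in> S then s * y (Some j) else 0)" for j
  have nn: "0 \<le> y' j" for j
  proof (cases "j \<in> S")
    case True
    have "real_of_int (y' j) = real_of_int (s * z) * x' j"
      using d0[THEN bspec, OF True] True by (simp add: y'_def d_def z_def)
    also have "... \<ge> 0"
      by (rule mult_nonneg_nonneg[OF _ S(2)[OF True]]) (use s(1) in \<open>simp only: of_int_0_le_iff\<close>)
    finally show ?thesis by (simp only: of_int_0_le_iff)
  qed (simp add: y'_def)
  have "y' j \<le> int H" for j
  proof (cases "j \<in> S")
    case True
    then have "\<bar>y (Some j)\<bar> \<le> int H" by (intro yH) (auto simp: J'_def)
    then show ?thesis using True s(2) by (auto simp: y'_def abs_if split: if_splits)
  qed (simp add: y'_def)
  moreover have "s * z \<le> int H"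
    using yH[of None] s by (auto simp: z_def J'_def abs_if split: if_splits)
  moreover have "(\<Sum>j\<in>J. a i j * y' j) = b i * (s * z)" if "i \<in> I" for i
  proof -
    have "(\<Sum>j\<in>J. a i j * y' j) = (\<Sum>j\<in>S. a i j * y' j)"
      using S(1) fin(2) by (intro sum.mono_neutral_right) (auto simp: y'_def)
    also have "... = s * (\<Sum>j\<in>S. a i j * y (Some j))"
      by (simp add: y'_def sum_distrib_left algebra_simps)
    also have "... = s * (b i * z)" using r0[OF that] r[of i] by (simp add: z_def)
    finally show ?thesis by simp
  qed
  ultimately show ?thesis
    using nn s(1) unfolding H_def by (intro exI[of _ y'] exI[of _ "s * z"]) simp
qed

text \<open>One slack variable per inequality reduces this to equations, which is why
  \<open>N\<close> counts unknowns and inequalities together.\<close>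

lemma small_solution:
  fixes a :: "'i => 'j => int" and b :: "'i => int" and x :: "'j => real" and M N :: nat
  assumes fin: "finite I" "finite J" and M1: "M \<ge> 1" and N: "card J + card I \<le> N"
    and x: "!!j. j \<in> J ==> x j \<ge> 0" "!!i. i \<in> I ==> (\<Sum>j\<in>J. of_int (a i j) * x j) \<le> of_int (b i)"
    and M: "!!i j. i \<in> I ==> j \<in> J ==> \<bar>a i j\<bar> \<le> int M" "!!i. i \<in> I ==> \<bar>b i\<bar> \<le> int M"
  shows "\<exists>(y :: 'j => nat) z. 0 < z \<and> z \<le> (2 * (N + 1) * (N * M ^ 2) + 1) ^ N \<and>
    (\<forall>j\<in>J. y j \<le> (2 * (N + 1) * (N * M ^ 2) + 1) ^ N) \<and>
    (\<forall>i\<in>I. (\<Sum>j\<in>J. a i j * int (y j)) \<le> b i * int z)"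
proof -
  define J' :: "('j + 'i) set" where "J' = J <+> I"
  define a' where "a' i q = (case q of Inl j => a i j | Inr k => if k = i then 1 else 0)" for i and q :: "'j + 'i"
  define x' where "x' q = (case q of Inl j => x j | Inr i => of_int (b i) - (\<Sum>j\<in>J. of_int (a i j) * x j))" for q
  have J': "finite J'" "card J' = card J + card I" using fin by (auto simp: J'_def card_Plus)
  have sumr: "(\<Sum>q\<in>J'. h q) = (\<Sum>j\<in>J. h (Inl j)) + (\<Sum>i\<in>I. h (Inr i))" for h :: "'j + 'i => real"
    unfolding J'_def using fin by (simp add: sum.Plus)
  have sumi: "(\<Sum>q\<in>J'. h q) = (\<Sum>j\<in>J. h (Inl j)) + (\<Sum>i\<in>I. h (Inr i))" for h :: "'j + 'i => int"
    unfolding J'_def using fin by (simp add: sum.Plus)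
  have x'0: "x' q \<ge> 0" if "q \<in> J'" for q
    using that x by (auto simp: x'_def J'_def)
  have eq: "(\<Sum>q\<in>J'. of_int (a' i q) * x' q) = of_int (b i)" if "i \<in> I" for i
  proof -
    have "(\<Sum>k\<in>I. of_int (a' i (Inr k)) * x' (Inr k)) = (\<Sum>k\<in>I. if k = i then x' (Inr i) else 0)"
      by (intro sum.cong) (auto simp: a'_def)
    also have "... = x' (Inr i)" using fin(1) that by simp
    finally show ?thesis by (simp add: sumr a'_def x'_def)
  qed
  have aM: "\<bar>a' i q\<bar> \<le> int M" if "i \<in> I" "q \<in> J'" for i q
    using that M(1) M1 by (auto simp: a'_def J'_def)
  have "\<exists>y (z :: int). z > 0 \<and> z \<le> int ((2 * (card J' + 1) * (card I * M ^ 2) + 1) ^ card J') \<and>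
    (\<forall>q\<in>J'. 0 \<le> y q \<and> y q \<le> int ((2 * (card J' + 1) * (card I * M ^ 2) + 1) ^ card J')) \<and>
    (\<forall>i\<in>I. (\<Sum>q\<in>J'. a' i q * y q) = b i * z)" (is "\<exists>y z. ?P y z")
    by (rule small_solution_eq[OF fin(1) J'(1) x'0 eq]) (assumption | rule aM M(2))+
  then obtain y and z :: int where yz0: "?P y z"
    by (elim exE)
  note yz = yz0[THEN conjunct1] yz0[THEN conjunct2, THEN conjunct1]
    yz0[THEN conjunct2, THEN conjunct2, THEN conjunct1, THEN bspec]
    yz0[THEN conjunct2, THEN conjunct2, THEN conjunct2, THEN bspec]
  let ?H = "(2 * (N + 1) * (N * M ^ 2) + 1) ^ N"
  have "(2 * (card J' + 1) * (card I * M ^ 2) + 1) ^ card J' \<le> (2 * (N + 1) * (N * M ^ 2) + 1) ^ card J'"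
    using N J'(2) by (intro power_mono add_mono mult_mono) auto
  also have "... \<le> ?H" using N J'(2) by (intro power_increasing) auto
  finally have H: "v \<le> int ?H" if "v \<le> int ((2 * (card J' + 1) * (card I * M ^ 2) + 1) ^ card J')" for v
    using that by (meson of_nat_mono order_trans)
  have Inl: "Inl j \<in> J'" if "j \<in> J" for j using that by (auto simp: J'_def)
  have "(\<Sum>j\<in>J. a i j * int (nat (y (Inl j)))) \<le> b i * int (nat z)" if "i \<in> I" for i
  proof -
    have "(\<Sum>k\<in>I. a' i (Inr k) * y (Inr k)) \<ge> 0"
      using yz(3) by (intro sum_nonneg) (auto simp: a'_def J'_def)
    moreover have "(\<Sum>j\<in>J. a i j * int (nat (y (Inl j)))) = (\<Sum>j\<in>J. a' i (Inl j) * y (Inl j))"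
      using yz(3) Inl by (intro sum.cong) (auto simp: a'_def)
    ultimately show ?thesis using yz(4)[OF that] yz(1) by (simp add: sumi)
  qed
  moreover have "nat z \<le> ?H" using H[OF yz(2)] by linarith
  moreover have "nat (y (Inl j)) \<le> ?H" if "j \<in> J" for j
    using H yz(3)[OF Inl[OF that]] by (simp add: nat_le_iff)
  ultimately show ?thesis
    using yz(1) by (intro exI[of _ "\<lambda>j. nat (y (Inl j))"] exI[of _ "nat z"]) auto
qed

section \<open>Acyclic flows\<close>

definition net :: "('v \<times> 'v) set => ('v \<times> 'v => real) => 'v => real" where
  "net E f v = (\<Sum>e\<in>E. f e * (of_bool (snd e = v) - of_bool (fst e = v)))"

text \<open>Unit flow along each edge of a walk, with multiplicity if an edge is repeated; the net
  flow telescopes and vanishes for a closed walk.\<close>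

lemma closed_walk_circulation:
  assumes "(u, v) \<in> S\<^sup>+" "S \<subseteq> E" "finite E"
  shows "\<exists>c :: _ => real. (\<forall>e. 0 \<le> c e) \<and> (\<forall>e. c e > 0 --> e \<in> S) \<and> (\<exists>e\<in>S. c e > 0) \<and>
    (\<forall>w. net E c w = of_bool (w = v) - of_bool (w = u))"
  using assms(1)
proof (induction rule: trancl_induct)
  have 1: "net E (\<lambda>e. of_bool (e = (u, v))) w = of_bool (w = v) - of_bool (w = u)" if "(u, v) \<in> S" for u v w
  proof -
    have "net E (\<lambda>e. of_bool (e = (u, v))) w = (\<Sum>e\<in>E. if e = (u, v) then of_bool (v = w) - of_bool (u = w) else 0)"
      unfolding net_def by (intro sum.cong) auto
    then show ?thesis using that assms(2,3) by (auto simp: of_bool_def)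
  qed
  {
    case (base v)
    then show ?case using 1[OF base] by (intro exI[of _ "\<lambda>e. of_bool (e = (u, v))"]) auto
  next
    case (step v v')
    then obtain c :: "_ => real" where c: "\<forall>e. 0 \<le> c e" "\<forall>e. c e > 0 --> e \<in> S" "\<exists>e\<in>S. c e > 0"
      "\<forall>w. net E c w = of_bool (w = v) - of_bool (w = u)" by blast
    let ?d = "\<lambda>e. c e + of_bool (e = (v, v'))"
    have "net E ?d w = net E c w + net E (\<lambda>e. of_bool (e = (v, v'))) w" for w
      by (simp add: net_def sum.distrib[symmetric] algebra_simps)
    then have "net E ?d w = of_bool (w = v') - of_bool (w = u)" for w
      using 1[OF step(2)] c(4) by simp
    moreover have "\<exists>e\<in>S. ?d e > 0" using step(2) c(1) by (intro bexI[of _ "(v, v')"]) (auto intro: add_nonneg_pos)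
    moreover have "\<forall>e. ?d e > 0 --> e \<in> S" using c(2) step(2) by (auto simp: of_bool_def split: if_splits)
    moreover have "\<forall>e. 0 \<le> ?d e" using c(1) by simp
    ultimately show ?case by (intro exI[of _ ?d]) simp
  }
qed

text \<open>Subtracting the largest admissible multiple of a circulation on the support empties an
  edge and changes no net flow; the induction is on the number of edges in use.\<close>

lemma acyclic_flow:
  assumes "finite E" "!!e. e \<in> E ==> f e \<ge> 0"
  shows "\<exists>f'. (\<forall>e\<in>E. 0 \<le> f' e \<and> f' e \<le> f e) \<and> (\<forall>v. net E f' v = net E f v) \<and> acyclic {e \<in> E. f' e > 0}"
  using assms(2)
proof (induction "card {e \<in> E. f e > 0}" arbitrary: f rule: less_induct)
  case less
  let ?S = "{e \<in> E. f e > 0}"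
  show ?case
  proof (cases "acyclic ?S")
    case True
    then show ?thesis using less.prems by (intro exI[of _ f]) auto
  next
    case False
    then obtain u where "(u, u) \<in> ?S\<^sup>+" by (auto simp: acyclic_def)
    from closed_walk_circulation[OF this _ assms(1)] obtain c :: "_ => real" where
      c: "\<forall>e. 0 \<le> c e" "\<forall>e. c e > 0 --> e \<in> ?S" "\<exists>e\<in>?S. c e > 0" "\<forall>w. net E c w = 0" by auto
    let ?P = "{e \<in> E. c e > 0}"
    have P: "finite ?P" "?P \<noteq> {}" using c(3) assms(1) by auto
    define \<theta> where "\<theta> = Min ((\<lambda>e. f e / c e) ` ?P)"
    have \<theta>: "\<theta> \<le> f e / c e" if "e \<in> ?P" for e
      unfolding \<theta>_def using that P by (intro Min_le) auto
    have "\<theta> \<in> (\<lambda>e. f e / c e) ` ?P" unfolding \<theta>_def using P by (intro Min_in) auto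
    then obtain e0 where e0: "e0 \<in> ?P" "\<theta> = f e0 / c e0" by blast
    then have \<theta>0: "\<theta> \<ge> 0" using less.prems c(1) by (auto intro: divide_nonneg_nonneg)
    define g where "g e = f e - \<theta> * c e" for e
    have g: "0 \<le> g e \<and> g e \<le> f e" if "e \<in> E" for e
    proof (cases "c e > 0")
      case True
      then have "\<theta> * c e \<le> f e" using \<theta>[of e] that by (simp add: pos_le_divide_eq)
      then show ?thesis using mult_nonneg_nonneg[OF \<theta>0 c(1)[THEN spec, of e]] by (simp add: g_def)
    next
      case False
      then have "c e = 0" using c(1) by (metis order_le_less)
      then show ?thesis using less.prems that by (simp add: g_def)
    qed
    have "g e0 = 0" using e0 by (simp add: g_def)
    moreover have "e0 \<in> ?S" using e0 c(2) by blast
    moreover have "{e \<in> E. g e > 0} \<subseteq> ?S" using g by (auto intro: less_le_trans)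
    ultimately have "{e \<in> E. g e > 0} \<subset> ?S" by (metis (mono_tags, lifting) mem_Collect_eq order_less_irrefl psubsetI)
    then have "card {e \<in> E. g e > 0} < card ?S" using assms(1) by (intro psubset_card_mono) auto
    from less.hyps[OF this] g obtain f' where
      f': "\<forall>e\<in>E. 0 \<le> f' e \<and> f' e \<le> g e" "\<forall>v. net E f' v = net E g v" "acyclic {e \<in> E. f' e > 0}" by blast
    have "net E g v = net E f v - \<theta> * net E c v" for v
      by (simp add: net_def g_def sum_distrib_left algebra_simps sum_subtractf sum.distrib)
    with f' g c(4) show ?thesis by (intro exI[of _ f']) (auto intro: order_trans)
  qed
qed

text \<open>Flow along an edge enters the set of vertices reachable from its head, and none leaves that set.\<close>

lemma acyclic_flow_le:
  assumes E: "finite E" "E \<subseteq> V \<times> V" "finite V"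
    and f: "!!e. e \<in> E ==> f e \<ge> 0" "acyclic {e \<in> E. f e > 0}"
    and n: "!!v. v \<in> V ==> net E f v \<le> (if v = t then D else 0)" "D \<ge> 0" and e: "e \<in> E"
  shows "f e \<le> D"
proof (cases "f e > 0")
  case True
  let ?S = "{e \<in> E. f e > 0}"
  define R where "R = {w. (snd e, w) \<in> ?S\<^sup>*}"
  have "w \<in> V" if "(snd e, w) \<in> ?S\<^sup>*" for w
    using that by (induction rule: rtrancl_induct) (use E(2) e in auto)
  then have RV: "R \<subseteq> V" by (auto simp: R_def)
  then have finR: "finite R" using E(3) finite_subset by blast
  have uR: "fst e \<notin> R"
  proof
    assume "fst e \<in> R"
    moreover have "(fst e, snd e) \<in> ?S" using True e by simp
    ultimately have "(fst e, fst e) \<in> ?S\<^sup>+" unfolding R_def by (meson mem_Collect_eq rtrancl_into_trancl2)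
    then show False using f(2) by (auto simp: acyclic_def)
  qed
  have 1: "(\<Sum>w\<in>R. of_bool (a = w) :: real) = of_bool (a \<in> R)" for a
    using finR by (simp add: of_bool_def)
  \<comment> \<open>Summed over \<open>R\<close>, edges inside \<open>R\<close> cancel; what is left
    is the flow that enters \<open>R\<close>, as none leaves it.\<close>
  have "(\<Sum>w\<in>R. net E f w) = (\<Sum>e\<in>E. f e * (of_bool (snd e \<in> R) - of_bool (fst e \<in> R)))"
    unfolding net_def by (subst sum.swap) (simp add: sum_distrib_left[symmetric] sum_subtractf 1)
  also have "... \<ge> f e * (of_bool (snd e \<in> R) - of_bool (fst e \<in> R))"
  proof (rule member_le_sum[OF e _ E(1)])
    fix a assume a: "a \<in> E - {e}"
    have "fst a \<in> R ==> f a > 0 ==> snd a \<in> R"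
      using a unfolding R_def by (auto intro: rtrancl_into_rtrancl)
    then show "0 \<le> f a * (of_bool (snd a \<in> R) - of_bool (fst a \<in> R))"
      using f(1)[of a] a by (cases "f a = 0") auto
  qed
  finally have "f e \<le> (\<Sum>w\<in>R. net E f w)" using uR by (simp add: R_def)
  also have "... \<le> (\<Sum>w\<in>R. if w = t then D else 0)" by (intro sum_mono n(1)) (use RV in blast)
  also have "... \<le> D" using finR n(2) by simp
  finally show ?thesis .
qed (use n(2) in simp)

section \<open>Solutions as linear programs\<close>

abbreviation lp_time :: "msp => split => real" where
  "lp_time I x \<equiv> (\<Sum>e\<in>edges I. real_of_rat (weight I e) * (\<Sum>i=0..modes I. real_of_rat (travel_time I i) *
     (\<Sum>\<kappa>\<in>commodities I. x \<kappa> e i)))"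

abbreviation lp_energy :: "msp => layout => split => real" where
  "lp_energy I L x \<equiv> (\<Sum>e\<in>edges I. real_of_rat (weight I e) * (real_of_rat (energy I 0) *
     (\<Sum>\<kappa>\<in>commodities I. x \<kappa> e 0) + (\<Sum>i=1..modes I. real_of_rat (energy I i) * real (L e i))))"

abbreviation lp_cost :: "msp => layout => real" where
  "lp_cost I L \<equiv> (\<Sum>e\<in>edges I. real_of_rat (weight I e) * (\<Sum>i=1..modes I. real_of_rat (cost I i) * real (L e i)))"

text \<open>In the variables \<open>x = F M\<close> all constraints are linear once the layout is
  fixed, since the product of flow and split has disappeared.\<close>

definition lp_ok :: "msp => layout => split => bool" where
  "lp_ok I L x \<longleftrightarrow>
     (\<forall>\<kappa>\<in>commodities I. \<forall>e\<in>edges I. \<forall>i\<le>modes I. x \<kappa> e i \<ge> 0) \<and>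
     feasible_layout I L \<and>
     (\<forall>e\<in>edges I. \<forall>i\<in>{1..modes I}. (\<Sum>\<kappa>\<in>commodities I. x \<kappa> e i) \<le> real_of_rat (capacity I i) * real (L e i)) \<and>
     (case time_bound I of None => True | Some a =>
       lp_time I x \<le> real_of_rat a) \<and>
     lp_energy I L x \<le> real_of_rat (energy_bound I)"

lemma solvable_flow_iff:
  "solvable_flow I F \<longleftrightarrow> feasible_flow I F \<and>
     (\<exists>L x. lp_ok I L x \<and> (\<forall>\<kappa>\<in>commodities I. \<forall>e\<in>edges I. (\<Sum>i=0..modes I. x \<kappa> e i) = F \<kappa> e))"
proof (cases "feasible_flow I F")
  case F: True
  have Fnn: "F \<kappa> e \<ge> 0" if "\<kappa> \<in> commodities I" "e \<in> edges I" for \<kappa> e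
    using F that by (cases \<kappa>) (auto simp: feasible_flow_def)
  note tfs = total_flow_split[OF F]
  have T: "total_time I F L M = lp_time I (\<lambda>\<kappa> e i. F \<kappa> e * M \<kappa> e i)" for L M
    unfolding total_time_def by (simp add: tfs mult.assoc cong: sum.cong)
  have H: "total_energy I F L M = lp_energy I L (\<lambda>\<kappa> e i. F \<kappa> e * M \<kappa> e i)" for L M
    unfolding total_energy_def by (simp add: tfs mult.assoc cong: sum.cong)
  have "solvable_flow I F \<longleftrightarrow>
     (\<exists>L x. lp_ok I L x \<and> (\<forall>\<kappa>\<in>commodities I. \<forall>e\<in>edges I. (\<Sum>i=0..modes I. x \<kappa> e i) = F \<kappa> e))" (is "_ \<longleftrightarrow> ?R")
  proof
    assume "solvable_flow I F"
    then obtain L M where L: "feasible_layout I L" and M: "feasible_split I F L M" and b: "within_bounds I F L M"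
      by (auto simp: solvable_flow_def feasible_solution_def)
    let ?x = "\<lambda>\<kappa> e i. F \<kappa> e * M \<kappa> e i"
    have "lp_ok I L ?x"
      using L M b Fnn unfolding lp_ok_def feasible_split_def within_bounds_def T H
      by (auto intro!: mult_nonneg_nonneg split: option.splits)
    moreover have "(\<Sum>i=0..modes I. ?x \<kappa> e i) = F \<kappa> e" if "\<kappa> \<in> commodities I" "e \<in> edges I" for \<kappa> e
      using M that by (simp add: feasible_split_def flip: sum_distrib_left)
    ultimately show ?R by (intro exI[of _ L] exI[of _ ?x]) simp
  next
    assume ?R
    then obtain L x where x: "lp_ok I L x" and
      s: "!!\<kappa> e. \<kappa> \<in> commodities I ==> e \<in> edges I ==> (\<Sum>i=0..modes I. x \<kappa> e i) = F \<kappa> e" by blast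
    \<comment> \<open>Without flow the split is arbitrary; all weight is put on private transport so
      that the fractions sum to 1.\<close>
    define M where "M = (\<lambda>\<kappa> e i. if F \<kappa> e = 0 then of_bool (i = 0) else x \<kappa> e i / F \<kappa> e)"
    have x0: "x \<kappa> e i \<ge> 0" if "\<kappa> \<in> commodities I" "e \<in> edges I" "i \<le> modes I" for \<kappa> e i
      using x that by (simp add: lp_ok_def)
    have xF: "x \<kappa> e i \<le> F \<kappa> e" if "\<kappa> \<in> commodities I" "e \<in> edges I" "i \<le> modes I" for \<kappa> e i
      using member_le_sum[of i "{0..modes I}" "x \<kappa> e"] x0 that s[of \<kappa> e] by simp
    have FM: "F \<kappa> e * M \<kappa> e i = x \<kappa> e i" if "\<kappa> \<in> commodities I" "e \<in> edges I" "i \<le> modes I" for \<kappa> e i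
      using x0[OF that] xF[OF that] by (auto simp: M_def)
    have sFM: "(\<Sum>\<kappa>\<in>commodities I. F \<kappa> e * M \<kappa> e i) = (\<Sum>\<kappa>\<in>commodities I. x \<kappa> e i)" if "e \<in> edges I" "i \<le> modes I" for e i
      using FM that by (intro sum.cong) auto
    have T': "total_time I F L M = lp_time I x"
      unfolding T
      by (rule sum.cong[OF refl], rule arg_cong2[where f="(*)", OF refl], rule sum.cong[OF refl], rule arg_cong2[where f="(*)", OF refl], rule sFM) simp_all
    have H': "total_energy I F L M = lp_energy I L x"
      unfolding H by (simp add: sFM cong: sum.cong)
    have M1: "M \<kappa> e i \<in> {0..1}" if "\<kappa> \<in> commodities I" "e \<in> edges I" "i \<le> modes I" for \<kappa> e i
      using x0[OF that] xF[OF that] Fnn[OF that(1,2)] by (auto simp: M_def divide_le_eq_1)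
    have M2: "(\<Sum>i=0..modes I. M \<kappa> e i) = 1" if "\<kappa> \<in> commodities I" "e \<in> edges I" for \<kappa> e
      using s[OF that] by (cases "F \<kappa> e = 0") (simp_all add: M_def of_bool_def flip: sum_divide_distrib)
    have "feasible_split I F L M"
      unfolding feasible_split_def using M1 M2 x sFM by (simp add: lp_ok_def)
    moreover have "within_bounds I F L M"
      using x unfolding within_bounds_def T' H' lp_ok_def by (auto split: option.splits)
    ultimately show "solvable_flow I F"
      using x F by (auto simp: solvable_flow_def feasible_solution_def lp_ok_def)
  qed
  then show ?thesis using F by simp
qed (simp add: solvable_flow_def feasible_solution_def)

lemma feasible_flow_cong:
  assumes "!!\<kappa> e. \<kappa> \<in> commodities I ==> e \<in> edges I ==> F \<kappa> e = F' \<kappa> e"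
  shows "feasible_flow I F = feasible_flow I F'"
proof -
  have *: "(\<Sum>e\<in>in_arcs (graph_of I) v. F \<kappa> e) = (\<Sum>e\<in>in_arcs (graph_of I) v. F' \<kappa> e)"
    "(\<Sum>e\<in>out_arcs (graph_of I) v. F \<kappa> e) = (\<Sum>e\<in>out_arcs (graph_of I) v. F' \<kappa> e)"
    if "\<kappa> \<in> commodities I" for \<kappa> v
    unfolding in_arcs_graph out_arcs_graph by (rule sum.cong[OF refl]; use assms[OF that] in simp)+
  show ?thesis
    unfolding feasible_flow_def
  proof (rule ball_cong[OF refl])
    fix \<kappa> assume \<kappa>: "\<kappa> \<in> commodities I"
    obtain s t where st: "\<kappa> = (s, t)" by (cases \<kappa>)
    have H: "(\<forall>e\<in>edges I. F \<kappa> e \<ge> 0) = (\<forall>e\<in>edges I. F' \<kappa> e \<ge> 0)"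
      by (rule ball_cong[OF refl]) (simp only: assms[OF \<kappa>])
    show "(case \<kappa> of (s, t) => (\<forall>e\<in>edges I. F (s, t) e \<ge> 0) \<and>
        (\<forall>v<num_verts I. (\<Sum>e\<in>in_arcs (graph_of I) v. F (s, t) e) - (\<Sum>e\<in>out_arcs (graph_of I) v. F (s, t) e) =
           (if v = t then real (demand I (s, t)) else if v = s then - real (demand I (s, t)) else 0))) =
      (case \<kappa> of (s, t) => (\<forall>e\<in>edges I. F' (s, t) e \<ge> 0) \<and>
        (\<forall>v<num_verts I. (\<Sum>e\<in>in_arcs (graph_of I) v. F' (s, t) e) - (\<Sum>e\<in>out_arcs (graph_of I) v. F' (s, t) e) =
           (if v = t then real (demand I (s, t)) else if v = s then - real (demand I (s, t)) else 0)))"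
      using *[OF \<kappa>] H by (simp only: st prod.case)
  qed
qed

lemma solvable_iff:
  "solvable I \<longleftrightarrow> (\<exists>L x. lp_ok I L x \<and> feasible_flow I (\<lambda>\<kappa> e. \<Sum>i=0..modes I. x \<kappa> e i))"
proof
  assume "solvable I"
  then obtain F where "solvable_flow I F" by (auto simp: solvable_def)
  then have F: "feasible_flow I F" and "\<exists>L x. lp_ok I L x \<and> (\<forall>\<kappa>\<in>commodities I. \<forall>e\<in>edges I. (\<Sum>i=0..modes I. x \<kappa> e i) = F \<kappa> e)"
    unfolding solvable_flow_iff by (rule conjunct1, rule conjunct2)
  then obtain L x where x: "lp_ok I L x \<and> (\<forall>\<kappa>\<in>commodities I. \<forall>e\<in>edges I. (\<Sum>i=0..modes I. x \<kappa> e i) = F \<kappa> e)"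
    by (elim exE)
  have "feasible_flow I (\<lambda>\<kappa> e. \<Sum>i=0..modes I. x \<kappa> e i)"
    by (subst feasible_flow_cong[where F' = F]) (use F x in auto)
  with x show "\<exists>L x. lp_ok I L x \<and> feasible_flow I (\<lambda>\<kappa> e. \<Sum>i=0..modes I. x \<kappa> e i)"
    by (intro exI[of _ L] exI[of _ x] conjI) (rule conjunct1, assumption+)
next
  assume "\<exists>L x. lp_ok I L x \<and> feasible_flow I (\<lambda>\<kappa> e. \<Sum>i=0..modes I. x \<kappa> e i)"
  then obtain L x where x: "lp_ok I L x" "feasible_flow I (\<lambda>\<kappa> e. \<Sum>i=0..modes I. x \<kappa> e i)" by (elim exE conjE)
  then have "solvable_flow I (\<lambda>\<kappa> e. \<Sum>i=0..modes I. x \<kappa> e i)"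
    unfolding solvable_flow_iff by (intro conjI exI[of _ L] exI[of _ x] ballI refl)
  then show "solvable I" unfolding solvable_def by blast
qed

definition bal :: "msp => commodity => nat => real" where
  "bal I \<kappa> v = (if v = snd \<kappa> then real (demand I \<kappa>) else if v = fst \<kappa> then - real (demand I \<kappa>) else 0)"

lemma feasible_flow_net:
  assumes "finite (edges I)"
  shows "feasible_flow I F \<longleftrightarrow> (\<forall>\<kappa>\<in>commodities I. (\<forall>e\<in>edges I. F \<kappa> e \<ge> 0) \<and>
    (\<forall>v<num_verts I. net (edges I) (F \<kappa>) v = bal I \<kappa> v))"
proof -
  have "(\<Sum>e\<in>edges I. F \<kappa> e * of_bool (g e = v)) = (\<Sum>e\<in>{e \<in> edges I. g e = v}. F \<kappa> e)" for g :: "edge => nat" and \<kappa> v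
    using assms by (subst sum.inter_filter) (auto simp: of_bool_def intro!: sum.cong)
  then have "net (edges I) (F \<kappa>) v = (\<Sum>e\<in>in_arcs (graph_of I) v. F \<kappa> e) - (\<Sum>e\<in>out_arcs (graph_of I) v. F \<kappa> e)" for \<kappa> v
    by (simp add: net_def right_diff_distrib sum_subtractf in_arcs_graph out_arcs_graph)
  then show ?thesis by (auto simp: feasible_flow_def bal_def split_beta)
qed

text \<open>All constraints but flow conservation are monotone in the flow.\<close>

lemma solvable_bounded:
  assumes I: "msp_instance I" and s: "solvable I" and D: "!!\<kappa>. \<kappa> \<in> commodities I ==> demand I \<kappa> \<le> D"
  shows "\<exists>L x. lp_ok I L x \<and> feasible_flow I (\<lambda>\<kappa> e. \<Sum>i=0..modes I. x \<kappa> e i) \<and>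
    (\<forall>\<kappa>\<in>commodities I. \<forall>e\<in>edges I. (\<Sum>i=0..modes I. x \<kappa> e i) \<le> D)"
proof -
  have E: "edges I \<subseteq> {..<num_verts I} \<times> {..<num_verts I}" "finite (edges I)"
    using I finite_subset[of "edges I" "{..<num_verts I} \<times> {..<num_verts I}"] by (auto simp: msp_instance_def pair_fin_digraph_graph)
  note ffn = feasible_flow_net[OF E(2)]
  obtain L x where x: "lp_ok I L x" "feasible_flow I (\<lambda>\<kappa> e. \<Sum>i=0..modes I. x \<kappa> e i)"
    using s unfolding solvable_iff by blast
  define F where "F \<kappa> e = (\<Sum>i=0..modes I. x \<kappa> e i)" for \<kappa> e
  have F: "!!\<kappa> e. \<kappa> \<in> commodities I ==> e \<in> edges I ==> F \<kappa> e \<ge> 0"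
    "!!\<kappa> v. \<kappa> \<in> commodities I ==> v < num_verts I ==> net (edges I) (F \<kappa>) v = bal I \<kappa> v"
    using x(2) unfolding ffn F_def by auto
  let ?Q = "\<lambda>\<kappa> f'. (\<forall>e\<in>edges I. 0 \<le> f' e \<and> f' e \<le> F \<kappa> e) \<and>
    (\<forall>v. net (edges I) f' v = net (edges I) (F \<kappa>) v) \<and> acyclic {e \<in> edges I. f' e > 0}"
  have "\<forall>\<kappa>. \<exists>f'. \<kappa> \<in> commodities I --> ?Q \<kappa> f'"
  proof
    fix \<kappa>
    show "\<exists>f'. \<kappa> \<in> commodities I --> ?Q \<kappa> f'"
    proof (cases "\<kappa> \<in> commodities I")
      case True
      have "\<exists>f'. ?Q \<kappa> f'"
        by (rule acyclic_flow[OF E(2)], rule F(1)[OF True])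
      then show ?thesis by (elim exE) (intro exI impI)
    qed simp
  qed
  from choice[OF this] obtain F' where F'0: "\<forall>\<kappa>. \<kappa> \<in> commodities I --> ?Q \<kappa> (F' \<kappa>)"
    by (elim exE)
  note F' = F'0[THEN spec, THEN mp]
  have F'D: "F' \<kappa> e \<le> real D" if "\<kappa> \<in> commodities I" "e \<in> edges I" for \<kappa> e
  proof -
    have "F' \<kappa> e \<le> real (demand I \<kappa>)"
      by (rule acyclic_flow_le[OF E(2,1) _ _ _ _ _ that(2), where t = "snd \<kappa>"])
        (use F' F(2) that(1) in \<open>auto simp: bal_def\<close>)
    then show ?thesis using D[OF that(1)] by simp
  qed
  \<comment> \<open>All modes of a commodity on an edge are scaled by a common factor at most 1;
    where \<open>F\<close> is 0, division by zero gives 0, in agreement with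
    \<open>F'\<close>.\<close>
  define x' where "x' \<kappa> e i = x \<kappa> e i * (F' \<kappa> e / F \<kappa> e)" for \<kappa> e i
  have x0: "x \<kappa> e i \<ge> 0" if "\<kappa> \<in> commodities I" "e \<in> edges I" "i \<le> modes I" for \<kappa> e i
    using x that by (simp add: lp_ok_def)
  have x': "0 \<le> x' \<kappa> e i \<and> x' \<kappa> e i \<le> x \<kappa> e i" if "\<kappa> \<in> commodities I" "e \<in> edges I" "i \<le> modes I" for \<kappa> e i
  proof -
    have "0 \<le> F' \<kappa> e / F \<kappa> e" "F' \<kappa> e / F \<kappa> e \<le> 1"
      using F'[OF that(1)] that(2) F(1)[OF that(1,2)] by (auto simp: divide_le_eq_1 order_le_less)
    then show ?thesis unfolding x'_def using x0[OF that] by (intro conjI mult_nonneg_nonneg mult_left_le)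
  qed
  have s': "(\<Sum>i=0..modes I. x' \<kappa> e i) = F' \<kappa> e" if "\<kappa> \<in> commodities I" "e \<in> edges I" for \<kappa> e
  proof -
    have "(\<Sum>i=0..modes I. x' \<kappa> e i) = F \<kappa> e * (F' \<kappa> e / F \<kappa> e)"
      unfolding x'_def F_def by (rule sum_distrib_right[symmetric])
    then show ?thesis using F'[OF that(1)] that(2) by (cases "F \<kappa> e = 0") force+
  qed
  have sx: "(\<Sum>\<kappa>\<in>commodities I. x' \<kappa> e i) \<le> (\<Sum>\<kappa>\<in>commodities I. x \<kappa> e i)" if "e \<in> edges I" "i \<le> modes I" for e i
    using x' that by (intro sum_mono) auto
  have w: "real_of_rat (weight I e) \<ge> 0" if "e \<in> edges I" for e
    using I that by (simp add: msp_instance_def)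
  have te: "real_of_rat (travel_time I i) \<ge> 0" "real_of_rat (energy I i) \<ge> 0" if "i \<le> modes I" for i
    using I that by (simp_all add: msp_instance_def)
  have "lp_ok I L x'"
    unfolding lp_ok_def
  proof (intro conjI)
    show "\<forall>e\<in>edges I. \<forall>i\<in>{1..modes I}. (\<Sum>\<kappa>\<in>commodities I. x' \<kappa> e i) \<le> real_of_rat (capacity I i) * real (L e i)"
    proof (intro ballI)
      fix e i assume ei: "e \<in> edges I" "i \<in> {1..modes I}"
      then have "(\<Sum>\<kappa>\<in>commodities I. x \<kappa> e i) \<le> real_of_rat (capacity I i) * real (L e i)"
        using x(1) unfolding lp_ok_def by blast
      with sx[OF ei(1), of i] ei(2) show "(\<Sum>\<kappa>\<in>commodities I. x' \<kappa> e i) \<le> real_of_rat (capacity I i) * real (L e i)"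
        by simp
    qed
    have "lp_time I x' \<le> lp_time I x"
      by (intro sum_mono mult_left_mono w te sx) auto
    then show "case time_bound I of None => True | Some a =>
       lp_time I x' \<le> real_of_rat a"
      using x(1) by (auto simp: lp_ok_def split: option.splits)
    have "lp_energy I L x' \<le> lp_energy I L x"
      by (intro sum_mono mult_left_mono add_mono w te sx order_refl) auto
    then show "lp_energy I L x' \<le> real_of_rat (energy_bound I)"
      using x(1) by (auto simp: lp_ok_def)
  qed (use x(1) x' in \<open>auto simp: lp_ok_def\<close>)
  moreover have "feasible_flow I F'"
    unfolding ffn using F' F by auto
  then have "feasible_flow I (\<lambda>\<kappa> e. \<Sum>i=0..modes I. x' \<kappa> e i)"
    using feasible_flow_cong[of I "\<lambda>\<kappa> e. \<Sum>i=0..modes I. x' \<kappa> e i" F'] s' by simp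
  ultimately show ?thesis using s' F'D by (intro exI[of _ L] exI[of _ x']) auto
qed

section \<open>Integral certificates\<close>

text \<open>The constraints multiplied out, with \<open>Q\<close> a common denominator of the
  numbers of the instance and \<open>z\<close> one of the flow by modes. Products of two such
  numbers carry \<open>Q\<close> twice, and one factor cancels against the bound.\<close>

abbreviation scaled_rows :: "msp => layout => split => real => real => (edge => real) => (nat => real) =>
    (nat => real) => (nat => real) => (nat => real) => real => real => real => bool" where
  "scaled_rows I L y z Q w t h c k B a b \<equiv> (\<forall>\<kappa>\<in>commodities I. \<forall>e\<in>edges I. \<forall>i\<le>modes I. y \<kappa> e i \<ge> 0) \<and>
    (\<Sum>e\<in>edges I. w e * (\<Sum>i=1..modes I. c i * real (L e i))) \<le> B * Q \<and>
    (\<forall>e\<in>edges I. \<forall>i\<in>{1..modes I}. Q * (\<Sum>\<kappa>\<in>commodities I. y \<kappa> e i) \<le> z * (k i * real (L e i))) \<and>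
    (time_bound I \<noteq> None -->
      (\<Sum>e\<in>edges I. w e * (\<Sum>i=0..modes I. t i * (\<Sum>\<kappa>\<in>commodities I. y \<kappa> e i))) \<le> a * Q * z) \<and>
    (\<Sum>e\<in>edges I. w e * (h 0 * (\<Sum>\<kappa>\<in>commodities I. y \<kappa> e 0) +
        z * (\<Sum>i=1..modes I. h i * real (L e i)))) \<le> b * Q * z"

lemma lp_ok_scaled:
  fixes y :: split and z Q B a b :: real and w :: "edge => real" and t h c k :: "nat => real"
  assumes pos: "z > 0" "Q > 0"
    and w: "!!e. e \<in> edges I ==> real_of_rat (weight I e) = w e / Q"
    and t: "!!i. i \<le> modes I ==> real_of_rat (travel_time I i) = t i / Q"
    and h: "!!i. i \<le> modes I ==> real_of_rat (energy I i) = h i / Q"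
    and c: "!!i. i \<le> modes I ==> real_of_rat (cost I i) = c i / Q"
    and k: "!!i. i \<le> modes I ==> real_of_rat (capacity I i) = k i / Q"
    and B: "real_of_rat (budget I) = B / Q" and b: "real_of_rat (energy_bound I) = b / Q"
    and a: "!!A. time_bound I = Some A ==> real_of_rat A = a / Q"
  shows "lp_ok I L (\<lambda>\<kappa> e i. y \<kappa> e i / z) \<longleftrightarrow>
    scaled_rows I L y z Q w t h c k B a b"
proof -
  have 1: "lp_cost I L =
      (\<Sum>e\<in>edges I. w e * (\<Sum>i=1..modes I. c i * real (L e i))) / (Q * Q)"
    unfolding sum_divide_distrib
  proof (rule sum.cong[OF refl])
    fix e assume e: "e \<in> edges I"
    have "(\<Sum>i=1..modes I. real_of_rat (cost I i) * real (L e i)) = (\<Sum>i=1..modes I. c i * real (L e i)) / Q"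
      unfolding sum_divide_distrib by (rule sum.cong) (simp_all add: c)
    then show "real_of_rat (weight I e) * (\<Sum>i=1..modes I. real_of_rat (cost I i) * real (L e i)) =
      w e * (\<Sum>i=1..modes I. c i * real (L e i)) / (Q * Q)" by (simp add: w[OF e])
  qed
  have 2: "lp_time I (\<lambda>\<kappa> e i. y \<kappa> e i / z) =
      (\<Sum>e\<in>edges I. w e * (\<Sum>i=0..modes I. t i * (\<Sum>\<kappa>\<in>commodities I. y \<kappa> e i))) / (Q * Q * z)"
    unfolding sum_divide_distrib
  proof (rule sum.cong[OF refl])
    fix e assume e: "e \<in> edges I"
    have "(\<Sum>i=0..modes I. real_of_rat (travel_time I i) * (\<Sum>\<kappa>\<in>commodities I. y \<kappa> e i / z)) =
        (\<Sum>i=0..modes I. t i * (\<Sum>\<kappa>\<in>commodities I. y \<kappa> e i)) / (Q * z)"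
      unfolding sum_divide_distrib[of "\<lambda>i. t i * (\<Sum>\<kappa>\<in>commodities I. y \<kappa> e i)"]
      by (rule sum.cong) (simp_all add: t flip: sum_divide_distrib)
    then show "real_of_rat (weight I e) * (\<Sum>i=0..modes I. real_of_rat (travel_time I i) * (\<Sum>\<kappa>\<in>commodities I. y \<kappa> e i / z)) =
      w e * (\<Sum>i=0..modes I. t i * (\<Sum>\<kappa>\<in>commodities I. y \<kappa> e i)) / (Q * Q * z)" by (simp add: w[OF e])
  qed
  have 3: "lp_energy I L (\<lambda>\<kappa> e i. y \<kappa> e i / z) =
      (\<Sum>e\<in>edges I. w e * (h 0 * (\<Sum>\<kappa>\<in>commodities I. y \<kappa> e 0) + z * (\<Sum>i=1..modes I. h i * real (L e i)))) / (Q * Q * z)"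
    unfolding sum_divide_distrib[of "\<lambda>e. w e * (h 0 * (\<Sum>\<kappa>\<in>commodities I. y \<kappa> e 0) + z * (\<Sum>i=1..modes I. h i * real (L e i)))"]
  proof (rule sum.cong[OF refl])
    fix e assume e: "e \<in> edges I"
    have 1: "(\<Sum>i=1..modes I. real_of_rat (energy I i) * real (L e i)) = (\<Sum>i=1..modes I. h i * real (L e i)) / Q"
      unfolding sum_divide_distrib by (rule sum.cong) (simp_all add: h)
    have 2: "real_of_rat (energy I 0) * (\<Sum>\<kappa>\<in>commodities I. y \<kappa> e 0 / z) = h 0 * (\<Sum>\<kappa>\<in>commodities I. y \<kappa> e 0) / (Q * z)"
      by (simp add: h flip: sum_divide_distrib)
    show "real_of_rat (weight I e) * (real_of_rat (energy I 0) * (\<Sum>\<kappa>\<in>commodities I. y \<kappa> e 0 / z) +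
        (\<Sum>i=1..modes I. real_of_rat (energy I i) * real (L e i))) =
      w e * (h 0 * (\<Sum>\<kappa>\<in>commodities I. y \<kappa> e 0) + z * (\<Sum>i=1..modes I. h i * real (L e i))) / (Q * Q * z)"
      unfolding 1 2 w[OF e] using pos by (simp add: divide_simps)
  qed
  have 4: "(\<Sum>\<kappa>\<in>commodities I. y \<kappa> e i / z) \<le> real_of_rat (capacity I i) * real (L e i) \<longleftrightarrow>
      Q * (\<Sum>\<kappa>\<in>commodities I. y \<kappa> e i) \<le> z * (k i * real (L e i))" if "i \<in> {1..modes I}" for e i
    using that pos by (simp add: k divide_simps mult_ac flip: sum_divide_distrib)
  have "(case time_bound I of None => True | Some A => X / (Q * Q * z) \<le> real_of_rat A) \<longleftrightarrow> (time_bound I \<noteq> None --> X \<le> a * Q * z)" for X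
    using a pos by (cases "time_bound I") (auto simp: divide_simps mult_ac)
  moreover have "X / (Q * Q * z) \<le> b / Q \<longleftrightarrow> X \<le> b * Q * z" for X
    using pos by (simp add: divide_simps mult_ac)
  moreover have "X / (Q * Q) \<le> B / Q \<longleftrightarrow> X \<le> B * Q" for X
    using pos by (simp add: divide_simps mult_ac)
  moreover have "(y \<kappa> e i / z \<ge> 0) \<longleftrightarrow> y \<kappa> e i \<ge> 0" for \<kappa> e i
    using pos by (simp add: zero_le_divide_iff)
  ultimately show ?thesis
    unfolding lp_ok_def feasible_layout_def 1 2 3 B b by (simp add: 4 conj_ac)
qed

definition scaled :: "nat => nat => rat => nat => bool" where
  "scaled S Q r k \<longleftrightarrow> real_of_rat r = real k / real Q \<and> k \<le> 2 ^ S"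

datatype 'r row = Cap edge nat | Time | Energy | EqP 'r | EqM 'r

text \<open>\<open>N\<close> bounds the number of unknowns plus inequalities and
  \<open>2 ^ (5 * S)\<close> the coefficients; the result is an exponent that majorizes the bound of
  \<open>small_solution\<close> for these values.\<close>

definition cert_bits :: "nat => nat" where
  "cert_bits S = (let N = 6 * (S + 1) ^ 5 in (2 * N + 3 + 10 * S) * N)"

lemma cert_bits_ge:
  fixes S :: nat
  defines "N \<equiv> 6 * (S + 1) ^ 5"
  shows "(2 * (N + 1) * (N * (2 ^ (5 * S)) ^ 2) + 1) ^ N \<le> 2 ^ cert_bits S" "4 * S \<le> cert_bits S"
proof -
  have N1: "1 \<le> N" using one_le_power[of "S + 1" 5] by (simp add: N_def)
  have le: "N + 1 \<le> 2 ^ N" using less_exp[of N] by (simp add: Suc_le_eq)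
  have "2 * (N + 1) * (N * (2 ^ (5 * S)) ^ 2) \<le> 2 * 2 ^ N * (2 ^ N * (2 ^ (5 * S)) ^ 2)"
    using le by (intro mult_mono) auto
  also have "... = 2 ^ (2 * N + 1 + 10 * S)"
  proof -
    have "((2::nat) ^ (5 * S)) ^ 2 = 2 ^ (10 * S)" by (simp flip: power_mult)
    moreover have "2 * N + 1 + 10 * S = Suc (N + (N + 10 * S))" by simp
    ultimately show ?thesis by (simp only: power_Suc power_add mult.assoc)
  qed
  finally have 1: "2 * (N + 1) * (N * (2 ^ (5 * S)) ^ 2) \<le> 2 ^ (2 * N + 1 + 10 * S)" .
  have "(2::nat) ^ (2 * N + 3 + 10 * S) = 4 * 2 ^ (2 * N + 1 + 10 * S)"
    by (simp add: numeral_3_eq_3)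
  moreover have "(1::nat) \<le> 2 ^ (2 * N + 1 + 10 * S)" by simp
  ultimately have "2 * (N + 1) * (N * (2 ^ (5 * S)) ^ 2) + 1 \<le> 2 ^ (2 * N + 3 + 10 * S)" using 1 by linarith
  then have "(2 * (N + 1) * (N * (2 ^ (5 * S)) ^ 2) + 1) ^ N \<le> (2 ^ (2 * N + 3 + 10 * S)) ^ N"
    by (rule power_mono) simp
  then show "(2 * (N + 1) * (N * (2 ^ (5 * S)) ^ 2) + 1) ^ N \<le> 2 ^ cert_bits S"
    by (simp add: cert_bits_def N_def Let_def flip: power_mult)
  have "4 * S * 1 \<le> (2 * N + 3 + 10 * S) * N" using N1 by (intro mult_mono) auto
  then show "4 * S \<le> cert_bits S" by (simp add: cert_bits_def N_def Let_def)
qed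

abbreviation integral_sol :: "msp => nat => 'r set => ('r => commodity => edge => int) => ('r => int) =>
    layout => (commodity \<times> edge \<times> nat => nat) => nat => bool" where
  "integral_sol I S R \<alpha> \<beta> L' y z \<equiv> 0 < z \<and> z \<le> 2 ^ cert_bits S \<and>
    (\<forall>e i. L' e i \<le> 2 ^ cert_bits S) \<and> (\<forall>\<kappa>\<in>commodities I. \<forall>e\<in>edges I. \<forall>i\<le>modes I. y (\<kappa>, e, i) \<le> 2 ^ cert_bits S) \<and>
    lp_ok I L' (\<lambda>\<kappa> e i. real (y (\<kappa>, e, i)) / real z) \<and>
    (\<forall>r\<in>R. (\<Sum>\<kappa>\<in>commodities I. \<Sum>e\<in>edges I. of_int (\<alpha> r \<kappa> e) * (\<Sum>i=0..modes I. real (y (\<kappa>, e, i)))) = \<beta> r * real z)"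

text \<open>The equations \<open>R\<close> on the flow are left open: conservation laws for a free
  flow, fixed values for a prescribed one. All sizes are controlled by the single exponent
  \<open>S\<close>.\<close>

lemma integral_certificate:
  fixes \<alpha> :: "'r => commodity => edge => int" and \<beta> :: "'r => int"
    and w :: "edge => nat" and t h c k :: "nat => nat" and x :: split
  assumes I: "msp_instance I" and x: "lp_ok I L x"
    and xS: "!!\<kappa> e. \<kappa> \<in> commodities I ==> e \<in> edges I ==> (\<Sum>i=0..modes I. x \<kappa> e i) \<le> 2 ^ S"
    and S: "num_verts I \<le> S" "Suc (modes I) \<le> S" "0 < Q" "Q \<le> 2 ^ S"
    and w: "!!e. e \<in> edges I ==> scaled S Q (weight I e) (w e)"
    and t: "!!i. i \<le> modes I ==> scaled S Q (travel_time I i) (t i)"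
    and h: "!!i. i \<le> modes I ==> scaled S Q (energy I i) (h i)"
    and c: "!!i. i \<le> modes I ==> scaled S Q (cost I i) (c i)"
    and k: "!!i. i \<le> modes I ==> scaled S Q (capacity I i) (k i)"
    and B: "scaled S Q (budget I) B" and b: "scaled S Q (energy_bound I) b"
    and a: "!!A. time_bound I = Some A ==> scaled S Q A a"
    and R: "finite R" "card R \<le> S ^ 4"
    and \<alpha>: "!!r \<kappa> e. r \<in> R ==> \<kappa> \<in> commodities I ==> e \<in> edges I ==> \<bar>\<alpha> r \<kappa> e\<bar> \<le> 2 ^ S"
    and \<beta>: "!!r. r \<in> R ==> \<bar>\<beta> r\<bar> \<le> 2 ^ S"
    and eq: "!!r. r \<in> R ==> (\<Sum>\<kappa>\<in>commodities I. \<Sum>e\<in>edges I. of_int (\<alpha> r \<kappa> e) * (\<Sum>i=0..modes I. x \<kappa> e i)) = \<beta> r"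
  shows "\<exists>L' y z. integral_sol I S R \<alpha> \<beta> L' y z"
proof -
  let ?K = "commodities I" and ?E = "edges I" and ?m = "modes I"
  have E: "?E \<subseteq> {..<num_verts I} \<times> {..<num_verts I}" "finite ?E"
    using I finite_subset[of "?E" "{..<num_verts I} \<times> {..<num_verts I}"] by (auto simp: msp_instance_def pair_fin_digraph_graph)
  have Ksub: "?K \<subseteq> {..<num_verts I} \<times> {..<num_verts I}" by (auto simp: commodities_def)
  then have finK: "finite ?K" by (rule finite_subset) auto
  have n2: "card ({..<num_verts I} \<times> {..<num_verts I}) \<le> S * S"
    using S(1) by (simp add: card_cartesian_product mult_mono)
  have cardE: "card ?E \<le> S * S" using card_mono[OF _ E(1)] n2 by simp
  have cardK: "card ?K \<le> S * S" using card_mono[OF _ Ksub] n2 by simp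
  have Q0: "real Q > 0" using S(3) by simp
  have sc: "lp_ok I L (\<lambda>\<kappa> e i. y \<kappa> e i / z) \<longleftrightarrow> scaled_rows I L y z (real Q) (\<lambda>e. real (w e))
      (\<lambda>i. real (t i)) (\<lambda>i. real (h i)) (\<lambda>i. real (c i)) (\<lambda>i. real (k i)) (real B) (real a) (real b)" if "z > 0" for L z and y :: split
    by (rule lp_ok_scaled[OF that Q0]) (assumption | rule w[unfolded scaled_def, THEN conjunct1]
      t[unfolded scaled_def, THEN conjunct1] h[unfolded scaled_def, THEN conjunct1] c[unfolded scaled_def, THEN conjunct1]
      k[unfolded scaled_def, THEN conjunct1] B[unfolded scaled_def, THEN conjunct1]
      b[unfolded scaled_def, THEN conjunct1] a[unfolded scaled_def, THEN conjunct1])+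
  have x0: "x \<kappa> e i \<ge> 0" if "\<kappa> \<in> ?K" "e \<in> ?E" "i \<le> ?m" for \<kappa> e i
    using x that by (simp add: lp_ok_def)
  define X where "X e i = (\<Sum>\<kappa>\<in>?K. x \<kappa> e i)" for e i
  have xle: "x \<kappa> e i \<le> 2 ^ S" if "\<kappa> \<in> ?K" "e \<in> ?E" "i \<le> ?m" for \<kappa> e i
    using member_le_sum[of i "{0..?m}" "x \<kappa> e"] x0 that xS[of \<kappa> e] by simp
  have X: "0 \<le> X e i \<and> X e i \<le> real (S * S * 2 ^ S)" if "e \<in> ?E" "i \<le> ?m" for e i
  proof
    show "0 \<le> X e i" unfolding X_def by (intro sum_nonneg x0 that)
    have "X e i \<le> (\<Sum>\<kappa>\<in>?K. 2 ^ S)" unfolding X_def by (intro sum_mono xle that)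
    also have "... = real (card ?K) * 2 ^ S" by simp
    also have "... \<le> real (S * S) * 2 ^ S" using cardK by (intro mult_right_mono) (simp_all flip: of_nat_mult)
    finally show "X e i \<le> real (S * S * 2 ^ S)" by simp
  qed
  \<comment> \<open>Vehicles beyond \<open>X e i * Q\<close> are of no use, since each capacity is
    at least \<open>1 / Q\<close>; removing them only lowers cost and energy.\<close>
  define L' where "L' e i = (if e \<in> ?E \<and> i \<le> ?m then min (L e i) (nat \<lceil>X e i * real Q\<rceil>) else 0)" for e i
  have L'L: "L' e i \<le> L e i" for e i by (simp add: L'_def)
  \<comment> \<open>At most \<open>S * S\<close> commodities of flow at most \<open>2 ^ S\<close>,
    times \<open>Q \<le> 2 ^ S\<close>; each factor \<open>S\<close> is estimated by
    \<open>2 ^ S\<close>.\<close>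
  have L'T: "L' e i \<le> 2 ^ (4 * S)" for e i
  proof (cases "e \<in> ?E \<and> i \<le> ?m")
    case True
    then have "X e i * real Q \<le> real (S * S * 2 ^ S) * real (2 ^ S)"
      using X[of e i] S(4) Q0 by (intro mult_mono) (simp_all del: of_nat_mult of_nat_power)
    also have "... \<le> real (2 ^ S * 2 ^ S * 2 ^ S) * real (2 ^ S)"
      using less_exp[of S] by (intro mult_right_mono) (simp_all add: mult_mono del: of_nat_mult of_nat_power)
    also have "... = real (2 ^ (4 * S))"
      by (simp add: power_add[symmetric])
    finally have "nat \<lceil>X e i * real Q\<rceil> \<le> 2 ^ (4 * S)" by (simp add: nat_le_iff ceiling_le_iff)
    then show ?thesis using True by (simp add: L'_def min.coboundedI2)
  next
    case False
    then show ?thesis by (simp only: L'_def if_False zero_le)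
  qed
  have kpos: "k i \<ge> 1" if "i \<le> ?m" for i
  proof -
    have "real_of_rat (capacity I i) > 0" using I that by (simp add: msp_instance_def)
    then show ?thesis using k[OF that] Q0 by (cases "k i") (auto simp: scaled_def)
  qed
  have "lp_ok I L (\<lambda>\<kappa> e i. x \<kappa> e i / 1)" using x by simp
  note x1 = this[unfolded sc[OF zero_less_one], unfolded mult_1 mult_1_right]
  have cap: "real Q * X e i \<le> real (k i) * real (L' e i)" if "e \<in> ?E" "i \<in> {1..?m}" for e i
  proof (cases "L e i \<le> nat \<lceil>X e i * real Q\<rceil>")
    case True
    then show ?thesis using x1 that by (simp add: L'_def X_def)
  next
    case False
    have "real Q * X e i \<le> 1 * real (nat \<lceil>X e i * real Q\<rceil>)"
      by (simp add: mult.commute real_nat_ceiling_ge)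
    also have "... \<le> real (k i) * real (nat \<lceil>X e i * real Q\<rceil>)"
      using kpos[of i] that by (intro mult_right_mono) auto
    finally show ?thesis using False that by (simp add: L'_def)
  qed
  have bud: "(\<Sum>e\<in>?E. real (w e) * (\<Sum>i=1..?m. real (c i) * real (L' e i))) \<le> real B * real Q"
  proof -
    have "(\<Sum>e\<in>?E. real (w e) * (\<Sum>i=1..?m. real (c i) * real (L' e i))) \<le>
        (\<Sum>e\<in>?E. real (w e) * (\<Sum>i=1..?m. real (c i) * real (L e i)))"
      using L'L by (intro sum_mono mult_left_mono) auto
    then show ?thesis using x1 by simp
  qed
  \<comment> \<open>The layout is a constant of the linear program, so its share of the energy moves
    to the right-hand side.\<close>
  define hL where "hL = (\<Sum>e\<in>?E. w e * (\<Sum>i=1..?m. h i * L' e i))"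
  define G where "G f = (\<Sum>e\<in>?E. real (w e) * (real (h 0) * (\<Sum>\<kappa>\<in>?K. f (\<kappa>, e, 0))))" for f :: "commodity \<times> edge \<times> nat => real"
  have GhL: "(\<Sum>e\<in>?E. real (w e) * (real (h 0) * (\<Sum>\<kappa>\<in>?K. f (\<kappa>, e, 0)) + z * (\<Sum>i=1..?m. real (h i) * real (L' e i)))) =
      G f + z * real hL" for f z
    by (simp add: G_def hL_def distrib_left sum.distrib sum_distrib_left mult_ac)
  have en: "G (\<lambda>(\<kappa>, e, i). x \<kappa> e i) + real hL \<le> real b * real Q"
  proof -
    have "(\<Sum>e\<in>?E. real (w e) * (real (h 0) * (\<Sum>\<kappa>\<in>?K. x \<kappa> e 0) + (\<Sum>i=1..?m. real (h i) * real (L' e i)))) \<le>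
        (\<Sum>e\<in>?E. real (w e) * (real (h 0) * (\<Sum>\<kappa>\<in>?K. x \<kappa> e 0) + (\<Sum>i=1..?m. real (h i) * real (L e i))))"
      using L'L by (intro sum_mono mult_left_mono add_left_mono) auto
    then show ?thesis using x1 GhL[of "\<lambda>(\<kappa>, e, i). x \<kappa> e i" 1] by simp
  qed
  define J where "J = ?K \<times> ?E \<times> {0..?m}"
  define rows where "rows = (\<lambda>(e, i). Cap e i) ` (?E \<times> {1..?m}) \<union> {Time, Energy} \<union> EqP ` R \<union> EqM ` R"
  define A :: "'r row => commodity \<times> edge \<times> nat => int" where
    "A r j = (case j of (\<kappa>, e, i) => case r of Cap e' i' => if e' = e \<and> i' = i then int Q else 0
      | Time => if time_bound I = None then 0 else int (w e * t i)
      | Energy => if 0 = i then int (w e * h 0) else 0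
      | EqP r => \<alpha> r \<kappa> e | EqM r => - \<alpha> r \<kappa> e)" for r j
  define b' :: "'r row => int" where
    "b' r = (case r of Cap e i => int (k i * L' e i) | Time => if time_bound I = None then 0 else int (a * Q)
      | Energy => int (b * Q) - int hL | EqP r => \<beta> r | EqM r => - \<beta> r)" for r
  have sumJ: "(\<Sum>j\<in>J. f j) = (\<Sum>\<kappa>\<in>?K. \<Sum>e\<in>?E. \<Sum>i=0..?m. f (\<kappa>, e, i))" for f :: "_ => real"
    unfolding J_def by (simp add: sum.cartesian_product)
  have rCap: "(\<Sum>j\<in>J. A (Cap e' i') j * f j) = real Q * (\<Sum>\<kappa>\<in>?K. f (\<kappa>, e', i'))" if "e' \<in> ?E" "i' \<in> {1..?m}" for e' i' and f :: "_ => real"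
  proof -
    have "(\<Sum>e\<in>?E. \<Sum>i=0..?m. A (Cap e' i') (\<kappa>, e, i) * f (\<kappa>, e, i)) = real Q * f (\<kappa>, e', i')" for \<kappa>
    proof -
      have "(\<Sum>e\<in>?E. \<Sum>i=0..?m. A (Cap e' i') (\<kappa>, e, i) * f (\<kappa>, e, i)) =
          (\<Sum>e\<in>?E. if e' = e then (\<Sum>i=0..?m. if i' = i then real Q * f (\<kappa>, e', i') else 0) else 0)"
      proof (rule sum.cong[OF refl])
        fix e
        have "A (Cap e' i') (\<kappa>, e, i) * f (\<kappa>, e, i) = (if e' = e then if i' = i then real Q * f (\<kappa>, e', i') else 0 else 0)" for i
          by (simp add: A_def)
        then show "(\<Sum>i=0..?m. A (Cap e' i') (\<kappa>, e, i) * f (\<kappa>, e, i)) =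
            (if e' = e then (\<Sum>i=0..?m. if i' = i then real Q * f (\<kappa>, e', i') else 0) else 0)"
          by simp
      qed
      then show ?thesis using that E(2) by (simp add: sum.delta')
    qed
    then show ?thesis by (simp add: sumJ sum_distrib_left)
  qed
  have rTime: "(\<Sum>j\<in>J. A Time j * f j) = (\<Sum>e\<in>?E. real (w e) * (\<Sum>i=0..?m. real (t i) * (\<Sum>\<kappa>\<in>?K. f (\<kappa>, e, i))))"
    if "time_bound I \<noteq> None" for f :: "_ => real"
  proof -
    have "(\<Sum>j\<in>J. A Time j * f j) = (\<Sum>e\<in>?E. \<Sum>\<kappa>\<in>?K. \<Sum>i=0..?m. A Time (\<kappa>, e, i) * f (\<kappa>, e, i))"
      unfolding sumJ by (rule sum.swap)
    also have "... = (\<Sum>e\<in>?E. \<Sum>i=0..?m. \<Sum>\<kappa>\<in>?K. A Time (\<kappa>, e, i) * f (\<kappa>, e, i))"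
      by (intro sum.cong refl sum.swap)
    finally have 1: "(\<Sum>j\<in>J. A Time j * f j) = (\<Sum>e\<in>?E. \<Sum>i=0..?m. \<Sum>\<kappa>\<in>?K. A Time (\<kappa>, e, i) * f (\<kappa>, e, i))" .
    have "A Time (\<kappa>, e, i) = int (w e * t i)" for \<kappa> e i using that by (auto simp: A_def)
    then show ?thesis unfolding 1 by (simp add: sum_distrib_left mult.assoc)
  qed
  have rEnergy: "(\<Sum>j\<in>J. A Energy j * f j) = G f" for f :: "_ => real"
  proof -
    have "(\<Sum>j\<in>J. A Energy j * f j) = (\<Sum>e\<in>?E. \<Sum>\<kappa>\<in>?K. \<Sum>i=0..?m. A Energy (\<kappa>, e, i) * f (\<kappa>, e, i))"
      unfolding sumJ by (rule sum.swap)
    also have "... = (\<Sum>e\<in>?E. \<Sum>\<kappa>\<in>?K. \<Sum>i=0..?m. if 0 = i then real (w e) * real (h 0) * f (\<kappa>, e, 0) else 0)"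
      by (intro sum.cong refl) (auto simp: A_def)
    finally show ?thesis by (simp add: G_def sum_distrib_left mult.assoc)
  qed
  have rEq: "(\<Sum>j\<in>J. A (EqP r) j * f j) = (\<Sum>\<kappa>\<in>?K. \<Sum>e\<in>?E. \<alpha> r \<kappa> e * (\<Sum>i=0..?m. f (\<kappa>, e, i)))"
    "(\<Sum>j\<in>J. A (EqM r) j * f j) = - (\<Sum>\<kappa>\<in>?K. \<Sum>e\<in>?E. \<alpha> r \<kappa> e * (\<Sum>i=0..?m. f (\<kappa>, e, i)))" for r and f :: "_ => real"
    by (simp_all add: sumJ A_def sum_distrib_left sum_negf)
  define x' where "x' = (\<lambda>(\<kappa>, e, i). x \<kappa> e i)"
  have x': "x' (\<kappa>, e, i) = x \<kappa> e i" for \<kappa> e i by (simp add: x'_def)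
  have row: "(\<Sum>j\<in>J. A r j * x' j) \<le> b' r" if r: "r \<in> rows" for r
  proof -
    consider e i where "r = Cap e i" "e \<in> ?E" "i \<in> {1..?m}" | "r = Time" | "r = Energy"
      | q where "r = EqP q" "q \<in> R" | q where "r = EqM q" "q \<in> R"
      using r unfolding rows_def by (elim UnE imageE insertE emptyE) auto
    then show ?thesis
    proof cases
      case 1
      then show ?thesis using cap[of e i] by (simp add: rCap x' b'_def X_def)
    next
      case 2
      show ?thesis
      proof (cases "time_bound I = None")
        case True
        then show ?thesis by (simp add: 2 A_def b'_def split_beta)
      next
        case False
        show ?thesis using x1[THEN conjunct2, THEN conjunct2, THEN conjunct2, THEN conjunct1, THEN mp, OF False] False
          unfolding 2 rTime[OF False] x' b'_def by auto
      qed
    next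
      case 3
      then show ?thesis using en by (simp add: rEnergy x'_def b'_def)
    next
      case 4
      then show ?thesis using eq by (simp add: rEq x' b'_def)
    next
      case 5
      then show ?thesis using eq by (simp add: rEq x' b'_def)
    qed
  qed
  \<comment> \<open>There are at most \<open>S ^ 5\<close> unknowns, one per commodity, edge and
    mode, and at most \<open>S ^ 3 + 2 + 2 * S ^ 4\<close> rows.\<close>
  define N where "N = 6 * (S + 1) ^ 5"
  have finJ: "finite J" "finite rows" using finK E(2) R(1) by (auto simp: J_def rows_def)
  have "card J + card rows \<le> N"
  proof -
    have "card J = card ?K * (card ?E * Suc ?m)" by (simp add: J_def card_cartesian_product)
    also have "... \<le> (S * S) * ((S * S) * S)" by (intro mult_mono cardE cardK S(2)) auto
    finally have 1: "card J \<le> S ^ 5" by (simp add: eval_nat_numeral algebra_simps)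
    have "card ((\<lambda>(e, i). Cap e i :: 'r row) ` (?E \<times> {1..?m})) \<le> card (?E \<times> {1..?m})"
      using E(2) by (intro card_image_le) auto
    also have "... = card ?E * ?m" by (simp add: card_cartesian_product)
    also have "... \<le> (S * S) * S" using S(2) by (intro mult_mono cardE) auto
    finally have 2: "card ((\<lambda>(e, i). Cap e i :: 'r row) ` (?E \<times> {1..?m})) \<le> S ^ 3"
      by (simp add: eval_nat_numeral algebra_simps)
    have 3: "card (EqP ` R) \<le> S ^ 4" "card (EqM ` R) \<le> S ^ 4"
      using card_image_le[OF R(1), of EqP] card_image_le[OF R(1), of EqM] R(2) by linarith+
    have 4: "card {Time, Energy :: 'r row} \<le> 2" by simp
    have "card rows \<le> S ^ 3 + 2 + S ^ 4 + S ^ 4"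
      unfolding rows_def
      by (intro order_trans[OF card_Un_le] add_mono 2 3 4)
    moreover have "S ^ k \<le> (S + 1) ^ 5" if "k \<le> 5" for k
      using power_mono[of S "S + 1" k] power_increasing[OF that, of "S + 1"] by simp
    from this[of 3] this[of 4] this[of 5] have "S ^ 3 \<le> (S + 1) ^ 5" "S ^ 4 \<le> (S + 1) ^ 5" "S ^ 5 \<le> (S + 1) ^ 5" by simp_all
    moreover have "1 \<le> (S + 1) ^ 5" by simp
    ultimately show ?thesis using 1 unfolding N_def by linarith
  qed
  note N = this
  have p: "(2::int) ^ i \<le> 2 ^ (5 * S)" if "i \<le> 5 * S" for i by (rule power_increasing[OF that]) simp
  have wS: "w e \<le> 2 ^ S" if "e \<in> ?E" for e using w[OF that] by (simp add: scaled_def)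
  have iS: "t i \<le> 2 ^ S" "h i \<le> 2 ^ S" "k i \<le> 2 ^ S" if "i \<le> ?m" for i
    using t[OF that] h[OF that] k[OF that] by (simp_all add: scaled_def)
  have prod: "int (u * v) \<le> 2 ^ (5 * S)" if "u \<le> 2 ^ i" "v \<le> 2 ^ j" "i + j \<le> 5 * S" for u v i j :: nat
  proof -
    have "u * v \<le> 2 ^ i * 2 ^ j" using that by (intro mult_mono) auto
    then have "int (u * v) \<le> int (2 ^ i * 2 ^ j)" by (simp only: of_nat_le_iff)
    also have "... = 2 ^ (i + j)" by (simp add: power_add)
    also have "... \<le> 2 ^ (5 * S)" by (rule p[OF that(3)])
    finally show ?thesis .
  qed
  have AM: "\<bar>A r j\<bar> \<le> int (2 ^ (5 * S))" if r: "r \<in> rows" "j \<in> J" for r j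
  proof -
    obtain \<kappa> e i where j: "j = (\<kappa>, e, i)" "\<kappa> \<in> ?K" "e \<in> ?E" "i \<le> ?m" using r(2) by (auto simp: J_def)
    have \<alpha>': "\<bar>\<alpha> q \<kappa> e\<bar> \<le> 2 ^ (5 * S)" if "q \<in> R" for q
      by (rule order_trans[OF \<alpha>[OF that j(2,3)] p]) simp
    have Q': "int Q \<le> 2 ^ (5 * S)" using prod[of Q S 1 0] S(4) by simp
    show ?thesis
      using r(1) \<alpha>' Q' prod[OF wS[OF j(3)] iS(1)[OF j(4)]] prod[OF wS[OF j(3)] iS(2)[of 0]]
      by (auto simp: rows_def A_def j(1))
  qed
  \<comment> \<open>The product \<open>k i * L' e i \<le> 2 ^ S * 2 ^ (4 * S)\<close> explains the
    exponent \<open>5 * S\<close>. In the energy row the given solution shows that the right-hand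
    side is nonnegative.\<close>
  have bM: "\<bar>b' r\<bar> \<le> int (2 ^ (5 * S))" if r: "r \<in> rows" for r
  proof -
    have \<beta>': "\<bar>\<beta> q\<bar> \<le> 2 ^ (5 * S)" if "q \<in> R" for q
      by (rule order_trans[OF \<beta>[OF that] p]) simp
    have "real hL \<le> real (b * Q)"
    proof -
      have "0 \<le> G x'" unfolding G_def by (intro sum_nonneg mult_nonneg_nonneg) (auto simp: x' x0)
      then show ?thesis using en by (simp add: x'_def)
    qed
    then have hL: "hL \<le> b * Q" by (simp only: of_nat_le_iff)
    have b': "b \<le> 2 ^ S" using b by (simp add: scaled_def)
    have a': "a \<le> 2 ^ S" if "time_bound I \<noteq> None" using a that by (auto simp: scaled_def)
    consider e i where "r = Cap e i" "e \<in> ?E" "i \<in> {1..?m}" | "r = Time" | "r = Energy"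
      | q where "r = EqP q" "q \<in> R" | q where "r = EqM q" "q \<in> R"
      using r unfolding rows_def by (elim UnE imageE insertE emptyE) auto
    then show ?thesis
    proof cases
      case 1
      then show ?thesis using prod[OF iS(3) L'T, of i e i] by (simp add: b'_def)
    next
      case 2
      then show ?thesis using prod[OF a' S(4)] by (simp add: b'_def)
    next
      case 3
      then show ?thesis using prod[OF b' S(4)] of_nat_mono[OF hL, where 'a = int] by (simp add: b'_def)
    next
      case 4
      then show ?thesis using \<beta>' by (simp add: b'_def)
    next
      case 5
      then show ?thesis using \<beta>' by (simp add: b'_def)
    qed
  qed
  have "\<exists>(y :: commodity \<times> edge \<times> nat => nat) z. 0 < z \<and> z \<le> (2 * (N + 1) * (N * (2 ^ (5 * S)) ^ 2) + 1) ^ N \<and>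
    (\<forall>j\<in>J. y j \<le> (2 * (N + 1) * (N * (2 ^ (5 * S)) ^ 2) + 1) ^ N) \<and>
    (\<forall>r\<in>rows. (\<Sum>j\<in>J. A r j * int (y j)) \<le> b' r * int z)"
    by (rule small_solution[OF finJ(2,1) _ N _ row]) (assumption | rule AM bM | simp add: J_def x' x0 split_beta; fail | (clarsimp simp: J_def x' x0))+
  then obtain y :: "commodity \<times> edge \<times> nat => nat" and z where yz0: "0 < z \<and> z \<le> (2 * (N + 1) * (N * (2 ^ (5 * S)) ^ 2) + 1) ^ N \<and>
    (\<forall>j\<in>J. y j \<le> (2 * (N + 1) * (N * (2 ^ (5 * S)) ^ 2) + 1) ^ N) \<and>
    (\<forall>r\<in>rows. (\<Sum>j\<in>J. A r j * int (y j)) \<le> b' r * int z)"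
    by (elim exE)
  note z = yz0[THEN conjunct1] and zb = yz0[THEN conjunct2, THEN conjunct1]
    and yb = yz0[THEN conjunct2, THEN conjunct2, THEN conjunct1, THEN bspec]
    and yr = yz0[THEN conjunct2, THEN conjunct2, THEN conjunct2, THEN bspec]
  note bits = cert_bits_ge[of S, folded N_def]
  have yr': "(\<Sum>j\<in>J. A r j * real (y j)) \<le> b' r * real z" if "r \<in> rows" for r
  proof -
    have "real_of_int (\<Sum>j\<in>J. A r j * int (y j)) \<le> real_of_int (b' r * int z)"
      using yr[OF that] by (simp only: of_int_le_iff)
    then show ?thesis by simp
  qed
  have z0: "real z > 0" using z by simp
  have "lp_ok I L' (\<lambda>\<kappa> e i. real (y (\<kappa>, e, i)) / real z)"
    unfolding sc[OF z0]
  proof (intro conjI ballI impI allI)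
    fix e i assume ei: "e \<in> ?E" "i \<in> {1..?m}"
    then have "Cap e i \<in> rows" by (auto simp: rows_def)
    from yr'[OF this, unfolded rCap[OF ei]] show "real Q * (\<Sum>\<kappa>\<in>?K. real (y (\<kappa>, e, i))) \<le> real z * (real (k i) * real (L' e i))"
      by (simp add: b'_def mult_ac)
  next
    assume n: "time_bound I \<noteq> None"
    have "Time \<in> rows" by (simp add: rows_def)
    from yr'[OF this] show "(\<Sum>e\<in>?E. real (w e) * (\<Sum>i=0..?m. real (t i) * (\<Sum>\<kappa>\<in>?K. real (y (\<kappa>, e, i))))) \<le> real a * real Q * real z"
      unfolding rTime[OF n] using n by (simp add: b'_def)
  next
    have "Energy \<in> rows" by (simp add: rows_def)
    from yr'[OF this] show "(\<Sum>e\<in>?E. real (w e) * (real (h 0) * (\<Sum>\<kappa>\<in>?K. real (y (\<kappa>, e, 0))) +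
        real z * (\<Sum>i=1..?m. real (h i) * real (L' e i)))) \<le> real b * real Q * real z"
      unfolding rEnergy GhL[of "\<lambda>j. real (y j)"] by (simp add: b'_def algebra_simps)
  qed (use bud in auto)
  moreover have "(\<Sum>\<kappa>\<in>?K. \<Sum>e\<in>?E. of_int (\<alpha> r \<kappa> e) * (\<Sum>i=0..?m. real (y (\<kappa>, e, i)))) = \<beta> r * real z" if "r \<in> R" for r
  proof -
    have "EqP r \<in> rows" "EqM r \<in> rows" using that by (auto simp: rows_def)
    from this[THEN yr'] show ?thesis unfolding rEq by (simp add: b'_def)
  qed
  moreover have "z \<le> 2 ^ cert_bits S" by (rule order_trans[OF zb bits(1)])
  moreover have "y (\<kappa>, e, i) \<le> 2 ^ cert_bits S" if "\<kappa> \<in> ?K" "e \<in> ?E" "i \<le> ?m" for \<kappa> e i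
    by (rule order_trans[OF yb bits(1)]) (use that in \<open>simp add: J_def\<close>)
  moreover have "L' e i \<le> 2 ^ cert_bits S" for e i
    by (rule order_trans[OF L'T power_increasing[OF bits(2)]]) simp
  ultimately show ?thesis
    using z by (intro exI[of _ L'] exI[of _ y] exI[of _ z] conjI ballI allI impI)
qed

section \<open>Checking certificates\<close>

text \<open>Adding up all matching entries makes lookup total on arbitrary lists; with distinct keys
  it returns the stored value.\<close>

definition lk :: "('k \<times> nat) list => 'k => nat" where
  "lk l k = sum_list (map snd (filter (\<lambda>p. fst p = k) l))"

lemma lk_map:
  assumes "distinct ks" shows "lk (map (\<lambda>k. (k, g k)) ks) k = (if k \<in> set ks then g k else 0)"
  using assms by (induction ks) (auto simp: lk_def)

lemma pt_lk [pti]: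
  assumes "pt l" "pt k" shows "pt (\<lambda>x. lk (l x) (k x))"
  unfolding lk_def by (intro pti pt_comp[OF assms(1)] pt_comp[OF assms(2)] assms(1))

definition wd :: "dat => edge => fr option" where
  "wd d e = nthd None (nthd [] (fst d) (fst e)) (snd e)"

definition dm :: "dat => commodity => nat" where
  "dm d \<kappa> = nthd 0 (nthd [] (fst (snd (snd d))) (fst \<kappa>)) (snd \<kappa>)"

definition md :: "dat => nat => fr \<times> fr \<times> fr \<times> fr" where
  "md d i = nthd ((0, 0), (0, 0), (0, 0), (0, 0)) (fst (snd (snd (snd d)))) i"

definition Vs :: "dat => nat list" where
  "Vs d = [0..<length (fst d)]"

definition Es :: "dat => edge list" where
  "Es d = filter (\<lambda>e. wd d e \<noteq> None) (List.product (Vs d) (Vs d))"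

definition Ks :: "dat => commodity list" where
  "Ks d = filter (\<lambda>\<kappa>. 0 < dm d \<kappa>) (List.product (Vs d) (Vs d))"

definition Is :: "dat => nat list" where
  "Is d = [0..<length (fst (snd (snd (snd d))))]"

definition Ps :: "dat => nat list" where
  "Ps d = filter (\<lambda>i. 0 < i) (Is d)"

lemma pt_wd [pti]: "pt d ==> pt e ==> pt (\<lambda>x. wd (d x) (e x))"
  unfolding wd_def by (intro pti)

lemma pt_dm [pti]: "pt d ==> pt e ==> pt (\<lambda>x. dm (d x) (e x))"
  unfolding dm_def by (intro pti)

lemma pt_md [pti]: "pt d ==> pt i ==> pt (\<lambda>x. md (d x) (i x))"
  unfolding md_def by (intro pti)

lemma pt_Vs [pti]: "pt d ==> pt (\<lambda>x. Vs (d x))"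
  unfolding Vs_def by (intro pti)

lemma pt_Es [pti]: assumes "pt d" shows "pt (\<lambda>x. Es (d x))"
  unfolding Es_def by (intro pti pt_comp[OF assms(1)] assms)

lemma pt_Ks [pti]: assumes "pt d" shows "pt (\<lambda>x. Ks (d x))"
  unfolding Ks_def by (intro pti pt_comp[OF assms(1)] assms)

lemma pt_Is [pti]: "pt d ==> pt (\<lambda>x. Is (d x))"
  unfolding Is_def by (intro pti)

lemma pt_Ps [pti]: assumes "pt d" shows "pt (\<lambda>x. Ps (d x))"
  unfolding Ps_def by (intro pti pt_comp[OF assms(1)] assms)

type_synonym cert = "(nat list \<times> nat) list"

text \<open>
  The first entry of a key tells what is stored: 0 the common denominator \<open>Q\<close> of the numbers of the
  instance, 1 the denominator \<open>z\<close> of the flow, 2 to 8 the numbers of the instance multiplied by \<open>Q\<close>,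
  9 the layout, 10 the flow by modes multiplied by \<open>z\<close>, 11 to 13 the numerator and the denominator of
  a prescribed flow and its product with \<open>Q\<close>, 14 and 15 the functions of a ranked graph.
\<close>

abbreviation "cQ c \<equiv> lk c [0::nat]"
abbreviation "cz c \<equiv> lk c [1::nat]"
abbreviation "cw c e \<equiv> lk c [2::nat, fst e, snd e]"
abbreviation "cm c j i \<equiv> lk c [3::nat, j, i]"
abbreviation "cB c \<equiv> lk c [6::nat]"
abbreviation "ca c \<equiv> lk c [7::nat]"
abbreviation "cb c \<equiv> lk c [8::nat]"
abbreviation "cL c e i \<equiv> lk c [9::nat, fst e, snd e, i]"
abbreviation "cy c \<kappa> e i \<equiv> lk c [10::nat, fst \<kappa>, snd \<kappa>, fst e, snd e, i]"
abbreviation "cf c j \<kappa> e \<equiv> lk c [j::nat, fst \<kappa>, snd \<kappa>, fst e, snd e]"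

section \<open>The checks of the verifier\<close>

definition sc :: "nat => fr => nat => bool" where
  "sc Q f k \<longleftrightarrow> fst f * Q = snd f * k"

lemma pt_sc [pti]: "pt q ==> pt f ==> pt k ==> pt (\<lambda>x. sc (q x) (f x) (k x))"
  unfolding sc_def by (intro pti)

text \<open>The numbers multiplied by \<open>Q\<close> are part of the certificate and are confirmed
  by cross-multiplication, so that the verifier never divides.\<close>

definition chk_scale :: "dat => cert => bool" where
  "chk_scale d c \<longleftrightarrow> 0 < cQ c \<and> 0 < cz c \<and>
     (\<forall>e\<in>set (Es d). case wd d e of None => True | Some f => sc (cQ c) f (cw c e)) \<and>
     (\<forall>i\<in>set (Is d). sc (cQ c) (fst (md d i)) (cm c 0 i) \<and> sc (cQ c) (fst (snd (md d i))) (cm c 1 i) \<and>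
        sc (cQ c) (fst (snd (snd (md d i)))) (cm c 2 i) \<and> sc (cQ c) (snd (snd (snd (md d i)))) (cm c 3 i)) \<and>
     sc (cQ c) (fst (snd d)) (cB c) \<and>
     (case fst (snd (snd (snd (snd d)))) of None => True | Some f => sc (cQ c) f (ca c)) \<and>
     sc (cQ c) (snd (snd (snd (snd (snd d))))) (cb c)"

definition chk_lp :: "dat => cert => bool" where
  "chk_lp d c \<longleftrightarrow>
     (\<Sum>e\<leftarrow>Es d. cw c e * (\<Sum>i\<leftarrow>Ps d. cm c 2 i * cL c e i)) \<le> cB c * cQ c \<and>
     (\<forall>e\<in>set (Es d). \<forall>i\<in>set (Ps d). cQ c * (\<Sum>\<kappa>\<leftarrow>Ks d. cy c \<kappa> e i) \<le> cz c * (cm c 3 i * cL c e i)) \<and>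
     (case fst (snd (snd (snd (snd d)))) of None => True | Some f =>
       (\<Sum>e\<leftarrow>Es d. cw c e * (\<Sum>i\<leftarrow>Is d. cm c 0 i * (\<Sum>\<kappa>\<leftarrow>Ks d. cy c \<kappa> e i))) \<le> ca c * cQ c * cz c) \<and>
     (\<Sum>e\<leftarrow>Es d. cw c e * (cm c 1 0 * (\<Sum>\<kappa>\<leftarrow>Ks d. cy c \<kappa> e 0) + cz c * (\<Sum>i\<leftarrow>Ps d. cm c 1 i * cL c e i)))
       \<le> cb c * cQ c * cz c"

text \<open>The balance is arranged without subtraction: the demand is added to the inflow at the
  source and to the outflow at the sink.\<close>

definition chk_flow :: "dat => cert => bool" where
  "chk_flow d c \<longleftrightarrow> (\<forall>\<kappa>\<in>set (Ks d). \<forall>v\<in>set (Vs d).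
     (\<Sum>e\<leftarrow>filter (\<lambda>e. snd e = v) (Es d). \<Sum>i\<leftarrow>Is d. cy c \<kappa> e i) + (if v = fst \<kappa> then cz c * dm d \<kappa> else 0) =
     (\<Sum>e\<leftarrow>filter (\<lambda>e. fst e = v) (Es d). \<Sum>i\<leftarrow>Is d. cy c \<kappa> e i) + (if v = snd \<kappa> then cz c * dm d \<kappa> else 0))"

definition chk_fix :: "dat => cert => bool" where
  "chk_fix d c \<longleftrightarrow> (\<forall>\<kappa>\<in>set (Ks d). \<forall>e\<in>set (Es d). valid_fr (cf c 11 \<kappa> e, cf c 12 \<kappa> e) \<and>
     sc (cQ c) (cf c 11 \<kappa> e, cf c 12 \<kappa> e) (cf c 13 \<kappa> e) \<and> cQ c * (\<Sum>i\<leftarrow>Is d. cy c \<kappa> e i) = cz c * cf c 13 \<kappa> e)"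

text \<open>The prescribed flow is not parsed from the input; its code is rebuilt from the
  certificate and compared.\<close>

definition flow_code :: "dat => cert => bool list" where
  "flow_code d c = enc_list (\<lambda>\<kappa>. enc_list (\<lambda>e. encf (cf c 11 \<kappa> e, cf c 12 \<kappa> e)) (Es d)) (Ks d)"

definition chk_rank :: "dat => cert => bool" where
  "chk_rank d c \<longleftrightarrow> 0 < length (fst d) \<and> (\<forall>e\<in>set (Es d). lk c [14, fst e] < lk c [14, snd e]) \<and>
     (\<forall>v\<in>set (Vs d). v = 0 \<or> (\<exists>u\<in>set (Vs d). lk c [15, u] < lk c [15, v] \<and> (wd d (u, v) \<noteq> None \<or> wd d (v, u) \<noteq> None)))"

lemma pt_chk_scale: "pt (\<lambda>p. chk_scale (fst p) (snd p))"
  unfolding chk_scale_def by (intro pti pt_case_option)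

lemma pt_chk_lp: "pt (\<lambda>p. chk_lp (fst p) (snd p))"
  unfolding chk_lp_def by (intro pti pt_case_option)

lemma pt_chk_flow: "pt (\<lambda>p. chk_flow (fst p) (snd p))"
  unfolding chk_flow_def by (intro pti pt_case_option)

lemma pt_chk_fix: "pt (\<lambda>p. chk_fix (fst p) (snd p))"
  unfolding chk_fix_def by (intro pti pt_case_option)

lemma pt_flow_code: "pt (\<lambda>p. flow_code (fst p) (snd p))"
  unfolding flow_code_def by (intro pti pt_case_option)

lemma pt_chk_rank: "pt (\<lambda>p. chk_rank (fst p) (snd p))"
  unfolding chk_rank_def by (intro pti pt_case_option)

lemma wd_todata: "u < num_verts I ==> v < num_verts I ==>
    wd (todata I) (u, v) = (if (u, v) \<in> edges I then Some (fr (weight I (u, v))) else None)"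
  by (simp add: wd_def todata_def nthd_def Let_def)

lemma dm_todata: "u < num_verts I ==> v < num_verts I ==> dm (todata I) (u, v) = demand I (u, v)"
  by (simp add: dm_def todata_def nthd_def Let_def)

lemma md_todata: "i \<le> modes I ==>
    md (todata I) i = (fr (travel_time I i), fr (energy I i), fr (cost I i), fr (capacity I i))"
  by (simp add: md_def todata_def nthd_def Let_def del: upt_Suc)

lemma Vs_todata: "Vs (todata I) = [0..<num_verts I]"
  by (simp add: Vs_def todata_def Let_def)

lemma Is_todata: "Is (todata I) = [0..<Suc (modes I)]"
  by (simp add: Is_def todata_def Let_def)

lemma todata_simps [simp]: "length (fst (todata I)) = num_verts I" "fst (snd (todata I)) = fr (budget I)"
  "fst (snd (snd (snd (snd (todata I))))) = map_option fr (time_bound I)"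
  "snd (snd (snd (snd (snd (todata I))))) = fr (energy_bound I)"
  by (simp_all add: todata_def Let_def)

lemma Es_todata: "Es (todata I) = filter (\<lambda>e. e \<in> edges I) (List.product [0..<num_verts I] [0..<num_verts I])"
  unfolding Es_def Vs_todata by (rule filter_cong[OF refl]) (auto simp: wd_todata split: if_splits)

lemma Ks_todata: "Ks (todata I) = filter (\<lambda>\<kappa>. \<kappa> \<in> commodities I) (List.product [0..<num_verts I] [0..<num_verts I])"
  unfolding Ks_def Vs_todata by (rule filter_cong[OF refl]) (auto simp: dm_todata commodities_def)

lemma sc_fr:
  assumes "r \<ge> 0" "0 < Q"
  shows "sc Q (fr r) k \<longleftrightarrow> real_of_rat r = real k / real Q"
proof -
  have v: "snd (fr r) > 0" using valid_fr_fr[OF assms(1)] by (simp add: valid_fr_def)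
  have "real_of_rat r = real (fst (fr r)) / real (snd (fr r))"
    by (subst frval_fr[OF assms(1), symmetric]) (simp add: frval_def of_rat_divide)
  also have "... = real k / real Q \<longleftrightarrow> real (fst (fr r) * Q) = real (snd (fr r) * k)"
    using v assms(2) by (simp add: field_simps)
  also have "... \<longleftrightarrow> sc Q (fr r) k" by (simp only: of_nat_eq_iff sc_def)
  finally show ?thesis ..
qed

context
  fixes I assumes I: "msp_instance I"
begin

lemma edges_sub: "edges I \<subseteq> {..<num_verts I} \<times> {..<num_verts I}"
  using I by (simp add: msp_instance_def pair_fin_digraph_graph)

lemma finite_edges: "finite (edges I)"
  using edges_sub by (rule finite_subset) auto

lemma set_Es: "set (Es (todata I)) = edges I"
  unfolding Es_todata using edges_sub by auto

lemma set_Ks: "set (Ks (todata I)) = commodities I"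
  unfolding Ks_todata by (auto simp: commodities_def)

lemma wd_edge: "e \<in> edges I ==> wd (todata I) e = Some (fr (weight I e))"
  using edges_sub by (cases e) (auto simp: wd_todata)

lemma dm_com: "\<kappa> \<in> commodities I ==> dm (todata I) \<kappa> = demand I \<kappa>"
  by (cases \<kappa>) (auto simp: dm_todata commodities_def)

lemma sum_Es: "(\<Sum>e\<leftarrow>Es (todata I). f e) = sum f (edges I)"
  by (subst set_Es[symmetric], rule sum_list_distinct_conv_sum_set) (simp add: Es_todata distinct_product)

lemma sum_Es_filter: "(\<Sum>e\<leftarrow>filter P (Es (todata I)). f e) = sum f {e \<in> edges I. P e}"
proof -
  have "set (filter P (Es (todata I))) = {e \<in> edges I. P e}" by (auto simp: set_Es)
  moreover have "distinct (filter P (Es (todata I)))" by (simp add: Es_todata distinct_product)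
  ultimately show ?thesis using sum_list_distinct_conv_sum_set by metis
qed

lemma sum_Ks: "(\<Sum>e\<leftarrow>Ks (todata I). f e) = sum f (commodities I)"
  by (subst set_Ks[symmetric], rule sum_list_distinct_conv_sum_set) (simp add: Ks_todata distinct_product)

lemma sum_Is: "(\<Sum>i\<leftarrow>Is (todata I). f i) = (\<Sum>i=0..modes I. f i)"
  by (subst sum_list_distinct_conv_sum_set)
    (simp_all add: Is_todata atLeastLessThanSuc_atLeastAtMost del: upt_Suc)

lemma set_Ps: "set (Ps (todata I)) = {1..modes I}"
  by (auto simp: Ps_def Is_todata)

lemma sum_Ps: "(\<Sum>i\<leftarrow>Ps (todata I). f i) = (\<Sum>i=1..modes I. f i)"
  by (subst set_Ps[symmetric], rule sum_list_distinct_conv_sum_set) (simp add: Ps_def Is_todata del: upt_Suc)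

lemma chk_lp_iff:
  assumes "chk_scale (todata I) c"
  shows "chk_lp (todata I) c \<longleftrightarrow> lp_ok I (cL c) (\<lambda>\<kappa> e i. real (cy c \<kappa> e i) / real (cz c))"
proof -
  have nn: "!!e. e \<in> edges I ==> weight I e \<ge> 0" "budget I \<ge> 0" "energy_bound I \<ge> 0"
    "!!i. i \<le> modes I ==> travel_time I i \<ge> 0" "!!i. i \<le> modes I ==> energy I i \<ge> 0"
    "!!i. i \<le> modes I ==> cost I i \<ge> 0" "!!i. i \<le> modes I ==> capacity I i \<ge> 0"
    "!!A. time_bound I = Some A ==> A \<ge> 0"
    using I by (auto simp: msp_instance_def order_less_imp_le split: option.splits)
  note s = assms[unfolded chk_scale_def]
  have Q: "0 < cQ c" and z: "0 < cz c" using s by blast+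
  have w: "sc (cQ c) (fr (weight I e)) (cw c e)" if "e \<in> edges I" for e
    using s that wd_edge[OF that] by (auto simp: set_Es)
  have m: "sc (cQ c) (fr (travel_time I i)) (cm c 0 i)" "sc (cQ c) (fr (energy I i)) (cm c 1 i)"
    "sc (cQ c) (fr (cost I i)) (cm c 2 i)" "sc (cQ c) (fr (capacity I i)) (cm c 3 i)" if "i \<le> modes I" for i
  proof -
    have "i \<in> set (Is (todata I))" using that by (simp add: Is_todata del: upt_Suc)
    then show "sc (cQ c) (fr (travel_time I i)) (cm c 0 i)" "sc (cQ c) (fr (energy I i)) (cm c 1 i)"
      "sc (cQ c) (fr (cost I i)) (cm c 2 i)" "sc (cQ c) (fr (capacity I i)) (cm c 3 i)"
      using s md_todata[OF that] by auto
  qed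
  have B: "sc (cQ c) (fr (budget I)) (cB c)" "sc (cQ c) (fr (energy_bound I)) (cb c)"
    using s by simp_all
  have a: "sc (cQ c) (fr A) (ca c)" if "time_bound I = Some A" for A
    using s that by simp
  have "lp_ok I (cL c) (\<lambda>\<kappa> e i. real (cy c \<kappa> e i) / real (cz c)) \<longleftrightarrow>
    scaled_rows I (cL c) (\<lambda>\<kappa> e i. real (cy c \<kappa> e i)) (real (cz c)) (real (cQ c)) (\<lambda>e. real (cw c e))
      (\<lambda>i. real (cm c 0 i)) (\<lambda>i. real (cm c 1 i)) (\<lambda>i. real (cm c 2 i)) (\<lambda>i. real (cm c 3 i))
      (real (cB c)) (real (ca c)) (real (cb c))"
    by (rule lp_ok_scaled) (use Q z in simp, use Q z in simp,
      (rule sc_fr[THEN iffD1]; (rule nn | rule Q | rule w | rule m | rule B | rule a); assumption?)+)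
  also have "... \<longleftrightarrow> chk_lp (todata I) c"
    unfolding chk_lp_def sum_Es sum_Is sum_Ps sum_Ks set_Es set_Ps todata_simps
    by (simp flip: of_nat_mult of_nat_add of_nat_sum split: option.split)
  finally show ?thesis ..
qed

lemma chk_flow_iff:
  assumes "0 < cz c"
  shows "chk_flow (todata I) c \<longleftrightarrow> feasible_flow I (\<lambda>\<kappa> e. \<Sum>i=0..modes I. real (cy c \<kappa> e i) / real (cz c))"
proof -
  define Y where "Y \<kappa> e = (\<Sum>i=0..modes I. cy c \<kappa> e i)" for \<kappa> e
  have d0: "demand I (v, v) = 0" if "v < num_verts I" for v using I that by (simp add: msp_instance_def)
  have Y: "(\<Sum>i=0..modes I. real (cy c \<kappa> e i) / real (cz c)) = real (Y \<kappa> e) / real (cz c)" for \<kappa> e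
    by (simp add: sum_divide_distrib Y_def)
  have eq: "net (edges I) (\<lambda>e. real (Y \<kappa> e) / real (cz c)) v = bal I \<kappa> v \<longleftrightarrow>
    (\<Sum>e\<in>{e \<in> edges I. snd e = v}. Y \<kappa> e) + (if v = fst \<kappa> then cz c * demand I \<kappa> else 0) =
    (\<Sum>e\<in>{e \<in> edges I. fst e = v}. Y \<kappa> e) + (if v = snd \<kappa> then cz c * demand I \<kappa> else 0)" (is "?l \<longleftrightarrow> ?r")
    if "\<kappa> \<in> commodities I" for \<kappa> v
  proof -
    have ne: "fst \<kappa> \<noteq> snd \<kappa>" using that(1) d0 by (cases \<kappa>) (auto simp: commodities_def)
    let ?i = "\<Sum>e\<in>{e \<in> edges I. snd e = v}. Y \<kappa> e" and ?o = "\<Sum>e\<in>{e \<in> edges I. fst e = v}. Y \<kappa> e"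
    have 1: "(\<Sum>e\<in>edges I. f e * of_bool (g e = v)) = (\<Sum>e\<in>{e \<in> edges I. g e = v}. f e)" for g :: "edge => nat" and f :: "edge => real"
      using finite_edges by (subst sum.inter_filter) (auto simp: of_bool_def intro!: sum.cong)
    have "net (edges I) (\<lambda>e. real (Y \<kappa> e) / real (cz c)) v = real ?i / real (cz c) - real ?o / real (cz c)"
      unfolding net_def right_diff_distrib sum_subtractf 1 by (simp add: sum_divide_distrib)
    then have "?l \<longleftrightarrow> real ?i / real (cz c) - real ?o / real (cz c) = bal I \<kappa> v" by simp
    also have "... \<longleftrightarrow> real ?i - real ?o = real (cz c) * bal I \<kappa> v"
      using assms by (simp add: field_simps)
    also have "... \<longleftrightarrow> real (?i + (if v = fst \<kappa> then cz c * demand I \<kappa> else 0)) =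
        real (?o + (if v = snd \<kappa> then cz c * demand I \<kappa> else 0))"
      using ne by (simp add: bal_def del: of_nat_sum) linarith
    also have "... \<longleftrightarrow> ?r" by (simp only: of_nat_eq_iff)
    finally show ?thesis .
  qed
  have nn: "(0 \<le> real (Y \<kappa> e) / real (cz c)) = True" for \<kappa> e by simp
  show ?thesis
    unfolding chk_flow_def feasible_flow_net[OF finite_edges] sum_Es_filter sum_Is set_Ks Vs_todata Y Y_def[symmetric]
    by (rule ball_cong[OF refl]) (simp only: eq dm_com nn set_upt atLeastLessThan_iff Ball_def le0 simp_thms)
qed

lemma chk_rank_iff:
  "chk_rank (todata I) c \<longleftrightarrow> ranked (edges I) (num_verts I) (\<lambda>v. lk c [14, v]) (\<lambda>v. lk c [15, v])"
  unfolding chk_rank_def ranked_def set_Es Vs_todata todata_simps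
  by (auto simp: wd_todata Bex_def Ball_def split: if_splits)

end

lemma lp_ok_cong:
  assumes x: "lp_ok I L x" and L: "!!e i. e \<in> edges I ==> i \<le> modes I ==> L' e i = L e i"
    and x': "!!\<kappa> e i. \<kappa> \<in> commodities I ==> e \<in> edges I ==> i \<le> modes I ==> x' \<kappa> e i = x \<kappa> e i"
  shows "lp_ok I L' x'"
proof -
  have 1: "(\<Sum>\<kappa>\<in>commodities I. x' \<kappa> e i) = (\<Sum>\<kappa>\<in>commodities I. x \<kappa> e i)" if "e \<in> edges I" "i \<le> modes I" for e i
    by (rule sum.cong[OF refl x'[OF _ that]])
  have 2: "(\<Sum>i=1..modes I. f i * real (L' e i)) = (\<Sum>i=1..modes I. f i * real (L e i))" if "e \<in> edges I" for f e
    by (rule sum.cong) (simp_all add: L[OF that])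
  have 3: "(\<Sum>i=0..modes I. f i * (\<Sum>\<kappa>\<in>commodities I. x' \<kappa> e i)) = (\<Sum>i=0..modes I. f i * (\<Sum>\<kappa>\<in>commodities I. x \<kappa> e i))"
    if "e \<in> edges I" for f e
    by (rule sum.cong) (simp_all add: 1[OF that])
  have 4: "lp_cost I L' =
      lp_cost I L"
    by (rule sum.cong[OF refl]) (simp only: 2)
  have 5: "lp_time I x' =
      lp_time I x"
    by (rule sum.cong[OF refl]) (simp only: 3)
  have 6: "lp_energy I L' x' =
      lp_energy I L x"
    by (rule sum.cong[OF refl]) (simp only: 1 2 le0)
  have 7: "(\<forall>\<kappa>\<in>commodities I. \<forall>e\<in>edges I. \<forall>i\<le>modes I. x' \<kappa> e i \<ge> 0)"
    using x x' by (simp add: lp_ok_def)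
  have 8: "\<forall>e\<in>edges I. \<forall>i\<in>{1..modes I}. (\<Sum>\<kappa>\<in>commodities I. x' \<kappa> e i) \<le> real_of_rat (capacity I i) * real (L' e i)"
  proof (intro ballI)
    fix e i assume ei: "e \<in> edges I" "i \<in> {1..modes I}"
    then have "(\<Sum>\<kappa>\<in>commodities I. x \<kappa> e i) \<le> real_of_rat (capacity I i) * real (L e i)"
      using x unfolding lp_ok_def by blast
    then show "(\<Sum>\<kappa>\<in>commodities I. x' \<kappa> e i) \<le> real_of_rat (capacity I i) * real (L' e i)"
      using 1[OF ei(1)] L[OF ei(1)] ei(2) by simp
  qed
  show ?thesis
    using x 7 8 unfolding lp_ok_def feasible_layout_def 4 5 6 by blast
qed

section \<open>Existence of short certificates\<close>

definition rats :: "msp => (commodity => edge => rat) => rat set" where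
  "rats I F = weight I ` edges I \<union> (travel_time I ` {..modes I} \<union> energy I ` {..modes I} \<union>
     cost I ` {..modes I} \<union> capacity I ` {..modes I}) \<union> {budget I, energy_bound I} \<union> set_option (time_bound I) \<union>
     (\<lambda>(\<kappa>, e). F \<kappa> e) ` (commodities I \<times> edges I)"

definition small :: "nat => rat => bool" where
  "small s r \<longleftrightarrow> r \<ge> 0 \<and> fst (fr r) \<le> 2 ^ s \<and> snd (fr r) \<le> 2 ^ s"

text \<open>The numerator over \<open>Q\<close>; the division is exact when \<open>Q\<close> is a
  multiple of the denominator.\<close>

definition num :: "nat => rat => nat" where
  "num Q r = fst (fr r) * (Q div snd (fr r))"

text \<open>One weight per edge, four numbers per mode, the budget and two bounds, and one flow
  value per commodity and edge.\<close>

definition num_rats :: "nat => nat" where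
  "num_rats s = s ^ 2 + 4 * s + 3 + s ^ 4"

lemma card_rats:
  assumes I: "msp_instance I" and n: "num_verts I \<le> s" "Suc (modes I) \<le> s"
  shows "finite (rats I F)" "card (rats I F) \<le> num_rats s"
    "card (edges I) \<le> s * s" "card (commodities I) \<le> s * s"
proof -
  have fE: "finite (edges I)" by (rule finite_edges[OF I])
  note fK = finite_commodities[of I]
  show "finite (rats I F)" using fE fK by (simp add: rats_def)
  have n2: "card ({..<num_verts I} \<times> {..<num_verts I}) \<le> s * s"
    using n(1) by (simp add: card_cartesian_product mult_mono)
  show cE: "card (edges I) \<le> s * s"
    using card_mono[OF _ edges_sub[OF I]] n2 by simp
  show cK: "card (commodities I) \<le> s * s"
    using card_mono[of "{..<num_verts I} \<times> {..<num_verts I}" "commodities I"] n2 by (auto simp: commodities_def)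
  have 1: "card (weight I ` edges I) \<le> s ^ 2"
    using card_image_le[OF fE, of "weight I"] cE by (simp add: power2_eq_square)
  have 2: "card (f ` {..modes I}) \<le> s" for f :: "nat => rat"
    using card_image_le[of "{..modes I}" f] n(2) by simp
  have 3: "card {budget I, energy_bound I} \<le> 2" by (simp add: card_insert_if)
  have 4: "card (set_option (time_bound I)) \<le> 1" by (cases "time_bound I") auto
  have "card ((\<lambda>(\<kappa>, e). F \<kappa> e) ` (commodities I \<times> edges I)) \<le> card (commodities I \<times> edges I)"
    using fE fK by (intro card_image_le) simp
  also have "... \<le> (s * s) * (s * s)" unfolding card_cartesian_product by (intro mult_mono cE cK) auto
  finally have 5: "card ((\<lambda>(\<kappa>, e). F \<kappa> e) ` (commodities I \<times> edges I)) \<le> s ^ 4"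
    by (simp add: eval_nat_numeral algebra_simps)
  have "card (rats I F) \<le> s ^ 2 + (s + s + s + s) + 2 + 1 + s ^ 4"
    unfolding rats_def by (intro order_trans[OF card_Un_le] add_mono 1 2 3 4 5)
  then show "card (rats I F) \<le> num_rats s" by (simp add: num_rats_def)
qed

lemma common_denominator:
  assumes "finite A" "!!r. r \<in> A ==> small s r" "card A \<le> N"
  shows "\<exists>Q>0. Q \<le> 2 ^ (s * N) \<and> (\<forall>r\<in>A. sc Q (fr r) (num Q r) \<and> num Q r \<le> 2 ^ (s * N + s))"
proof -
  define Q where "Q = (\<Prod>r\<in>A. snd (fr r))"
  have pos: "snd (fr r) > 0" if "r \<in> A" for r
    using valid_fr_fr[of r] assms(2)[OF that] by (simp add: small_def valid_fr_def)
  have "Q > 0" unfolding Q_def using pos by (intro prod_pos) auto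
  have "Q \<le> (\<Prod>r\<in>A. 2 ^ s)" unfolding Q_def using assms(2) by (intro prod_mono) (auto simp: small_def)
  also have "... = 2 ^ (s * card A)" by (simp add: power_mult)
  also have "... \<le> 2 ^ (s * N)" using assms(3) by (intro power_increasing) auto
  finally have Q: "Q \<le> 2 ^ (s * N)" .
  have "sc Q (fr r) (num Q r) \<and> num Q r \<le> 2 ^ (s * N + s)" if r: "r \<in> A" for r
  proof
    have "snd (fr r) dvd Q" unfolding Q_def using assms(1) r by (intro dvd_prodI)
    then show "sc Q (fr r) (num Q r)" by (auto simp: sc_def num_def)
    have "num Q r \<le> 2 ^ s * Q" unfolding num_def using assms(2)[OF r] by (intro mult_mono) (auto simp: small_def)
    also have "... \<le> 2 ^ s * 2 ^ (s * N)" using Q by simp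
    finally show "num Q r \<le> 2 ^ (s * N + s)" by (simp add: power_add mult.commute)
  qed
  with \<open>Q > 0\<close> Q show ?thesis by blast
qed

text \<open>Keys are lists of length 0 to 6 over numbers below \<open>S + 16\<close>, as labels are
  at most 15 and vertices and modes are below \<open>S\<close>. The last factor bounds the size of
  an entry.\<close>

definition cert_size :: "nat => nat" where
  "cert_size S = 1 + 7 * (S + 16) ^ 6 * (1 + (1 + (1 + 6 * (2 + 6 * (S + 16))) + (1 + 6 * (cert_bits S + 1))))"

lemma pb_cert_size: "pb cert_size"
  unfolding cert_size_def cert_bits_def Let_def by (intro pb_add pb_mult pb_power pb_const pb_id)

lemma store_exists:
  fixes g :: "nat list => nat"
  shows "\<exists>c. sz c \<le> cert_size S \<and>
    (\<forall>k. set k \<subseteq> {..<S + 16} \<and> length k \<le> 6 \<and> g k \<le> 2 ^ cert_bits S --> lk c k = g k)"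
proof -
  let ?A = "{k. set k \<subseteq> {..<S + 16} \<and> length k \<le> 6}"
  have "finite ?A" by (rule finite_lists_length_le) simp
  from finite_distinct_list[OF this] obtain ks where ks: "set ks = ?A" "distinct ks" by (elim exE conjE)
  define c where "c = map (\<lambda>k. (k, min (g k) (2 ^ cert_bits S))) ks"
  have "length c = card ?A" using distinct_card[OF ks(2)] ks(1) by (simp add: c_def)
  also have "... = (\<Sum>i\<le>6. (S + 16) ^ i)" by (rule card_lists_length_le[of "{..<S + 16}" 6, unfolded card_lessThan]) simp
  also have "... \<le> (\<Sum>i\<le>(6::nat). (S + 16) ^ 6)"
    by (intro sum_mono power_increasing) auto
  also have "... = 7 * (S + 16) ^ 6" unfolding sum_constant card_atMost by simp
  finally have len: "length c \<le> 7 * (S + 16) ^ 6" .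
  let ?B = "1 + (1 + 6 * (2 + 6 * (S + 16))) + (1 + 6 * (cert_bits S + 1))"
  have "sz p \<le> ?B" if "p \<in> set c" for p
  proof -
    obtain k where k: "k \<in> ?A" "p = (k, min (g k) (2 ^ cert_bits S))" using \<open>p \<in> set c\<close> ks(1) by (auto simp: c_def)
    have "sz j \<le> 1 + 6 * (S + 16)" if "j \<in> set k" for j :: nat
      using k(1) that bl_le_self[of j] by (auto simp: sz_nat)
    then have "sz k \<le> 1 + length k * (1 + (1 + 6 * (S + 16)))" by (rule sz_list_le)
    also have "... \<le> 1 + 6 * (1 + (1 + 6 * (S + 16)))" using k(1) by (intro add_mono mult_mono) auto
    finally have 1: "sz k \<le> 1 + 6 * (2 + 6 * (S + 16))" by simp
    have "min (g k) (2 ^ cert_bits S) < 2 ^ (cert_bits S + 1)"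
      by (rule le_less_trans[OF min.cobounded2]) simp
    then have "bl (min (g k) (2 ^ cert_bits S)) \<le> cert_bits S + 1" by (simp only: bl_le_iff)
    then have 2: "sz (min (g k) (2 ^ cert_bits S)) \<le> 1 + 6 * (cert_bits S + 1)" unfolding sz_nat by simp
    show ?thesis unfolding k(2) sz_pair by (intro add_mono 1 2 order_refl)
  qed
  then have "sz c \<le> 1 + length c * (1 + ?B)" by (rule sz_list_le)
  also have "... \<le> cert_size S" unfolding cert_size_def using len by (intro add_mono mult_right_mono) auto
  finally have "sz c \<le> cert_size S" .
  moreover have "lk c k = g k" if "set k \<subseteq> {..<S + 16}" "length k \<le> 6" "g k \<le> 2 ^ cert_bits S" for k
    unfolding c_def lk_map[OF ks(2)] using that ks(1) by simp
  ultimately show ?thesis by (intro exI[of _ c] conjI allI impI) auto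
qed

abbreviation certifies :: "msp => nat => nat => (commodity => edge => rat) => 'r set => ('r => commodity => edge => int) =>
    ('r => int) => (nat => nat) => (nat => nat) => cert => bool" where
  "certifies I S Q F R \<alpha> \<beta> rk d0 c \<equiv> sz c \<le> cert_size S \<and> chk_scale (todata I) c \<and> chk_lp (todata I) c \<and> cQ c = Q \<and>
    (\<forall>r\<in>R. (\<Sum>\<kappa>\<in>commodities I. \<Sum>e\<in>edges I. of_int (\<alpha> r \<kappa> e) * (\<Sum>i=0..modes I. real (cy c \<kappa> e i))) = of_int (\<beta> r) * real (cz c)) \<and>
    (\<forall>\<kappa>\<in>commodities I. \<forall>e\<in>edges I. cf c 11 \<kappa> e = fst (fr (F \<kappa> e)) \<and> cf c 12 \<kappa> e = snd (fr (F \<kappa> e)) \<and> cf c 13 \<kappa> e = num Q (F \<kappa> e)) \<and>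
    (\<forall>v<num_verts I. lk c [14, v] = rk v \<and> lk c [15, v] = d0 v)"

lemma certificate_exists:
  fixes \<alpha> :: "'r => commodity => edge => int" and \<beta> :: "'r => int" and x :: split and F :: "commodity => edge => rat"
  assumes I: "msp_instance I" and x: "lp_ok I L x"
    and xS: "!!\<kappa> e. \<kappa> \<in> commodities I ==> e \<in> edges I ==> (\<Sum>i=0..modes I. x \<kappa> e i) \<le> 2 ^ S"
    and S: "num_verts I \<le> S" "Suc (modes I) \<le> S" "0 < Q" "Q \<le> 2 ^ S"
    and F: "!!r. r \<in> rats I F ==> small S r \<and> sc Q (fr r) (num Q r) \<and> num Q r \<le> 2 ^ S"
    and R: "finite R" "card R \<le> S ^ 4"
    and \<alpha>: "!!r \<kappa> e. r \<in> R ==> \<kappa> \<in> commodities I ==> e \<in> edges I ==> \<bar>\<alpha> r \<kappa> e\<bar> \<le> 2 ^ S"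
    and \<beta>: "!!r. r \<in> R ==> \<bar>\<beta> r\<bar> \<le> 2 ^ S"
    and eq: "!!r. r \<in> R ==> (\<Sum>\<kappa>\<in>commodities I. \<Sum>e\<in>edges I. of_int (\<alpha> r \<kappa> e) * (\<Sum>i=0..modes I. x \<kappa> e i)) = of_int (\<beta> r)"
    and rk: "!!v. rk v \<le> num_verts I" "!!v. d0 v \<le> num_verts I"
  shows "\<exists>c. certifies I S Q F R \<alpha> \<beta> rk d0 c"
proof -
  have mem: "!!e. e \<in> edges I ==> weight I e \<in> rats I F" "budget I \<in> rats I F" "energy_bound I \<in> rats I F"
    "!!i. i \<le> modes I ==> travel_time I i \<in> rats I F" "!!i. i \<le> modes I ==> energy I i \<in> rats I F"
    "!!i. i \<le> modes I ==> cost I i \<in> rats I F" "!!i. i \<le> modes I ==> capacity I i \<in> rats I F"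
    "!!A. time_bound I = Some A ==> A \<in> rats I F"
    "!!\<kappa> e. \<kappa> \<in> commodities I ==> e \<in> edges I ==> F \<kappa> e \<in> rats I F"
    by (auto simp: rats_def)
  have scal: "scaled S Q r (num Q r)" if "r \<in> rats I F" for r
    unfolding scaled_def using F[OF that] sc_fr[OF _ S(3), of r "num Q r"] by (simp add: small_def)
  define a where "a = (case time_bound I of None => 0 | Some A => num Q A)"
  have aS: "scaled S Q A a" if "time_bound I = Some A" for A
    using that scal[OF mem(8)[OF that]] by (simp add: a_def)
  have "\<exists>L' y z. integral_sol I S R \<alpha> \<beta> L' y z"
    by (rule integral_certificate[OF I x xS S]) (assumption | rule scal[OF mem(1)] scal[OF mem(2)] scal[OF mem(3)]
      scal[OF mem(4)] scal[OF mem(5)] scal[OF mem(6)] scal[OF mem(7)] aS R \<alpha> \<beta> eq)+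
  then obtain L' y z where yz: "integral_sol I S R \<alpha> \<beta> L' y z"
    by (elim exE)
  note Lb = yz[THEN conjunct2, THEN conjunct2, THEN conjunct1, THEN spec, THEN spec]
    and lp = yz[THEN conjunct2, THEN conjunct2, THEN conjunct2, THEN conjunct2, THEN conjunct1]
    and rows = yz[THEN conjunct2, THEN conjunct2, THEN conjunct2, THEN conjunct2, THEN conjunct2, THEN bspec]
  \<comment> \<open>The content of the certificate by label; keys that carry no information receive
    arbitrary values.\<close>
  define g where "g k = (let j = k ! 0 in if j = 0 then Q else if j = 1 then z else if j = 2 then num Q (weight I (k ! 1, k ! 2))
    else if j = 3 then num Q ([travel_time I (k ! 2), energy I (k ! 2), cost I (k ! 2), capacity I (k ! 2)] ! (k ! 1))
    else if j = 6 then num Q (budget I) else if j = 7 then a else if j = 8 then num Q (energy_bound I)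
    else if j = 9 then L' (k ! 1, k ! 2) (k ! 3) else if j = 10 then y ((k ! 1, k ! 2), (k ! 3, k ! 4), k ! 5)
    else if j = 11 then fst (fr (F (k ! 1, k ! 2) (k ! 3, k ! 4))) else if j = 12 then snd (fr (F (k ! 1, k ! 2) (k ! 3, k ! 4)))
    else if j = 13 then num Q (F (k ! 1, k ! 2) (k ! 3, k ! 4)) else if j = 14 then rk (k ! 1) else d0 (k ! 1))" for k :: "nat list"
  obtain c where c: "sz c \<le> cert_size S"
    "!!k. set k \<subseteq> {..<S + 16} ==> length k \<le> 6 ==> g k \<le> 2 ^ cert_bits S ==> lk c k = g k"
    using store_exists[of S g] by blast
  have b: "k \<le> 2 ^ cert_bits S" if "k \<le> 2 ^ S" for k :: nat
    by (rule order_trans[OF that power_increasing]) (use cert_bits_ge(2)[of S] in auto)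
  have num: "num Q r \<le> 2 ^ cert_bits S" "fst (fr r) \<le> 2 ^ cert_bits S" "snd (fr r) \<le> 2 ^ cert_bits S" if "r \<in> rats I F" for r
    using F[OF that] by (simp_all add: b small_def)
  have lt: "fst e < S + 16" "snd e < S + 16" if "e \<in> edges I" for e
    using edges_sub[OF I] that S(1) by auto
  have ltK: "fst e < S + 16" "snd e < S + 16" if "e \<in> commodities I" for e
    using that S(1) by (auto simp: commodities_def)
  have ltm: "i < S + 16" if "i \<le> modes I" for i using that S(2) by simp
  have cQ: "cQ c = Q" by (subst c(2)) (auto simp: g_def b S(4))
  have cz: "cz c = z" by (subst c(2)) (use yz in \<open>auto simp: g_def\<close>)
  have cw: "cw c e = num Q (weight I e)" if "e \<in> edges I" for e
    by (subst c(2)) (use lt[OF that] num(1)[OF mem(1)[OF that]] in \<open>auto simp: g_def\<close>)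
  have cm: "cm c 0 i = num Q (travel_time I i)" "cm c 1 i = num Q (energy I i)" "cm c 2 i = num Q (cost I i)"
    "cm c 3 i = num Q (capacity I i)" if "i \<le> modes I" for i
    by (subst c(2); use ltm[OF that] num(1) mem(4-7)[OF that] in \<open>simp add: g_def eval_nat_numeral\<close>)+
  have cB: "cB c = num Q (budget I)" by (subst c(2)) (use num(1) mem(2) in \<open>auto simp: g_def\<close>)
  have cb: "cb c = num Q (energy_bound I)" by (subst c(2)) (use num(1) mem(3) in \<open>auto simp: g_def\<close>)
  have "a \<le> 2 ^ cert_bits S" unfolding a_def using num(1) mem(8) by (auto split: option.split)
  then have ca: "ca c = a" by (subst c(2)) (auto simp: g_def)
  have cL: "cL c e i = L' e i" if "e \<in> edges I" "i \<le> modes I" for e i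
    by (subst c(2)) (use lt[OF that(1)] ltm[OF that(2)] Lb[of e i] in \<open>auto simp: g_def eval_nat_numeral\<close>)
  have cy: "cy c \<kappa> e i = y (\<kappa>, e, i)" if "\<kappa> \<in> commodities I" "e \<in> edges I" "i \<le> modes I" for \<kappa> e i
    by (subst c(2)) (use ltK[OF that(1)] lt[OF that(2)] ltm[OF that(3)] yz that in \<open>auto simp: g_def eval_nat_numeral\<close>)
  have cf: "cf c 11 \<kappa> e = fst (fr (F \<kappa> e))" "cf c 12 \<kappa> e = snd (fr (F \<kappa> e))" "cf c 13 \<kappa> e = num Q (F \<kappa> e)"
    if "\<kappa> \<in> commodities I" "e \<in> edges I" for \<kappa> e
    by (subst c(2); use ltK[OF that(1)] lt[OF that(2)] num mem(9)[OF that] in \<open>simp add: g_def eval_nat_numeral\<close>)+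
  have nb: "num_verts I \<le> 2 ^ cert_bits S"
    by (rule b) (use S(1) less_exp[of S] in linarith)
  have cr: "lk c [14, v] = rk v" "lk c [15, v] = d0 v" if "v < num_verts I" for v
    by (subst c(2); use that S(1) order_trans[OF rk(1) nb] order_trans[OF rk(2) nb] in \<open>simp add: g_def\<close>)+
  have s: "chk_scale (todata I) c"
    unfolding chk_scale_def set_Es[OF I] todata_simps cQ cz
  proof (intro conjI ballI)
    show "case wd (todata I) e of None => True | Some f => sc Q f (cw c e)" if "e \<in> edges I" for e
      using F[OF mem(1)[OF that]] by (simp add: wd_edge[OF I that] cw[OF that])
    fix i assume "i \<in> set (Is (todata I))"
    then have i: "i \<le> modes I" by (auto simp: Is_todata)
    show "sc Q (fst (md (todata I) i)) (cm c 0 i)" "sc Q (fst (snd (md (todata I) i))) (cm c 1 i)"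
      "sc Q (fst (snd (snd (md (todata I) i)))) (cm c 2 i)" "sc Q (snd (snd (snd (md (todata I) i)))) (cm c 3 i)"
      unfolding cm[OF i] md_todata[OF i] using F mem(4-7)[OF i] by simp_all
  next
    show "case map_option fr (time_bound I) of None => True | Some f => sc Q f (ca c)"
      unfolding ca a_def using F mem(8) by (auto split: option.split)
  qed (use S(3) yz F mem(2,3) in \<open>simp_all add: cB cb\<close>)
  moreover have "chk_lp (todata I) c"
    unfolding chk_lp_iff[OF I s]
    by (rule lp_ok_cong[OF lp]) (simp_all only: cL cy cz)
  moreover have "(\<Sum>\<kappa>\<in>commodities I. \<Sum>e\<in>edges I. of_int (\<alpha> r \<kappa> e) * (\<Sum>i=0..modes I. real (cy c \<kappa> e i))) = of_int (\<beta> r) * real (cz c)"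
    if "r \<in> R" for r
  proof -
    have "(\<Sum>\<kappa>\<in>commodities I. \<Sum>e\<in>edges I. of_int (\<alpha> r \<kappa> e) * (\<Sum>i=0..modes I. real (cy c \<kappa> e i))) =
        (\<Sum>\<kappa>\<in>commodities I. \<Sum>e\<in>edges I. of_int (\<alpha> r \<kappa> e) * (\<Sum>i=0..modes I. real (y (\<kappa>, e, i))))"
      by (intro sum.cong[OF refl] arg_cong2[where f = "(*)", OF refl]) (simp add: cy)
    then show ?thesis by (simp only: rows[OF that] cz)
  qed
  ultimately show ?thesis using c(1) cQ cf cr by (intro exI[of _ c] conjI ballI allI impI) auto
qed

text \<open>An exponent for the common denominator, a product of up to \<open>num_rats s\<close>
  numbers of at most \<open>2 ^ s\<close>, and for the numerators over it.\<close>

definition cert_scale :: "nat => nat" where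
  "cert_scale s = s * num_rats s + s"

lemma pb_cert_size_scale: "pb (\<lambda>s. cert_size (cert_scale s))"
  by (rule pb_comp[OF pb_cert_size]) (unfold cert_scale_def num_rats_def, intro pb_add pb_mult pb_power pb_const pb_id)

lemma small_mono: "small s r ==> s \<le> t ==> small t r"
  unfolding small_def by (meson order_trans power_increasing one_le_numeral)

lemma common_denominator_msp:
  assumes I: "msp_instance I" "num_verts I \<le> s" "Suc (modes I) \<le> s" and F: "!!r. r \<in> rats I F ==> small s r"
  shows "\<exists>Q>0. Q \<le> 2 ^ cert_scale s \<and> (\<forall>r\<in>rats I F. small (cert_scale s) r \<and> sc Q (fr r) (num Q r) \<and> num Q r \<le> 2 ^ cert_scale s)"
proof -
  have "\<exists>Q>0. Q \<le> 2 ^ (s * num_rats s) \<and> (\<forall>r\<in>rats I F. sc Q (fr r) (num Q r) \<and> num Q r \<le> 2 ^ (s * num_rats s + s))"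
    by (rule common_denominator[OF card_rats(1)[OF I] F card_rats(2)[OF I]])
  then obtain Q where Q: "0 < Q" "Q \<le> 2 ^ (s * num_rats s)"
    "\<forall>r\<in>rats I F. sc Q (fr r) (num Q r) \<and> num Q r \<le> 2 ^ (s * num_rats s + s)"
    by (elim exE conjE)
  have "Q \<le> 2 ^ cert_scale s"
    by (rule order_trans[OF Q(2)], rule power_increasing) (auto simp: cert_scale_def)
  moreover have "small (cert_scale s) r" if "r \<in> rats I F" for r
    by (rule small_mono[OF F[OF that]]) (simp add: cert_scale_def)
  ultimately show ?thesis using Q unfolding cert_scale_def[symmetric] by (intro exI[of _ Q]) auto
qed

lemma net_row:
  fixes X :: "commodity => edge => real"
  assumes "finite K" "\<kappa>0 \<in> K"
  shows "(\<Sum>\<kappa>\<in>K. \<Sum>e\<in>E. of_int (if \<kappa>0 = \<kappa> then of_bool (snd e = v) - of_bool (fst e = v) else 0) * X \<kappa> e) = net E (X \<kappa>0) v"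
proof -
  have "(\<Sum>\<kappa>\<in>K. \<Sum>e\<in>E. of_int (if \<kappa>0 = \<kappa> then of_bool (snd e = v) - of_bool (fst e = v) else 0) * X \<kappa> e) =
      (\<Sum>\<kappa>\<in>K. if \<kappa>0 = \<kappa> then net E (X \<kappa>0) v else 0)"
    by (rule sum.cong[OF refl]) (simp add: net_def mult.commute)
  then show ?thesis using assms by simp
qed

lemma fix_row:
  fixes X :: "commodity => edge => real"
  assumes "finite K" "\<kappa>0 \<in> K" "finite E" "e0 \<in> E"
  shows "(\<Sum>\<kappa>\<in>K. \<Sum>e\<in>E. of_int (if \<kappa>0 = \<kappa> then if e0 = e then q else 0 else 0) * X \<kappa> e) = of_int q * X \<kappa>0 e0"
proof -
  have "(\<Sum>e\<in>E. of_int (if \<kappa>0 = \<kappa> then if e0 = e then q else 0 else 0) * X \<kappa> e) =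
      (if \<kappa>0 = \<kappa> then of_int q * X \<kappa>0 e0 else 0)" for \<kappa>
  proof -
    have "(\<Sum>e\<in>E. of_int (if \<kappa>0 = \<kappa> then if e0 = e then q else 0 else 0) * X \<kappa> e) =
        (\<Sum>e\<in>E. if e0 = e then if \<kappa>0 = \<kappa> then of_int q * X \<kappa>0 e0 else 0 else 0)"
      by (rule sum.cong) auto
    then show ?thesis using assms(3,4) by simp
  qed
  then show ?thesis using assms(1,2) by simp
qed

text \<open>The extra rows are the conservation laws, with incidence coefficients -1, 0 and 1 and
  the balances on the right.\<close>

lemma solvable_certificate:
  assumes I: "msp_instance I" "num_verts I \<le> s" "Suc (modes I) \<le> s"
    and F: "!!r. r \<in> rats I (\<lambda>_ _. 0) ==> small s r" and D: "!!\<kappa>. \<kappa> \<in> commodities I ==> demand I \<kappa> \<le> 2 ^ s"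
    and s: "solvable I" and rk: "!!v. rk v \<le> num_verts I" "!!v. d0 v \<le> num_verts I"
  shows "\<exists>c. sz c \<le> cert_size (cert_scale s) \<and> chk_scale (todata I) c \<and> chk_lp (todata I) c \<and> chk_flow (todata I) c \<and>
    (\<forall>v<num_verts I. lk c [14, v] = rk v \<and> lk c [15, v] = d0 v)"
proof -
  let ?S = "cert_scale s" and ?K = "commodities I" and ?E = "edges I"
  obtain Q where Q: "0 < Q" "Q \<le> 2 ^ ?S"
    "!!r. r \<in> rats I (\<lambda>_ _. 0) ==> small ?S r \<and> sc Q (fr r) (num Q r) \<and> num Q r \<le> 2 ^ ?S"
    using common_denominator_msp[OF I F] by blast
  have sS: "s \<le> ?S" by (simp add: cert_scale_def)
  have p: "(2::nat) ^ s \<le> 2 ^ ?S" using sS by simp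
  have "\<exists>L x. lp_ok I L x \<and> feasible_flow I (\<lambda>\<kappa> e. \<Sum>i=0..modes I. x \<kappa> e i) \<and>
    (\<forall>\<kappa>\<in>commodities I. \<forall>e\<in>edges I. (\<Sum>i=0..modes I. x \<kappa> e i) \<le> real (2 ^ s))"
    by (rule solvable_bounded[OF I(1) s D])
  then obtain L x where x: "lp_ok I L x" "feasible_flow I (\<lambda>\<kappa> e. \<Sum>i=0..modes I. x \<kappa> e i)"
    "\<forall>\<kappa>\<in>commodities I. \<forall>e\<in>edges I. (\<Sum>i=0..modes I. x \<kappa> e i) \<le> real (2 ^ s)"
    by (elim exE conjE)
  have xS: "(\<Sum>i=0..modes I. x \<kappa> e i) \<le> 2 ^ ?S" if "\<kappa> \<in> ?K" "e \<in> ?E" for \<kappa> e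
  proof -
    have "(\<Sum>i=0..modes I. x \<kappa> e i) \<le> real (2 ^ s)" using x(3) that by blast
    also have "... \<le> real (2 ^ ?S)" using p by (simp only: of_nat_le_iff)
    finally show ?thesis by simp
  qed
  define \<alpha> :: "commodity \<times> nat => commodity => edge => int" where
    "\<alpha> r \<kappa> e = (if fst r = \<kappa> then of_bool (snd e = snd r) - of_bool (fst e = snd r) else 0)" for r \<kappa> e
  define \<beta> :: "commodity \<times> nat => int" where
    "\<beta> r = (if snd r = snd (fst r) then int (demand I (fst r)) else if snd r = fst (fst r) then - int (demand I (fst r)) else 0)" for r
  have \<beta>: "of_int (\<beta> r) = bal I (fst r) (snd r)" for r by (simp add: \<beta>_def bal_def)
  let ?R = "?K \<times> {..<num_verts I}"
  have row: "(\<Sum>\<kappa>\<in>?K. \<Sum>e\<in>?E. of_int (\<alpha> r \<kappa> e) * X \<kappa> e) = net ?E (X (fst r)) (snd r)" if "r \<in> ?R" for r and X :: "commodity => edge => real"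
    unfolding \<alpha>_def by (rule net_row[OF finite_commodities]) (use that in auto)
  have "\<exists>c. certifies I ?S Q (\<lambda>_ _. 0) ?R \<alpha> \<beta> rk d0 c"
  proof (rule certificate_exists[OF I(1) x(1) xS _ _ Q(1,2)])
    show "finite ?R" using finite_commodities by simp
    have "card ?R \<le> (s * s) * s" unfolding card_cartesian_product using card_rats(4)[OF I] I(2) by (intro mult_mono) auto
    also have "... \<le> (s * s) * (s * s)" by simp
    also have "... = s ^ 4" by (simp add: eval_nat_numeral)
    also have "... \<le> ?S ^ 4" by (rule power_mono[OF sS]) simp
    finally show "card ?R \<le> ?S ^ 4" .
    show "\<bar>\<alpha> r \<kappa> e\<bar> \<le> 2 ^ ?S" for r \<kappa> e
      using one_le_power[of "2 :: int" ?S] by (auto simp: \<alpha>_def of_bool_def)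
    show "\<bar>\<beta> r\<bar> \<le> 2 ^ ?S" if "r \<in> ?R" for r
    proof -
      have "demand I (fst r) \<le> 2 ^ ?S" by (rule order_trans[OF D p]) (use that in auto)
      then have "int (demand I (fst r)) \<le> int (2 ^ ?S)" by (simp only: of_nat_le_iff)
      then show ?thesis by (auto simp: \<beta>_def)
    qed
    show "(\<Sum>\<kappa>\<in>?K. \<Sum>e\<in>?E. of_int (\<alpha> r \<kappa> e) * (\<Sum>i=0..modes I. x \<kappa> e i)) = of_int (\<beta> r)" if r: "r \<in> ?R" for r
      unfolding row[OF r] \<beta> using x(2) r unfolding feasible_flow_net[OF finite_edges[OF I(1)]] by auto
  qed (use I(2,3) sS Q(3) rk in auto)
  then obtain c where c: "sz c \<le> cert_size ?S" "chk_scale (todata I) c" "chk_lp (todata I) c" "cQ c = Q"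
    and r: "\<forall>r\<in>?R. (\<Sum>\<kappa>\<in>?K. \<Sum>e\<in>?E. of_int (\<alpha> r \<kappa> e) * (\<Sum>i=0..modes I. real (cy c \<kappa> e i))) = of_int (\<beta> r) * real (cz c)"
    and rk': "\<forall>v<num_verts I. lk c [14, v] = rk v \<and> lk c [15, v] = d0 v"
    by (elim exE conjE)
  have cz: "0 < cz c" using c(2) by (simp add: chk_scale_def)
  have "chk_flow (todata I) c"
    unfolding chk_flow_iff[OF I(1) cz] feasible_flow_net[OF finite_edges[OF I(1)]]
  proof (intro ballI conjI allI impI)
    fix \<kappa> v assume "\<kappa> \<in> ?K" "v < num_verts I"
    then have kv: "(\<kappa>, v) \<in> ?R" by simp
    have "net ?E (\<lambda>e. \<Sum>i=0..modes I. real (cy c \<kappa> e i)) v = bal I \<kappa> v * real (cz c)"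
      using r[THEN bspec, OF kv] unfolding row[OF kv] \<beta> by simp
    moreover have "net ?E (\<lambda>e. \<Sum>i=0..modes I. real (cy c \<kappa> e i) / real (cz c)) v = net ?E (\<lambda>e. \<Sum>i=0..modes I. real (cy c \<kappa> e i)) v / real (cz c)"
      by (simp add: net_def sum_divide_distrib[symmetric])
    ultimately show "net ?E (\<lambda>e. \<Sum>i=0..modes I. real (cy c \<kappa> e i) / real (cz c)) v = bal I \<kappa> v"
      using cz by simp
  qed (simp add: sum_nonneg)
  with c rk' show ?thesis by blast
qed

lemma fix_value:
  assumes "0 < Q" "0 < z" "q * y = z * p" "Q = q"
  shows "real y / real z = real p / real Q"
proof -
  have "real q * real y = real z * real p" using assms(3) by (simp flip: of_nat_mult)
  then show ?thesis using assms by (simp add: field_simps)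
qed

text \<open>The extra rows fix the flow on each edge, both sides being multiplied by
  \<open>Q\<close> to become integral; conservation is inherited from the given flow.\<close>

lemma solvable_flow_certificate:
  assumes I: "msp_instance I" "num_verts I \<le> s" "Suc (modes I) \<le> s"
    and F: "!!r. r \<in> rats I F ==> small s r"
    and s: "solvable_flow I (rflow F)" and rk: "!!v. rk v \<le> num_verts I" "!!v. d0 v \<le> num_verts I"
  shows "\<exists>c. sz c \<le> cert_size (cert_scale s) \<and> chk_scale (todata I) c \<and> chk_lp (todata I) c \<and> chk_flow (todata I) c \<and>
    chk_fix (todata I) c \<and> (\<forall>\<kappa>\<in>commodities I. \<forall>e\<in>edges I. fr (F \<kappa> e) = (cf c 11 \<kappa> e, cf c 12 \<kappa> e)) \<and>
    (\<forall>v<num_verts I. lk c [14, v] = rk v \<and> lk c [15, v] = d0 v)"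
proof -
  let ?S = "cert_scale s" and ?K = "commodities I" and ?E = "edges I"
  obtain Q where Q: "0 < Q" "Q \<le> 2 ^ ?S"
    "!!r. r \<in> rats I F ==> small ?S r \<and> sc Q (fr r) (num Q r) \<and> num Q r \<le> 2 ^ ?S"
    using common_denominator_msp[OF I F] by blast
  have sS: "s \<le> ?S" by (simp add: cert_scale_def)
  have mem: "F \<kappa> e \<in> rats I F" if "\<kappa> \<in> ?K" "e \<in> ?E" for \<kappa> e
    using that by (auto simp: rats_def)
  have Fv: "real_of_rat (F \<kappa> e) = real (num Q (F \<kappa> e)) / real Q" "F \<kappa> e \<ge> 0" "num Q (F \<kappa> e) \<le> 2 ^ ?S"
    if "\<kappa> \<in> ?K" "e \<in> ?E" for \<kappa> e
    using Q(3)[OF mem[OF that]] sc_fr[OF _ Q(1)] by (auto simp: small_def)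
  obtain L x where x: "feasible_flow I (rflow F)" "lp_ok I L x"
    "\<forall>\<kappa>\<in>?K. \<forall>e\<in>?E. (\<Sum>i=0..modes I. x \<kappa> e i) = real_of_rat (F \<kappa> e)"
    using s unfolding solvable_flow_iff by (elim exE conjE)
  have xS: "(\<Sum>i=0..modes I. x \<kappa> e i) \<le> 2 ^ ?S" if "\<kappa> \<in> ?K" "e \<in> ?E" for \<kappa> e
  proof -
    have "(\<Sum>i=0..modes I. x \<kappa> e i) = real (num Q (F \<kappa> e)) / real Q" using x(3) that Fv(1) by auto
    also have "... \<le> real (num Q (F \<kappa> e)) / 1" using Q(1) by (intro divide_left_mono) auto
    also have "... \<le> real (2 ^ ?S)" using Fv(3)[OF that] by (simp only: div_by_1 of_nat_le_iff)
    finally show ?thesis by simp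
  qed
  define \<alpha> :: "commodity \<times> edge => commodity => edge => int" where
    "\<alpha> r \<kappa> e = (if fst r = \<kappa> then if snd r = e then int Q else 0 else 0)" for r \<kappa> e
  define \<beta> :: "commodity \<times> edge => int" where "\<beta> r = int (num Q (F (fst r) (snd r)))" for r
  let ?R = "?K \<times> ?E"
  have row: "(\<Sum>\<kappa>\<in>?K. \<Sum>e\<in>?E. of_int (\<alpha> r \<kappa> e) * X \<kappa> e) = real Q * X (fst r) (snd r)" if "r \<in> ?R" for r and X :: "commodity => edge => real"
    unfolding \<alpha>_def using fix_row[OF finite_commodities _ finite_edges[OF I(1)], of "fst r" _ "snd r" "int Q" X] that by auto
  have "\<exists>c. certifies I ?S Q F ?R \<alpha> \<beta> rk d0 c"
  proof (rule certificate_exists[OF I(1) x(2) xS _ _ Q(1,2)])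
    show "finite ?R" using finite_commodities finite_edges[OF I(1)] by simp
    have "card ?R \<le> (s * s) * (s * s)" unfolding card_cartesian_product by (intro mult_mono card_rats[OF I]) auto
    also have "... = s ^ 4" by (simp add: eval_nat_numeral)
    also have "... \<le> ?S ^ 4" by (rule power_mono[OF sS]) simp
    finally show "card ?R \<le> ?S ^ 4" .
    have "int Q \<le> int (2 ^ ?S)" using Q(2) by (simp only: of_nat_le_iff)
    then show "\<bar>\<alpha> r \<kappa> e\<bar> \<le> 2 ^ ?S" for r \<kappa> e by (auto simp: \<alpha>_def)
    show "\<bar>\<beta> r\<bar> \<le> 2 ^ ?S" if "r \<in> ?R" for r
    proof -
      have "int (num Q (F (fst r) (snd r))) \<le> int (2 ^ ?S)" using that Fv(3) by (auto simp only: of_nat_le_iff mem_Times_iff)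
      then show ?thesis by (simp add: \<beta>_def)
    qed
    show "(\<Sum>\<kappa>\<in>?K. \<Sum>e\<in>?E. of_int (\<alpha> r \<kappa> e) * (\<Sum>i=0..modes I. x \<kappa> e i)) = of_int (\<beta> r)" if r: "r \<in> ?R" for r
    proof -
      have "fst r \<in> ?K" "snd r \<in> ?E" using r by auto
      with x(3) Fv(1) have "(\<Sum>i=0..modes I. x (fst r) (snd r) i) = real (num Q (F (fst r) (snd r))) / real Q" by auto
      then show ?thesis unfolding row[OF r] \<beta>_def using Q(1) by simp
    qed
  qed (use I(2,3) sS Q(3) rk in auto)
  then obtain c where c: "sz c \<le> cert_size ?S" "chk_scale (todata I) c" "chk_lp (todata I) c" "cQ c = Q"
    and r: "\<forall>r\<in>?R. (\<Sum>\<kappa>\<in>?K. \<Sum>e\<in>?E. of_int (\<alpha> r \<kappa> e) * (\<Sum>i=0..modes I. real (cy c \<kappa> e i))) = of_int (\<beta> r) * real (cz c)"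
    and cf: "\<forall>\<kappa>\<in>?K. \<forall>e\<in>?E. cf c 11 \<kappa> e = fst (fr (F \<kappa> e)) \<and> cf c 12 \<kappa> e = snd (fr (F \<kappa> e)) \<and> cf c 13 \<kappa> e = num Q (F \<kappa> e)"
    and rk': "\<forall>v<num_verts I. lk c [14, v] = rk v \<and> lk c [15, v] = d0 v"
    by (elim exE conjE)
  have cz: "0 < cz c" using c(2) by (simp add: chk_scale_def)
  have y: "Q * (\<Sum>i=0..modes I. cy c \<kappa> e i) = cz c * num Q (F \<kappa> e)" if "\<kappa> \<in> ?K" "e \<in> ?E" for \<kappa> e
  proof -
    have ke: "(\<kappa>, e) \<in> ?R" using that by simp
    have "real (Q * (\<Sum>i=0..modes I. cy c \<kappa> e i)) = real (cz c * num Q (F \<kappa> e))"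
      using r[THEN bspec, OF ke] unfolding row[OF ke] \<beta>_def by (simp add: mult.commute)
    then show ?thesis by (simp only: of_nat_eq_iff)
  qed
  have "chk_fix (todata I) c"
    unfolding chk_fix_def set_Ks[OF I(1)] set_Es[OF I(1)] sum_Is[OF I(1)]
  proof (intro ballI conjI)
    fix \<kappa> e assume ke: "\<kappa> \<in> ?K" "e \<in> ?E"
    have f: "(cf c 11 \<kappa> e, cf c 12 \<kappa> e) = fr (F \<kappa> e)" "cf c 13 \<kappa> e = num Q (F \<kappa> e)" using cf ke by auto
    show "valid_fr (cf c 11 \<kappa> e, cf c 12 \<kappa> e)" unfolding f by (rule valid_fr_fr[OF Fv(2)[OF ke]])
    show "sc (cQ c) (cf c 11 \<kappa> e, cf c 12 \<kappa> e) (cf c 13 \<kappa> e)" unfolding f c(4) using Q(3)[OF mem[OF ke]] by blast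
    show "cQ c * (\<Sum>i=0..modes I. cy c \<kappa> e i) = cz c * cf c 13 \<kappa> e" unfolding f c(4) by (rule y[OF ke])
  qed
  moreover have "chk_flow (todata I) c"
    unfolding chk_flow_iff[OF I(1) cz]
  proof (subst feasible_flow_cong[where F' = "rflow F"])
    fix \<kappa> e assume ke: "\<kappa> \<in> ?K" "e \<in> ?E"
    show "(\<Sum>i=0..modes I. real (cy c \<kappa> e i) / real (cz c)) = real_of_rat (F \<kappa> e)"
      unfolding Fv(1)[OF ke] fix_value[OF Q(1) cz y[OF ke] refl, symmetric] by (simp add: sum_divide_distrib)
  qed (rule x(1))
  ultimately show ?thesis using c(1-3) cf rk' by (intro exI[of _ c]) (simp add: prod_eq_iff)
qed

section \<open>Soundness of the checks\<close>

lemma solvable_sound: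
  assumes I: "msp_instance I" and c: "chk_scale (todata I) c" "chk_lp (todata I) c" "chk_flow (todata I) c"
  shows "solvable I"
proof -
  have cz: "0 < cz c" using c(1) by (simp add: chk_scale_def)
  show ?thesis
    unfolding solvable_iff using c(2,3) unfolding chk_lp_iff[OF I c(1)] chk_flow_iff[OF I cz]
    by (intro exI[of _ "cL c"] exI[of _ "\<lambda>\<kappa> e i. real (cy c \<kappa> e i) / real (cz c)"] conjI)
qed

lemma solvable_flow_sound:
  assumes I: "msp_instance I" and c: "chk_scale (todata I) c" "chk_lp (todata I) c" "chk_flow (todata I) c" "chk_fix (todata I) c"
    and F: "!!\<kappa> e. \<kappa> \<in> commodities I ==> e \<in> edges I ==> F \<kappa> e \<ge> 0 \<and> fr (F \<kappa> e) = (cf c 11 \<kappa> e, cf c 12 \<kappa> e)"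
  shows "solvable_flow I (rflow F)"
proof -
  have cz: "0 < cz c" "0 < cQ c" using c(1) by (simp_all add: chk_scale_def)
  have v: "(\<Sum>i=0..modes I. real (cy c \<kappa> e i) / real (cz c)) = real_of_rat (F \<kappa> e)" if "\<kappa> \<in> commodities I" "e \<in> edges I" for \<kappa> e
  proof -
    note f = c(4)[unfolded chk_fix_def set_Ks[OF I] set_Es[OF I] sum_Is[OF I], THEN bspec, OF that(1), THEN bspec, OF that(2)]
    have "real_of_rat (F \<kappa> e) = real (cf c 13 \<kappa> e) / real (cQ c)"
      using f F[OF that] sc_fr[OF _ cz(2), of "F \<kappa> e"] by simp
    also have "... = real (\<Sum>i=0..modes I. cy c \<kappa> e i) / real (cz c)"
      by (rule fix_value[OF cz(2,1) f[THEN conjunct2, THEN conjunct2] refl, symmetric])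
    finally show ?thesis by (simp add: sum_divide_distrib)
  qed
  have "feasible_flow I (rflow F)"
    using c(3) unfolding chk_flow_iff[OF I cz(1)] by (subst (asm) feasible_flow_cong[OF v])
  moreover have "lp_ok I (cL c) (\<lambda>\<kappa> e i. real (cy c \<kappa> e i) / real (cz c))"
    using c(2) unfolding chk_lp_iff[OF I c(1)] .
  ultimately show ?thesis
    unfolding solvable_flow_iff using v
    by (intro exI[of _ "cL c"] exI[of _ "\<lambda>\<kappa> e i. real (cy c \<kappa> e i) / real (cz c)"] conjI ballI)
qed

section \<open>Membership in NP\<close>

text \<open>Exactly the data that come from an instance. Dimensions, reducedness and positivity must
  be tested, because a certificate may contain anything.\<close>

definition valid :: "dat => bool" where
  "valid d \<longleftrightarrow>
     (\<forall>r\<in>set (fst d). length r = length (fst d) \<and> (\<forall>q\<in>set r. case q of None => True | Some f => valid_fr f)) \<and>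
     valid_fr (fst (snd d)) \<and> 0 < fst (fst (snd d)) \<and>
     length (fst (snd (snd d))) = length (fst d) \<and> (\<forall>r\<in>set (fst (snd (snd d))). length r = length (fst d)) \<and>
     (\<forall>v\<in>set (Vs d). dm d (v, v) = 0) \<and>
     0 < length (fst (snd (snd (snd d)))) \<and>
     (\<forall>q\<in>set (fst (snd (snd (snd d)))). valid_fr (fst q) \<and> valid_fr (fst (snd q)) \<and> valid_fr (fst (snd (snd q))) \<and>
        valid_fr (snd (snd (snd q))) \<and> 0 < fst (snd (snd (snd q)))) \<and>
     fst (snd (snd (md d 0))) = (0, 1) \<and> snd (snd (snd (md d 0))) = (1, 1) \<and>
     (case fst (snd (snd (snd (snd d)))) of None => True | Some f => valid_fr f) \<and>
     valid_fr (snd (snd (snd (snd (snd d)))))"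

lemma pt_valid: "pt valid"
  unfolding valid_def[abs_def] by (intro pti pt_case_option)

definition ofdata :: "dat => msp" where
  "ofdata d = \<lparr> num_verts = length (fst d), edges = set (Es d),
     weight = (\<lambda>e. case wd d e of None => 0 | Some f => frval f), budget = frval (fst (snd d)),
     demand = dm d, modes = length (fst (snd (snd (snd d)))) - 1,
     travel_time = (\<lambda>i. frval (fst (md d i))), energy = (\<lambda>i. frval (fst (snd (md d i)))),
     cost = (\<lambda>i. frval (fst (snd (snd (md d i))))), capacity = (\<lambda>i. frval (snd (snd (snd (md d i))))),
     time_bound = map_option frval (fst (snd (snd (snd (snd d))))),
     energy_bound = frval (snd (snd (snd (snd (snd d))))) \<rparr>"

lemma frval_pos: "valid_fr f ==> 0 < fst f ==> 0 < frval f"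
  by (simp add: frval_def valid_fr_def)

lemma ofdata:
  assumes v: "valid d"
  shows "msp_instance (ofdata d)" "todata (ofdata d) = d"
proof -
  obtain W B Dm Ms tb eb where d: "d = (W, B, Dm, Ms, tb, eb)" by (cases d)
  let ?n = "length W"
  let ?g = "\<lambda>u. map (\<lambda>w. if (u, w) \<in> edges (ofdata d) then Some (fr (weight (ofdata d) (u, w))) else None) [0..<?n]"
  let ?f = "map ?g [0..<?n]"
  have W: "length r = ?n" "!!q. q \<in> set r ==> case q of None => True | Some f => valid_fr f" if "r \<in> set W" for r
    using v that by (auto simp: valid_def d)
  have Wl: "length (W ! u) = ?n" if "u < ?n" for u using W(1) that by simp
  have Dml: "length Dm = ?n" "!!u. u < ?n ==> length (Dm ! u) = ?n"
    using v by (auto simp: valid_def d)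
  have wd: "wd d (u, w) = W ! u ! w" if "u < ?n" "w < ?n" for u w
    using that by (simp add: wd_def d nthd_def Wl)
  have dm: "dm d (u, w) = Dm ! u ! w" if "u < ?n" "w < ?n" for u w
    using that by (simp add: dm_def d nthd_def Dml)
  have md: "md d i = Ms ! i" if "i < length Ms" for i
    using that by (simp add: md_def d nthd_def)
  have Ms: "valid_fr (fst (Ms ! i))" "valid_fr (fst (snd (Ms ! i)))" "valid_fr (fst (snd (snd (Ms ! i))))"
    "valid_fr (snd (snd (snd (Ms ! i))))" "0 < fst (snd (snd (snd (Ms ! i))))" if "i < length Ms" for i
    using v nth_mem[OF that] by (auto simp: valid_def d)
  have Ms0: "0 < length Ms" "fst (snd (snd (md d 0))) = (0, 1)" "snd (snd (snd (md d 0))) = (1, 1)"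
    and B: "valid_fr B" "0 < fst B" and D0: "!!u. u < ?n ==> dm d (u, u) = 0"
    and tb: "case tb of None => True | Some f => valid_fr f" and eb: "valid_fr eb"
    using v by (auto simp: valid_def d Vs_def)
  have Es: "e \<in> set (Es d) \<longleftrightarrow> fst e < ?n \<and> snd e < ?n \<and> wd d e \<noteq> None" for e
    by (cases e) (auto simp: Es_def Vs_def d)
  show "msp_instance (ofdata d)"
    unfolding msp_instance_def
  proof (intro conjI ballI allI impI)
    show "pair_fin_digraph (graph_of (ofdata d))"
      unfolding pair_fin_digraph_graph by (auto simp: ofdata_def Es) (simp_all add: d)
    show "0 < budget (ofdata d)" using frval_pos[OF B] by (simp add: ofdata_def d)
    show "demand (ofdata d) (u, u) = 0" if "u < num_verts (ofdata d)" for u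
      using D0[of u] that by (simp add: ofdata_def d)
    show "0 < capacity (ofdata d) i" if "i \<le> modes (ofdata d)" for i
    proof -
      have i: "i < length Ms" using that Ms0(1) by (cases Ms) (auto simp: ofdata_def d)
      show ?thesis using frval_pos[OF Ms(4,5)[OF i]] md[OF i] by (simp add: ofdata_def)
    qed
    show "cost (ofdata d) 0 = 0" "capacity (ofdata d) 0 = 1" using Ms0 by (simp_all add: ofdata_def frval_def)
  qed (auto simp: ofdata_def frval_nonneg split: option.split)
  have n: "num_verts (ofdata d) = ?n" "Suc (modes (ofdata d)) = length Ms"
    using Ms0(1) by (simp_all add: ofdata_def d)
  have 1: "?f = W"
  proof (rule nth_equalityI)
    fix u assume "u < length (?f)"
    then have u: "u < ?n" by simp
    have "?g u = W ! u"
    proof (rule nth_equalityI)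
      fix w assume "w < length (?g u)"
      then have w: "w < ?n" by simp
      have "W ! u ! w \<in> set (W ! u)" using w Wl[OF u] by simp
      then have "case W ! u ! w of None => True | Some f => valid_fr f" using W(2)[of "W ! u"] u by simp
      then show "?g u ! w = W ! u ! w"
        using u w wd[OF u w] by (cases "W ! u ! w") (auto simp: ofdata_def Es fr_frval)
    qed (simp add: Wl[OF u])
    then show "?f ! u = W ! u"
      using u by (simp cong del: if_weak_cong)
  qed simp
  have 2: "map (\<lambda>u. map (\<lambda>w. demand (ofdata d) (u, w)) [0..<?n]) [0..<?n] = Dm"
  proof (rule nth_equalityI)
    fix u assume "u < length (map (\<lambda>u. map (\<lambda>w. demand (ofdata d) (u, w)) [0..<?n]) [0..<?n])"
    then have u: "u < ?n" by simp
    have "map (\<lambda>w. demand (ofdata d) (u, w)) [0..<?n] = Dm ! u"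
      by (rule nth_equalityI) (use u in \<open>simp_all add: Dml ofdata_def dm\<close>)
    then show "map (\<lambda>u. map (\<lambda>w. demand (ofdata d) (u, w)) [0..<?n]) [0..<?n] ! u = Dm ! u" using u by simp
  qed (simp add: Dml)
  have 3: "map (\<lambda>i. (fr (travel_time (ofdata d) i), fr (energy (ofdata d) i), fr (cost (ofdata d) i), fr (capacity (ofdata d) i))) [0..<length Ms] = Ms"
    by (rule nth_equalityI) (simp_all add: ofdata_def md Ms fr_frval)
  have 4: "map_option fr (time_bound (ofdata d)) = tb"
    using tb by (cases tb) (simp_all add: ofdata_def d fr_frval)
  have 5: "fr (budget (ofdata d)) = B" "fr (energy_bound (ofdata d)) = eb"
    using fr_frval[OF B(1)] fr_frval[OF eb] by (simp_all add: ofdata_def d)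
  show "todata (ofdata d) = d"
    unfolding todata_def Let_def n 1 2 3 4 5 by (simp add: d)
qed

lemma valid_todata:
  assumes I: "msp_instance I" shows "valid (todata I)"
proof -
  have fr0: "fr 0 = (0, 1)" "fr 1 = (1, 1)" by (simp_all add: fr_def)
  have "0 < fst (fr r)" if "0 < r" for r
    using frval_fr[of r] that by (cases "fst (fr r)") (auto simp: frval_def)
  then show ?thesis
    using I md_todata[of 0 I] unfolding valid_def msp_instance_def
    by (auto simp: todata_def Let_def fr0 Vs_def nthd_def dm_def valid_fr_fr less_imp_le simp del: upt_Suc split: option.splits)
qed

text \<open>The surplus 1 on the left absorbs the constructor of a list cell and makes the estimate
  additive.\<close>

lemma sz_enc_list:
  assumes "!!x. x \<in> set l ==> sz x + 1 \<le> 3 * length (f x)" shows "sz l + 1 \<le> 3 * length (enc_list f l)"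
  using assms
proof (induction l)
  case (Cons a l)
  have "enc_list f (a # l) = True # f a @ enc_list f l" by (simp add: enc_list_def)
  moreover have "sz a + 1 \<le> 3 * length (f a)" "sz l + 1 \<le> 3 * length (enc_list f l)"
    using Cons by simp_all
  ultimately show ?case by simp
qed (simp add: enc_list_def)

lemma sz_enc_nat: "sz n + 1 \<le> 3 * length (enc_nat n)"
proof -
  have "length (enc_nat n) = 2 * bl n + 1"
    unfolding enc_nat_nbits bl_def by (simp add: length_concat o_def sum_list_triv)
  then show ?thesis by (simp add: sz_nat)
qed

lemma sz_encf: "sz f + 1 \<le> 3 * length (encf f)"
  using sz_enc_nat[of "fst f"] sz_enc_nat[of "snd f"] by (cases f) (simp add: encf_def)

lemma sz_enc_option:
  assumes "!!x. sz x + 1 \<le> 3 * length (f x)" shows "sz q + 1 \<le> 3 * length (enc_option f q)"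
  using assms[of "the q"] by (cases q) (simp_all add: enc_option_def)

lemma sz_encd: "sz d \<le> 3 * length (encd d)"
proof -
  obtain W B Dm Ms tb eb where d: "d = (W, B, Dm, Ms, tb, eb)" by (cases d)
  have "sz W + 1 \<le> 3 * length (enc_list (enc_list (enc_option encf)) W)"
    by (intro sz_enc_list sz_enc_option sz_encf)
  moreover have "sz Dm + 1 \<le> 3 * length (enc_list (enc_list enc_nat) Dm)"
    by (intro sz_enc_list sz_enc_nat)
  moreover have "sz q + 1 \<le> 3 * length (encm q)" for q
    using sz_encf[of "fst q"] sz_encf[of "fst (snd q)"] sz_encf[of "fst (snd (snd q))"] sz_encf[of "snd (snd (snd q))"]
    by (cases q) (simp add: encm_def)
  then have "sz Ms + 1 \<le> 3 * length (enc_list encm Ms)" by (rule sz_enc_list)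
  moreover have "sz tb + 1 \<le> 3 * length (enc_option encf tb)" by (intro sz_enc_option sz_encf)
  ultimately show ?thesis using sz_encf[of B] sz_encf[of eb] by (simp add: d encd_def)
qed

lemma length_enc_list: "length l \<le> length (enc_list f l)"
  by (induction l) (auto simp: enc_list_def)

lemma length_enc_list_mem: "x \<in> set l ==> length (f x) \<le> length (enc_list f l)"
  by (induction l) (auto simp: enc_list_def)

lemma le_enc_nat: "n \<le> 2 ^ length (enc_nat n)"
proof -
  have "bl n \<le> length (enc_nat n)" using sz_enc_nat[of n] by (simp add: sz_nat)
  then show ?thesis using bl_le_iff less_imp_le by blast
qed

lemma small_encf:
  assumes "r \<ge> 0" "length (encf (fr r)) \<le> s" shows "small s r"
proof -
  have "length (enc_nat (fst (fr r))) \<le> s" "length (enc_nat (snd (fr r))) \<le> s" using assms(2) by (simp_all add: encf_def)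
  then show ?thesis
    unfolding small_def using assms(1) le_enc_nat power_increasing[of _ s "2 :: nat"] by (meson order_trans one_le_numeral)
qed

text \<open>Vertices and modes are listed one by one in the input and numbers are written in binary,
  so the input length bounds the former and the exponents of the latter.\<close>

lemma small_msp:
  assumes I: "msp_instance I" and s: "length (enc_msp I) \<le> s"
  shows "num_verts I \<le> s" "Suc (modes I) \<le> s" "!!r. r \<in> rats I (\<lambda>_ _. 0) ==> small s r"
    "!!\<kappa>. \<kappa> \<in> commodities I ==> demand I \<kappa> \<le> 2 ^ s"
proof -
  note e = s[unfolded enc_msp_todata[OF I] encd_def]
  have 1: "length (enc_list (enc_list (enc_option encf)) (fst (todata I))) \<le> s"
    "length (encf (fr (budget I))) \<le> s" "length (enc_list (enc_list enc_nat) (fst (snd (snd (todata I))))) \<le> s"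
    "length (enc_list encm (fst (snd (snd (snd (todata I)))))) \<le> s"
    "length (enc_option encf (map_option fr (time_bound I))) \<le> s" "length (encf (fr (energy_bound I))) \<le> s"
    using e by simp_all
  show "num_verts I \<le> s" using order_trans[OF length_enc_list 1(1)] by simp
  have "length (fst (snd (snd (snd (todata I))))) = Suc (modes I)" by (simp add: todata_def Let_def)
  then show "Suc (modes I) \<le> s" using order_trans[OF length_enc_list 1(4)] by simp
  have w: "small s (weight I e)" if "e \<in> edges I" for e
  proof (rule small_encf)
    show "weight I e \<ge> 0" using I that by (simp add: msp_instance_def)
    obtain u v where e: "e = (u, v)" "u < num_verts I" "v < num_verts I"
      using edges_sub[OF I] \<open>e \<in> edges I\<close> by (cases e) auto
    let ?r = "map (\<lambda>v. if (u, v) \<in> edges I then Some (fr (weight I (u, v))) else None) [0..<num_verts I]"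
    have r: "?r \<in> set (fst (todata I))" using e(2) by (auto simp: todata_def Let_def)
    have q: "Some (fr (weight I e)) \<in> set ?r" unfolding set_map
      by (rule image_eqI[of _ _ v]) (use e that in simp_all)
    have "length (encf (fr (weight I e))) \<le> length (enc_option encf (Some (fr (weight I e))))" by (simp add: enc_option_def)
    also note length_enc_list_mem[OF q]
    also note length_enc_list_mem[OF r]
    also note 1(1)
    finally show "length (encf (fr (weight I e))) \<le> s" .
  qed
  have m: "small s (travel_time I i)" "small s (energy I i)" "small s (cost I i)" "small s (capacity I i)" if "i \<le> modes I" for i
  proof -
    let ?q = "(fr (travel_time I i), fr (energy I i), fr (cost I i), fr (capacity I i))"
    have "?q \<in> set (fst (snd (snd (snd (todata I)))))" using that by (auto simp: todata_def Let_def image_iff simp del: upt_Suc)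
    then have "length (encm ?q) \<le> s" by (rule order_trans[OF length_enc_list_mem 1(4)])
    then have "length (encf (fr (travel_time I i))) \<le> s" "length (encf (fr (energy I i))) \<le> s"
      "length (encf (fr (cost I i))) \<le> s" "length (encf (fr (capacity I i))) \<le> s" by (simp_all add: encm_def)
    moreover have "0 \<le> travel_time I i" "0 \<le> energy I i" "0 \<le> cost I i" "0 \<le> capacity I i"
      using I that by (simp_all add: msp_instance_def less_imp_le)
    ultimately show "small s (travel_time I i)" "small s (energy I i)" "small s (cost I i)" "small s (capacity I i)"
      by (simp_all add: small_encf)
  qed
  have B: "small s (budget I)" "small s (energy_bound I)"
    using 1(2,6) I by (auto simp: msp_instance_def intro!: small_encf)
  have t: "small s A" if "time_bound I = Some A" for A
    using 1(5) I that by (auto simp: msp_instance_def enc_option_def intro!: small_encf)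
  have z: "small s 0" by (simp add: small_def fr_def)
  show "small s r" if "r \<in> rats I (\<lambda>_ _. 0)" for r
    using that unfolding rats_def by (elim UnE imageE insertE emptyE) (simp_all add: w m B t z split_beta)
  show "demand I \<kappa> \<le> 2 ^ s" if "\<kappa> \<in> commodities I" for \<kappa>
  proof -
    obtain u v where e: "\<kappa> = (u, v)" "u < num_verts I" "v < num_verts I" using \<open>\<kappa> \<in> commodities I\<close> by (auto simp: commodities_def)
    let ?r = "map (\<lambda>v. demand I (u, v)) [0..<num_verts I]"
    have r: "?r \<in> set (fst (snd (snd (todata I))))" using e(2) by (auto simp: todata_def Let_def)
    have q: "demand I \<kappa> \<in> set ?r" using e by auto
    have "length (enc_nat (demand I \<kappa>)) \<le> s"
      by (rule order_trans[OF length_enc_list_mem[OF q] order_trans[OF length_enc_list_mem[OF r] 1(3)]])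
    then have "(2::nat) ^ length (enc_nat (demand I \<kappa>)) \<le> 2 ^ s" by (rule power_increasing) simp
    with le_enc_nat show ?thesis by (rule order_trans)
  qed
qed

definition flow_data :: "msp => (commodity => edge => rat) => fr list list" where
  "flow_data I F = map (\<lambda>\<kappa>. map (\<lambda>e. fr (F \<kappa> e)) (Es (todata I))) (Ks (todata I))"

context
  fixes I :: msp and F :: "commodity => edge => rat"
  assumes I: "msp_instance I" and F: "!!\<kappa> e. \<kappa> \<in> commodities I ==> e \<in> edges I ==> F \<kappa> e \<ge> 0"
begin

lemma enc_flow_data: "enc_flow I F = enc_list (enc_list encf) (flow_data I F)"
proof -
  have "enc_flow I F = enc_list (\<lambda>\<kappa>. enc_list (\<lambda>e. enc_rat (F \<kappa> e)) (Es (todata I))) (Ks (todata I))"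
    by (simp add: enc_flow_def Es_todata Ks_todata Let_def)
  also have "... = enc_list (enc_list encf) (flow_data I F)"
    unfolding flow_data_def using F by (intro enc_list_cong) (auto simp: set_Ks[OF I] set_Es[OF I] enc_rat_fr)
  finally show ?thesis .
qed

lemma enc_flow_code:
  assumes "!!\<kappa> e. \<kappa> \<in> commodities I ==> e \<in> edges I ==> fr (F \<kappa> e) = (cf c 11 \<kappa> e, cf c 12 \<kappa> e)"
  shows "enc_flow I F = flow_code (todata I) c"
proof -
  have "enc_list (\<lambda>e. encf (cf c 11 \<kappa> e, cf c 12 \<kappa> e)) (Es (todata I)) = enc_list encf (map (\<lambda>e. fr (F \<kappa> e)) (Es (todata I)))"
    if "\<kappa> \<in> set (Ks (todata I))" for \<kappa>
    by (rule enc_list_cong) (use assms that in \<open>simp add: set_Ks[OF I] set_Es[OF I]\<close>)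
  then show ?thesis
    unfolding enc_flow_data flow_data_def flow_code_def by (rule enc_list_cong[symmetric])
qed

lemma small_flow:
  assumes "length (enc_msp I) \<le> s" "length (enc_flow I F) \<le> s" "r \<in> rats I F" shows "small s r"
proof -
  have "small s (F \<kappa> e)" if ke: "\<kappa> \<in> commodities I" "e \<in> edges I" for \<kappa> e
  proof (rule small_encf[OF F[OF ke]])
    let ?r = "map (\<lambda>e. fr (F \<kappa> e)) (Es (todata I))"
    have r: "?r \<in> set (flow_data I F)" using ke by (auto simp: flow_data_def set_Ks[OF I])
    have q: "fr (F \<kappa> e) \<in> set ?r" using ke by (auto simp: set_Es[OF I])
    show "length (encf (fr (F \<kappa> e))) \<le> s"
      by (rule order_trans[OF length_enc_list_mem[OF q, of encf] order_trans[OF length_enc_list_mem[OF r, of "enc_list encf"]]])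
        (use assms(2) enc_flow_data in simp)
  qed
  moreover have "r \<in> rats I (\<lambda>_ _. 0) \<or> (\<exists>\<kappa>\<in>commodities I. \<exists>e\<in>edges I. r = F \<kappa> e)"
    using assms(3) unfolding rats_def by auto
  ultimately show ?thesis using small_msp(3)[OF I assms(1)] by blast
qed

end

text \<open>The class is checked along with the certificate. For members it may ask for two short
  functions on vertices, stored under the labels 14 and 15; since every certificate with these
  entries must pass, the other entries remain free for the solution.\<close>

definition decides :: "(dat => cert => bool) => (msp => bool) => bool" where
  "decides CC C \<longleftrightarrow> pt (\<lambda>p. CC (fst p) (snd p)) \<and>
     (\<forall>I c. msp_instance I --> CC (todata I) c --> C I) \<and>
     (\<forall>I. msp_instance I --> C I --> (\<exists>rk d. (\<forall>v. rk v \<le> num_verts I \<and> d v \<le> num_verts I) \<and>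
        (\<forall>c. (\<forall>v<num_verts I. lk c [14, v] = rk v \<and> lk c [15, v] = d v) --> CC (todata I) c)))"

text \<open>The instance is guessed and re-encoded instead of being parsed from the input; its size
  is linear in the input length, so the certificate stays short.\<close>

definition accepts :: "(dat => cert => bool) => bool list => dat \<times> cert => bool" where
  "accepts CC x p \<longleftrightarrow> encd (fst p) = x \<and> valid (fst p) \<and> chk_scale (fst p) (snd p) \<and> chk_lp (fst p) (snd p) \<and>
     chk_flow (fst p) (snd p) \<and> CC (fst p) (snd p)"

definition accepts_flow :: "(dat => cert => bool) => bool list => dat \<times> cert => bool" where
  "accepts_flow CC x p \<longleftrightarrow> encd (fst p) @ flow_code (fst p) (snd p) = x \<and> valid (fst p) \<and> chk_scale (fst p) (snd p) \<and>
     chk_lp (fst p) (snd p) \<and> chk_flow (fst p) (snd p) \<and> chk_fix (fst p) (snd p) \<and> CC (fst p) (snd p)"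

definition cert_bound :: "nat => nat" where
  "cert_bound n = 1 + 3 * n + cert_size (cert_scale n)"

lemma cert_bound_poly: "\<exists>q. \<forall>n. cert_bound n \<le> poly q n"
proof -
  have "pb cert_bound"
    unfolding cert_bound_def by (intro pb_add pb_mult pb_const pb_id pb_cert_size_scale)
  then show ?thesis by (simp add: pb_def)
qed

lemma pt_dv_cert: "pt (dv :: val => dat \<times> cert)"
  by (intro pti)

lemma MSP_solvable: "MSP C = {enc_msp I | I. msp_instance I \<and> C I \<and> solvable I}"
  by (simp add: MSP_def solvable_def solvable_flow_def)

lemma MSP_fixed_flow_solvable: "MSP_fixed_flow C = {enc_msp I @ enc_flow I F | I F. msp_instance I \<and> C I \<and>
    solvable_flow I (rflow F)}"
proof -
  have "feasible_flow I F \<and> (\<exists>L M. feasible_solution I F L M \<and> within_bounds I F L M) \<longleftrightarrow> solvable_flow I F" for I F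
    by (auto simp: solvable_flow_def feasible_solution_def)
  then show ?thesis by (simp add: MSP_fixed_flow_def)
qed

lemma solvable_accepts:
  assumes CC: "decides CC C" and I: "msp_instance I" "C I" "solvable I"
  shows "\<exists>p. accepts CC (enc_msp I) p \<and> sz p \<le> cert_bound (length (enc_msp I))"
proof -
  let ?s = "length (enc_msp I)"
  obtain rk d where r: "\<forall>v. rk v \<le> num_verts I \<and> d v \<le> num_verts I"
    and rc: "\<forall>c. (\<forall>v<num_verts I. lk c [14, v] = rk v \<and> lk c [15, v] = d v) --> CC (todata I) c"
    using CC I(1,2) unfolding decides_def by blast
  have "\<exists>c. sz c \<le> cert_size (cert_scale ?s) \<and> chk_scale (todata I) c \<and> chk_lp (todata I) c \<and> chk_flow (todata I) c \<and>
    (\<forall>v<num_verts I. lk c [14, v] = rk v \<and> lk c [15, v] = d v)"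
    by (rule solvable_certificate[OF I(1) small_msp(1,2)[OF I(1) order_refl] _ _ I(3)])
      (use small_msp(3,4)[OF I(1) order_refl] r in auto)
  then obtain c where c: "sz c \<le> cert_size (cert_scale ?s)" "chk_scale (todata I) c" "chk_lp (todata I) c"
    "chk_flow (todata I) c" "CC (todata I) c" using rc by blast
  have "sz (todata I) \<le> 3 * ?s" using sz_encd[of "todata I"] by (simp add: enc_msp_todata[OF I(1)])
  then have "sz (todata I, c) \<le> cert_bound ?s" using c(1) by (simp add: cert_bound_def)
  moreover have "accepts CC (enc_msp I) (todata I, c)"
    using c valid_todata[OF I(1)] by (simp add: accepts_def enc_msp_todata[OF I(1)])
  ultimately show ?thesis by blast
qed

lemma accepts_solvable:
  assumes CC: "decides CC C" and p: "accepts CC x p"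
  shows "\<exists>I. msp_instance I \<and> C I \<and> solvable I \<and> x = enc_msp I \<and> fst p = todata I"
proof -
  let ?I = "ofdata (fst p)"
  have v: "valid (fst p)" using p by (simp add: accepts_def)
  note I = ofdata[OF v]
  have "C ?I"
    by (rule CC[unfolded decides_def, THEN conjunct2, THEN conjunct1, rule_format, OF I(1), of "snd p"])
      (use p in \<open>simp add: accepts_def I(2)\<close>)
  moreover have "solvable ?I" using p by (intro solvable_sound[OF I(1), of "snd p"]) (simp_all add: accepts_def I(2))
  moreover have "x = enc_msp ?I" using p by (simp add: enc_msp_todata[OF I(1)] I(2) accepts_def)
  ultimately show ?thesis by (intro exI[of _ ?I]) (simp add: I)
qed

lemma MSP_NP:
  assumes CC: "decides CC C" shows "MSP C \<in> NP"
proof -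
  obtain q where q: "!!n. cert_bound n \<le> poly q n" using cert_bound_poly by blast
  have "pt (\<lambda>p. accepts CC (fst p) (snd p))"
    unfolding accepts_def
    by (intro pti pt_comp2[OF CC[unfolded decides_def, THEN conjunct1]] pt_comp[OF pt_valid] pt_comp2[OF pt_chk_scale] pt_comp2[OF pt_chk_lp] pt_comp2[OF pt_chk_flow])
  then have 1: "{x. \<exists>p. accepts CC x p} \<in> NP"
  proof (rule NP_I[OF _ pt_dv_cert])
    fix x p assume "accepts CC x p"
    from accepts_solvable[OF CC this] obtain I where I: "msp_instance I" "C I" "solvable I" "x = enc_msp I"
      by (elim exE conjE)
    from solvable_accepts[OF CC I(1-3)] obtain p' where "accepts CC x p'" "sz p' \<le> cert_bound (length x)"
      unfolding I(4)[symmetric] by (elim exE conjE)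
    then show "\<exists>p'. accepts CC x p' \<and> sz p' \<le> poly q (length x)"
      using order_trans[OF _ q] by (intro exI[of _ p'] conjI)
  qed
  have 2: "x \<in> MSP C \<longleftrightarrow> (\<exists>p. accepts CC x p)" for x
  proof
    assume "x \<in> MSP C"
    then obtain I where I: "x = enc_msp I" "msp_instance I" "C I" "solvable I"
      unfolding MSP_solvable by (elim CollectE exE conjE)
    from solvable_accepts[OF CC I(2-4)] show "\<exists>p. accepts CC x p"
      unfolding I(1) by (elim exE conjE) (rule exI)
  next
    assume "\<exists>p. accepts CC x p"
    then obtain p where "accepts CC x p" by (elim exE)
    from accepts_solvable[OF CC this] show "x \<in> MSP C"
      unfolding MSP_solvable by (elim exE conjE) (intro CollectI exI conjI)
  qed
  from 1[folded 2] show ?thesis by (simp only: Collect_mem_eq)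
qed

lemma solvable_flow_accepts:
  assumes CC: "decides CC C" and I: "msp_instance I" "C I" "solvable_flow I (rflow F)"
  shows "\<exists>p. accepts_flow CC (enc_msp I @ enc_flow I F) p \<and> sz p \<le> cert_bound (length (enc_msp I @ enc_flow I F)) \<and>
    fst p = todata I \<and> (\<forall>\<kappa>\<in>commodities I. \<forall>e\<in>edges I. F \<kappa> e \<ge> 0 \<and> fr (F \<kappa> e) = (cf (snd p) 11 \<kappa> e, cf (snd p) 12 \<kappa> e))"
proof -
  let ?s = "length (enc_msp I @ enc_flow I F)"
  obtain rk d where r: "\<forall>v. rk v \<le> num_verts I \<and> d v \<le> num_verts I"
    and rc: "\<forall>c. (\<forall>v<num_verts I. lk c [14, v] = rk v \<and> lk c [15, v] = d v) --> CC (todata I) c"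
    using CC I(1,2) unfolding decides_def by blast
  have F: "F \<kappa> e \<ge> 0" if "\<kappa> \<in> commodities I" "e \<in> edges I" for \<kappa> e
    using I(3) that unfolding solvable_flow_iff feasible_flow_def by (cases \<kappa>) auto
  have s: "length (enc_msp I) \<le> ?s" "length (enc_flow I F) \<le> ?s" by simp_all
  have "\<exists>c. sz c \<le> cert_size (cert_scale ?s) \<and> chk_scale (todata I) c \<and> chk_lp (todata I) c \<and> chk_flow (todata I) c \<and>
    chk_fix (todata I) c \<and> (\<forall>\<kappa>\<in>commodities I. \<forall>e\<in>edges I. fr (F \<kappa> e) = (cf c 11 \<kappa> e, cf c 12 \<kappa> e)) \<and>
    (\<forall>v<num_verts I. lk c [14, v] = rk v \<and> lk c [15, v] = d v)"
    by (rule solvable_flow_certificate[OF I(1) small_msp(1,2)[OF I(1) s(1)] small_flow[OF I(1) F s] I(3)]) (use r in auto)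
  then obtain c where c: "sz c \<le> cert_size (cert_scale ?s)" "chk_scale (todata I) c" "chk_lp (todata I) c"
    "chk_flow (todata I) c" "chk_fix (todata I) c" "CC (todata I) c"
    "\<forall>\<kappa>\<in>commodities I. \<forall>e\<in>edges I. fr (F \<kappa> e) = (cf c 11 \<kappa> e, cf c 12 \<kappa> e)" using rc by blast
  have "sz (todata I) \<le> 3 * ?s" using sz_encd[of "todata I"] by (simp add: enc_msp_todata[OF I(1)])
  then have "sz (todata I, c) \<le> cert_bound ?s" using c(1) by (simp add: cert_bound_def)
  moreover have "enc_flow I F = flow_code (todata I) c"
    by (rule enc_flow_code[OF I(1) F]) (use c(7) in blast)+
  then have "accepts_flow CC (enc_msp I @ enc_flow I F) (todata I, c)"
    using c valid_todata[OF I(1)] by (simp add: accepts_flow_def enc_msp_todata[OF I(1)])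
  ultimately show ?thesis using c(7) F by (intro exI[of _ "(todata I, c)"]) simp
qed

lemma accepts_flow_solvable:
  assumes CC: "decides CC C" and p: "accepts_flow CC x p"
  shows "\<exists>I F. msp_instance I \<and> C I \<and> solvable_flow I (rflow F) \<and> x = enc_msp I @ enc_flow I F"
proof -
  let ?I = "ofdata (fst p)"
  have v: "valid (fst p)" using p by (simp add: accepts_flow_def)
  note I = ofdata[OF v]
  define F where "F \<kappa> e = frval (cf (snd p) 11 \<kappa> e, cf (snd p) 12 \<kappa> e)" for \<kappa> e
  have fix': "chk_fix (todata ?I) (snd p)" using p by (simp add: accepts_flow_def I(2))
  have F: "F \<kappa> e \<ge> 0 \<and> fr (F \<kappa> e) = (cf (snd p) 11 \<kappa> e, cf (snd p) 12 \<kappa> e)" if "\<kappa> \<in> commodities ?I" "e \<in> edges ?I" for \<kappa> e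
  proof -
    have "valid_fr (cf (snd p) 11 \<kappa> e, cf (snd p) 12 \<kappa> e)"
      using fix' that unfolding chk_fix_def set_Ks[OF I(1)] set_Es[OF I(1)] by blast
    then show ?thesis unfolding F_def by (simp add: fr_frval frval_nonneg)
  qed
  have "C ?I"
    by (rule CC[unfolded decides_def, THEN conjunct2, THEN conjunct1, rule_format, OF I(1), of "snd p"])
      (use p in \<open>simp add: accepts_flow_def I(2)\<close>)
  moreover have "solvable_flow ?I (rflow F)"
    by (rule solvable_flow_sound[OF I(1) _ _ _ fix' F]) (use p in \<open>simp_all add: accepts_flow_def I(2)\<close>)
  moreover have "enc_flow ?I F = flow_code (todata ?I) (snd p)"
    by (rule enc_flow_code[OF I(1)]) (use F in blast)+
  then have "x = enc_msp ?I @ enc_flow ?I F" using p by (simp add: enc_msp_todata[OF I(1)] I(2) accepts_flow_def)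
  ultimately show ?thesis by (intro exI[of _ ?I] exI[of _ F]) (simp add: I(1))
qed

lemma MSP_fixed_flow_NP:
  assumes CC: "decides CC C" shows "MSP_fixed_flow C \<in> NP"
proof -
  obtain q where q: "!!n. cert_bound n \<le> poly q n" using cert_bound_poly by blast
  have "pt (\<lambda>p. accepts_flow CC (fst p) (snd p))"
    unfolding accepts_flow_def
    by (intro pti pt_comp2[OF CC[unfolded decides_def, THEN conjunct1]] pt_comp[OF pt_valid] pt_comp2[OF pt_chk_scale] pt_comp2[OF pt_chk_lp] pt_comp2[OF pt_chk_flow]
      pt_comp2[OF pt_chk_fix] pt_comp2[OF pt_flow_code])
  then have 1: "{x. \<exists>p. accepts_flow CC x p} \<in> NP"
  proof (rule NP_I[OF _ pt_dv_cert])
    fix x p assume "accepts_flow CC x p"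
    from accepts_flow_solvable[OF CC this] obtain I F where
      I: "msp_instance I" "C I" "solvable_flow I (rflow F)" "x = enc_msp I @ enc_flow I F"
      by (elim exE conjE)
    from solvable_flow_accepts[OF CC I(1-3)] obtain p' where "accepts_flow CC x p'" "sz p' \<le> cert_bound (length x)"
      unfolding I(4)[symmetric] by (elim exE conjE)
    then show "\<exists>p'. accepts_flow CC x p' \<and> sz p' \<le> poly q (length x)"
      using order_trans[OF _ q] by (intro exI[of _ p'] conjI)
  qed
  have 2: "x \<in> MSP_fixed_flow C \<longleftrightarrow> (\<exists>p. accepts_flow CC x p)" for x
  proof
    assume "x \<in> MSP_fixed_flow C"
    then obtain I F where I: "x = enc_msp I @ enc_flow I F" "msp_instance I" "C I" "solvable_flow I (rflow F)"
      unfolding MSP_fixed_flow_solvable by (elim CollectE exE conjE)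
    from solvable_flow_accepts[OF CC I(2-4)] show "\<exists>p. accepts_flow CC x p"
      unfolding I(1) by (elim exE conjE) (rule exI)
  next
    assume "\<exists>p. accepts_flow CC x p"
    then obtain p where "accepts_flow CC x p" by (elim exE)
    from accepts_flow_solvable[OF CC this] show "x \<in> MSP_fixed_flow C"
      unfolding MSP_fixed_flow_solvable by (elim exE conjE) (intro CollectI exI conjI)
  qed
  from 1[folded 2] show ?thesis by (simp only: Collect_mem_eq)
qed

section \<open>The classes of instances\<close>

lemma decides_True: "decides (\<lambda>_ _. True) (\<lambda>I. True)"
  unfolding decides_def using pt_const[of True] by (auto intro!: exI[of _ "\<lambda>_. 0 :: nat"])

lemma decides_one_mode:
  assumes "decides CC C"
  shows "decides (\<lambda>d c. CC d c \<and> length (fst (snd (snd (snd d)))) = 2) (\<lambda>I. C I \<and> modes I = 1)"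
proof -
  have m: "length (fst (snd (snd (snd (todata I))))) = Suc (modes I)" for I by (simp add: todata_def Let_def)
  have "pt (\<lambda>p. CC (fst p) (snd p) \<and> length (fst (snd (snd (snd (fst p))))) = 2)"
    by (intro pti pt_comp2[OF assms[unfolded decides_def, THEN conjunct1]])
  moreover have "C I \<and> modes I = 1" if "msp_instance I" "CC (todata I) c \<and> Suc (modes I) = 2" for I c
    using assms[unfolded decides_def, THEN conjunct2, THEN conjunct1, rule_format, OF that(1)] that(2) by auto
  moreover have "\<exists>rk d. (\<forall>v. rk v \<le> num_verts I \<and> d v \<le> num_verts I) \<and>
        (\<forall>c. (\<forall>v<num_verts I. lk c [14, v] = rk v \<and> lk c [15, v] = d v) --> CC (todata I) c \<and> Suc (modes I) = 2)"
    if I: "msp_instance I" "C I \<and> modes I = 1" for I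
  proof -
    from assms[unfolded decides_def, THEN conjunct2, THEN conjunct2, rule_format, OF I(1) I(2)[THEN conjunct1]]
    obtain rk d where r: "\<forall>v. rk v \<le> num_verts I \<and> d v \<le> num_verts I"
      "\<forall>c. (\<forall>v<num_verts I. lk c [14, v] = rk v \<and> lk c [15, v] = d v) --> CC (todata I) c"
      by (elim exE conjE)
    show ?thesis
    proof (rule exI[of _ rk], rule exI[of _ d], intro conjI allI impI)
      show "CC (todata I) c" if "\<forall>v<num_verts I. lk c [14, v] = rk v \<and> lk c [15, v] = d v" for c
        using r(2)[THEN spec, THEN mp, OF that] .
    qed (use r(1) I(2) in simp_all)
  qed
  ultimately show ?thesis
    unfolding decides_def m by (intro conjI allI impI) simp_all
qed

lemma ranked_cong:
  assumes "E \<subseteq> {..<n} \<times> {..<n}" "!!v. v < n ==> rk v = rk' v \<and> d v = d' v" "ranked E n rk' d'"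
  shows "ranked E n rk d"
  unfolding ranked_def
proof (intro conjI ballI allI impI)
  show "0 < n" using assms(3) by (simp add: ranked_def)
  show "case e of (u, v) => rk u < rk v" if "e \<in> E" for e
  proof -
    obtain u v where e: "e = (u, v)" "u < n" "v < n" using assms(1) \<open>e \<in> E\<close> by (cases e) auto
    have "rk' u < rk' v" using assms(3) that e unfolding ranked_def by blast
    then show ?thesis using assms(2) e by simp
  qed
  fix v assume v: "v < n" "v \<noteq> 0"
  then obtain u where "u < n" "d' u < d' v" "(u, v) \<in> E \<or> (v, u) \<in> E" using assms(3) unfolding ranked_def by blast
  then show "\<exists>u<n. d u < d v \<and> ((u, v) \<in> E \<or> (v, u) \<in> E)" using assms(2) v by auto
qed

lemma decides_tree_like: "decides chk_rank (\<lambda>I. tree_like (graph_of I))"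
  unfolding decides_def
proof (intro conjI allI impI)
  show "pt (\<lambda>p. chk_rank (fst p) (snd p))" by (rule pt_chk_rank)
  show "tree_like (graph_of I)" if "msp_instance I" "chk_rank (todata I) c" for I c
    using ranked_imp_tree_like[OF edges_sub] chk_rank_iff that by blast
  fix I assume I: "msp_instance I" "tree_like (graph_of I)"
  obtain rk d where r: "ranked (edges I) (num_verts I) rk d" "\<forall>v. rk v \<le> num_verts I \<and> d v \<le> num_verts I"
    using tree_like_imp_ranked[OF edges_sub[OF I(1)] I(2)] by blast
  have "chk_rank (todata I) c" if "\<forall>v<num_verts I. lk c [14, v] = rk v \<and> lk c [15, v] = d v" for c
    unfolding chk_rank_iff[OF I(1)] by (rule ranked_cong[OF edges_sub[OF I(1)] _ r(1)]) (use that in simp)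
  with r(2) show "\<exists>rk d. (\<forall>v. rk v \<le> num_verts I \<and> d v \<le> num_verts I) \<and>
      (\<forall>c. (\<forall>v<num_verts I. lk c [14, v] = rk v \<and> lk c [15, v] = d v) --> chk_rank (todata I) c)" by blast
qed

text \<open>The vertices are 0 and 1, so the edge has one of two orientations.\<close>

definition chk_edge :: "dat => cert => bool" where
  "chk_edge d c \<longleftrightarrow> length (fst d) = 2 \<and>
     (Es d = [(0, 1)] \<and> wd d (0, 1) = Some (1, 1) \<or> Es d = [(1, 0)] \<and> wd d (1, 0) = Some (1, 1))"

lemma chk_edge_iff:
  assumes I: "msp_instance I" shows "chk_edge (todata I) c \<longleftrightarrow> single_unit_edge I"
proof -
  have fr1: "fr r = (1, 1) \<longleftrightarrow> r = 1" if "r \<ge> 0" for r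
    using frval_fr[OF that] by (auto simp: frval_def fr_def)
  have E2: "Es (todata I) = [e] \<longleftrightarrow> edges I = {e}" if "num_verts I = 2" "e = (0, 1) \<or> e = (1, 0)" for e
  proof
    show "edges I = {e}" if "Es (todata I) = [e]" using set_Es[OF I] that by simp
    show "Es (todata I) = [e]" if "edges I = {e}"
      unfolding Es_todata \<open>num_verts I = 2\<close> that using \<open>e = (0, 1) \<or> e = (1, 0)\<close> by (auto simp: upt_rec)
  qed
  have w: "wd (todata I) e = Some (1, 1) \<longleftrightarrow> weight I e = 1" if "edges I = {e}" for e
    using wd_edge[OF I, of e] fr1[of "weight I e"] I that by (simp add: msp_instance_def)
  have n: "{..<num_verts I} = {u, v} \<longleftrightarrow> num_verts I = 2 \<and> (u = 0 \<and> v = 1 \<or> u = 1 \<and> v = 0)" if "u \<noteq> v" for u v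
  proof
    assume e: "{..<num_verts I} = {u, v}"
    then have "num_verts I = 2" using that by (metis card_2_iff card_lessThan)
    moreover have "u \<in> {..<num_verts I}" "v \<in> {..<num_verts I}" using e by auto
    ultimately show "num_verts I = 2 \<and> (u = 0 \<and> v = 1 \<or> u = 1 \<and> v = 0)" using that by auto
  qed auto
  show ?thesis
  proof
    assume c: "chk_edge (todata I) c"
    then have n2: "num_verts I = 2" by (simp add: chk_edge_def)
    from c obtain e where e: "e = (0, 1) \<or> e = (1, 0)" "Es (todata I) = [e]" "wd (todata I) e = Some (1, 1)"
      unfolding chk_edge_def by blast
    have E: "edges I = {e}" using E2[OF n2 e(1)] e(2) by simp
    then have W: "weight I e = 1" using w[OF E] e(3) by simp
    have V: "{..<num_verts I} = {0, 1}" "{..<num_verts I} = {1, 0}" unfolding n2 by auto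
    from e(1) show "single_unit_edge I"
    proof
      assume "e = (0, 1)"
      then show ?thesis unfolding single_unit_edge_def graph_of_simps
        by (intro exI[of _ "0::nat"] exI[of _ "1::nat"]) (use V(1) E W in simp)
    next
      assume "e = (1, 0)"
      then show ?thesis unfolding single_unit_edge_def graph_of_simps
        by (rule_tac exI[of _ "1::nat"], rule_tac exI[of _ "0::nat"]) (use V(2) E W in simp)
    qed
  next
    assume "single_unit_edge I"
    then obtain u v where uv: "u \<noteq> v" "{..<num_verts I} = {u, v}" "edges I = {(u, v)}" "weight I (u, v) = 1"
      unfolding single_unit_edge_def graph_of_simps by (elim exE conjE)
    from n[OF uv(1)] uv(2) have n2: "num_verts I = 2" and c: "u = 0 \<and> v = 1 \<or> u = 1 \<and> v = 0" by simp_all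
    have e: "(u, v) = (0, 1) \<or> (u, v) = (1, 0)" using c by auto
    have "Es (todata I) = [(u, v)]" "wd (todata I) (u, v) = Some (1, 1)"
      using E2[OF n2 e] uv(3) w[OF uv(3)] uv(4) by simp_all
    with c n2 show "chk_edge (todata I) c" by (elim disjE conjE) (simp_all add: chk_edge_def)
  qed
qed

lemma decides_edge: "decides chk_edge single_unit_edge"
proof -
  have "pt (\<lambda>p. chk_edge (fst p) (snd p))" unfolding chk_edge_def by (intro pti)
  then show ?thesis
    unfolding decides_def using chk_edge_iff by (auto intro!: exI[of _ "\<lambda>_. 0 :: nat"])
qed

section \<open>Hardness\<close>

text \<open>Records with equal encodings may differ at meaningless arguments. That solvability
  agrees is read off the verifier, whose checks see only the common data: a certificate for one
  instance is a certificate for the other.\<close>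

lemma solvable_enc:
  assumes "msp_instance I" "msp_instance I'" "enc_msp I = enc_msp I'" "solvable I'"
  shows "solvable I"
proof -
  obtain p where p: "accepts (\<lambda>_ _. True) (enc_msp I') p"
    using solvable_accepts[OF decides_True assms(2) TrueI assms(4)] by blast
  then have "fst p = todata I"
    using pfree_inj[OF pfree_encd] assms(1,3) by (metis accepts_def enc_msp_todata)
  with p show ?thesis by (intro solvable_sound[OF assms(1), of "snd p"]) (simp_all add: accepts_def)
qed

text \<open>Prefix-freeness first separates the instance from the flow; the flows then agree on all
  commodities and edges, and the certificate can be reused.\<close>

lemma solvable_flow_enc:
  assumes I: "msp_instance I" "msp_instance I'" and eq: "enc_msp I @ enc_flow I F = enc_msp I' @ enc_flow I' F'"
    and F: "!!\<kappa> e. \<kappa> \<in> commodities I ==> e \<in> edges I ==> F \<kappa> e \<ge> 0"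
    and s: "solvable_flow I' (rflow F')"
  shows "solvable_flow I (rflow F)"
proof -
  have "todata I = todata I' \<and> enc_flow I F = enc_flow I' F'"
    using pfree_encd eq unfolding pfree_def enc_msp_todata[OF I(1)] enc_msp_todata[OF I(2)] by blast
  then have d: "todata I' = todata I" and f: "enc_flow I F = enc_flow I' F'" by simp_all
  have KE: "commodities I' = commodities I" "edges I' = edges I"
    using set_Ks[OF I(1)] set_Ks[OF I(2)] set_Es[OF I(1)] set_Es[OF I(2)] d by simp_all
  obtain p where p: "accepts_flow (\<lambda>_ _. True) (enc_msp I' @ enc_flow I' F') p" "fst p = todata I'"
    "\<forall>\<kappa>\<in>commodities I'. \<forall>e\<in>edges I'. F' \<kappa> e \<ge> 0 \<and> fr (F' \<kappa> e) = (cf (snd p) 11 \<kappa> e, cf (snd p) 12 \<kappa> e)"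
    using solvable_flow_accepts[OF decides_True I(2) TrueI s] by blast
  have "enc_list (enc_list encf) (flow_data I F) = enc_list (enc_list encf) (flow_data I' F')"
    using f enc_flow_data[OF I(1) F] enc_flow_data[OF I(2), of F'] p(3) by simp
  then have "flow_data I F = flow_data I' F'"
    by (rule pfree_inj[OF pfree_list[OF pfree_list[OF pfree_encf]]])
  then have "fr (F \<kappa> e) = fr (F' \<kappa> e)" if "\<kappa> \<in> commodities I" "e \<in> edges I" for \<kappa> e
    unfolding flow_data_def d using that set_Ks[OF I(1)] set_Es[OF I(1)] by simp
  then show ?thesis
    using p F KE d by (intro solvable_flow_sound[OF I(1), of "snd p"]) (simp_all add: accepts_flow_def)
qed

lemma poly_reducible_I:
  assumes "pt f" "!!x. x \<in> A \<longleftrightarrow> f x \<in> B" shows "poly_reducible A B"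
  unfolding poly_reducible_def using pt_poly_time_computable[OF assms(1)] assms(2) by blast

lemma enc_in_MSP:
  assumes "msp_instance I" "C I" shows "enc_msp I \<in> MSP C \<longleftrightarrow> solvable I"
proof
  assume "enc_msp I \<in> MSP C"
  then obtain I' where I': "enc_msp I = enc_msp I'" "msp_instance I'" "solvable I'"
    unfolding MSP_solvable by (elim CollectE exE conjE)
  then show "solvable I" by (intro solvable_enc[OF assms(1)])
next
  assume "solvable I"
  with assms show "enc_msp I \<in> MSP C" unfolding MSP_solvable by (intro CollectI exI[of _ I] conjI refl)
qed

lemma enc_in_MSP_fixed_flow:
  assumes "msp_instance I" "C I" "feasible_flow I (rflow F)"
  shows "enc_msp I @ enc_flow I F \<in> MSP_fixed_flow C \<longleftrightarrow> solvable_flow I (rflow F)"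
proof
  have F: "F \<kappa> e \<ge> 0" if "\<kappa> \<in> commodities I" "e \<in> edges I" for \<kappa> e
    using assms(3) that unfolding feasible_flow_def by (cases \<kappa>) auto
  assume "enc_msp I @ enc_flow I F \<in> MSP_fixed_flow C"
  then obtain I' F' where I': "enc_msp I @ enc_flow I F = enc_msp I' @ enc_flow I' F'" "msp_instance I'"
    "solvable_flow I' (rflow F')"
    unfolding MSP_fixed_flow_solvable by (elim CollectE exE conjE)
  show "solvable_flow I (rflow F)"
    by (rule solvable_flow_enc[OF assms(1) I'(2,1) F I'(3)])
next
  assume "solvable_flow I (rflow F)"
  with assms(1,2) show "enc_msp I @ enc_flow I F \<in> MSP_fixed_flow C"
    unfolding MSP_fixed_flow_solvable by (intro CollectI exI[of _ I] exI[of _ F] conjI refl)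
qed

text \<open>The reduction produces tree-like instances with one mode, so hardness passes to every
  class that contains them; this covers the unrestricted and the restricted variants at
  once.\<close>

lemma MSP_hard:
  assumes C: "!!I. tree_like (graph_of I) ==> modes I = 1 ==> C I"
    and C': "!!I. modes I = 1 ==> C' I"
  shows "NP_hard (MSP C)" "NP_hard (MSP_fixed_flow C')"
proof -
  have "poly_reducible A (MSP C) \<and> poly_reducible A (MSP_fixed_flow C')" if A: "A \<in> NP" for A
  proof -
    from NP_star[OF A] obtain f g where f: "pt f" "pt g" "\<forall>x. \<exists>I F. f x = enc_msp I \<and> g x = enc_msp I @ enc_flow I F \<and>
        msp_instance I \<and> tree_like (graph_of I) \<and> modes I = 1 \<and> feasible_flow I (rflow F) \<and>
        (x \<in> A \<longleftrightarrow> solvable I) \<and> (x \<in> A \<longleftrightarrow> solvable_flow I (rflow F))"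
      by (elim exE conjE)
    have "(x \<in> A \<longleftrightarrow> f x \<in> MSP C) \<and> (x \<in> A \<longleftrightarrow> g x \<in> MSP_fixed_flow C')" for x
    proof -
      from f(3)[THEN spec, of x] obtain I F where I: "f x = enc_msp I" "g x = enc_msp I @ enc_flow I F"
        "msp_instance I" "tree_like (graph_of I)" "modes I = 1" "feasible_flow I (rflow F)"
        "x \<in> A \<longleftrightarrow> solvable I" "x \<in> A \<longleftrightarrow> solvable_flow I (rflow F)"
        by (elim exE conjE)
      show ?thesis
        unfolding I(1,2) enc_in_MSP[of I C, OF I(3) C[OF I(4,5)]] enc_in_MSP_fixed_flow[of I C' F, OF I(3) C'[OF I(5)] I(6)]
        using I(7,8) by (rule conjI)
    qed
    then show ?thesis
      by (intro conjI poly_reducible_I[OF f(1), of A "MSP C"] poly_reducible_I[OF f(2), of A "MSP_fixed_flow C'"]) (rule conjunct1 conjunct2, assumption)+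
  qed
  then show "NP_hard (MSP C)" "NP_hard (MSP_fixed_flow C')" by (simp_all add: NP_hard_def)
qed

lemma MSP_edge_hard: "NP_hard (MSP single_unit_edge)"
proof -
  have "poly_reducible A (MSP single_unit_edge)" if A: "A \<in> NP" for A
  proof -
    from NP_edge[OF A] obtain f where f: "pt f" "\<forall>x. \<exists>I. f x = enc_msp I \<and> msp_instance I \<and>
        single_unit_edge I \<and> (x \<in> A \<longleftrightarrow> solvable I)" by (elim exE conjE)
    have "x \<in> A \<longleftrightarrow> f x \<in> MSP single_unit_edge" for x
    proof -
      from f(2)[THEN spec, of x] obtain I where I: "f x = enc_msp I" "msp_instance I" "single_unit_edge I" "x \<in> A \<longleftrightarrow> solvable I"
        by (elim exE conjE)
      show ?thesis unfolding I(1) enc_in_MSP[of I single_unit_edge, OF I(2,3)] by (rule I(4))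
    qed
    with f(1) show ?thesis by (rule poly_reducible_I)
  qed
  then show ?thesis by (simp add: NP_hard_def)
qed

theorem theorem4p1:
  shows "(NP_complete (MSP (\<lambda>I. True)) \<and>
          NP_complete (MSP_fixed_flow (\<lambda>I. True)) \<and>
          NP_complete (MSP (\<lambda>I. tree_like (graph_of I))) \<and>
          NP_complete (MSP_fixed_flow (\<lambda>I. modes I = 1)) \<and>
          NP_complete (MSP (\<lambda>I. tree_like (graph_of I) \<and> modes I = 1))) \<and>
         NP_complete (MSP single_unit_edge)"
proof -
  \<comment> \<open>The class obtained is a conjunction with True, which has to be simplified to
    match the statement.\<close>
  have "MSP_fixed_flow (\<lambda>I. modes I = 1) \<in> NP"
    using MSP_fixed_flow_NP[OF decides_one_mode[OF decides_True]] by (simp only: simp_thms)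
  then show ?thesis
    unfolding NP_complete_def
    by (intro conjI MSP_hard MSP_edge_hard MSP_NP[OF decides_True] MSP_fixed_flow_NP[OF decides_True]
      MSP_NP[OF decides_tree_like] MSP_NP[OF decides_one_mode[OF decides_tree_like]] MSP_NP[OF decides_edge])
      (assumption | rule TrueI conjI)+
qed

end
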